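(* Let $\alpha\in(1,2]$ and consider the setting and assumptions (A1)–(A3) given in the context, with $\theta\in(0,1)$ the constant in (A3). Assume that the generator $\tilde{\mathbb Q}$ is weakly irreducible with stationary vector $\nu=(\nu_1,\dots,\nu_n)$, and that the initial value satisfies $x\in\mathcal D((-A)^\theta)$. For $\varepsilon\in(0,1)$ let $X^\varepsilon$ be the mild solution of $$\mathrm dX^\varepsilon(t)=\{AX^\varepsilon(t)+b(X^\varepsilon(t),r^\varepsilon(t))\}\,\mathrm dt+\mathrm dL(t),\qquad X^\varepsilon(0)=x,\quad r^\varepsilon(0)=r_0\in\mathbb S,$$ and let $\bar X$ be the mild solution of $$\mathrm d\bar X(t)=\{A\bar X(t)+\bar b(\bar X(t))\}\,\mathrm dt+\mathrm dL(t),\qquad \bar X(0)=x,\qquad \bar b(y):=\sum_{i=1}^n b(y,i)\,\nu_i .$$ Let $T>0$, $p\in(1,\alpha)$ and $\rho<(\alpha-p)/(\alpha-p+p\theta\alpha)$. Then there exist $\varepsilon_0\in(0,1)$ and a constant $C_T>0$, not depending on $\varepsilon$, such that for all $\varepsilon\in(0,\varepsilon_0)$, $$\sup_{0\le t\le T}\bigl(\mathbb E|X^\varepsilon(t)-\bar X(t)|_H^p\bigr)^{1/p}\le C_T\,\varepsilon^{\rho\theta}.$$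
   Context: $(H,\langle\cdot,\cdot\rangle,|\cdot|_H)$ is a real separable Hilbert space and $(\Omega,\mathcal F,\{\mathcal F_t\}_{t\ge0},\mathbb P)$ is a stochastic basis. $\|\cdot\|$ is the operator norm. $\{e_k\}_{k\ge1}$ is an orthonormal basis of $H$. The cylindrical $\alpha$-stable process is $L(t)=\sum_{k\ge1}\beta_kL_k(t)e_k$, where $\beta_k>0$ and $\{L_k\}_{k\ge1}$ are i.i.d. real-valued symmetric $\alpha$-stable Lévy processes on the stochastic basis (characteristic function $\mathbb E e^{iuL_k(t)}=e^{-t\sigma^\alpha|u|^\alpha}$ for a fixed $\sigma>0$). Switching process: $\mathbb S=\{1,\dots,n\}$. For $\varepsilon\in(0,1)$, $r^\varepsilon(t)$ is a continuous-time Markov chain with state space $\mathbb S$ and generator $\mathbb Q^\varepsilon=\tilde{\mathbb Q}/\varepsilon+\hat{\mathbb Q}$, where $\tilde{\mathbb Q},\hat{\mathbb Q}$ are generators of Markov chains on $\mathbb S$. Weak irreducibility of $\tilde{\mathbb Q}$ means that the system $\nu\tilde{\mathbb Q}=0$, $\sum_{i=1}^n\nu_i=1$ has a unique solution $\nu=(\nu_1,\dots,\nu_n)$ and it satisfies $\nu_i\ge0$ for all $i$. Assumptions, where $b:H\times\mathbb S\to H$: (A1) $A:\mathcal D(A)\subset H\to H$ is self-adjoint with compact resolvent, and $-A$ has discrete spectrum $0<\lambda_1<\lambda_2<\cdots$ with $\lambda_k\to\infty$ and $-Ae_k=\lambda_ke_k$ for all $k$. Thus $A$ generates an analytic contraction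 semigroup $\{e^{tA}\}_{t\ge0}$ with $\|e^{tA}\|\le e^{-\lambda_1t}$. (A2) For each $i\in\mathbb S$ there is $K_i>0$ such that $|b(x,i)-b(y,i)|_H\le K_i|x-y|_H$ for all $x,y\in H$. (A3) There exists $\theta\in(0,1)$ with $\alpha\theta\in(0,1)$ and $\sum_{k\ge1}\beta_k^\alpha\lambda_k^{-(1-\alpha\theta)}<\infty$. Mild solution: a predictable $H$-valued process with, $\mathbb P$-a.s. for each $t\ge 0$, $X^\varepsilon(t)=e^{tA}x+\int_0^te^{(t-s)A}b(X^\varepsilon(s),r^\varepsilon(s))\,\mathrm ds+\int_0^te^{(t-s)A}\,\mathrm dL(s)$, and similarly for $\bar X$ with drift $\bar b(\bar X(s))$. Under (A1)–(A3) these mild solutions exist and are unique. *)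

theory Defs
  imports "HOL-Probability.Probability"
begin

section \<open>Unbounded operators and semigroups\<close>

text \<open>An unbounded operator is given by its domain \<open>D\<close> and a total function \<open>A\<close>; only the values of
  \<open>A\<close> on \<open>D\<close> are ever used.\<close>

definition orthonormal_basis :: "(nat \<Rightarrow> 'h::real_inner) \<Rightarrow> bool" where
  "orthonormal_basis e \<longleftrightarrow>
     (\<forall>j k. e j \<bullet> e k = (if j = k then 1 else 0)) \<and> closure (span (range e)) = UNIV"

definition linear_on_dom :: "'h::real_vector set \<Rightarrow> ('h \<Rightarrow> 'h) \<Rightarrow> bool" where
  "linear_on_dom D A \<longleftrightarrow> subspace D \<and>
     (\<forall>x\<in>D. \<forall>y\<in>D. A (x + y) = A x + A y) \<and> (\<forall>c. \<forall>x\<in>D. A (c *\<^sub>R x) = c *\<^sub>R A x)"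

text \<open>The left-hand side of the equivalence says that \<open>(y, z)\<close> is in the graph of the adjoint.\<close>

definition self_adjoint_op :: "'h::real_inner set \<Rightarrow> ('h \<Rightarrow> 'h) \<Rightarrow> bool" where
  "self_adjoint_op D A \<longleftrightarrow> linear_on_dom D A \<and> closure D = UNIV \<and>
     (\<forall>y z. (\<forall>x\<in>D. A x \<bullet> y = x \<bullet> z) \<longleftrightarrow> (y \<in> D \<and> z = A y))"

definition resolvent :: "'h::real_normed_vector set \<Rightarrow> ('h \<Rightarrow> 'h) \<Rightarrow> real \<Rightarrow> 'h \<Rightarrow> 'h" where
  "resolvent D A \<mu> = inv_into D (\<lambda>x. \<mu> *\<^sub>R x - A x)"

definition resolvent_set :: "'h::real_normed_vector set \<Rightarrow> ('h \<Rightarrow> 'h) \<Rightarrow> real set" where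
  "resolvent_set D A =
     {\<mu>. bij_betw (\<lambda>x. \<mu> *\<^sub>R x - A x) D UNIV \<and> bounded_linear (resolvent D A \<mu>)}"

text \<open>Real spectral points only; for a self-adjoint operator there are no others.\<close>

definition op_spectrum :: "'h::real_normed_vector set \<Rightarrow> ('h \<Rightarrow> 'h) \<Rightarrow> real set" where
  "op_spectrum D A = - resolvent_set D A"

definition compact_op :: "('h::real_normed_vector \<Rightarrow> 'h) \<Rightarrow> bool" where
  "compact_op B \<longleftrightarrow> bounded_linear B \<and> compact (closure (B ` cball 0 1))"

definition compact_resolvent :: "'h::real_normed_vector set \<Rightarrow> ('h \<Rightarrow> 'h) \<Rightarrow> bool" where
  "compact_resolvent D A \<longleftrightarrow> (\<exists>\<mu>\<in>resolvent_set D A. compact_op (resolvent D A \<mu>))"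

text \<open>\<open>S\<close> is the strongly continuous semigroup whose infinitesimal generator is exactly \<open>(D, A)\<close>,
  that is, \<open>S t\<close> is the operator usually written $e^{tA}$ (for \<open>t \<ge> 0\<close>).\<close>

definition generates_C0_semigroup ::
    "'h::real_normed_vector set \<Rightarrow> ('h \<Rightarrow> 'h) \<Rightarrow> (real \<Rightarrow> 'h \<Rightarrow> 'h) \<Rightarrow> bool" where
  "generates_C0_semigroup D A S \<longleftrightarrow>
     (\<forall>t\<ge>0. bounded_linear (S t)) \<and> (\<forall>x. S 0 x = x) \<and>
     (\<forall>s\<ge>0. \<forall>t\<ge>0. \<forall>x. S (s + t) x = S s (S t x)) \<and>
     (\<forall>x. ((\<lambda>t. S t x) \<longlongrightarrow> x) (at_right 0)) \<and>
     (\<forall>x y. (x \<in> D \<and> A x = y) \<longleftrightarrow> ((\<lambda>h. (S h x - x) /\<^sub>R h) \<longlongrightarrow> y) (at_right 0))"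

text \<open>Domain of the power \<open>\<theta>\<close> of the positive self-adjoint operator with eigenvalues \<open>lam k\<close> and
  orthonormal eigenbasis \<open>e\<close>, by the spectral calculus.\<close>

definition frac_power_dom :: "(nat \<Rightarrow> 'h::real_inner) \<Rightarrow> (nat \<Rightarrow> real) \<Rightarrow> real \<Rightarrow> 'h set" where
  "frac_power_dom e lam \<theta> = {x. summable (\<lambda>k. (lam k powr \<theta> * (x \<bullet> e k))\<^sup>2)}"

section \<open>Stochastic bases, Levy processes and stochastic integrals\<close>

text \<open>The time parameter is a real number; all conditions are restricted to nonnegative times.\<close>

definition stochastic_basis :: "'w measure \<Rightarrow> (real \<Rightarrow> 'w measure) \<Rightarrow> bool" where
  "stochastic_basis M F \<longleftrightarrow> prob_space M \<and> (\<forall>t\<ge>0. subalgebra M (F t)) \<and>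
     (\<forall>s t. 0 \<le> s \<and> s \<le> t \<longrightarrow> sets (F s) \<subseteq> sets (F t))"

definition predictable_sigma :: "'w measure \<Rightarrow> (real \<Rightarrow> 'w measure) \<Rightarrow> (real \<times> 'w) measure" where
  "predictable_sigma M F = sigma ({0..} \<times> space M)
     ({{0} \<times> B |B. B \<in> sets (F 0)} \<union>
      {{s<..t} \<times> B |s t B. 0 \<le> s \<and> s \<le> t \<and> B \<in> sets (F s)})"

definition predictable_process ::
    "'w measure \<Rightarrow> (real \<Rightarrow> 'w measure) \<Rightarrow> (real \<Rightarrow> 'w \<Rightarrow> 'h::topological_space) \<Rightarrow> bool" where
  "predictable_process M F X \<longleftrightarrow> (\<lambda>(t, \<omega>). X t \<omega>) \<in> borel_measurable (predictable_sigma M F)"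

definition levy_process ::
    "'w measure \<Rightarrow> (real \<Rightarrow> 'w measure) \<Rightarrow> (real \<Rightarrow> 'w \<Rightarrow> real) \<Rightarrow> bool" where
  "levy_process M F Z \<longleftrightarrow>
     (\<forall>t\<ge>0. Z t \<in> borel_measurable (F t)) \<and>
     (AE \<omega> in M. Z 0 \<omega> = 0) \<and>
     (\<forall>s t. 0 \<le> s \<and> s \<le> t \<longrightarrow>
        prob_space.indep_set M (sets (F s))
          (sets (vimage_algebra (space M) (\<lambda>\<omega>. Z t \<omega> - Z s \<omega>) borel))) \<and>
     (\<forall>s\<ge>0. \<forall>t\<ge>0. distr M borel (\<lambda>\<omega>. Z (s + t) \<omega> - Z s \<omega>) = distr M borel (Z t)) \<and>
     (AE \<omega> in M. \<forall>t\<ge>0. continuous (at_right t) (\<lambda>s. Z s \<omega>) \<and>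
        (t > 0 \<longrightarrow> (\<exists>l. ((\<lambda>s. Z s \<omega>) \<longlongrightarrow> l) (at_left t))))"

definition symmetric_stable_levy ::
    "'w measure \<Rightarrow> (real \<Rightarrow> 'w measure) \<Rightarrow> real \<Rightarrow> real \<Rightarrow> (real \<Rightarrow> 'w \<Rightarrow> real) \<Rightarrow> bool" where
  "symmetric_stable_levy M F \<alpha> \<sigma> Z \<longleftrightarrow> levy_process M F Z \<and>
     (\<forall>t\<ge>0. \<forall>u. char (distr M borel (Z t)) u
        = complex_of_real (exp (- (t * \<sigma> powr \<alpha> * \<bar>u\<bar> powr \<alpha>))))"

text \<open>Independence and equality in law refer to whole paths, as random elements of the product
  space indexed by \<open>[0, \<infinity>)\<close>.\<close>

definition iid_processes :: "'w measure \<Rightarrow> (nat \<Rightarrow> real \<Rightarrow> 'w \<Rightarrow> real) \<Rightarrow> bool" where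
  "iid_processes M L \<longleftrightarrow>
     prob_space.indep_vars M (\<lambda>_. PiM {0..} (\<lambda>_. borel)) (\<lambda>k \<omega>. \<lambda>t\<in>{0..}. L k t \<omega>) UNIV \<and>
     (\<forall>j k. distr M (PiM {0..} (\<lambda>_. borel)) (\<lambda>\<omega>. \<lambda>t\<in>{0..}. L j t \<omega>)
          = distr M (PiM {0..} (\<lambda>_. borel)) (\<lambda>\<omega>. \<lambda>t\<in>{0..}. L k t \<omega>))"

definition tendsto_in_prob ::
    "'w measure \<Rightarrow> (nat \<Rightarrow> 'w \<Rightarrow> 'h::real_normed_vector) \<Rightarrow> ('w \<Rightarrow> 'h) \<Rightarrow> bool" where
  "tendsto_in_prob M Y Y0 \<longleftrightarrow>
     (\<forall>m. Y m \<in> borel_measurable M) \<and> Y0 \<in> borel_measurable M \<and>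
     (\<forall>\<delta>>0. (\<lambda>m. measure M {\<omega> \<in> space M. norm (Y m \<omega> - Y0 \<omega>) > \<delta>}) \<longlonglongrightarrow> 0)"

text \<open>\<open>I\<close> is (a version of) the integral over \<open>[0, t]\<close> of the deterministic function \<open>\<Phi>\<close> against the
  real process \<open>Z\<close>, as limit in probability of the integrals of step functions on uniform
  partitions. Used only for \<open>\<Phi>\<close> continuous on \<open>[0, t]\<close>, where the choice of the partitions is
  irrelevant.\<close>

definition has_levy_integral ::
    "'w measure \<Rightarrow> (real \<Rightarrow> 'h::real_normed_vector) \<Rightarrow> (real \<Rightarrow> 'w \<Rightarrow> real) \<Rightarrow> real \<Rightarrow> ('w \<Rightarrow> 'h) \<Rightarrow> bool"
  where
  "has_levy_integral M \<Phi> Z t I \<longleftrightarrow>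
     tendsto_in_prob M
       (\<lambda>m \<omega>. \<Sum>j<m. (Z (t * real (Suc j) / real m) \<omega> - Z (t * real j / real m) \<omega>)
                       *\<^sub>R \<Phi> (t * real j / real m)) I"

text \<open>\<open>W\<close> is (a version of) the stochastic convolution $\int_0^t e^{(t-s)A}\,dL(s)$ with the cylindrical
  process $L = \sum_k \beta_k L_k e_k$, which in general is not \<open>H\<close>-valued; the integral is
  $\sum_k \beta_k \int_0^t e^{(t-s)A} e_k\,dL_k(s)$, convergent in \<open>H\<close> in probability.\<close>

definition stochastic_convolution ::
    "'w measure \<Rightarrow> (real \<Rightarrow> 'h \<Rightarrow> 'h) \<Rightarrow> (nat \<Rightarrow> 'h::real_normed_vector) \<Rightarrow> (nat \<Rightarrow> real) \<Rightarrow>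
      (nat \<Rightarrow> real \<Rightarrow> 'w \<Rightarrow> real) \<Rightarrow> real \<Rightarrow> ('w \<Rightarrow> 'h) \<Rightarrow> bool" where
  "stochastic_convolution M S e \<beta> L t W \<longleftrightarrow>
     (\<exists>I. (\<forall>k. has_levy_integral M (\<lambda>s. S (t - s) (e k)) (L k) t (I k)) \<and>
          tendsto_in_prob M (\<lambda>m \<omega>. \<Sum>k<m. \<beta> k *\<^sub>R I k \<omega>) W)"

text \<open>The drift \<open>B s \<omega> y\<close> may depend on time and chance. Integrability of the drift along the path is
  required because the Bochner integral of a non-integrable function is \<open>0\<close> by convention.\<close>

definition mild_solution ::
    "'w measure \<Rightarrow> (real \<Rightarrow> 'w measure) \<Rightarrow> (real \<Rightarrow> 'h \<Rightarrow> 'h) \<Rightarrow>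
      (nat \<Rightarrow> 'h::{real_inner, banach, second_countable_topology}) \<Rightarrow> (nat \<Rightarrow> real) \<Rightarrow>
      (nat \<Rightarrow> real \<Rightarrow> 'w \<Rightarrow> real) \<Rightarrow> (real \<Rightarrow> 'w \<Rightarrow> 'h \<Rightarrow> 'h) \<Rightarrow> 'h \<Rightarrow> (real \<Rightarrow> 'w \<Rightarrow> 'h) \<Rightarrow> bool" where
  "mild_solution M F S e \<beta> L B x X \<longleftrightarrow>
     predictable_process M F X \<and>
     (\<forall>t\<ge>0. \<exists>W. stochastic_convolution M S e \<beta> L t W \<and>
        (AE \<omega> in M. set_integrable lborel {0..t} (\<lambda>s. B s \<omega> (X s \<omega>)) \<and>
           X t \<omega> = S t x + (LINT s:{0..t}|lborel. S (t - s) (B s \<omega> (X s \<omega>))) + W \<omega>))"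

section \<open>Finite Markov chains\<close>

definition generator_matrix :: "real^'s^'s \<Rightarrow> bool" where
  "generator_matrix Q \<longleftrightarrow>
     (\<forall>i j. i \<noteq> j \<longrightarrow> Q $ i $ j \<ge> 0) \<and> (\<forall>i. (\<Sum>j\<in>UNIV. Q $ i $ j) = 0)"

definition stationary_vector :: "real^'s^'s \<Rightarrow> real^'s \<Rightarrow> bool" where
  "stationary_vector Q \<nu> \<longleftrightarrow> \<nu> v* Q = 0 \<and> (\<Sum>i\<in>UNIV. \<nu> $ i) = 1"

definition weakly_irreducible :: "real^'s^'s \<Rightarrow> bool" where
  "weakly_irreducible Q \<longleftrightarrow>
     (\<exists>!\<nu>. stationary_vector Q \<nu>) \<and> (\<forall>\<nu>. stationary_vector Q \<nu> \<longrightarrow> (\<forall>i. \<nu> $ i \<ge> 0))"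

definition mat_exp :: "real^'s^'s \<Rightarrow> real^'s^'s" where
  "mat_exp Q = (\<Sum>k. (1 / fact k) *\<^sub>R (((**) Q) ^^ k) (mat 1))"

definition natural_filtration :: "'w measure \<Rightarrow> (real \<Rightarrow> 'w \<Rightarrow> 's) \<Rightarrow> real \<Rightarrow> 'w measure" where
  "natural_filtration M r s = sigma (space M) {r u -` {i} \<inter> space M |u i. 0 \<le> u \<and> u \<le> s}"

text \<open>Continuous-time Markov chain (with respect to its own filtration) with generator \<open>Q\<close> and
  almost surely right-continuous paths in the discrete finite state space.\<close>

definition ct_markov_chain ::
    "'w measure \<Rightarrow> (real \<Rightarrow> 'w \<Rightarrow> 's::finite) \<Rightarrow> real^'s^'s \<Rightarrow> bool" where
  "ct_markov_chain M r Q \<longleftrightarrow>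
     (\<forall>t\<ge>0. r t \<in> measurable M (count_space UNIV)) \<and>
     (AE \<omega> in M. \<forall>t\<ge>0. eventually (\<lambda>s. r s \<omega> = r t \<omega>) (at_right t)) \<and>
     (\<forall>s t j. 0 \<le> s \<and> s \<le> t \<longrightarrow>
        (AE \<omega> in M. real_cond_exp M (natural_filtration M r s) (\<lambda>\<omega>'. indicator {j} (r t \<omega>')) \<omega>
            = mat_exp ((t - s) *\<^sub>R Q) $ (r s \<omega>) $ j))"

definition averaged_drift :: "('h::real_vector \<Rightarrow> 's::finite \<Rightarrow> 'h) \<Rightarrow> real^'s \<Rightarrow> 'h \<Rightarrow> 'h" where
  "averaged_drift b \<nu> y = (\<Sum>i\<in>UNIV. \<nu> $ i *\<^sub>R b y i)"

section \<open>The \<open>L\<^sup>p\<close> norm\<close>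

text \<open>$(\mathbb E |f|^p)^{1/p}$ with values in \<open>[0, \<infinity>]\<close>, so that an upper bound includes integrability.\<close>

definition Lp_norm :: "'w measure \<Rightarrow> real \<Rightarrow> ('w \<Rightarrow> 'h::real_normed_vector) \<Rightarrow> ennreal" where
  "Lp_norm M p f =
     (let I = (\<integral>\<^sup>+ \<omega>. ennreal (norm (f \<omega>) powr p) \<partial>M)
      in if I = \<infinity> then \<infinity> else ennreal (enn2real I powr (1 / p)))"

end

theory Submission
  imports Defs
begin

text \<open>
  The two solutions are driven by the same noise, so their difference contains no stochastic integral,
  and by Lipschitz continuity and Gronwall's inequality (applied pathwise, since no moments of \<open>X \<epsilon>\<close>
  are known beforehand) it is controlled by
  $\sum_i \int_0^t e^{(t-s)A} b(\bar X(s), i)\,(1_{r^\varepsilon(s) = i} - \nu_i)\,ds$.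
  Freezing \<open>Xbar\<close> and the semigroup on a grid of mesh \<open>\<delta>\<close> costs \<open>\<delta> powr \<theta>\<close>. On each cell the
  remaining integral of $1_{r^\varepsilon = i} - \nu_i$ is at most \<open>\<delta>\<close> and has second moment of order
  \<open>\<epsilon> * \<delta>\<close>: weak irreducibility makes this function \<open>Qt *v h\<close> for some \<open>h\<close>, and
  $\tilde Q = \varepsilon\,(Q^\varepsilon - \hat Q)$, so its correlations integrate to \<open>O(\<epsilon>)\<close> by the Kolmogorov equation.
  The chain and the noise may be dependent; Hoelder's inequality with \<open>Xbar\<close> in \<open>L\<^sup>q\<close> for \<open>q < \<alpha>\<close> gives
  \<open>(\<epsilon> / \<delta>) powr ((q - p) / (p * q))\<close>. Taking \<open>\<delta> = \<epsilon> powr \<rho>\<close> and \<open>q\<close> close to \<open>\<alpha>\<close> balances the two errors.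

  The moments of the stochastic convolution come from its coordinates alone: a bound on
  \<open>E (1 - cos (u Y\<^sub>k))\<close> by \<open>c\<^sub>k * \<bar>u\<bar> powr \<alpha>\<close> yields \<open>P (norm Y \<ge> R) \<le> 64 * (\<Sum>k. c\<^sub>k) * R powr - \<alpha>\<close>, with no independence
  between the coordinates. These bounds follow from the characteristic functions of Riemann sums, which
  converge pathwise by summation by parts.
\<close>

section \<open>Moment bounds and Gronwall's inequality\<close>

text \<open>With \<open>\<delta> = \<epsilon> powr \<rho>\<close> the two errors have order
  \<open>\<epsilon> powr (\<rho> * \<theta>)\<close> and
  \<open>\<epsilon> powr ((1 - \<rho>) * (1/p - 1/q))\<close>. At \<open>q = \<alpha>\<close> these
  agree exactly when \<open>\<rho> = (\<alpha> - p) / (\<alpha> - p + p * \<theta> *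
  \<alpha>)\<close>; the argument provides moments only below order \<alpha>, whence the strict
  inequality. The power \<theta> of the mesh has three sources: the initial value lies in the domain
  of the fractional power; smoothing bounds a semigroup increment by the kernel
  \<open>(h / v) powr \<theta>\<close>, integrable since \<open>\<theta> < 1\<close>; noise
  increments over a time \<delta> leave, up to constants, the series of (A3) once
  \<open>\<delta> powr (\<alpha> * \<theta>)\<close> is taken out. What shapes the argument is that
  a mild solution satisfies its equation almost surely at each fixed time, with an exceptional set
  and a version of the convolution depending on that time. Versions are identified through their
  coordinates, which have a pathwise formula, and pathwise estimates are used at almost every time,
  by Fubini, before being inserted into the equation at a fixed time.\<close>

lemma powr_tangent:
  fixes x c p :: real
  assumes p: "p > 1" and x: "x \<ge> 0" and c: "c \<ge> 0"
  shows "p * c powr (p - 1) * x \<le> x powr p + (p - 1) * c powr p"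
proof -
  \<comment> \<open>Young's inequality with the conjugate exponents \<open>p\<close> and
    \<open>p / (p - 1)\<close>; multiplied by \<open>p\<close> it says that the graph of
    \<open>z powr p\<close> lies above its tangent at \<open>c\<close>.\<close>
  have "x * c powr (p - 1) \<le> x powr p / p + (c powr (p - 1)) powr (p / (p - 1)) / (p / (p - 1))"
    by (rule Youngs_inequality) (use p x c in \<open>auto simp: field_simps\<close>)
  also have "(c powr (p - 1)) powr (p / (p - 1)) = c powr p"
    using p by (simp add: powr_powr)
  finally have "p * (x * c powr (p - 1)) \<le> p * (x powr p / p + c powr p / (p / (p - 1)))"
    using p by (intro mult_left_mono) auto
  also have "\<dots> = x powr p + (p - 1) * c powr p"
    using p unfolding distrib_left by simp
  finally show ?thesis by (simp add: mult_ac)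
qed

text \<open>Comparing \<open>p\<close>-th powers in \<open>[0, \<infinity>]\<close> lets a bound
  include finiteness of the moment without a separate integrability claim; \<open>Lp_norm_le\<close>
  takes the root once, at the end.\<close>

definition Lp_bd :: "'w measure \<Rightarrow> real \<Rightarrow> ('w \<Rightarrow> 'h::real_normed_vector) \<Rightarrow> real \<Rightarrow> bool" where
  "Lp_bd M p Y c \<longleftrightarrow> (\<integral>\<^sup>+ \<omega>. ennreal (norm (Y \<omega>) powr p) \<partial>M) \<le> ennreal (c powr p)"

lemma Lp_bd_norm: "Lp_bd M p (\<lambda>\<omega>. norm (Y \<omega>)) c \<longleftrightarrow> Lp_bd M p Y c"
  by (simp add: Lp_bd_def)

lemma Lp_bd_mono:
  assumes "Lp_bd M p Z c" "AE \<omega> in M. norm (Y \<omega>) \<le> norm (Z \<omega>)" "c \<le> d" "0 \<le> c" "0 \<le> p"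
  shows "Lp_bd M p Y d"
proof -
  have "(\<integral>\<^sup>+ \<omega>. ennreal (norm (Y \<omega>) powr p) \<partial>M) \<le> (\<integral>\<^sup>+ \<omega>. ennreal (norm (Z \<omega>) powr p) \<partial>M)"
    by (intro nn_integral_mono_AE) (use assms in \<open>auto elim!: eventually_mono intro!: ennreal_leI powr_mono2\<close>)
  also have "\<dots> \<le> ennreal (d powr p)"
    using assms unfolding Lp_bd_def
    by (meson dual_order.trans ennreal_leI powr_mono2)
  finally show ?thesis by (simp add: Lp_bd_def)
qed

lemma Lp_bd_const:
  assumes "prob_space M" "norm a \<le> c" "p \<ge> 0"
  shows "Lp_bd M p (\<lambda>_. a) c"
  using assms by (simp add: Lp_bd_def prob_space.emeasure_space_1 ennreal_leI powr_mono2)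

lemma Lp_bd_scaleR:
  fixes Y :: "'w \<Rightarrow> 'h::{real_normed_vector, second_countable_topology}"
  assumes "Lp_bd M p Y c" and [measurable]: "Y \<in> borel_measurable M" and "c \<ge> 0"
  shows "Lp_bd M p (\<lambda>\<omega>. a *\<^sub>R Y \<omega>) (\<bar>a\<bar> * c)"
proof -
  have "(\<integral>\<^sup>+ \<omega>. ennreal (norm (a *\<^sub>R Y \<omega>) powr p) \<partial>M)
      = ennreal (\<bar>a\<bar> powr p) * (\<integral>\<^sup>+ \<omega>. ennreal (norm (Y \<omega>) powr p) \<partial>M)"
    by (subst nn_integral_cmult[symmetric]) (auto simp: powr_mult ennreal_mult)
  also have "\<dots> \<le> ennreal (\<bar>a\<bar> powr p) * ennreal (c powr p)"
    using assms by (intro mult_left_mono) (auto simp: Lp_bd_def)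
  also have "\<dots> = ennreal ((\<bar>a\<bar> * c) powr p)"
    using assms by (simp add: powr_mult ennreal_mult)
  finally show ?thesis by (simp add: Lp_bd_def)
qed

text \<open>Convexity of \<open>z powr p\<close>: the mean \<open>(a + b) / (c + d)\<close> averages
  \<open>a / c\<close> and \<open>b / d\<close> with weights \<open>c / (c + d)\<close> and
  \<open>d / (c + d)\<close>, and the tangent inequalities at this mean add up. Integrated, it is
  Minkowski's inequality with prescribed bounds \<open>c\<close>, \<open>d\<close> in place of the
  norms.\<close>

lemma powr_add_weighted:
  fixes a b c d p :: real
  assumes p: "p > 1" and ab: "a \<ge> 0" "b \<ge> 0" and cd: "c > 0" "d > 0"
  shows "(a + b) powr p \<le> (c + d) powr p * (c / (c + d) * (a / c) powr p + d / (c + d) * (b / d) powr p)"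
proof -
  define t where "t = c + d"
  define y where "y = (a + b) / t"
  have t: "t > 0" using cd by (simp add: t_def)
  have y: "y \<ge> 0" using ab t by (simp add: y_def)
  have "p * y powr (p - 1) * (a / c) \<le> (a / c) powr p + (p - 1) * y powr p"
    "p * y powr (p - 1) * (b / d) \<le> (b / d) powr p + (p - 1) * y powr p"
    by (rule powr_tangent; use p ab cd y in simp)+
  then have "(c / t) * (p * y powr (p - 1) * (a / c)) + (d / t) * (p * y powr (p - 1) * (b / d))
     \<le> (c / t) * ((a / c) powr p + (p - 1) * y powr p) + (d / t) * ((b / d) powr p + (p - 1) * y powr p)"
    using cd t by (intro add_mono mult_left_mono) auto
  moreover have "(c / t) * (p * y powr (p - 1) * (a / c)) + (d / t) * (p * y powr (p - 1) * (b / d))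
     = p * y powr (p - 1) * y"
    using cd t by (simp add: y_def field_simps)
  moreover have "y powr (p - 1) * y = y powr p"
    using y by (cases "y = 0") (use p in \<open>auto simp: powr_diff\<close>)
  moreover have "(c / t) * ((p - 1) * y powr p) + (d / t) * ((p - 1) * y powr p) = (p - 1) * y powr p"
  proof -
    have "c / t + d / t = 1" using cd by (simp add: t_def flip: add_divide_distrib)
    then show ?thesis by (metis distrib_right mult_1)
  qed
  ultimately have "y powr p \<le> c / t * (a / c) powr p + d / t * (b / d) powr p"
    by (simp add: algebra_simps)
  then have "t powr p * y powr p \<le> t powr p * (c / t * (a / c) powr p + d / t * (b / d) powr p)"
    by (intro mult_left_mono) auto
  moreover have "t powr p * y powr p = (a + b) powr p"
    using t y ab by (simp add: y_def flip: powr_mult)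
  ultimately show ?thesis by (simp add: t_def)
qed

lemma Lp_bd_add:
  fixes Y Z :: "'w \<Rightarrow> 'h::{real_normed_vector, second_countable_topology}"
  assumes p: "p > 1" and Y: "Lp_bd M p Y c" "Y \<in> borel_measurable M"
    and Z: "Lp_bd M p Z d" "Z \<in> borel_measurable M" and cd: "c > 0" "d > 0"
  shows "Lp_bd M p (\<lambda>\<omega>. Y \<omega> + Z \<omega>) (c + d)"
proof -
  note [measurable] = Y(2) Z(2)
  let ?w = "(c + d) powr p"
  let ?a = "?w * (c / (c + d)) / c powr p" and ?b = "?w * (d / (c + d)) / d powr p"
  have pt: "norm (Y \<omega> + Z \<omega>) powr p \<le> ?a * norm (Y \<omega>) powr p + ?b * norm (Z \<omega>) powr p" for \<omega>
  proof -
    have "norm (Y \<omega> + Z \<omega>) powr p \<le> (norm (Y \<omega>) + norm (Z \<omega>)) powr p"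
      using p by (intro powr_mono2 norm_triangle_ineq) auto
    also have "\<dots> \<le> ?w * (c / (c + d) * (norm (Y \<omega>) / c) powr p + d / (c + d) * (norm (Z \<omega>) / d) powr p)"
      using p cd by (intro powr_add_weighted) auto
    also have "\<dots> = ?a * norm (Y \<omega>) powr p + ?b * norm (Z \<omega>) powr p"
      using cd by (simp add: powr_divide distrib_left)
    finally show ?thesis .
  qed
  have ab: "?a \<ge> 0" "?b \<ge> 0" using cd by auto
  have "(\<integral>\<^sup>+ \<omega>. ennreal (norm (Y \<omega> + Z \<omega>) powr p) \<partial>M)
    \<le> (\<integral>\<^sup>+ \<omega>. ennreal ?a * ennreal (norm (Y \<omega>) powr p) + ennreal ?b * ennreal (norm (Z \<omega>) powr p) \<partial>M)"
    using pt ab cd by (intro nn_integral_mono) (simp add: ennreal_leI flip: ennreal_mult ennreal_plus)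
  also have "\<dots> = ennreal ?a * (\<integral>\<^sup>+ \<omega>. ennreal (norm (Y \<omega>) powr p) \<partial>M)
       + ennreal ?b * (\<integral>\<^sup>+ \<omega>. ennreal (norm (Z \<omega>) powr p) \<partial>M)"
    by (subst nn_integral_add) (auto simp: nn_integral_cmult)
  also have "\<dots> \<le> ennreal ?a * ennreal (c powr p) + ennreal ?b * ennreal (d powr p)"
    using Y Z by (intro add_mono mult_left_mono) (auto simp: Lp_bd_def)
  also have "\<dots> = ennreal (?a * c powr p + ?b * d powr p)"
  proof -
    have "ennreal A * ennreal C + ennreal B * ennreal D = ennreal (A * C + B * D)"
      if "A \<ge> 0" "B \<ge> 0" "C \<ge> 0" "D \<ge> 0" for A B C D
      using that by (simp add: ennreal_mult ennreal_plus)
    from this[OF ab] show ?thesis by simp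
  qed
  also have "?a * c powr p + ?b * d powr p = ?w * (c / (c + d) + d / (c + d))"
    using cd by (simp add: distrib_left)
  also have "c / (c + d) + d / (c + d) = 1" using cd by (simp flip: add_divide_distrib)
  finally show ?thesis by (simp add: Lp_bd_def)
qed

lemma Lp_bd_diff:
  fixes Y Z :: "'w \<Rightarrow> 'h::{real_normed_vector, second_countable_topology}"
  assumes p: "p > 1" and Y: "Lp_bd M p Y c" "Y \<in> borel_measurable M"
    and Z: "Lp_bd M p Z d" "Z \<in> borel_measurable M" and cd: "c > 0" "d > 0"
  shows "Lp_bd M p (\<lambda>\<omega>. Y \<omega> - Z \<omega>) (c + d)"
  using Lp_bd_add[OF p Y, of "\<lambda>\<omega>. - Z \<omega>" d] Z cd by (simp add: Lp_bd_def)

lemma Lp_bd_sum: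
  fixes Y :: "'i \<Rightarrow> 'w \<Rightarrow> 'h::{real_normed_vector, second_countable_topology}"
  assumes p: "p > 1" and "finite I" "I \<noteq> {}" and Y: "\<And>i. i \<in> I \<Longrightarrow> Lp_bd M p (Y i) c"
    "\<And>i. i \<in> I \<Longrightarrow> Y i \<in> borel_measurable M" and c: "c > 0"
  shows "Lp_bd M p (\<lambda>\<omega>. \<Sum>i\<in>I. Y i \<omega>) (real (card I) * c)"
  using assms(2-5)
proof (induction I rule: finite_ne_induct)
  case (insert i I)
  have "Lp_bd M p (\<lambda>\<omega>. Y i \<omega> + (\<Sum>i\<in>I. Y i \<omega>)) (c + real (card I) * c)"
    using insert c by (intro Lp_bd_add[OF p]) (auto simp: card_gt_0_iff)
  then show ?case using insert by (simp add: algebra_simps)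
qed auto

text \<open>Minkowski's integral inequality for a measure of mass at most \<open>W\<close>: Jensen's
  inequality in \<open>N\<close> for each \<open>\<omega>\<close>, then Fubini. \<open>G\<close>
  enters only through a bound by a nonnegative integral, so it can be a Bochner integral whose
  integrand is not yet known to be integrable.\<close>

lemma Lp_bd_integral:
  fixes f :: "'a \<Rightarrow> 'w \<Rightarrow> real" and G :: "'w \<Rightarrow> 'h::{real_normed_vector, second_countable_topology}"
  assumes p: "p > 1" and N: "sigma_finite_measure N" and M: "sigma_finite_measure M"
    and f[measurable]: "case_prod f \<in> borel_measurable (N \<Otimes>\<^sub>M M)"
    and W: "emeasure N (space N) \<le> ennreal W" "W > 0" and c: "c \<ge> 0"
    and fc: "AE s in N. Lp_bd M p (f s) c"
    and G: "AE \<omega> in M. ennreal (norm (G \<omega>)) \<le> (\<integral>\<^sup>+ s. ennreal \<bar>f s \<omega>\<bar> \<partial>N)"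
    and Gm[measurable]: "G \<in> borel_measurable M"
  shows "Lp_bd M p G (W * c)"
proof -
  interpret N: sigma_finite_measure N by fact
  interpret M: sigma_finite_measure M by fact
  interpret pair_sigma_finite N M ..
  have pt: "ennreal (norm (G \<omega>) powr p) \<le> ennreal (W powr (p - 1)) * (\<integral>\<^sup>+ s. ennreal (\<bar>f s \<omega>\<bar> powr p) \<partial>N)"
    if *: "ennreal (norm (G \<omega>)) \<le> (\<integral>\<^sup>+ s. ennreal \<bar>f s \<omega>\<bar> \<partial>N)" and \<omega>: "\<omega> \<in> space M" for \<omega>
  proof -
    \<comment> \<open>The point at which the tangent is taken; integrating the tangent inequality
      over \<open>N\<close> then gives Jensen's inequality.\<close>
    define d where "d = norm (G \<omega>) / W"
    have d: "d \<ge> 0" using W by (simp add: d_def)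
    have fm[measurable]: "(\<lambda>s. f s \<omega>) \<in> borel_measurable N" using f \<omega> by measurable
    have dd: "d powr (p - 1) * d = d powr p"
      using d p by (cases "d = 0") (auto simp: powr_diff)
    have "p * d powr p * W = p * d powr (p - 1) * norm (G \<omega>)"
      using W unfolding dd[symmetric] by (simp add: d_def)
    then have "ennreal (p * d powr p * W) = ennreal (p * d powr (p - 1)) * ennreal (norm (G \<omega>))"
      using p by (simp only:) (intro ennreal_mult, auto)
    also have "\<dots> \<le> ennreal (p * d powr (p - 1)) * (\<integral>\<^sup>+ s. ennreal \<bar>f s \<omega>\<bar> \<partial>N)"
      by (intro mult_left_mono *) auto
    also have "\<dots> = (\<integral>\<^sup>+ s. ennreal (p * d powr (p - 1) * \<bar>f s \<omega>\<bar>) \<partial>N)"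
      using p by (subst nn_integral_cmult[symmetric]) (auto simp: ennreal_mult)
    also have "\<dots> \<le> (\<integral>\<^sup>+ s. ennreal (\<bar>f s \<omega>\<bar> powr p) + ennreal ((p - 1) * d powr p) \<partial>N)"
      using p d powr_tangent[OF p, of "\<bar>f s \<omega>\<bar>" d for s]
      by (intro nn_integral_mono) (auto simp: simp flip: ennreal_plus intro!: ennreal_leI)
    also have "\<dots> = (\<integral>\<^sup>+ s. ennreal (\<bar>f s \<omega>\<bar> powr p) \<partial>N) + ennreal ((p - 1) * d powr p) * emeasure N (space N)"
      by (subst nn_integral_add) auto
    also have "\<dots> \<le> (\<integral>\<^sup>+ s. ennreal (\<bar>f s \<omega>\<bar> powr p) \<partial>N) + ennreal ((p - 1) * d powr p) * ennreal W"
      by (intro add_mono mult_left_mono W) auto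
    also have "ennreal ((p - 1) * d powr p) * ennreal W = ennreal ((p - 1) * d powr p * W)"
      using p W by (subst ennreal_mult) auto
    finally have le: "ennreal (p * d powr p * W)
       \<le> (\<integral>\<^sup>+ s. ennreal (\<bar>f s \<omega>\<bar> powr p) \<partial>N) + ennreal ((p - 1) * d powr p * W)" .
    have "p * d powr p * W = d powr p * W + (p - 1) * d powr p * W"
      by (simp add: algebra_simps)
    moreover have "0 \<le> d powr p * W" "0 \<le> (p - 1) * d powr p * W" using p W by auto
    ultimately have "ennreal (d powr p * W) + ennreal ((p - 1) * d powr p * W)
       \<le> (\<integral>\<^sup>+ s. ennreal (\<bar>f s \<omega>\<bar> powr p) \<partial>N) + ennreal ((p - 1) * d powr p * W)"
      using le by (simp only: ennreal_plus)
    \<comment> \<open>The subtracted term is finite, so it cancels even if the integral of the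
      powers is infinite.\<close>
    then have le: "ennreal (d powr p * W) \<le> (\<integral>\<^sup>+ s. ennreal (\<bar>f s \<omega>\<bar> powr p) \<partial>N)"
      by (simp add: add.commute[of _ "ennreal ((p - 1) * d powr p * W)"] ennreal_add_left_cancel_le)
    have "norm (G \<omega>) powr p = W powr (p - 1) * (d powr p * W)"
      using W p by (simp add: d_def powr_divide powr_diff)
    then have "ennreal (norm (G \<omega>) powr p) = ennreal (W powr (p - 1)) * ennreal (d powr p * W)"
      using W by (subst ennreal_mult[symmetric]) auto
    then show ?thesis using le by (simp add: mult_left_mono)
  qed
  have fm[measurable]: "(\<lambda>x. ennreal (\<bar>case_prod f x\<bar> powr p)) \<in> borel_measurable (N \<Otimes>\<^sub>M M)" by measurable
  have "(\<integral>\<^sup>+ \<omega>. ennreal (norm (G \<omega>) powr p) \<partial>M)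
     \<le> (\<integral>\<^sup>+ \<omega>. ennreal (W powr (p - 1)) * (\<integral>\<^sup>+ s. ennreal (\<bar>f s \<omega>\<bar> powr p) \<partial>N) \<partial>M)"
    using G by (intro nn_integral_mono_AE) (auto intro: pt elim: AE_mp)
  also have "\<dots> = ennreal (W powr (p - 1)) * (\<integral>\<^sup>+ \<omega>. (\<integral>\<^sup>+ s. ennreal (\<bar>f s \<omega>\<bar> powr p) \<partial>N) \<partial>M)"
    by (rule nn_integral_cmult) measurable
  also have "(\<integral>\<^sup>+ \<omega>. (\<integral>\<^sup>+ s. ennreal (\<bar>f s \<omega>\<bar> powr p) \<partial>N) \<partial>M)
     = (\<integral>\<^sup>+ s. (\<integral>\<^sup>+ \<omega>. ennreal (\<bar>f s \<omega>\<bar> powr p) \<partial>M) \<partial>N)"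
    using Fubini[OF fm] by simp
  also have "\<dots> \<le> (\<integral>\<^sup>+ s. ennreal (c powr p) \<partial>N)"
    using fc by (intro nn_integral_mono_AE) (auto simp: Lp_bd_def)
  also have "\<dots> \<le> ennreal (c powr p) * ennreal W"
    using W by (auto intro!: mult_left_mono)
  also have "ennreal (W powr (p - 1)) * (ennreal (c powr p) * ennreal W) = ennreal ((W * c) powr p)"
    using W c by (simp add: powr_mult powr_diff flip: ennreal_mult)
  finally show ?thesis by (simp add: Lp_bd_def mult_left_mono)
qed

text \<open>The weight \<open>exp (- 2 * K * t)\<close> turns \<open>K\<close> times the time
  integral into a contraction of factor \<open>K / (2 * K) = 1/2\<close>, so half of the weighted
  integral can be absorbed; this is legitimate because the integral of \<open>u\<close> is finite.
  The factor \<open>2\<close> comes from the absorption, the exponential from removing the weight.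
  An inequality at almost every \<open>t\<close> is what Fubini can supply.\<close>

lemma gronwall_integral:
  fixes u h :: "real \<Rightarrow> real"
  assumes [measurable]: "u \<in> borel_measurable borel" "h \<in> borel_measurable borel"
    and K: "K > 0" and T: "T \<ge> 0"
    and ineq: "AE t in lborel. t \<in> {0..T} \<longrightarrow>
       ennreal (u t) \<le> ennreal (h t) + ennreal K * (\<integral>\<^sup>+ s\<in>{0..t}. ennreal (u s) \<partial>lborel)"
    and fin: "(\<integral>\<^sup>+ s\<in>{0..T}. ennreal (u s) \<partial>lborel) < \<infinity>"
  shows "(\<integral>\<^sup>+ s\<in>{0..T}. ennreal (u s) \<partial>lborel)
      \<le> ennreal (2 * exp (2 * K * T)) * (\<integral>\<^sup>+ s\<in>{0..T}. ennreal (h s) \<partial>lborel)"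
proof -
  define a where "a t = ennreal (exp (- (2 * K) * t))" for t :: real
  have [measurable]: "a \<in> borel_measurable borel" unfolding a_def by measurable
  define I where "I = (\<integral>\<^sup>+ t\<in>{0..T}. a t * ennreal (u t) \<partial>lborel)"
  define H where "H = (\<integral>\<^sup>+ s\<in>{0..T}. ennreal (h s) \<partial>lborel)"
  have a1: "a t \<le> 1" if "t \<ge> 0" for t using that K by (simp add: a_def)
  have "I \<le> (\<integral>\<^sup>+ s\<in>{0..T}. ennreal (u s) \<partial>lborel)"
    unfolding I_def using a1 mult_right_mono[of "a t" 1 for t]
    by (intro nn_integral_mono) (auto simp: indicator_def mult_right_mono split: if_splits)
  then have Ifin: "I < \<infinity>" using fin by (rule le_less_trans)
  have "I \<le> (\<integral>\<^sup>+ t. ennreal (h t) * indicator {0..T} t + ennreal K *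
      (\<integral>\<^sup>+ s. a t * indicator {0..T} t * (ennreal (u s) * indicator {0..t} s) \<partial>lborel) \<partial>lborel)"
    unfolding I_def
  proof (intro nn_integral_mono_AE, use ineq in eventually_elim)
    case (elim t)
    show ?case
    proof (cases "t \<in> {0..T}")
      case True
      have "a t * ennreal (u t) \<le> a t * (ennreal (h t) + ennreal K * (\<integral>\<^sup>+ s\<in>{0..t}. ennreal (u s) \<partial>lborel))"
        using elim True by (intro mult_left_mono) auto
      also have "\<dots> = a t * ennreal (h t) + ennreal K * (\<integral>\<^sup>+ s. a t * (ennreal (u s) * indicator {0..t} s) \<partial>lborel)"
        by (subst nn_integral_cmult) (auto simp: distrib_left mult_ac)
      also have "\<dots> \<le> ennreal (h t) + ennreal K * (\<integral>\<^sup>+ s. a t * (ennreal (u s) * indicator {0..t} s) \<partial>lborel)"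
        using a1[of t] mult_right_mono[of "a t" 1 "ennreal (h t)"] True by (intro add_mono) auto
      finally show ?thesis using True by simp
    qed auto
  qed
  also have "\<dots> = H + ennreal K * (\<integral>\<^sup>+ t. (\<integral>\<^sup>+ s. a t * indicator {0..T} t * (ennreal (u s) * indicator {0..t} s) \<partial>lborel) \<partial>lborel)"
  proof -
    have [measurable]: "Measurable.pred (lborel \<Otimes>\<^sub>M lborel) (\<lambda>x::real\<times>real. 0 \<le> snd x \<and> snd x \<le> fst x)" by measurable
    have eq: "indicator {0..t} s = (if 0 \<le> s \<and> s \<le> t then 1 else 0::ennreal)" for s t :: real by (auto simp: indicator_def)
    have [measurable]: "(\<lambda>t. \<integral>\<^sup>+ s. a t * indicator {0..T} t * (ennreal (u s) * indicator {0..t} s) \<partial>lborel) \<in> borel_measurable lborel"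
      unfolding eq by measurable
    show ?thesis unfolding H_def
      by (subst nn_integral_add, measurable, subst nn_integral_cmult, measurable)
  qed
  also have "(\<integral>\<^sup>+ t. (\<integral>\<^sup>+ s. a t * indicator {0..T} t * (ennreal (u s) * indicator {0..t} s) \<partial>lborel) \<partial>lborel)
    = (\<integral>\<^sup>+ s. (\<integral>\<^sup>+ t. a t * indicator {0..T} t * (ennreal (u s) * indicator {0..t} s) \<partial>lborel) \<partial>lborel)"
  proof -
    have eq: "indicator {0..t} s = (if 0 \<le> s \<and> s \<le> t then 1 else 0::ennreal)" for s t :: real by (auto simp: indicator_def)
    show ?thesis unfolding eq by (intro lborel_pair.Fubini') measurable
  qed
  \<comment> \<open>After the exchange of integrals \<open>u s\<close> carries the weight of all
    later times; extending these to \<open>{s..}\<close> gives the weight at \<open>s\<close> times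
    \<open>1 / (2 * K)\<close>.\<close>
  also have "\<dots> \<le> (\<integral>\<^sup>+ s. ennreal (u s) * indicator {0..T} s * (\<integral>\<^sup>+ t. a t * indicator {s..} t \<partial>lborel) \<partial>lborel)"
  proof (intro nn_integral_mono)
    fix s :: real
    have "(\<integral>\<^sup>+ t. a t * indicator {0..T} t * (ennreal (u s) * indicator {0..t} s) \<partial>lborel)
        \<le> (\<integral>\<^sup>+ t. (ennreal (u s) * indicator {0..T} s) * (a t * indicator {s..} t) \<partial>lborel)"
      by (intro nn_integral_mono) (auto simp: indicator_def mult_ac)
    then show "(\<integral>\<^sup>+ t. a t * indicator {0..T} t * (ennreal (u s) * indicator {0..t} s) \<partial>lborel)
      \<le> ennreal (u s) * indicator {0..T} s * (\<integral>\<^sup>+ t. a t * indicator {s..} t \<partial>lborel)"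
      by (subst (asm) nn_integral_cmult) auto
  qed
  also have "\<dots> = (\<integral>\<^sup>+ s. ennreal (u s) * indicator {0..T} s * (a s * ennreal (1 / (2 * K))) \<partial>lborel)"
  proof (intro nn_integral_cong arg_cong2[where f="(*)"] refl)
    fix s :: real
    have "((\<lambda>t. - exp (- (2 * K) * t) / (2 * K)) \<longlongrightarrow> 0) at_top"
    proof -
      have "filterlim (\<lambda>t. - (2 * K) * t) at_bot at_top"
        using K by (intro filterlim_tendsto_neg_mult_at_bot[OF tendsto_const]) (auto simp: filterlim_ident)
      then have "((\<lambda>t. exp (- (2 * K) * t)) \<longlongrightarrow> 0) at_top"
        by (rule filterlim_compose[OF exp_at_bot])
      from tendsto_divide[OF tendsto_minus[OF this] tendsto_const[of "2 * K"]] show ?thesis using K by simp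
    qed
    then have "(\<integral>\<^sup>+ t. ennreal (exp (- (2 * K) * t)) * indicator {s..} t \<partial>lborel) = ennreal (0 - (- exp (- (2 * K) * s) / (2 * K)))"
      using K by (intro nn_integral_FTC_atLeast) (auto intro!: derivative_eq_intros)
    also have "\<dots> = a s * ennreal (1 / (2 * K))"
      using K unfolding a_def by (subst ennreal_mult[symmetric]) auto
    finally show "(\<integral>\<^sup>+ t. a t * indicator {s..} t \<partial>lborel) = a s * ennreal (1 / (2 * K))"
      by (simp add: a_def)
  qed
  also have "\<dots> = ennreal (1 / (2 * K)) * I"
    unfolding I_def by (subst nn_integral_cmult[symmetric]) (auto simp: mult_ac)
  finally have "I \<le> H + ennreal K * (ennreal (1 / (2 * K)) * I)"
    by (simp add: mult_left_mono add_left_mono)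
  also have "ennreal K * (ennreal (1 / (2 * K)) * I) = ennreal (1/2) * I"
    using K by (simp add: mult.assoc[symmetric] flip: ennreal_mult)
  finally have I2: "I \<le> H + ennreal (1/2) * I" .
  have I2': "I \<le> 2 * H"
  proof (cases "H = \<infinity>")
    case False
    obtain i where i: "I = ennreal i" "i \<ge> 0" using Ifin by (cases I) auto
    obtain k where k: "H = ennreal k" "k \<ge> 0" using False by (cases H) auto
    have "ennreal (1/2) * I = ennreal (1/2 * i)"
      unfolding i(1) by (rule ennreal_mult[symmetric]) (use i in auto)
    with I2 have "ennreal i \<le> ennreal (k + 1/2 * i)" using i k by (simp only: ennreal_plus)
    then have "i \<le> 2 * k" using i k by (subst (asm) ennreal_le_iff) auto
    then show ?thesis using i k by (metis ennreal_leI ennreal_mult ennreal_numeral zero_le_numeral)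
  qed (simp add: ennreal_mult_eq_top_iff)
  have "(\<integral>\<^sup>+ s\<in>{0..T}. ennreal (u s) \<partial>lborel)
      \<le> (\<integral>\<^sup>+ s. ennreal (exp (2 * K * T)) * (a s * ennreal (u s) * indicator {0..T} s) \<partial>lborel)"
  proof (intro nn_integral_mono)
    fix s :: real
    have "1 \<le> ennreal (exp (2 * K * T)) * a s" if "s \<in> {0..T}"
      unfolding a_def using that K by (subst ennreal_mult[symmetric]) (auto simp: mult_exp_exp)
    then have "1 * ennreal (u s) \<le> ennreal (exp (2 * K * T)) * a s * ennreal (u s)" if "s \<in> {0..T}"
      using that by (intro mult_right_mono) auto
    then show "ennreal (u s) * indicator {0..T} s \<le> ennreal (exp (2 * K * T)) * (a s * ennreal (u s) * indicator {0..T} s)"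
      by (auto simp: indicator_def mult_ac)
  qed
  also have "\<dots> = ennreal (exp (2 * K * T)) * I"
    unfolding I_def by (subst nn_integral_cmult) auto
  also have "\<dots> \<le> ennreal (exp (2 * K * T)) * (2 * H)"
    using I2' by (intro mult_left_mono) auto
  also have "\<dots> = ennreal (2 * exp (2 * K * T)) * H"
    by (simp add: ennreal_mult mult_ac)
  finally show ?thesis by (simp add: H_def)
qed

section \<open>Diagonal semigroups\<close>

text \<open>Banach-Steinhaus from Baire's theorem: the closed sets of points whose orbit is bounded
  by \<open>m\<close> cover the space, so one of them contains a ball. It serves for the semigroup
  near time \<open>0\<close>, where only strong continuity is given.\<close>

lemma uniform_boundedness_principle:
  fixes U :: "nat \<Rightarrow> 'a::banach \<Rightarrow> 'b::real_normed_vector"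
  assumes lin: "\<And>n. bounded_linear (U n)" and bdd: "\<And>x. bounded (range (\<lambda>n. U n x))"
  shows "\<exists>B. \<forall>n x. norm (U n x) \<le> B * norm x"
proof -
  define E where "E m = {x. \<forall>n. norm (U n x) \<le> real m}" for m
  have closed: "closed (E m)" for m
  proof -
    have "E m = (\<Inter>n. {x. norm (U n x) \<le> real m})" by (auto simp: E_def)
    then show ?thesis
      by (auto intro!: closed_INT closed_Collect_le continuous_intros linear_continuous_on[OF lin])
  qed
  have "x \<in> \<Union>(range E)" for x
  proof -
    obtain c where "\<forall>n. norm (U n x) \<le> c" using bdd[of x] by (auto simp: bounded_iff)
    moreover obtain m :: nat where "c \<le> real m" using real_arch_simple by blast
    ultimately show ?thesis by (auto simp: E_def intro: order_trans)
  qed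
  then have cover: "\<Union>(range E) = UNIV" by auto
  obtain m where "interior (E m) \<noteq> {}"
  proof (rule ccontr)
    assume "\<not> thesis"
    with that have "\<And>m. interior (E m) = {}" by blast
    then have "Met_TC.mtopology interior_of \<Union>(range E) = {}"
      using closed by (intro Met_TC.metric_Baire_category_alt) (auto simp: complete_UNIV)
    then show False by (simp add: cover)
  qed
  then obtain x0 r where r: "r > 0" "cball x0 r \<subseteq> E m"
    by (meson ex_in_conv interior_subset mem_interior_cball)
  have "norm (U n x) \<le> (2 * real m / r) * norm x" for n x
  proof (cases "x = 0")
    case False
    interpret bounded_linear "U n" by (rule lin)
    \<comment> \<open>A point of the ball in direction \<open>x\<close>: its image and that of the
      centre have norm at most \<open>m\<close>, so their difference, a multiple of
      \<open>U n x\<close>, has norm at most \<open>2 * m\<close>.\<close>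
    define y where "y = x0 + (r / norm x) *\<^sub>R x"
    have "y \<in> E m" using r False by (intro set_mp[OF r(2)]) (auto simp: y_def dist_norm)
    moreover have "x0 \<in> E m" using r by auto
    ultimately have "norm (U n y) \<le> real m" "norm (U n x0) \<le> real m" by (auto simp: E_def)
    then have "norm (U n y - U n x0) \<le> 2 * real m"
      using norm_triangle_ineq4[of "U n y" "U n x0"] by linarith
    moreover have "U n y - U n x0 = (r / norm x) *\<^sub>R U n x"
      by (simp add: y_def add scaleR)
    ultimately have "r / norm x * norm (U n x) \<le> 2 * real m" using r by simp
    then show ?thesis using r False by (simp add: field_simps)
  qed (simp add: linear_0 bounded_linear.linear[OF lin])
  then show ?thesis by blast
qed

locale onb =
  fixes e :: "nat \<Rightarrow> 'h::{real_inner, banach, second_countable_topology}"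
  assumes onb: "orthonormal_basis e"
begin

lemma inner_e: "e j \<bullet> e k = (if j = k then 1 else 0)"
  using onb by (auto simp: orthonormal_basis_def)

definition proj :: "nat \<Rightarrow> 'h \<Rightarrow> 'h" where
  "proj n y = (\<Sum>k<n. (y \<bullet> e k) *\<^sub>R e k)"

lemma inner_proj: "proj n y \<bullet> e k = (if k < n then y \<bullet> e k else 0)"
  by (simp add: proj_def inner_sum_left inner_e if_distrib[of "\<lambda>x. _ * x"] cong: if_cong)

lemma norm_diff_proj: "(norm (y - proj n y))\<^sup>2 = (norm y)\<^sup>2 - (\<Sum>k<n. (y \<bullet> e k)\<^sup>2)"
proof -
  have a: "y \<bullet> proj n y = (\<Sum>k<n. (y \<bullet> e k)\<^sup>2)"
    by (simp add: proj_def inner_sum_right power2_eq_square)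
  have "proj n y \<bullet> proj n y = (\<Sum>k<n. (y \<bullet> e k) * (proj n y \<bullet> e k))"
    by (subst (2) proj_def) (simp add: inner_sum_right)
  also have "\<dots> = (\<Sum>k<n. (y \<bullet> e k)\<^sup>2)"
    by (simp add: inner_proj power2_eq_square)
  finally show ?thesis using a
    by (simp add: power2_norm_eq_inner inner_diff_left inner_diff_right inner_commute[of "proj n y" y])
qed

lemma proj_linear: "proj n (x - y) = proj n x - proj n y"
  by (simp add: proj_def inner_diff_left scaleR_left_diff_distrib sum_subtractf)

lemma span_proj: assumes "z \<in> span (range e)" shows "\<exists>m. \<forall>n\<ge>m. proj n z = z"
  using assms
proof (induction rule: span_induct_alt)
  case base
  show ?case by (simp add: proj_def)
next
  case (step c x y)
  then obtain k m where x: "x = e k" and m: "\<forall>n\<ge>m. proj n y = y" by auto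
  have "proj n (c *\<^sub>R x + y) = c *\<^sub>R x + y" if "n \<ge> max m (Suc k)" for n
  proof -
    have "proj n (c *\<^sub>R x + y) = (\<Sum>j<n. if j = k then c *\<^sub>R e k else 0) + proj n y"
      unfolding proj_def x sum.distrib[symmetric]
      by (intro sum.cong) (auto simp: inner_add_left inner_e scaleR_add_left)
    then show ?thesis using that m by (simp add: x)
  qed
  then show ?case by blast
qed

text \<open>On the span the projections are eventually the identity, and \<open>y - proj n y\<close>
  never exceeds \<open>y\<close> in norm, so the error for \<open>y\<close> is at most its distance
  to a point of the dense span.\<close>

lemma parseval: "(\<lambda>k. (y \<bullet> e k)\<^sup>2) sums (norm y)\<^sup>2"
proof -
  have "(\<lambda>n. norm (y - proj n y)) \<longlonglongrightarrow> 0"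
  proof (rule LIMSEQ_I)
    fix \<eta> :: real assume "\<eta> > 0"
    have "y \<in> closure (span (range e))" using onb by (simp add: orthonormal_basis_def)
    then obtain z where z: "z \<in> span (range e)" "dist z y < \<eta>"
      using \<open>\<eta> > 0\<close> by (auto simp: closure_approachable)
    then obtain m where m: "\<forall>n\<ge>m. proj n z = z" using span_proj by blast
    have "norm (norm (y - proj n y) - 0) < \<eta>" if "n \<ge> m" for n
    proof -
      have "y - proj n y = (y - z) - proj n (y - z)" using m that by (simp add: proj_linear)
      moreover have "(norm ((y - z) - proj n (y - z)))\<^sup>2 \<le> (norm (y - z))\<^sup>2"
        using norm_diff_proj[of "y - z" n] sum_nonneg[of "{..<n}" "\<lambda>k. ((y - z) \<bullet> e k)\<^sup>2"] by simp
      ultimately have "(norm (y - proj n y))\<^sup>2 \<le> (norm (y - z))\<^sup>2" by (simp only:)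
      then have "norm (y - proj n y) \<le> norm (y - z)" by (rule power2_le_imp_le) simp
      then show ?thesis using z by (simp add: dist_norm norm_minus_commute)
    qed
    then show "\<exists>m. \<forall>n\<ge>m. norm (norm (y - proj n y) - 0) < \<eta>" by blast
  qed
  then have "(\<lambda>n. (norm (y - proj n y))\<^sup>2) \<longlonglongrightarrow> 0" by (auto intro: tendsto_eq_intros)
  then have "(\<lambda>n. (norm y)\<^sup>2 - (norm (y - proj n y))\<^sup>2) \<longlonglongrightarrow> (norm y)\<^sup>2 - 0"
    by (intro tendsto_diff tendsto_const)
  then show ?thesis by (simp add: norm_diff_proj sums_def)
qed

lemma coord_eqI:
  assumes "\<And>k. y \<bullet> e k = z \<bullet> e k" shows "y = z"
proof -
  have "(\<lambda>k. 0) sums (norm (y - z))\<^sup>2"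
    using parseval[of "y - z"] assms by (simp add: inner_diff_left)
  then show ?thesis using sums_unique2[OF _ sums_zero] by fastforce
qed

lemma norm_le_coord:
  assumes "\<And>k. \<bar>y \<bullet> e k\<bar> \<le> \<bar>z \<bullet> e k\<bar>" shows "norm y \<le> norm z"
proof -
  have "(norm y)\<^sup>2 \<le> (norm z)\<^sup>2"
    by (rule sums_le[OF _ parseval parseval]) (use assms in \<open>auto simp: abs_le_square_iff\<close>)
  then show ?thesis by (rule power2_le_imp_le) simp
qed

lemma norm_le_coord_scaled:
  assumes "\<And>k. \<bar>y \<bullet> e k\<bar> \<le> c * \<bar>z \<bullet> e k\<bar>" "c \<ge> 0" shows "norm y \<le> c * norm z"
  using norm_le_coord[of y "c *\<^sub>R z"] assms by (simp add: abs_mult)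

end

text \<open>Interpolates between the bounds \<open>a\<close> and \<open>1\<close>. Applied to
  multiples of \<open>lam k * h\<close> it is the origin of the fractional powers of time
  increments.\<close>

lemma one_minus_exp_le_powr:
  fixes a \<theta> :: real
  assumes "a \<ge> 0" "0 < \<theta>" "\<theta> \<le> 1"
  shows "1 - exp (- a) \<le> a powr \<theta>"
proof (cases "a \<le> 1")
  case True
  have "1 - exp (- a) \<le> a" using exp_ge_add_one_self[of "- a"] by simp
  also have "a \<le> a powr \<theta>"
    using True assms powr_mono'[of \<theta> 1 a] by (cases "a = 0") auto
  finally show ?thesis .
next
  case False
  then have "1 \<le> a powr \<theta>" using assms by (simp add: ge_one_powr_ge_zero)
  then show ?thesis using exp_gt_zero[of "-a"] by linarith
qed

text \<open>With \<open>a = lam k * v\<close> this is the analytic smoothing estimate on an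
  eigenspace: the power \<theta> of \<open>-A\<close> composed with \<open>S v\<close> is bounded by
  \<open>v powr (- \<theta>)\<close>.\<close>

lemma powr_mult_exp_le_1:
  fixes a \<theta> :: real
  assumes "a \<ge> 0" "0 < \<theta>" "\<theta> \<le> 1"
  shows "a powr \<theta> * exp (- a) \<le> 1"
proof -
  have "a powr \<theta> \<le> 1 + a"
  proof (cases "a \<le> 1")
    case True
    then have "a powr \<theta> \<le> 1" using assms by (simp add: powr_le1)
    then show ?thesis using assms by linarith
  next
    case False
    then have "a powr \<theta> \<le> a powr 1" using assms by (intro powr_mono) auto
    then show ?thesis using False by simp
  qed
  also have "\<dots> \<le> exp a" by (rule exp_ge_add_one_self)
  finally have "a powr \<theta> * exp (- a) \<le> exp a * exp (- a)" by (intro mult_right_mono) auto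
  then show ?thesis by (simp add: mult_exp_exp)
qed

text \<open>\<open>S\<close> is known only as the semigroup generated by \<open>(D, A)\<close>; its
  action on coordinates is derived from the eigenvalue relation in \<open>S_e\<close> and
  \<open>S_coord\<close>.\<close>

locale diag_semigroup = onb e for e :: "nat \<Rightarrow> 'h::{real_inner, banach, second_countable_topology}" +
  fixes D :: "'h set" and A :: "'h \<Rightarrow> 'h" and S :: "real \<Rightarrow> 'h \<Rightarrow> 'h" and lam :: "nat \<Rightarrow> real"
  assumes eigen: "\<And>k. e k \<in> D" "\<And>k. - A (e k) = lam k *\<^sub>R e k"
    and lam_pos: "\<And>k. lam k > 0"
    and gen: "generates_C0_semigroup D A S"
begin

lemma S_bl: "t \<ge> 0 \<Longrightarrow> bounded_linear (S t)"
  and S_0: "S 0 y = y"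
  and S_plus: "s \<ge> 0 \<Longrightarrow> t \<ge> 0 \<Longrightarrow> S (s + t) y = S s (S t y)"
  and S_lim: "((\<lambda>t. S t y) \<longlongrightarrow> y) (at_right 0)"
  using gen by (auto simp: generates_C0_semigroup_def)

lemma S_eigen_deriv: "((\<lambda>h. (S h (e k) - e k) /\<^sub>R h) \<longlongrightarrow> - lam k *\<^sub>R e k) (at_right 0)"
  using gen eigen(1)[of k] eigen(2)[of k] unfolding generates_C0_semigroup_def
  by (metis minus_minus scaleR_minus_left)

text \<open>Strong continuity bounds each orbit along times tending to \<open>0\<close>, and uniform
  boundedness makes this a bound on the operators. It stands in for the contraction property, which
  is available only once the coordinates of \<open>S t y\<close> are known.\<close>

lemma S_locally_bounded: "\<exists>d>0. \<exists>B. \<forall>h y. 0 \<le> h \<and> h \<le> d \<longrightarrow> norm (S h y) \<le> B * norm y"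
proof (rule ccontr)
  assume *: "\<not> ?thesis"
  have "\<exists>h. 0 \<le> h \<and> h \<le> 1 / real (Suc n) \<and> (\<exists>y. norm (S h y) > real n * norm y)" for n
    using *[unfolded not_ex not_all, rule_format, of "1 / real (Suc n)"] by (auto simp: not_le)
  then obtain h where h: "\<And>n. 0 \<le> h n" "\<And>n. h n \<le> 1 / real (Suc n)"
     "\<And>n. \<exists>y. norm (S (h n) y) > real n * norm y" by metis
  have h0: "h \<longlonglongrightarrow> 0"
    by (rule real_tendsto_sandwich[OF always_eventually always_eventually tendsto_const LIMSEQ_Suc[OF lim_1_over_n]])
      (use h in auto)
  have "bounded (range (\<lambda>n. S (h n) y))" for y
  proof (rule convergent_imp_bounded)
    have "((\<lambda>t. S t y) \<longlongrightarrow> S 0 y) (at 0 within {0..})"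
      using S_lim[of y] by (simp add: S_0 at_within_Ici_at_right)
    \<comment> \<open>Some \<open>h n\<close> may be \<open>0\<close>, so the limit has to include
      the point \<open>0\<close> itself.\<close>
    then have "((\<lambda>t. S t y) \<longlongrightarrow> S 0 y) (inf (nhds 0) (principal {0..}))"
      by (simp add: continuous_within_open filterlim_def at_within_def S_0 flip: tendsto_at_within_iff_tendsto_nhds)
        (use tendsto_at_within_iff_tendsto_nhds[of "\<lambda>t. S t y" 0 "{0..}"] in \<open>simp add: filterlim_def S_0 at_within_def\<close>)
    moreover have "filterlim h (inf (nhds 0) (principal {0..})) sequentially"
      using h0 h(1) by (simp add: filterlim_inf filterlim_principal)
    ultimately show "(\<lambda>n. S (h n) y) \<longlonglongrightarrow> S 0 y" by (rule filterlim_compose)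
  qed
  then obtain B where B: "\<And>n y. norm (S (h n) y) \<le> B * norm y"
    using uniform_boundedness_principle[of "\<lambda>n. S (h n)"] S_bl h(1) by metis
  obtain n :: nat where "B \<le> real n" using real_arch_simple by blast
  moreover obtain y where "norm (S (h n) y) > real n * norm y" using h(3) by blast
  ultimately show False using B[of n y] by (smt (verit) mult_right_mono norm_ge_zero)
qed

text \<open>The local bound is chained by the semigroup law in steps of length \<open>d\<close>; it
  grows geometrically with the number of steps, which is fixed once \<open>t\<close> is.\<close>

lemma S_bounded_on: "\<exists>B\<ge>0. \<forall>h y. 0 \<le> h \<and> h \<le> t \<longrightarrow> norm (S h y) \<le> B * norm y"
proof -
  obtain d B0 where d: "d > 0" and B0: "\<And>h y. 0 \<le> h \<Longrightarrow> h \<le> d \<Longrightarrow> norm (S h y) \<le> B0 * norm y"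
    using S_locally_bounded by blast
  define B where "B = max 1 B0"
  have B: "norm (S h y) \<le> B * norm y" if "0 \<le> h" "h \<le> d" for h y
    using B0[OF that, of y] mult_right_mono[of B0 B "norm y"] by (simp add: B_def)
  have B1: "B \<ge> 1" by (simp add: B_def)
  have n: "norm (S h y) \<le> B ^ n * norm y" if "0 \<le> h" "h \<le> real n * d" for n h y
    using that
  proof (induction n arbitrary: h y)
    case (Suc n)
    show ?case
    proof (cases "h \<le> d")
      case True
      have "B * norm y \<le> B ^ Suc n * norm y"
        using B1 by (intro mult_right_mono) (simp_all add: one_le_power)
      then show ?thesis using B[of h y] True Suc.prems by linarith
    next
      case False
      have "S h y = S (h - d) (S d y)" using S_plus[of "h - d" d y] False d by simp
      also have "norm \<dots> \<le> B ^ n * norm (S d y)"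
        using Suc.prems False d by (intro Suc.IH) (auto simp: algebra_simps)
      also have "\<dots> \<le> B ^ n * (B * norm y)"
        using B[of d y] B1 d by (intro mult_left_mono) auto
      finally show ?thesis by (simp add: mult_ac)
    qed
  qed (simp add: S_0)
  obtain m :: nat where "t / d \<le> real m" using real_arch_simple by blast
  then have "t \<le> real m * d" using d by (simp add: field_simps)
  then show ?thesis using n[of _ m] B1 by (intro exI[of _ "B ^ m"]) auto
qed

lemma S_add: "t \<ge> 0 \<Longrightarrow> S t (y + z) = S t y + S t z"
  and S_diff: "t \<ge> 0 \<Longrightarrow> S t (y - z) = S t y - S t z"
  and S_scaleR: "t \<ge> 0 \<Longrightarrow> S t (c *\<^sub>R y) = c *\<^sub>R S t y"
  using S_bl by (auto simp: bounded_linear.linear linear_add linear_diff linear_scale)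

text \<open>Telescoping with steps \<open>h = t / (n + 1)\<close>: \<open>S h (e k)\<close> and
  \<open>exp (- lam k * h) *\<^sub>R e k\<close> have the same right derivative at \<open>0\<close>,
  so one step errs by \<open>h *\<^sub>R R h\<close> with \<open>R h\<close> tending to
  \<open>0\<close>. The operators that propagate these errors are bounded on \<open>[0, t]\<close>,
  so the total is at most \<open>t * B * norm (R h)\<close>.\<close>

lemma S_e: assumes t: "t \<ge> 0" shows "S t (e k) = exp (- lam k * t) *\<^sub>R e k"
proof (cases "t = 0")
  case False
  then have t: "t > 0" using t by simp
  obtain B where B: "B \<ge> 0" "\<And>h y. 0 \<le> h \<Longrightarrow> h \<le> t \<Longrightarrow> norm (S h y) \<le> B * norm y"
    using S_bounded_on by blast
  define R where "R h = (S h (e k) - exp (- lam k * h) *\<^sub>R e k) /\<^sub>R h" for h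
  have R0: "(R \<longlongrightarrow> 0) (at_right 0)"
  proof -
    have "((\<lambda>h. (exp (- lam k * h) - 1) / h) \<longlongrightarrow> - lam k) (at_right 0)"
    proof -
      have "((\<lambda>h. exp (- lam k * h)) has_real_derivative - lam k) (at 0)"
        by (auto intro!: derivative_eq_intros)
      then have "((\<lambda>h. (exp (- lam k * h) - 1) / h) \<longlongrightarrow> - lam k) (at 0)"
        by (simp add: DERIV_def)
      then show ?thesis by (rule tendsto_within_subset) simp
    qed
    then have "((\<lambda>h. (S h (e k) - e k) /\<^sub>R h - ((exp (- lam k * h) - 1) / h) *\<^sub>R e k)
       \<longlongrightarrow> - lam k *\<^sub>R e k - (- lam k) *\<^sub>R e k) (at_right 0)"
      by (intro tendsto_intros S_eigen_deriv)
    moreover have "(S h (e k) - e k) /\<^sub>R h - ((exp (- lam k * h) - 1) / h) *\<^sub>R e k = R h" for h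
      by (simp add: R_def algebra_simps divide_inverse)
    ultimately show ?thesis by simp
  qed
  have telescope: "norm (S (real n * h) (e k) - exp (- lam k * (real n * h)) *\<^sub>R e k) \<le> real n * (B * (h * norm (R h)))"
    if h: "h > 0" "real n * h \<le> t" for n h
    using h(2)
  proof (induction n)
    case (Suc n)
    have nh: "real n * h \<le> t" using Suc.prems h(1) by (simp add: algebra_simps)
    have "S (real (Suc n) * h) (e k) - exp (- lam k * (real (Suc n) * h)) *\<^sub>R e k
      = S (real n * h) (S h (e k) - exp (- lam k * h) *\<^sub>R e k)
        + exp (- lam k * h) *\<^sub>R (S (real n * h) (e k) - exp (- lam k * (real n * h)) *\<^sub>R e k)"
      using h(1) S_plus[of "real n * h" h "e k"]
      by (simp add: S_diff S_scaleR algebra_simps mult_exp_exp)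
    also have "S h (e k) - exp (- lam k * h) *\<^sub>R e k = h *\<^sub>R R h" using h(1) by (simp add: R_def)
    also have "norm (S (real n * h) (h *\<^sub>R R h)
        + exp (- lam k * h) *\<^sub>R (S (real n * h) (e k) - exp (- lam k * (real n * h)) *\<^sub>R e k))
      \<le> B * norm (h *\<^sub>R R h) + real n * (B * (h * norm (R h)))"
    proof (intro norm_triangle_mono B)
      show "norm (exp (- lam k * h) *\<^sub>R (S (real n * h) (e k) - exp (- lam k * (real n * h)) *\<^sub>R e k))
         \<le> real n * (B * (h * norm (R h)))"
        using h(1) lam_pos[of k] Suc.IH[OF nh]
        by (intro order_trans[OF _ Suc.IH[OF nh]]) (simp add: mult_left_le_one_le)
    qed (use h(1) nh in auto)
    finally show ?case using h(1) by (simp add: algebra_simps)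
  qed (simp add: S_0)
  define h where "h n = t / real (Suc n)" for n
  have h0: "h \<longlonglongrightarrow> 0"
    unfolding h_def using tendsto_mult_right_zero[OF LIMSEQ_Suc[OF lim_1_over_n], of t] by simp
  have hp: "h n > 0" for n using t by (simp add: h_def)
  have "norm (S t (e k) - exp (- lam k * t) *\<^sub>R e k) \<le> t * B * norm (R (h n))" for n
  proof -
    have eq: "real (Suc n) * h n = t" by (simp add: h_def)
    have "norm (S (real (Suc n) * h n) (e k) - exp (- lam k * (real (Suc n) * h n)) *\<^sub>R e k)
       \<le> real (Suc n) * (B * (h n * norm (R (h n))))"
      by (rule telescope) (use hp eq in auto)
    also have "\<dots> = (real (Suc n) * h n) * B * norm (R (h n))" by simp
    finally show ?thesis unfolding eq .
  qed
  moreover have "(\<lambda>n. t * B * norm (R (h n))) \<longlonglongrightarrow> t * B * norm (0::'h)"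
    by (intro tendsto_intros filterlim_compose[OF R0]) (use h0 hp less_imp_neq[OF hp] in \<open>auto simp: filterlim_at\<close>)
  ultimately have "norm (S t (e k) - exp (- lam k * t) *\<^sub>R e k) \<le> 0"
    by (intro LIMSEQ_le_const) auto
  then show ?thesis by simp
qed (simp add: S_0)

text \<open>True on eigenvectors, hence on their span by linearity, hence everywhere by density and
  continuity of both sides.\<close>

lemma S_coord: assumes t: "t \<ge> 0" shows "S t y \<bullet> e k = exp (- lam k * t) * (y \<bullet> e k)"
proof -
  define f where "f y = S t y \<bullet> e k - exp (- lam k * t) * (y \<bullet> e k)" for y
  have cont: "continuous_on UNIV f" unfolding f_def
    by (intro continuous_intros linear_continuous_on[OF S_bl[OF t]])
  have "f z = 0" if "z \<in> span (range e)" for z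
    using that
  proof (induction rule: span_induct_alt)
    case base
    show ?case using S_bl[OF t] by (simp add: f_def bounded_linear.linear linear_0)
  next
    case (step c x y)
    then show ?case using t
      by (auto simp: f_def S_add S_scaleR S_e inner_add_left inner_e algebra_simps split: if_splits)
  qed
  then have "span (range e) \<subseteq> f -` {0}" by auto
  then have "closure (span (range e)) \<subseteq> f -` {0}"
    by (intro closure_minimal continuous_closed_vimage) (use cont in \<open>auto simp: continuous_on_eq_continuous_at\<close>)
  then have "f y = 0" using onb by (auto simp: orthonormal_basis_def)
  then show ?thesis by (simp add: f_def)
qed

lemma S_contraction: assumes t: "t \<ge> 0" shows "norm (S t y) \<le> norm y"
  by (rule norm_le_coord) (use t lam_pos in \<open>auto simp: S_coord abs_mult less_imp_le intro!: mult_left_le_one_le\<close>)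

text \<open>In each coordinate the decay \<open>exp (- lam k * v)\<close> pays for the factor
  \<open>(lam k * v) powr \<theta>\<close> that the increment over \<open>h\<close> produces. The
  estimate holds for arbitrary \<open>y\<close> at the price of a singularity at
  \<open>v = 0\<close>, integrable when \<open>\<theta> < 1\<close>.\<close>

lemma S_increment:
  assumes v: "v > 0" and h: "h \<ge> 0" and th: "0 < \<theta>" "\<theta> \<le> 1"
  shows "norm (S (v + h) y - S v y) \<le> (h / v) powr \<theta> * norm y"
proof (rule norm_le_coord_scaled)
  fix k
  have l: "lam k > 0" by (rule lam_pos)
  have "(S (v + h) y - S v y) \<bullet> e k = - (exp (- (lam k * v)) * (1 - exp (- (lam k * h)))) * (y \<bullet> e k)"
    using v h by (simp add: inner_diff_left S_coord algebra_simps mult_exp_exp)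
  then have "\<bar>(S (v + h) y - S v y) \<bullet> e k\<bar> = exp (- (lam k * v)) * (1 - exp (- (lam k * h))) * \<bar>y \<bullet> e k\<bar>"
    using l h by (simp add: abs_mult)
  also have "\<dots> \<le> (h / v) powr \<theta> * \<bar>y \<bullet> e k\<bar>"
  proof (intro mult_right_mono)
    have "exp (- (lam k * v)) * (1 - exp (- (lam k * h))) \<le> exp (- (lam k * v)) * (lam k * h) powr \<theta>"
      using l h th by (intro mult_left_mono one_minus_exp_le_powr) auto
    also have "(lam k * h) powr \<theta> = (lam k * v) powr \<theta> * (h / v) powr \<theta>"
      using l h v by (simp flip: powr_mult)
    also have "exp (- (lam k * v)) * ((lam k * v) powr \<theta> * (h / v) powr \<theta>)
       = ((lam k * v) powr \<theta> * exp (- (lam k * v))) * (h / v) powr \<theta>" by simp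
    also have "\<dots> \<le> 1 * (h / v) powr \<theta>"
      using l v th by (intro mult_right_mono powr_mult_exp_le_1) auto
    finally show "exp (- (lam k * v)) * (1 - exp (- (lam k * h))) \<le> (h / v) powr \<theta>" by simp
  qed auto
  finally show "\<bar>(S (v + h) y - S v y) \<bullet> e k\<bar> \<le> (h / v) powr \<theta> * \<bar>y \<bullet> e k\<bar>" .
qed auto

text \<open>Here the regularity of \<open>x\<close> takes the place of smoothing, so there is no
  singularity at \<open>s = 0\<close>; the constant is the norm of the power \<theta> of
  \<open>-A\<close> applied to \<open>x\<close>.\<close>

lemma S_increment_dom:
  assumes x: "x \<in> frac_power_dom e lam \<theta>" and th: "0 < \<theta>" "\<theta> \<le> 1"
  shows "\<exists>C\<ge>0. \<forall>s\<ge>0. \<forall>h\<ge>0. norm (S (s + h) x - S s x) \<le> C * h powr \<theta>"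
proof -
  have sm: "summable (\<lambda>k. (lam k powr \<theta> * (x \<bullet> e k))\<^sup>2)" using x by (simp add: frac_power_dom_def)
  define C where "C = sqrt (\<Sum>k. (lam k powr \<theta> * (x \<bullet> e k))\<^sup>2)"
  have C2: "C\<^sup>2 = (\<Sum>k. (lam k powr \<theta> * (x \<bullet> e k))\<^sup>2)" unfolding C_def using suminf_nonneg[OF sm] by simp
  have "norm (S (s + h) x - S s x) \<le> C * h powr \<theta>" if sh: "s \<ge> 0" "h \<ge> 0" for s h
  proof (rule power2_le_imp_le)
    have "(norm (S h x - x))\<^sup>2 \<le> (h powr \<theta>)\<^sup>2 * C\<^sup>2"
      unfolding C2
    proof (rule sums_le[OF _ parseval sums_mult[OF summable_sums[OF sm]]])
      fix k
      have l: "lam k > 0" by (rule lam_pos)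
      have "(S h x - x) \<bullet> e k = - ((1 - exp (- (lam k * h))) * (x \<bullet> e k))"
        using sh by (simp add: inner_diff_left S_coord algebra_simps)
      then have "\<bar>(S h x - x) \<bullet> e k\<bar> = (1 - exp (- (lam k * h))) * \<bar>x \<bullet> e k\<bar>"
        using l sh by (simp add: abs_mult)
      also have "\<dots> \<le> (lam k * h) powr \<theta> * \<bar>x \<bullet> e k\<bar>"
        using l sh th by (intro mult_right_mono one_minus_exp_le_powr) auto
      also have "\<dots> = \<bar>h powr \<theta> * (lam k powr \<theta> * (x \<bullet> e k))\<bar>"
        using l sh by (simp add: powr_mult abs_mult)
      finally have "((S h x - x) \<bullet> e k)\<^sup>2 \<le> (h powr \<theta> * (lam k powr \<theta> * (x \<bullet> e k)))\<^sup>2"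
        by (simp only: abs_le_square_iff)
      then show "((S h x - x) \<bullet> e k)\<^sup>2 \<le> (h powr \<theta>)\<^sup>2 * (lam k powr \<theta> * (x \<bullet> e k))\<^sup>2"
        by (simp add: power_mult_distrib)
    qed
    moreover have "norm (S (s + h) x - S s x) \<le> norm (S h x - x)"
      using S_contraction[OF sh(1), of "S h x - x"] sh by (simp add: S_diff S_plus)
    then have "(norm (S (s + h) x - S s x))\<^sup>2 \<le> (norm (S h x - x))\<^sup>2" by (intro power_mono) auto
    ultimately show "(norm (S (s + h) x - S s x))\<^sup>2 \<le> (C * h powr \<theta>)\<^sup>2"
      by (simp only: power_mult_distrib mult.commute[of "C\<^sup>2"])
  qed (simp add: C_def suminf_nonneg[OF sm])
  then show ?thesis by (intro exI[of _ C]) (auto simp: C_def suminf_nonneg[OF sm])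
qed

text \<open>Truncating the time at \<open>0\<close> gives a total function, whose joint continuity
  makes the later integrands Borel. For a change of time, the smaller of the two times is removed by
  contraction, which leaves strong continuity at \<open>0\<close> on the fixed vector
  \<open>y0\<close>.\<close>

lemma S_jointly_continuous: "continuous_on UNIV (\<lambda>(t, y). S (max t 0) y)"
proof -
  have near: "((\<lambda>h. norm (S \<bar>h\<bar> y - y)) \<longlongrightarrow> 0) (at 0)" for y
  proof -
    have "((\<lambda>h. norm (S h y - y)) \<longlongrightarrow> 0) (at_right 0)"
      using S_lim[of y] by (simp add: LIM_zero_iff tendsto_norm_zero_iff)
    moreover have "filterlim (\<lambda>h::real. \<bar>h\<bar>) (at_right 0) (at 0)"
      by (auto simp: filterlim_at eventually_at_filter intro!: tendsto_eq_intros)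
    ultimately show ?thesis by (rule filterlim_compose)
  qed
  have "isCont (\<lambda>(t, y). S (max t 0) y) (t0, y0)" for t0 y0
  proof -
    have bound: "norm (S (max t 0) y - S (max t0 0) y0) \<le> norm (y - y0) + norm (S \<bar>max t 0 - max t0 0\<bar> y0 - y0)" for t y
    proof -
      have "norm (S (max t 0) y - S (max t0 0) y0) \<le> norm (S (max t 0) (y - y0)) + norm (S (max t 0) y0 - S (max t0 0) y0)"
        by (simp add: S_diff norm_triangle_sub order_trans[OF _ norm_triangle_ineq]
              norm_triangle_ineq[of "S (max t 0) y - S (max t 0) y0" "S (max t 0) y0 - S (max t0 0) y0", simplified])
      also have "norm (S (max t 0) (y - y0)) \<le> norm (y - y0)" by (intro S_contraction) simp
      also have "norm (S (max t 0) y0 - S (max t0 0) y0) \<le> norm (S \<bar>max t 0 - max t0 0\<bar> y0 - y0)"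
      proof -
        define a b where "a = min (max t 0) (max t0 0)" and "b = \<bar>max t 0 - max t0 0\<bar>"
        have ab: "a \<ge> 0" "b \<ge> 0" by (auto simp: a_def b_def)
        have "norm (S (max t 0) y0 - S (max t0 0) y0) = norm (S (a + b) y0 - S a y0)"
        proof (cases "max t 0 \<le> max t0 0")
          case True
          then have "a = max t 0" "a + b = max t0 0" by (auto simp: a_def b_def)
          then show ?thesis by (simp only: norm_minus_commute)
        next
          case False
          then have "a = max t0 0" "a + b = max t 0" by (auto simp: a_def b_def)
          then show ?thesis by simp
        qed
        also have "\<dots> = norm (S a (S b y0 - y0))" using ab by (simp add: S_plus S_diff)
        also have "\<dots> \<le> norm (S b y0 - y0)" using ab by (intro S_contraction)
        finally show ?thesis by (simp add: b_def)
      qed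
      finally show ?thesis by simp
    qed
    have z: "isCont (\<lambda>h. norm (S \<bar>h\<bar> y0 - y0)) 0" using near[of y0] by (simp add: isCont_def S_0)
    have "isCont (\<lambda>x. norm (S \<bar>max (fst x) 0 - max t0 0\<bar> y0 - y0)) (t0, y0)"
      by (rule isCont_o2[where f="\<lambda>x. max (fst x) 0 - max t0 0"]) (use z in \<open>auto intro!: continuous_intros\<close>)
    then have "((\<lambda>x. norm (S \<bar>max (fst x) 0 - max t0 0\<bar> y0 - y0)) \<longlongrightarrow> 0) (at (t0, y0))"
      by (simp add: isCont_def S_0)
    moreover have "((\<lambda>x. norm (snd x - y0)) \<longlongrightarrow> 0) (at (t0, y0))"
      by (auto intro!: tendsto_eq_intros)
    ultimately have "((\<lambda>x. norm (snd x - y0) + norm (S \<bar>max (fst x) 0 - max t0 0\<bar> y0 - y0)) \<longlongrightarrow> 0) (at (t0, y0))"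
      by (rule tendsto_add_zero[rotated])
    then have "((\<lambda>x. S (max (fst x) 0) (snd x) - S (max t0 0) y0) \<longlongrightarrow> 0) (at (t0, y0))"
      by (rule Lim_null_comparison[rotated]) (use bound in auto)
    then show ?thesis by (simp add: isCont_def LIM_zero_iff case_prod_unfold)
  qed
  then show ?thesis by (auto simp: continuous_on_eq_continuous_at)
qed

lemma S_measurable [measurable (raw)]:
  assumes [measurable]: "f \<in> borel_measurable N" "g \<in> borel_measurable N"
  shows "(\<lambda>x. S (max (f x) 0) (g x)) \<in> borel_measurable N"
  using borel_measurable_continuous_Pair[of f N g "\<lambda>t y. S (max t 0) y"] S_jointly_continuous assms
  by (simp add: case_prod_unfold)

end

section \<open>Stochastic convolutions along cadlag paths\<close>

definition cadlag :: "(real \<Rightarrow> real) \<Rightarrow> bool" where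
  "cadlag g \<longleftrightarrow> (\<forall>t\<ge>0. continuous (at_right t) g \<and> (t > 0 \<longrightarrow> (\<exists>l. (g \<longlongrightarrow> l) (at_left t))))"

text \<open>Bisection: at each point the one-sided limits bound the path on either side, and the
  value at the point itself is one more number.\<close>

lemma cadlag_bounded:
  assumes g: "cadlag g"
  shows "\<exists>B. \<forall>s. 0 \<le> s \<and> s \<le> t \<longrightarrow> \<bar>g s\<bar> \<le> B"
proof (cases "t \<ge> 0")
  case True
  define P where "P a b \<longleftrightarrow> (\<exists>B. \<forall>s. 0 \<le> s \<and> a \<le> s \<and> s \<le> b \<longrightarrow> \<bar>g s\<bar> \<le> B)" for a b
  have loc: "\<exists>d>0. \<exists>B. \<forall>s. s \<in> A \<and> \<bar>s - x\<bar> < d \<and> s \<noteq> x \<longrightarrow> \<bar>g s\<bar> \<le> B"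
    if "(g \<longlongrightarrow> l) (at x within A)" for A l x
  proof -
    have "\<forall>\<^sub>F s in at x within A. dist (g s) l < 1" using that by (rule tendstoD) simp
    then obtain d where "d > 0" "\<And>s. s \<in> A \<Longrightarrow> s \<noteq> x \<Longrightarrow> dist s x < d \<Longrightarrow> dist (g s) l < 1"
      by (auto simp: eventually_at)
    then show ?thesis
      by (intro exI[of _ d] conjI exI[of _ "\<bar>l\<bar> + 1"]) (fastforce simp: dist_real_def)+
  qed
  have "P 0 t"
  proof (rule Bolzano[OF True])
    fix a b c assume P: "P a b" "P b c" "a \<le> b" "b \<le> c"
    then obtain B1 B2 where B: "\<forall>s. 0 \<le> s \<and> a \<le> s \<and> s \<le> b \<longrightarrow> \<bar>g s\<bar> \<le> B1"
        "\<forall>s. 0 \<le> s \<and> b \<le> s \<and> s \<le> c \<longrightarrow> \<bar>g s\<bar> \<le> B2"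
      by (auto simp: P_def)
    then have "\<bar>g s\<bar> \<le> max B1 B2" if "0 \<le> s \<and> a \<le> s \<and> s \<le> c" for s
      using that by (cases "s \<le> b") (auto intro: max.coboundedI1 max.coboundedI2)
    then show "P a c" unfolding P_def by blast
  next
    fix x assume x: "0 \<le> x" "x \<le> t"
    have "(g \<longlongrightarrow> g x) (at_right x)" using g x by (simp add: cadlag_def continuous_within)
    from loc[OF this] obtain d1 B1 where d1': "d1 > 0" "\<forall>s. s \<in> {x<..} \<and> \<bar>s - x\<bar> < d1 \<and> s \<noteq> x \<longrightarrow> \<bar>g s\<bar> \<le> B1"
      by blast
    then have d1: "d1 > 0" "\<And>s. s > x \<Longrightarrow> \<bar>s - x\<bar> < d1 \<Longrightarrow> \<bar>g s\<bar> \<le> B1" by auto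
    obtain d2 B2 where d2: "d2 > 0" "\<And>s. 0 \<le> s \<Longrightarrow> s < x \<Longrightarrow> \<bar>s - x\<bar> < d2 \<Longrightarrow> \<bar>g s\<bar> \<le> B2"
    proof (cases "x = 0")
      case False
      then obtain l where "(g \<longlongrightarrow> l) (at_left x)" using g x by (auto simp: cadlag_def)
      from loc[OF this] obtain d B where "d > 0" "\<forall>s. s \<in> {..<x} \<and> \<bar>s - x\<bar> < d \<and> s \<noteq> x \<longrightarrow> \<bar>g s\<bar> \<le> B"
        by blast
      then show ?thesis by (intro that[of d B]) auto
    qed (use that[of 1] in auto)
    show "\<exists>d>0. \<forall>a b. a \<le> x \<and> x \<le> b \<and> b - a < d \<longrightarrow> P a b"
    proof (intro exI[of _ "min d1 d2"] conjI allI impI)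
      fix a b assume ab: "a \<le> x \<and> x \<le> b \<and> b - a < min d1 d2"
      have "\<bar>g s\<bar> \<le> max \<bar>g x\<bar> (max B1 B2)" if "0 \<le> s \<and> a \<le> s \<and> s \<le> b" for s
        using d1(2)[of s] d2(2)[of s] ab that by (cases s x rule: linorder_cases) auto
      then show "P a b" unfolding P_def by blast
    qed (use d1 d2 in auto)
  qed
  then show ?thesis by (auto simp: P_def)
qed auto

text \<open>The step function takes the value of \<open>g\<close> at the right end of a cell, as
  summation by parts will require. That end lies strictly to the right of \<open>v\<close> and tends
  to \<open>v\<close>, so right continuity gives the limit.\<close>

lemma cadlag_step_approx:
  assumes g: "cadlag g" and s: "0 \<le> s" and h: "0 \<le> h"
    and f_def: "\<And>m v. f m v = (\<Sum>j<m. g (s + h * real (Suc j) / real m) *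
          indicat_real {s + h * real j / real m ..< s + h * real (Suc j) / real m} v)"
  shows "(\<lambda>m. f m v) \<longlonglongrightarrow> indicator {s..<s+h} v * g v"
    and "\<forall>w. 0 \<le> w \<and> w \<le> s + h \<longrightarrow> \<bar>g w\<bar> \<le> B \<Longrightarrow> \<bar>f m v\<bar> \<le> indicator {s..<s+h} v * B"
proof -
  have zero: "f m v = 0" if "v \<notin> {s..<s+h}" for m
    unfolding f_def
  proof (intro sum.neutral ballI)
    fix j assume "j \<in> {..<m}"
    then have "0 \<le> h * real j / real m" "h * real (Suc j) / real m \<le> h"
      using h mult_left_mono[of "real (Suc j)" "real m" h] by (auto simp: divide_le_eq)
    then have "v \<notin> {s + h * real j / real m ..< s + h * real (Suc j) / real m}" using that by auto
    then show "g (s + h * real (Suc j) / real m) *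
          indicat_real {s + h * real j / real m ..< s + h * real (Suc j) / real m} v = 0" by simp
  qed
  have val: "\<exists>w. v < w \<and> w \<le> v + h / real m \<and> w \<le> s + h \<and> f m v = g w" if v: "v \<in> {s..<s+h}" and m: "m > 0" for m
  proof -
    have hp: "h > 0" using v by auto
    define i where "i = nat \<lfloor>(v - s) * real m / h\<rfloor>"
    have nn: "0 \<le> (v - s) * real m / h" using v hp by simp
    have i1: "real i \<le> (v - s) * real m / h" using nn by (simp add: i_def)
    have i2: "(v - s) * real m / h < real (Suc i)" using nn unfolding i_def by linarith
    have i1': "s + h * real i / real m \<le> v" using i1 hp m by (simp add: field_simps)
    have i2': "v < s + h * real (Suc i) / real m" using i2 hp m by (simp add: field_simps)
    have "(v - s) * real m < h * real m" using v m by (intro mult_strict_right_mono) auto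
    then have "(v - s) * real m / h < real m" using hp by (simp add: pos_divide_less_eq mult.commute)
    then have im: "i < m" using i1 by linarith
    have other: "v \<notin> {s + h * real j / real m ..< s + h * real (Suc j) / real m}" if "j \<noteq> i" for j
    proof (cases "j < i")
      case True
      then have "s + h * real (Suc j) / real m \<le> s + h * real i / real m"
        using hp m by (intro add_left_mono divide_right_mono mult_left_mono) auto
      then show ?thesis using i1' by auto
    next
      case False
      then have "s + h * real (Suc i) / real m \<le> s + h * real j / real m"
        using hp m that by (intro add_left_mono divide_right_mono mult_left_mono) auto
      then show ?thesis using i2' by auto
    qed
    have "f m v = (\<Sum>j<m. if j = i then g (s + h * real (Suc i) / real m) else 0)"
      unfolding f_def using other i1' i2' by (intro sum.cong) auto
    then have "f m v = g (s + h * real (Suc i) / real m)" using im by simp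
    moreover have "s + h * real (Suc i) / real m \<le> v + h / real m"
      using i1' by (simp add: distrib_left add_divide_distrib)
    moreover have "h * real (Suc i) / real m \<le> h"
      using im hp mult_left_mono[of "real (Suc i)" "real m" h] by (simp add: divide_le_eq)
    ultimately show ?thesis using i2'
      by (intro exI[of _ "s + h * real (Suc i) / real m"]) (simp del: of_nat_Suc)
  qed
  show "(\<lambda>m. f m v) \<longlonglongrightarrow> indicator {s..<s+h} v * g v"
  proof (cases "v \<in> {s..<s+h}")
    case True
    have "\<forall>m. \<exists>w. v < w \<and> w \<le> v + h / real (Suc m) \<and> f (Suc m) v = g w" using val[OF True] by blast
    then obtain w where w: "\<And>m. v < w m" "\<And>m. w m \<le> v + h / real (Suc m)" "\<And>m. f (Suc m) v = g (w m)"
      by metis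
    have "(\<lambda>m. v + h / real (Suc m)) \<longlonglongrightarrow> v + 0"
      using tendsto_mult_right_zero[OF LIMSEQ_Suc[OF lim_1_over_n], of h]
      by (intro tendsto_add tendsto_const) simp
    then have up: "(\<lambda>m. v + h / real (Suc m)) \<longlonglongrightarrow> v" by (simp only: add_0_right)
    have "w \<longlonglongrightarrow> v"
    proof (rule real_tendsto_sandwich[OF _ _ tendsto_const up])
      show "\<forall>\<^sub>F n in sequentially. v \<le> w n" using less_imp_le[OF w(1)] by (rule always_eventually[OF allI])
      show "\<forall>\<^sub>F n in sequentially. w n \<le> v + h / real (Suc n)" using w(2) by (rule always_eventually[OF allI])
    qed
    moreover have "w m \<noteq> v" for m using w(1)[of m] by simp
    ultimately have "filterlim w (at_right v) sequentially"
      using w(1) by (simp add: filterlim_at)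
    moreover have "(g \<longlongrightarrow> g v) (at_right v)"
      using g True s by (simp add: cadlag_def continuous_within)
    ultimately have "(\<lambda>m. g (w m)) \<longlonglongrightarrow> g v" by (rule filterlim_compose[rotated])
    then have "(\<lambda>m. f (Suc m) v) \<longlonglongrightarrow> g v" by (simp add: w(3))
    then have "(\<lambda>m. f m v) \<longlonglongrightarrow> g v" by (rule LIMSEQ_imp_Suc)
    then show ?thesis using True by simp
  qed (simp add: zero)
  show "\<bar>f m v\<bar> \<le> indicator {s..<s+h} v * B" if B: "\<forall>w. 0 \<le> w \<and> w \<le> s + h \<longrightarrow> \<bar>g w\<bar> \<le> B"
  proof (cases "v \<in> {s..<s+h}")
    case True
    show ?thesis
    proof (cases "m = 0")
      case True
      have "\<bar>g s\<bar> \<le> B" using B s h by simp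
      then have "0 \<le> B" by linarith
      then show ?thesis using True by (simp add: f_def)
    next
      case False
      then obtain w where w: "v < w" "w \<le> s + h" "f m v = g w" using val[OF True] by blast
      then have "0 \<le> w" using True s by simp
      then have "\<bar>f m v\<bar> \<le> B" using B w by simp
      then show ?thesis using True by simp
    qed
  qed (simp add: zero)
qed

lemma cadlag_measurable:
  assumes g: "cadlag g" and sh: "0 \<le> s" "0 \<le> h"
  shows "(\<lambda>v. indicator {s..<s+h} v * g v) \<in> borel_measurable borel"
proof (rule borel_measurable_LIMSEQ_real)
  define f where "f m v = (\<Sum>j<m. g (s + h * real (Suc j) / real m) *
          indicat_real {s + h * real j / real m ..< s + h * real (Suc j) / real m} v)" for m v
  show "(\<lambda>m. f m v) \<longlonglongrightarrow> indicator {s..<s+h} v * g v" for v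
    by (rule cadlag_step_approx[OF g sh]) (simp add: f_def)
  show "f m \<in> borel_measurable borel" for m unfolding f_def by measurable
qed

text \<open>Pathwise value of $\int_0^t e^{-\lambda(t-v)}\,dg(v)$ for \<open>g 0 = 0\<close>, by integration by parts.\<close>

definition ou_path :: "real \<Rightarrow> (real \<Rightarrow> real) \<Rightarrow> real \<Rightarrow> real" where
  "ou_path \<kappa> g t = g t - (\<integral>v. indicator {0..<t} v * g v * (\<kappa> * exp (- \<kappa> * (t - v))) \<partial>lborel)"

lemma sum_by_parts:
  fixes g c :: "nat \<Rightarrow> real"
  shows "(\<Sum>j<m. (g (Suc j) - g j) * c j) = g m * c m - g 0 * c 0 - (\<Sum>j<m. g (Suc j) * (c (Suc j) - c j))"
  by (induction m) (auto simp: algebra_simps)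

text \<open>Summation by parts moves the increments from \<open>g\<close> to the exponential, where
  each is the exact integral of \<open>\<psi>\<close> over a cell. What remains is the integral of a
  step approximation of \<open>g\<close>, so dominated convergence applies although \<open>g\<close>
  may have unbounded variation. The limit is the integral over \<open>[s, s + h]\<close>, written as
  the recursion of an Ornstein-Uhlenbeck path.\<close>

lemma ou_path_Riemann:
  assumes g: "cadlag g" and s: "0 \<le> s" and h: "0 \<le> h" and \<kappa>: "\<kappa> \<ge> 0"
  shows "(\<lambda>m. \<Sum>j<m. (g (s + h * real (Suc j) / real m) - g (s + h * real j / real m))
            * exp (- \<kappa> * (h - h * real j / real m)))
       \<longlonglongrightarrow> ou_path \<kappa> g (s + h) - exp (- \<kappa> * h) * ou_path \<kappa> g s"
proof -
  \<comment> \<open>The derivative of \<open>exp (- \<kappa> * (s + h - v))\<close> in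
    \<open>v\<close>.\<close>
  define \<psi> where "\<psi> v = \<kappa> * exp (- \<kappa> * (s + h - v))" for v
  have [measurable]: "\<psi> \<in> borel_measurable borel" unfolding \<psi>_def by measurable
  let ?f = "\<lambda>m v. (\<Sum>j<m. g (s + h * real (Suc j) / real m) *
          indicat_real {s + h * real j / real m ..< s + h * real (Suc j) / real m} v)"
  obtain B where B: "\<forall>w. 0 \<le> w \<and> w \<le> s + h \<longrightarrow> \<bar>g w\<bar> \<le> B" using cadlag_bounded[OF g] by blast
  have B0: "B \<ge> 0" using B[rule_format, of s] s h by auto
  have psi: "0 \<le> \<psi> v" "v \<le> s + h \<Longrightarrow> \<psi> v \<le> \<kappa>" for v using \<kappa> by (auto simp: \<psi>_def mult_left_le)
  have ind[measurable]: "(\<lambda>v. indicator {a..<b} v * g v) \<in> borel_measurable lborel" if "0 \<le> a" "a \<le> b" for a b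
    using cadlag_measurable[OF g, of a "b - a"] that by simp
  have int: "integrable lborel (\<lambda>v. indicator {a..<b} v * g v * \<psi> v)" if "0 \<le> a" "a \<le> b" "b \<le> s + h" for a b
  proof (rule Bochner_Integration.integrable_bound[where f="\<lambda>v. indicator {a..<b} v * (B * \<kappa>)"])
    have "integrable lborel (indicat_real {a..<b})"
      using \<open>a \<le> b\<close> by (intro integrable_real_indicator) auto
    then show "integrable lborel (\<lambda>v. indicat_real {a..<b} v * (B * \<kappa>))" by (rule integrable_mult_left)
    show "AE v in lborel. norm (indicat_real {a..<b} v * g v * \<psi> v) \<le> norm (indicat_real {a..<b} v * (B * \<kappa>))"
    proof (intro AE_I2)
      fix v
      have "\<bar>g v\<bar> * \<bar>\<psi> v\<bar> \<le> B * \<kappa>" if "v \<in> {a..<b}"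
        using that \<open>0 \<le> a\<close> \<open>b \<le> s + h\<close> B psi[of v] B0 by (intro mult_mono) auto
      then show "norm (indicat_real {a..<b} v * g v * \<psi> v) \<le> norm (indicat_real {a..<b} v * (B * \<kappa>))"
        using B0 \<kappa> by (cases "v \<in> {a..<b}") (simp_all add: abs_mult)
    qed
  qed (use ind[OF that(1,2)] in measurable)
  have cell: "(\<integral>v. indicat_real {a..<b} v * \<psi> v \<partial>lborel) = exp (- \<kappa> * (s + h - b)) - exp (- \<kappa> * (s + h - a))"
    if "a \<le> b" for a b
  proof -
    have "(\<integral>v. \<psi> v * indicat_real {a..b} v \<partial>lborel) = exp (- \<kappa> * (s + h - b)) - exp (- \<kappa> * (s + h - a))"
      using that unfolding \<psi>_def by (intro integral_FTC_Icc_real) (auto intro!: derivative_eq_intros continuous_intros)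
    moreover have "(\<integral>v. \<psi> v * indicat_real {a..b} v \<partial>lborel) = (\<integral>v. indicat_real {a..<b} v * \<psi> v \<partial>lborel)"
    proof (intro integral_cong_AE)
      show "AE v in lborel. \<psi> v * indicat_real {a..b} v = indicat_real {a..<b} v * \<psi> v"
        using AE_lborel_singleton[of b] by eventually_elim (auto simp: indicator_def)
    qed auto
    ultimately show ?thesis by simp
  qed
  have "(\<lambda>m. \<integral>v. ?f m v * \<psi> v \<partial>lborel) \<longlonglongrightarrow> (\<integral>v. indicator {s..<s+h} v * g v * \<psi> v \<partial>lborel)"
  proof (rule integral_dominated_convergence[where w="\<lambda>v. indicator {s..<s+h} v * (B * \<kappa>)"])
    show "integrable lborel (\<lambda>v. indicat_real {s..<s+h} v * (B * \<kappa>))"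
      using h by (intro integrable_mult_left integrable_real_indicator) auto
    show "AE v in lborel. (\<lambda>m. ?f m v * \<psi> v) \<longlonglongrightarrow> indicator {s..<s+h} v * g v * \<psi> v"
      by (intro AE_I2 tendsto_mult tendsto_const cadlag_step_approx(1)[OF g s h refl])
    show "AE v in lborel. norm (?f m v * \<psi> v) \<le> indicator {s..<s+h} v * (B * \<kappa>)" for m
    proof (intro AE_I2)
      fix v
      have "\<bar>?f m v\<bar> \<le> indicator {s..<s+h} v * B" by (rule cadlag_step_approx(2)[OF g s h refl B])
      moreover have "\<bar>\<psi> v\<bar> \<le> \<kappa>" if "v \<in> {s..<s+h}" using psi[of v] that by simp
      ultimately have "\<bar>?f m v\<bar> * \<bar>\<psi> v\<bar> \<le> (indicator {s..<s+h} v * B) * \<kappa>" if "v \<in> {s..<s+h}"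
        using that \<kappa> by (intro mult_mono) auto
      moreover have "?f m v = 0" if "v \<notin> {s..<s+h}" 
        using \<open>\<bar>?f m v\<bar> \<le> indicator {s..<s+h} v * B\<close> that by simp
      ultimately show "norm (?f m v * \<psi> v) \<le> indicator {s..<s+h} v * (B * \<kappa>)"
        by (cases "v \<in> {s..<s+h}")
          (simp_all add: abs_mult)
    qed
    show "(\<lambda>v. indicator {s..<s+h} v * g v * \<psi> v) \<in> borel_measurable lborel"
      by (intro borel_measurable_times ind) (use s h in \<open>simp_all, measurable\<close>)
    show "(\<lambda>v. ?f m v * \<psi> v) \<in> borel_measurable lborel" for m by measurable
  qed
  moreover have "(\<integral>v. ?f m v * \<psi> v \<partial>lborel) = (\<Sum>j<m. g (s + h * real (Suc j) / real m) *
     (exp (- \<kappa> * (h - h * real (Suc j) / real m)) - exp (- \<kappa> * (h - h * real j / real m))))" for m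
  proof -
    have le: "s + h * real j / real m \<le> s + h * real (Suc j) / real m" for j
      using h by (intro add_left_mono divide_right_mono mult_left_mono) auto
    have i: "integrable lborel (\<lambda>v. indicat_real {a..<b} v * \<psi> v)" if "a \<le> b" for a b
    proof -
      have "set_integrable lborel {a..b} \<psi>" by (rule borel_integrable_atLeastAtMost') (unfold \<psi>_def, intro continuous_intros)
      then have "set_integrable lborel {a..<b} \<psi>" by (rule set_integrable_subset) auto
      then show ?thesis by (simp add: set_integrable_def)
    qed
    have "(\<integral>v. ?f m v * \<psi> v \<partial>lborel) = (\<integral>v. (\<Sum>j<m. g (s + h * real (Suc j) / real m) *
         (indicat_real {s + h * real j / real m ..< s + h * real (Suc j) / real m} v * \<psi> v)) \<partial>lborel)"
      by (simp only: sum_distrib_right mult.assoc)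
    also have "\<dots> = (\<Sum>j<m. g (s + h * real (Suc j) / real m) *
         (\<integral>v. indicat_real {s + h * real j / real m ..< s + h * real (Suc j) / real m} v * \<psi> v \<partial>lborel))"
      using i[OF le] by (subst Bochner_Integration.integral_sum) auto
    also have "\<dots> = (\<Sum>j<m. g (s + h * real (Suc j) / real m) *
     (exp (- \<kappa> * (h - h * real (Suc j) / real m)) - exp (- \<kappa> * (h - h * real j / real m))))"
      by (simp only: cell[OF le] add_diff_cancel_left)
    finally show ?thesis .
  qed
  ultimately have lim: "(\<lambda>m. \<Sum>j<m. g (s + h * real (Suc j) / real m) *
     (exp (- \<kappa> * (h - h * real (Suc j) / real m)) - exp (- \<kappa> * (h - h * real j / real m))))
     \<longlonglongrightarrow> (\<integral>v. indicator {s..<s+h} v * g v * \<psi> v \<partial>lborel)" by (simp only:)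
  \<comment> \<open>The part before \<open>s\<close> is \<open>exp (- \<kappa> * h)\<close> times
    the integral in \<open>ou_path \<kappa> g s\<close>; this turns the integral over
    \<open>[s, s + h]\<close> into a difference of two values of \<open>ou_path\<close>.\<close>
  have split: "(\<integral>v. indicator {0..<s+h} v * g v * \<psi> v \<partial>lborel)
     = (\<integral>v. indicator {0..<s} v * g v * \<psi> v \<partial>lborel) + (\<integral>v. indicator {s..<s+h} v * g v * \<psi> v \<partial>lborel)"
  proof -
    have "indicat_real {0..<s+h} v * g v * \<psi> v
       = indicat_real {0..<s} v * g v * \<psi> v + indicat_real {s..<s+h} v * g v * \<psi> v" for v
      using s h by (cases "v < s") (simp_all add: indicator_def)
    then have "(\<integral>v. indicator {0..<s+h} v * g v * \<psi> v \<partial>lborel) =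
       (\<integral>v. indicat_real {0..<s} v * g v * \<psi> v + indicat_real {s..<s+h} v * g v * \<psi> v \<partial>lborel)"
      by (rule Bochner_Integration.integral_cong[OF refl])
    also have "\<dots> = (\<integral>v. indicator {0..<s} v * g v * \<psi> v \<partial>lborel) + (\<integral>v. indicator {s..<s+h} v * g v * \<psi> v \<partial>lborel)"
      by (intro Bochner_Integration.integral_add int) (use s h in linarith)+
    finally show ?thesis .
  qed
  have "(\<integral>v. indicator {0..<s} v * g v * \<psi> v \<partial>lborel)
     = (\<integral>v. exp (- \<kappa> * h) * (indicator {0..<s} v * g v * (\<kappa> * exp (- \<kappa> * (s - v)))) \<partial>lborel)"
  proof (intro Bochner_Integration.integral_cong[OF refl])
    fix v
    have "exp (- \<kappa> * (s + h - v)) = exp (- \<kappa> * h) * exp (- \<kappa> * (s - v))"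
      unfolding mult_exp_exp by (rule arg_cong[of _ _ exp]) (simp add: algebra_simps)
    then show "indicator {0..<s} v * g v * \<psi> v = exp (- \<kappa> * h) * (indicator {0..<s} v * g v * (\<kappa> * exp (- \<kappa> * (s - v))))"
      by (simp only: \<psi>_def mult_ac)
  qed
  also have "\<dots> = exp (- \<kappa> * h) * (\<integral>v. indicator {0..<s} v * g v * (\<kappa> * exp (- \<kappa> * (s - v))) \<partial>lborel)"
    by (rule integral_mult_right_zero)
  finally have A: "(\<integral>v. indicator {0..<s} v * g v * \<psi> v \<partial>lborel) =
    exp (- \<kappa> * h) * (\<integral>v. indicator {0..<s} v * g v * (\<kappa> * exp (- \<kappa> * (s - v))) \<partial>lborel)" .
  have "ou_path \<kappa> g (s + h) = g (s + h) - (\<integral>v. indicator {0..<s+h} v * g v * \<psi> v \<partial>lborel)"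
    unfolding ou_path_def \<psi>_def ..
  moreover have "exp (- \<kappa> * h) * ou_path \<kappa> g s = exp (- \<kappa> * h) * g s - (\<integral>v. indicator {0..<s} v * g v * \<psi> v \<partial>lborel)"
    unfolding ou_path_def A by (rule right_diff_distrib)
  ultimately have eq: "ou_path \<kappa> g (s + h) - exp (- \<kappa> * h) * ou_path \<kappa> g s
    = g (s + h) - exp (- \<kappa> * h) * g s - (\<integral>v. indicator {s..<s+h} v * g v * \<psi> v \<partial>lborel)"
    unfolding split by linarith
  \<comment> \<open>Only for \<open>m > 0\<close>: for \<open>m = 0\<close> all quotients are
    \<open>0\<close> and the grid does not end at \<open>s + h\<close>.\<close>
  have ev: "\<forall>\<^sub>F m in sequentially. (g (s + h) - exp (- \<kappa> * h) * g s - (\<Sum>j<m. g (s + h * real (Suc j) / real m) *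
     (exp (- \<kappa> * (h - h * real (Suc j) / real m)) - exp (- \<kappa> * (h - h * real j / real m)))))
    = (\<Sum>j<m. (g (s + h * real (Suc j) / real m) - g (s + h * real j / real m))
            * exp (- \<kappa> * (h - h * real j / real m)))"
    using eventually_gt_at_top[of 0]
  proof eventually_elim
    case (elim m)
    then have "h * real m / real m = h" by simp
    then show ?case
      by (subst sum_by_parts[of "\<lambda>j. g (s + h * real j / real m)" "\<lambda>j. exp (- \<kappa> * (h - h * real j / real m))" m])
        (simp del: of_nat_Suc)
  qed
  show ?thesis unfolding eq
    by (rule Lim_transform_eventually[OF _ ev]) (intro tendsto_diff tendsto_const lim)
qed

text \<open>Convergence in probability yields, almost surely and for all \<open>n\<close> and
  \<open>i\<close> at once, some \<open>m \<ge> n\<close> with distance at most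
  \<open>1 / (i + 1)\<close>. Such indices suffice to identify the coordinate with the almost sure
  limit, in place of an extracted subsequence.\<close>

lemma tendsto_in_prob_unique:
  fixes v :: "'h::{real_inner, second_countable_topology}"
  assumes M: "prob_space M" and Y: "tendsto_in_prob M Y I"
    and J: "AE \<omega> in M. (\<lambda>m. Y m \<omega> \<bullet> v) \<longlonglongrightarrow> J \<omega>"
  shows "AE \<omega> in M. I \<omega> \<bullet> v = J \<omega>"
proof -
  interpret prob_space M by fact
  have [measurable]: "\<And>m. Y m \<in> borel_measurable M" "I \<in> borel_measurable M"
    using Y by (auto simp: tendsto_in_prob_def)
  have "AE \<omega> in M. \<exists>m\<ge>n. norm (Y m \<omega> - I \<omega>) \<le> 1 / real (Suc i)" for n i
  proof -
    let ?E = "{\<omega> \<in> space M. \<not> (\<exists>m\<ge>n. norm (Y m \<omega> - I \<omega>) \<le> 1 / real (Suc i))}"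
    have le: "prob ?E \<le> prob {\<omega> \<in> space M. norm (Y m \<omega> - I \<omega>) > 1 / real (Suc i)}" if "m \<ge> n" for m
    proof (rule finite_measure_mono)
      show "?E \<subseteq> {\<omega> \<in> space M. norm (Y m \<omega> - I \<omega>) > 1 / real (Suc i)}"
        using that not_le by blast
    qed measurable
    have d: "1 / real (Suc i) > 0" by simp
    have "\<And>\<delta>. \<delta> > 0 \<Longrightarrow> (\<lambda>m. prob {\<omega> \<in> space M. norm (Y m \<omega> - I \<omega>) > \<delta>}) \<longlonglongrightarrow> 0"
      using Y unfolding tendsto_in_prob_def by blast
    from LIMSEQ_le_const[OF this[OF d]] have "prob ?E \<le> 0" using le by blast
    then have "emeasure M ?E = 0" by (simp only: emeasure_eq_measure measure_le_0_iff ennreal_0)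
    moreover have "?E \<in> sets M" by measurable
    ultimately show ?thesis by (intro AE_I[OF order_refl])
  qed
  then have "AE \<omega> in M. \<forall>n i. \<exists>m\<ge>n. norm (Y m \<omega> - I \<omega>) \<le> 1 / real (Suc i)"
    by (simp add: AE_all_countable)
  with J show ?thesis
  proof eventually_elim
    case (elim \<omega>)
    show ?case
    proof (rule ccontr)
      define \<eta> where "\<eta> = \<bar>I \<omega> \<bullet> v - J \<omega>\<bar>"
      assume "I \<omega> \<bullet> v \<noteq> J \<omega>"
      then have \<eta>: "\<eta> > 0" unfolding \<eta>_def by linarith
      obtain n where n: "\<And>m. m \<ge> n \<Longrightarrow> \<bar>Y m \<omega> \<bullet> v - J \<omega>\<bar> < \<eta> / 2"
        using LIMSEQ_D[OF elim(1) half_gt_zero[OF \<eta>]] unfolding real_norm_def by blast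
      obtain i :: nat where i: "norm v * 2 / \<eta> < real i" using reals_Archimedean2 by blast
      obtain m where m: "m \<ge> n" "norm (Y m \<omega> - I \<omega>) \<le> 1 / real (Suc i)" using elim(2) by blast
      have "\<bar>Y m \<omega> \<bullet> v - I \<omega> \<bullet> v\<bar> \<le> norm (Y m \<omega> - I \<omega>) * norm v"
        using Cauchy_Schwarz_ineq2[of "Y m \<omega> - I \<omega>" v] by (simp add: inner_diff_left)
      also have "\<dots> \<le> (1 / real (Suc i)) * norm v" by (intro mult_right_mono m) auto
      also have "\<dots> \<le> \<eta> / 2"
      proof -
        have "norm v * 2 < real i * \<eta>" using i \<eta> by (simp only: pos_divide_less_eq)
        also have "\<dots> \<le> real (Suc i) * \<eta>" using \<eta> by (intro mult_right_mono) auto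
        finally show ?thesis by (simp add: divide_le_eq mult.commute)
      qed
      finally have "\<bar>Y m \<omega> \<bullet> v - I \<omega> \<bullet> v\<bar> \<le> \<eta> / 2" .
      moreover have "\<eta> \<le> \<bar>Y m \<omega> \<bullet> v - J \<omega>\<bar> + \<bar>Y m \<omega> \<bullet> v - I \<omega> \<bullet> v\<bar>"
        using abs_triangle_ineq4[of "Y m \<omega> \<bullet> v - J \<omega>" "Y m \<omega> \<bullet> v - I \<omega> \<bullet> v"] by (simp add: \<eta>_def)
      ultimately show False using n[OF m(1)] \<eta> by linarith
    qed
  qed
qed

section \<open>Symmetric stable integrals: tails and moments\<close>

lemma (in prob_space) indep_var_of_indep_set:
  fixes X Y :: "'a \<Rightarrow> real"
  assumes ind: "indep_set (sets A) (sets B)" and A: "subalgebra M A" and B: "subalgebra M B"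
    and X: "X \<in> borel_measurable A" and Y: "Y \<in> borel_measurable B"
  shows "indep_var borel X borel Y"
  unfolding indep_var_eq
proof (intro conjI)
  show "random_variable borel X" using measurable_from_subalg[OF A X] .
  show "random_variable borel Y" using measurable_from_subalg[OF B Y] .
  have sub: "sigma_sets (space M) {f -` C \<inter> space M |C. C \<in> sets borel} \<subseteq> sets N"
    if "subalgebra M N" "f \<in> borel_measurable N" for N and f :: "'a \<Rightarrow> real"
  proof -
    have sp: "space N = space M" using that by (simp add: subalgebra_def)
    have "{f -` C \<inter> space N |C. C \<in> sets borel} \<subseteq> sets N"
      using that(2) by (auto intro: measurable_sets)
    from sets.sigma_sets_subset[OF this] show ?thesis unfolding sp .
  qed
  show "indep_set (sigma_sets (space M) {X -` C \<inter> space M |C. C \<in> sets borel})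
        (sigma_sets (space M) {Y -` C \<inter> space M |C. C \<in> sets borel})"
    using ind unfolding indep_set_def
    by (rule indep_sets_mono_sets) (auto split: bool.split intro: sub[OF A X, THEN subsetD] sub[OF B Y, THEN subsetD])
qed

lemma ennreal_le_suminf: "f j \<le> (\<Sum>i. f i)" for f :: "nat \<Rightarrow> ennreal"
  using sum_le_suminf[of f "{j}"] by simp

lemma char_scale:
  assumes [measurable]: "Y \<in> borel_measurable M"
  shows "char (distr M borel (\<lambda>\<omega>. Y \<omega> * c)) u = char (distr M borel Y) (u * c)"
  by (simp add: char_def integral_distr mult_ac)

text \<open>By induction: the first \<open>m\<close> terms are measurable at time
  \<open>P m\<close>, from which the next increment is independent, so characteristic functions
  multiply. Stationarity gives that increment the stable law of the elapsed time.\<close>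

lemma char_weighted_increments:
  fixes Z :: "real \<Rightarrow> 'w \<Rightarrow> real" and P c :: "nat \<Rightarrow> real"
  assumes basis: "stochastic_basis M F" and Z: "symmetric_stable_levy M F \<alpha> \<sigma> Z"
    and P: "\<And>j. 0 \<le> P j" "\<And>j. P j \<le> P (Suc j)"
  shows "char (distr M borel (\<lambda>\<omega>. \<Sum>j<m. (Z (P (Suc j)) \<omega> - Z (P j) \<omega>) * c j)) u
     = complex_of_real (exp (- (\<Sum>j<m. (P (Suc j) - P j) * \<sigma> powr \<alpha> * \<bar>u * c j\<bar> powr \<alpha>)))"
proof -
  interpret prob_space M using basis by (simp add: stochastic_basis_def)
  have F: "\<And>t. t \<ge> 0 \<Longrightarrow> subalgebra M (F t)" "\<And>s t. 0 \<le> s \<Longrightarrow> s \<le> t \<Longrightarrow> sets (F s) \<subseteq> sets (F t)"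
    using basis by (auto simp: stochastic_basis_def)
  have Zl: "levy_process M F Z" using Z by (simp add: symmetric_stable_levy_def)
  have ZF: "\<And>t. t \<ge> 0 \<Longrightarrow> Z t \<in> borel_measurable (F t)" using Zl by (simp add: levy_process_def)
  have ZFmono: "Z s \<in> borel_measurable (F t)" if "0 \<le> s" "s \<le> t" for s t
    using ZF[OF that(1)] F that
    by (intro measurable_from_subalg[OF _ ZF[OF that(1)]]) (auto simp: subalgebra_def)
  have Zm: "\<And>t. t \<ge> 0 \<Longrightarrow> Z t \<in> borel_measurable M" using ZF F(1) measurable_from_subalg by blast
  have incr: "indep_set (sets (F s)) (sets (vimage_algebra (space M) (\<lambda>\<omega>. Z t \<omega> - Z s \<omega>) borel))"
    if "0 \<le> s" "s \<le> t" for s t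
    using Zl that unfolding levy_process_def by (elim conjE) simp
  have stat: "distr M borel (\<lambda>\<omega>. Z (s + t) \<omega> - Z s \<omega>) = distr M borel (Z t)"
    if "0 \<le> s" "0 \<le> t" for s t
    using Zl that unfolding levy_process_def by (elim conjE) simp
  define X where "X m \<omega> = (\<Sum>j<m. (Z (P (Suc j)) \<omega> - Z (P j) \<omega>) * c j)" for m \<omega>
  have mono: "P i \<le> P j" if "i \<le> j" for i j using P(2) that by (rule lift_Suc_mono_le)
  have XF: "X m \<in> borel_measurable (F (P m))" for m
    unfolding X_def using P mono
    by (intro borel_measurable_sum borel_measurable_times borel_measurable_diff ZFmono) auto
  have "char (distr M borel (X m)) u
     = complex_of_real (exp (- (\<Sum>j<m. (P (Suc j) - P j) * \<sigma> powr \<alpha> * \<bar>u * c j\<bar> powr \<alpha>)))"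
  proof (induction m)
    case 0
    have "distr M borel (X 0) = return borel 0"
      unfolding X_def by simp
    then show ?case by (simp add: char_def integral_return)
  next
    case (Suc m)
    define D where "D \<omega> = Z (P (Suc m)) \<omega> - Z (P m) \<omega>" for \<omega>
    define V where "V = vimage_algebra (space M) D borel"
    have Dm: "D \<in> borel_measurable M" unfolding D_def using Zm P by (intro borel_measurable_diff) auto
    have V: "subalgebra M V"
      unfolding subalgebra_def V_def using measurable_sets[OF Dm] by (auto simp: sets_vimage_algebra2)
    have DV: "D \<in> borel_measurable V" unfolding V_def by (rule measurable_vimage_algebra1) auto
    have ind: "indep_set (sets (F (P m))) (sets V)"
      unfolding V_def D_def[abs_def] by (rule incr) (use P in auto)
    have "indep_var borel (X m) borel (\<lambda>\<omega>. D \<omega> * c m)"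
      by (rule indep_var_of_indep_set[OF ind F(1) V XF]) (use P DV in auto)
    then have "char (distr M borel (\<lambda>\<omega>. X m \<omega> + D \<omega> * c m)) u
       = char (distr M borel (X m)) u * char (distr M borel (\<lambda>\<omega>. D \<omega> * c m)) u"
      by (rule char_distr_add)
    also have "char (distr M borel (\<lambda>\<omega>. D \<omega> * c m)) u = char (distr M borel D) (u * c m)"
      by (rule char_scale[OF Dm])
    also have "distr M borel D = distr M borel (Z (P (Suc m) - P m))"
    proof -
      have "distr M borel (\<lambda>\<omega>. Z (P m + (P (Suc m) - P m)) \<omega> - Z (P m) \<omega>) = distr M borel (Z (P (Suc m) - P m))"
        by (rule stat) (use P[of m] in auto)
      then show ?thesis by (simp add: D_def[abs_def])
    qed
    also have "char \<dots> (u * c m) = complex_of_real (exp (- ((P (Suc m) - P m) * \<sigma> powr \<alpha> * \<bar>u * c m\<bar> powr \<alpha>)))"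
      using Z P[of m] unfolding symmetric_stable_levy_def by simp
    finally show ?case
      by (simp add: X_def D_def Suc.IH[unfolded X_def] exp_add[symmetric] flip: of_real_mult)
  qed
  then show ?thesis by (simp add: X_def[abs_def])
qed

lemma (in prob_space) expectation_cos:
  assumes [measurable]: "Y \<in> borel_measurable M"
  shows "expectation (\<lambda>\<omega>. cos (u * Y \<omega>)) = Re (char (distr M borel Y) u)"
proof -
  have "integrable M (\<lambda>\<omega>. iexp (u * Y \<omega>))"
    by (rule integrable_const_bound[where B=1]) auto
  from integral_bounded_linear[OF bounded_linear_Re this]
  show ?thesis by (simp add: char_def integral_distr Re_exp)
qed

text \<open>A left Riemann sum of an increasing function lies below its integral;
  \<open>1 + z \<le> exp z\<close> on each cell makes the bound telescope.\<close>

lemma sum_increasing_exp_le: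
  fixes h a :: real
  assumes h: "h \<ge> 0" and a: "a > 0"
  shows "(\<Sum>j<m. h / real m * exp (- a * (h - h * real j / real m))) \<le> (1 - exp (- a * h)) / a"
proof (cases "m = 0")
  case False
  let ?E = "\<lambda>j. exp (- a * (h - h * real j / real m))"
  have "h / real m * ?E j \<le> (?E (Suc j) - ?E j) / a" for j
  proof -
    have "?E (Suc j) = ?E j * exp (a * (h / real m))"
      unfolding mult_exp_exp by (rule arg_cong[of _ _ exp]) (simp add: algebra_simps add_divide_distrib)
    also have "\<dots> \<ge> ?E j * (1 + a * (h / real m))" by (intro mult_left_mono exp_ge_add_one_self) auto
    finally show ?thesis using a by (simp add: field_simps)
  qed
  then have "(\<Sum>j<m. h / real m * ?E j) \<le> (\<Sum>j<m. (?E (Suc j) - ?E j) / a)" by (intro sum_mono)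
  also have "\<dots> = (?E m - ?E 0) / a"
    using sum_lessThan_telescope[of ?E m] by (simp only: sum_divide_distrib[symmetric])
  also have "\<dots> = (1 - exp (- a * h)) / a" using False by simp
  finally show ?thesis .
qed (use assms in auto)

text \<open>The characteristic functions of the Riemann sums are at least \<open>1 - b\<close>,
  uniformly in \<open>m\<close>, because their exponents are left Riemann sums of an exponential.
  Dominated convergence along almost every path carries this one-sided bound to the limit, and it is
  all that the tail estimates use.\<close>

lemma levy_ou_cos:
  assumes basis: "stochastic_basis M F" and Z: "symmetric_stable_levy M F \<alpha> \<sigma> Z"
    and s: "0 \<le> s" and h: "0 \<le> h" and \<kappa>: "\<kappa> > 0" and \<alpha>: "\<alpha> > 0"
    and [measurable]: "\<xi> \<in> borel_measurable M"
    and \<xi>: "AE \<omega> in M. \<xi> \<omega> = ou_path \<kappa> (\<lambda>t. Z t \<omega>) (s + h) - exp (- \<kappa> * h) * ou_path \<kappa> (\<lambda>t. Z t \<omega>) s"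
  shows "(\<integral>\<omega>. 1 - cos (u * \<xi> \<omega>) \<partial>M) \<le> \<sigma> powr \<alpha> * \<bar>u\<bar> powr \<alpha> * ((1 - exp (- (\<alpha> * \<kappa>) * h)) / (\<alpha> * \<kappa>))"
proof -
  interpret prob_space M using basis by (simp add: stochastic_basis_def)
  have Zl: "levy_process M F Z" using Z by (simp add: symmetric_stable_levy_def)
  have Zm: "Z t \<in> borel_measurable M" if "t \<ge> 0" for t
  proof (rule measurable_from_subalg)
    show "subalgebra M (F t)" using basis that by (simp add: stochastic_basis_def)
    show "Z t \<in> borel_measurable (F t)" using Zl that by (simp add: levy_process_def)
  qed
  define R where "R m \<omega> = (\<Sum>j<m. (Z (s + h * real (Suc j) / real m) \<omega> - Z (s + h * real j / real m) \<omega>)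
            * exp (- \<kappa> * (h - h * real j / real m)))" for m \<omega>
  have pos: "0 \<le> s + h * real j / real m" for j m using s h by simp
  have Rm[measurable]: "R m \<in> borel_measurable M" for m unfolding R_def
    by (intro borel_measurable_sum borel_measurable_times borel_measurable_diff Zm pos) auto
  have "AE \<omega> in M. cadlag (\<lambda>t. Z t \<omega>)" using Zl unfolding levy_process_def cadlag_def by (elim conjE)
  with \<xi> have conv: "AE \<omega> in M. (\<lambda>m. R m \<omega>) \<longlonglongrightarrow> \<xi> \<omega>"
  proof eventually_elim
    case (elim \<omega>)
    show ?case unfolding elim(1) R_def using \<kappa> by (intro ou_path_Riemann elim s h) auto
  qed
  define b where "b = \<sigma> powr \<alpha> * \<bar>u\<bar> powr \<alpha> * ((1 - exp (- (\<alpha> * \<kappa>) * h)) / (\<alpha> * \<kappa>))"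
  have le: "1 - b \<le> expectation (\<lambda>\<omega>. cos (u * R m \<omega>))" for m
  proof -
    define Q where "Q = (\<Sum>j<m. ((s + h * real (Suc j) / real m) - (s + h * real j / real m)) * \<sigma> powr \<alpha>
        * \<bar>u * exp (- \<kappa> * (h - h * real j / real m))\<bar> powr \<alpha>)"
    have "char (distr M borel (R m)) u = complex_of_real (exp (- Q))"
      unfolding R_def Q_def
      by (rule char_weighted_increments[OF basis Z]) (use pos h in \<open>auto intro!: divide_right_mono mult_left_mono\<close>)
    then have "expectation (\<lambda>\<omega>. cos (u * R m \<omega>)) = exp (- Q)" by (simp add: expectation_cos)
    also have "\<dots> \<ge> 1 - Q" using exp_ge_add_one_self[of "- Q"] by simp
    also have "Q = (\<Sum>j<m. \<sigma> powr \<alpha> * \<bar>u\<bar> powr \<alpha> * (h / real m * exp (- (\<alpha> * \<kappa>) * (h - h * real j / real m))))"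
      unfolding Q_def
    proof (intro sum.cong refl)
      fix j
      have "\<bar>u * exp (- \<kappa> * (h - h * real j / real m))\<bar> powr \<alpha>
        = \<bar>u\<bar> powr \<alpha> * exp (- (\<alpha> * \<kappa>) * (h - h * real j / real m))"
        by (simp add: abs_mult powr_mult powr_def[of "exp _"] mult_ac)
      moreover have "(s + h * real (Suc j) / real m) - (s + h * real j / real m) = h / real m"
        by (simp add: algebra_simps add_divide_distrib)
      ultimately show "((s + h * real (Suc j) / real m) - (s + h * real j / real m)) * \<sigma> powr \<alpha>
        * \<bar>u * exp (- \<kappa> * (h - h * real j / real m))\<bar> powr \<alpha>
        = \<sigma> powr \<alpha> * \<bar>u\<bar> powr \<alpha> * (h / real m * exp (- (\<alpha> * \<kappa>) * (h - h * real j / real m)))"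
        by (simp only: mult_ac)
    qed
    also have "\<dots> = \<sigma> powr \<alpha> * \<bar>u\<bar> powr \<alpha> * (\<Sum>j<m. h / real m * exp (- (\<alpha> * \<kappa>) * (h - h * real j / real m)))"
      by (simp only: sum_distrib_left)
    finally have *: "1 - \<sigma> powr \<alpha> * \<bar>u\<bar> powr \<alpha> * (\<Sum>j<m. h / real m * exp (- (\<alpha> * \<kappa>) * (h - h * real j / real m)))
       \<le> expectation (\<lambda>\<omega>. cos (u * R m \<omega>))" .
    have "\<sigma> powr \<alpha> * \<bar>u\<bar> powr \<alpha> * (\<Sum>j<m. h / real m * exp (- (\<alpha> * \<kappa>) * (h - h * real j / real m))) \<le> b"
      unfolding b_def using \<kappa> \<alpha> h by (intro mult_left_mono sum_increasing_exp_le) auto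
    then show ?thesis using * by linarith
  qed
  have "(\<lambda>m. expectation (\<lambda>\<omega>. cos (u * R m \<omega>))) \<longlonglongrightarrow> expectation (\<lambda>\<omega>. cos (u * \<xi> \<omega>))"
  proof (rule integral_dominated_convergence[where w="\<lambda>_. 1"])
    show "AE \<omega> in M. (\<lambda>m. cos (u * R m \<omega>)) \<longlonglongrightarrow> cos (u * \<xi> \<omega>)"
      using conv by eventually_elim (intro tendsto_intros)
  qed auto
  then have "1 - b \<le> expectation (\<lambda>\<omega>. cos (u * \<xi> \<omega>))" using le by (intro LIMSEQ_le_const) auto
  moreover have "integrable M (\<lambda>\<omega>. cos (u * \<xi> \<omega>))" by (rule integrable_const_bound[where B=1]) auto
  ultimately show ?thesis by (simp add: b_def prob_space)
qed

lemma one_minus_cos_ge: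
  fixes y :: real assumes "\<bar>y\<bar> \<le> 1" shows "y\<^sup>2 / 8 \<le> 1 - cos y"
proof -
  define x where "x = \<bar>y\<bar> / 2"
  have x: "0 \<le> x" "x \<le> 1/2" using assms by (auto simp: x_def)
  \<comment> \<open>The cosine is at least \<open>1/2\<close> up to \<open>pi / 3\<close>, beyond
    the range of \<open>x\<close>; then \<open>1 - cos y\<close>, twice the square of
    \<open>sin x\<close>, is at least half the square of \<open>x = \<bar>y\<bar> / 2\<close>,
    whence the \<open>8\<close>.\<close>
  have "x / 2 \<le> sin x"
  proof (cases "x = 0")
    case False
    then obtain z where z: "0 < z" "z < x" "sin x - sin 0 = (x - 0) * cos z"
      using MVT2[of 0 x sin cos] x by (auto intro: DERIV_sin)
    have "cos (pi / 3) \<le> cos z" using z x pi_gt3 by (intro cos_monotone_0_pi_le) auto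
    then have "1/2 \<le> cos z" by (simp add: cos_60)
    then have "x * (1/2) \<le> x * cos z" using x by (intro mult_left_mono) auto
    then show ?thesis using z(3) by simp
  qed simp
  then have "(x / 2)\<^sup>2 \<le> (sin x)\<^sup>2" using x by (intro power_mono) auto
  moreover have "cos y = cos (2 * x)" by (simp add: x_def)
  then have "1 - cos y = 2 * (sin x)\<^sup>2" by (simp add: cos_double_sin)
  ultimately show ?thesis by (simp add: x_def power2_eq_square)
qed

lemma dyadic_scale:
  fixes y :: real assumes "1 \<le> y" shows "\<exists>n. 2 ^ n \<le> y \<and> y < 2 ^ Suc n"
proof -
  define j where "j = (LEAST j. y < 2 ^ j)"
  have ex: "\<exists>j. y < 2 ^ j" using real_arch_pow[of 2 y] by auto
  then have j: "y < 2 ^ j" unfolding j_def by (rule LeastI_ex)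
  then have "j \<noteq> 0" using assms by (cases j) auto
  then obtain n where n: "j = Suc n" by (cases j) auto
  have "\<not> y < 2 ^ n" using not_less_Least[of n "\<lambda>j. y < 2 ^ j"] n by (simp add: j_def)
  then show ?thesis using j n by (intro exI[of _ n]) auto
qed

text \<open>At multiples of \<open>2 * pi\<close> the function \<open>1 - cos\<close> vanishes, so a
  single frequency cannot control large \<open>y\<close>. Halving \<open>y\<close> until its modulus
  lies between \<open>1/2\<close> and \<open>1\<close> gives
  \<open>1 - cos \<ge> (1/4) / 8 = 1/32\<close>, the origin of the constant.\<close>

lemma min_square_le_cos:
  fixes y :: real shows "\<exists>j::nat. min 1 (y\<^sup>2) \<le> 32 * (1 - cos (y / 2 ^ j))"
proof (cases "\<bar>y\<bar> \<le> 1")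
  case True
  have "a \<le> 32 * (1 - c)" if "a / 8 \<le> 1 - c" "c \<le> 1" for a c :: real
    using that by (simp add: right_diff_distrib)
  from this[OF one_minus_cos_ge[OF True] cos_le_one] have "y\<^sup>2 \<le> 32 * (1 - cos y)" .
  then have "min 1 (y\<^sup>2) \<le> 32 * (1 - cos (y / 2 ^ 0))" by (simp only: power_0 div_by_1 min.coboundedI2)
  then show ?thesis by blast
next
  case False
  then obtain n where n: "2 ^ n \<le> \<bar>y\<bar>" "\<bar>y\<bar> < 2 ^ Suc n" using dyadic_scale[of "\<bar>y\<bar>"] by auto
  define x where "x = y / 2 ^ Suc n"
  have x: "1/2 \<le> \<bar>x\<bar>" "\<bar>x\<bar> \<le> 1" using n by (auto simp: x_def abs_divide field_simps)
  have "(1/2)\<^sup>2 \<le> \<bar>x\<bar>\<^sup>2" using x by (intro power_mono) auto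
  then have "1 \<le> 32 * (1 - cos x)" using one_minus_cos_ge[OF x(2)] by (simp add: power2_eq_square)
  then show ?thesis unfolding x_def by (intro exI[of _ "Suc n"]) auto
qed

text \<open>The good scale in \<open>min_square_le_cos\<close> depends on \<open>\<omega>\<close>,
  so all scales are summed. At frequency \<open>u / 2 ^ j\<close> the hypothesis gains a factor of
  at most \<open>(1/2) ^ j\<close> because \<open>\<alpha> \<ge> 1\<close>; the sum costs a factor
  \<open>2\<close>, and \<open>64 = 32 * 2\<close>.\<close>

lemma truncated_second_moment:
  assumes M: "prob_space M" and [measurable]: "Y \<in> borel_measurable M"
    and Y: "\<And>u. (\<integral>\<omega>. 1 - cos (u * Y \<omega>) \<partial>M) \<le> c * \<bar>u\<bar> powr \<alpha>" and c: "c \<ge> 0" and \<alpha>: "\<alpha> \<ge> 1"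
  shows "(\<integral>\<^sup>+\<omega>. ennreal (min 1 ((u * Y \<omega>)\<^sup>2)) \<partial>M) \<le> ennreal (64 * c * \<bar>u\<bar> powr \<alpha>)"
proof -
  interpret prob_space M by fact
  have "(\<integral>\<^sup>+\<omega>. ennreal (min 1 ((u * Y \<omega>)\<^sup>2)) \<partial>M)
     \<le> (\<integral>\<^sup>+\<omega>. (\<Sum>j. ennreal (32 * (1 - cos (u / 2 ^ j * Y \<omega>)))) \<partial>M)"
  proof (intro nn_integral_mono)
    fix \<omega>
    obtain j where j: "min 1 ((u * Y \<omega>)\<^sup>2) \<le> 32 * (1 - cos (u * Y \<omega> / 2 ^ j))" using min_square_le_cos by blast
    have "ennreal (min 1 ((u * Y \<omega>)\<^sup>2)) \<le> ennreal (32 * (1 - cos (u / 2 ^ j * Y \<omega>)))"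
      using j by (intro ennreal_leI) simp
    also have "\<dots> \<le> (\<Sum>j. ennreal (32 * (1 - cos (u / 2 ^ j * Y \<omega>))))"
      by (rule ennreal_le_suminf)
    finally show "ennreal (min 1 ((u * Y \<omega>)\<^sup>2)) \<le> (\<Sum>j. ennreal (32 * (1 - cos (u / 2 ^ j * Y \<omega>))))" .
  qed
  also have "\<dots> = (\<Sum>j. \<integral>\<^sup>+\<omega>. ennreal (32 * (1 - cos (u / 2 ^ j * Y \<omega>))) \<partial>M)"
    by (rule nn_integral_suminf) measurable
  also have "\<dots> \<le> (\<Sum>j. ennreal (32 * c * \<bar>u\<bar> powr \<alpha> * (1/2) ^ j))"
  proof (intro suminf_le summableI)
    fix j :: nat
    have "integrable M (\<lambda>\<omega>. 32 * (1 - cos (u / 2 ^ j * Y \<omega>)))"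
    proof (rule integrable_const_bound[where B=64])
      have "\<bar>32 * (1 - c)\<bar> \<le> 64" if "c \<le> 1" "-1 \<le> c" for c :: real
        using that by (simp add: abs_le_iff right_diff_distrib)
      from this[OF cos_le_one cos_ge_minus_one] have "\<bar>32 * (1 - cos z)\<bar> \<le> 64" for z :: real .
      then show "AE \<omega> in M. norm (32 * (1 - cos (u / 2 ^ j * Y \<omega>))) \<le> 64" by (simp only: real_norm_def AE_I2)
    qed measurable
    then have "(\<integral>\<^sup>+\<omega>. ennreal (32 * (1 - cos (u / 2 ^ j * Y \<omega>))) \<partial>M) = ennreal (\<integral>\<omega>. 32 * (1 - cos (u / 2 ^ j * Y \<omega>)) \<partial>M)"
      by (rule nn_integral_eq_integral) auto
    also have "\<dots> \<le> ennreal (32 * (c * \<bar>u / 2 ^ j\<bar> powr \<alpha>))"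
      unfolding integral_mult_right_zero by (intro ennreal_leI mult_left_mono Y) simp
    also have "\<dots> \<le> ennreal (32 * c * \<bar>u\<bar> powr \<alpha> * (1/2) ^ j)"
    proof (intro ennreal_leI)
      have "\<bar>u / 2 ^ j\<bar> powr \<alpha> = \<bar>u\<bar> powr \<alpha> * ((1/2) ^ j) powr \<alpha>"
        by (simp add: abs_divide powr_divide power_one_over)
      also have "\<dots> \<le> \<bar>u\<bar> powr \<alpha> * ((1/2) ^ j) powr 1"
        using \<alpha> by (intro mult_left_mono powr_mono') (auto simp: power_le_one)
      finally have "32 * c * \<bar>u / 2 ^ j\<bar> powr \<alpha> \<le> 32 * c * (\<bar>u\<bar> powr \<alpha> * (1/2) ^ j)"
        using c by (intro mult_left_mono) auto
      then show "32 * (c * \<bar>u / 2 ^ j\<bar> powr \<alpha>) \<le> 32 * c * \<bar>u\<bar> powr \<alpha> * (1/2) ^ j" by (simp add: mult_ac)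
    qed
    finally show "(\<integral>\<^sup>+\<omega>. ennreal (32 * (1 - cos (u / 2 ^ j * Y \<omega>))) \<partial>M) \<le> ennreal (32 * c * \<bar>u\<bar> powr \<alpha> * (1/2) ^ j)" .
  qed
  also have "\<dots> = ennreal (32 * c * \<bar>u\<bar> powr \<alpha> * 2)"
    using c sums_mult[OF geometric_sums[of "1/2::real"], of "32 * c * \<bar>u\<bar> powr \<alpha>"]
    by (intro suminf_ennreal_eq) auto
  finally show ?thesis by (simp add: mult_ac)
qed

context onb begin

text \<open>If \<open>norm (Y \<omega>) \<ge> R\<close>, then either one coordinate reaches
  \<open>R\<close> in modulus, or no truncation takes effect and, by Parseval, the squares of the
  coordinates divided by \<open>R\<close> sum to at least \<open>1\<close>. In both cases the sum of
  truncated squares is at least \<open>1\<close>, and its expectation is estimated term by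
  term.\<close>

lemma tail_bound_coord:
  fixes Y :: "'w \<Rightarrow> 'h"
  assumes M: "prob_space M" and [measurable]: "Y \<in> borel_measurable M"
    and Y: "\<And>k u. (\<integral>\<omega>. 1 - cos (u * (Y \<omega> \<bullet> e k)) \<partial>M) \<le> c k * \<bar>u\<bar> powr \<alpha>"
    and c: "\<And>k. c k \<ge> 0" "summable c" and \<alpha>: "\<alpha> \<ge> 1" and R: "R > 0"
  shows "emeasure M {\<omega> \<in> space M. R \<le> norm (Y \<omega>)} \<le> ennreal (64 * suminf c * R powr (- \<alpha>))"
proof -
  have pt: "indicator {\<omega> \<in> space M. R \<le> norm (Y \<omega>)} \<omega> \<le> (\<Sum>k. ennreal (min 1 ((1 / R * (Y \<omega> \<bullet> e k))\<^sup>2)))" for \<omega>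
  proof (cases "\<omega> \<in> space M \<and> R \<le> norm (Y \<omega>)")
    case True
    show ?thesis
    proof (cases "\<exists>k. 1 \<le> (1 / R * (Y \<omega> \<bullet> e k))\<^sup>2")
      case ex: True
      then obtain k where "1 \<le> (1 / R * (Y \<omega> \<bullet> e k))\<^sup>2" by blast
      then have "1 = ennreal (min 1 ((1 / R * (Y \<omega> \<bullet> e k))\<^sup>2))" by simp
      also have "\<dots> \<le> (\<Sum>k. ennreal (min 1 ((1 / R * (Y \<omega> \<bullet> e k))\<^sup>2)))"
        by (rule ennreal_le_suminf)
      finally show ?thesis by (auto simp: indicator_def)
    next
      case False
      have s: "(\<lambda>k. (1 / R * (Y \<omega> \<bullet> e k))\<^sup>2) sums ((1 / R)\<^sup>2 * (norm (Y \<omega>))\<^sup>2)"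
        unfolding power_mult_distrib by (intro sums_mult parseval)
      have "1 \<le> norm (Y \<omega>) / R" using True R by simp
      then have "1 \<le> (norm (Y \<omega>) / R)\<^sup>2" by (rule one_le_power)
      then have "1 \<le> (1 / R)\<^sup>2 * (norm (Y \<omega>))\<^sup>2" by (simp add: power_divide)
      then have "1 \<le> ennreal ((1 / R)\<^sup>2 * (norm (Y \<omega>))\<^sup>2)" by simp
      also have "\<dots> = (\<Sum>k. ennreal ((1 / R * (Y \<omega> \<bullet> e k))\<^sup>2))"
        by (rule suminf_ennreal_eq[OF _ s, symmetric]) simp
      also have "\<dots> = (\<Sum>k. ennreal (min 1 ((1 / R * (Y \<omega> \<bullet> e k))\<^sup>2)))"
      proof (intro suminf_cong arg_cong[of _ _ ennreal])
        fix k
        have "(1 / R * (Y \<omega> \<bullet> e k))\<^sup>2 \<le> 1" using False by (meson linear)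
        then show "(1 / R * (Y \<omega> \<bullet> e k))\<^sup>2 = min 1 ((1 / R * (Y \<omega> \<bullet> e k))\<^sup>2)" by (simp only: min_absorb2)
      qed
      finally show ?thesis by (auto simp: indicator_def)
    qed
  qed auto
  have "emeasure M {\<omega> \<in> space M. R \<le> norm (Y \<omega>)} = (\<integral>\<^sup>+\<omega>. indicator {\<omega> \<in> space M. R \<le> norm (Y \<omega>)} \<omega> \<partial>M)"
    by simp
  also have "\<dots> \<le> (\<integral>\<^sup>+\<omega>. (\<Sum>k. ennreal (min 1 ((1 / R * (Y \<omega> \<bullet> e k))\<^sup>2))) \<partial>M)"
    by (intro nn_integral_mono pt)
  also have "\<dots> = (\<Sum>k. \<integral>\<^sup>+\<omega>. ennreal (min 1 ((1 / R * (Y \<omega> \<bullet> e k))\<^sup>2)) \<partial>M)"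
    by (rule nn_integral_suminf) measurable
  also have "\<dots> \<le> (\<Sum>k. ennreal (64 * R powr (- \<alpha>) * c k))"
  proof (intro suminf_le summableI)
    fix k
    have "(\<integral>\<^sup>+\<omega>. ennreal (min 1 ((1 / R * (Y \<omega> \<bullet> e k))\<^sup>2)) \<partial>M) \<le> ennreal (64 * c k * \<bar>1 / R\<bar> powr \<alpha>)"
      by (rule truncated_second_moment[OF M _ Y c(1) \<alpha>]) measurable
    then show "(\<integral>\<^sup>+\<omega>. ennreal (min 1 ((1 / R * (Y \<omega> \<bullet> e k))\<^sup>2)) \<partial>M) \<le> ennreal (64 * R powr (- \<alpha>) * c k)"
      using R by (simp add: powr_minus_divide powr_divide mult_ac)
  qed
  also have "\<dots> = ennreal (64 * R powr (- \<alpha>) * suminf c)"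
    using c by (intro suminf_ennreal_eq sums_mult summable_sums) auto
  finally show ?thesis by (simp add: mult_ac)
qed

text \<open>The \<open>1\<close> covers the values of norm at most \<open>K\<close>; the quotient is
  the geometric series over dyadic shells, of ratio \<open>2 powr (q - \<alpha>)\<close>, and is the
  reason for \<open>q < \<alpha>\<close>.\<close>

definition moment_const :: "real \<Rightarrow> real \<Rightarrow> real" where
  "moment_const \<alpha> q = (1 + 64 * 2 powr q / (1 - 2 powr (q - \<alpha>))) powr (1 / q)"

lemma moment_const_pos: "0 < q \<Longrightarrow> q < \<alpha> \<Longrightarrow> moment_const \<alpha> q > 0"
proof -
  assume q: "0 < q" "q < \<alpha>"
  have "(2::real) powr (q - \<alpha>) < 2 powr 0" using q by (intro powr_less_mono) auto
  then have "0 \<le> 64 * 2 powr q / (1 - 2 powr (q - \<alpha>))" by simp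
  then have "0 < 1 + 64 * 2 powr q / (1 - 2 powr (q - \<alpha>))" by linarith
  then show ?thesis by (simp add: moment_const_def)
qed

text \<open>Summing the weak-type tail bounds over the dyadic shells \<open>2 ^ n * K \<le> norm Y < 2 ^ (n + 1) * K\<close>.\<close>

lemma Lp_bd_coord:
  fixes Y :: "'w \<Rightarrow> 'h"
  assumes M: "prob_space M" and [measurable]: "Y \<in> borel_measurable M"
    and Y: "\<And>k u. (\<integral>\<omega>. 1 - cos (u * (Y \<omega> \<bullet> e k)) \<partial>M) \<le> c k * \<bar>u\<bar> powr \<alpha>"
    and c: "\<And>k. c k \<ge> 0" "summable c" and \<alpha>: "\<alpha> \<ge> 1" and q: "0 < q" "q < \<alpha>"
    and K: "K > 0" "suminf c \<le> K powr \<alpha>"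
  shows "Lp_bd M q Y (moment_const \<alpha> q * K)"
proof -
  interpret prob_space M by fact
  let ?A = "\<lambda>n::nat. {\<omega> \<in> space M. 2 ^ n * K \<le> norm (Y \<omega>)}"
  let ?r = "2 powr (q - \<alpha>)"
  have r: "0 < ?r" "?r < 1" using q powr_less_mono[of "q - \<alpha>" 0 2] by auto
  have pt: "ennreal (norm (Y \<omega>) powr q) \<le> ennreal (K powr q) + (\<Sum>n. ennreal ((2 ^ Suc n * K) powr q) * indicator (?A n) \<omega>)"
    if \<omega>: "\<omega> \<in> space M" for \<omega>
  proof (cases "norm (Y \<omega>) \<le> K")
    case True
    then have "ennreal (norm (Y \<omega>) powr q) \<le> ennreal (K powr q)"
      using q by (intro ennreal_leI powr_mono2) auto
    then show ?thesis by (rule add_increasing2[rotated]) simp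
  next
    case False
    then have "1 \<le> norm (Y \<omega>) / K" using K by simp
    then obtain n where n: "2 ^ n \<le> norm (Y \<omega>) / K" "norm (Y \<omega>) / K < 2 ^ Suc n" using dyadic_scale by blast
    have n': "2 ^ n * K \<le> norm (Y \<omega>)" "norm (Y \<omega>) < 2 ^ Suc n * K" using n K by (simp_all add: field_simps)
    have "ennreal (norm (Y \<omega>) powr q) \<le> ennreal ((2 ^ Suc n * K) powr q) * indicator (?A n) \<omega>"
      using n' \<omega> q by (auto intro!: ennreal_leI powr_mono2)
    also have "\<dots> \<le> (\<Sum>n. ennreal ((2 ^ Suc n * K) powr q) * indicator (?A n) \<omega>)"
      by (rule ennreal_le_suminf)
    finally show ?thesis by (rule add_increasing[rotated]) simp
  qed
  have "(\<integral>\<^sup>+\<omega>. ennreal (norm (Y \<omega>) powr q) \<partial>M)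
     \<le> (\<integral>\<^sup>+\<omega>. ennreal (K powr q) + (\<Sum>n. ennreal ((2 ^ Suc n * K) powr q) * indicator (?A n) \<omega>) \<partial>M)"
    by (intro nn_integral_mono pt)
  also have "\<dots> = ennreal (K powr q) + (\<Sum>n. ennreal ((2 ^ Suc n * K) powr q) * emeasure M (?A n))"
    by (subst nn_integral_add) (auto simp: nn_integral_suminf nn_integral_cmult emeasure_space_1)
  also have "\<dots> \<le> ennreal (K powr q) + (\<Sum>n. ennreal (64 * 2 powr q * K powr q * ?r ^ n))"
  proof (intro add_left_mono suminf_le summableI)
    fix n :: nat
    have "ennreal ((2 ^ Suc n * K) powr q) * emeasure M (?A n)
       \<le> ennreal ((2 ^ Suc n * K) powr q) * ennreal (64 * suminf c * (2 ^ n * K) powr (- \<alpha>))"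
      using K by (intro mult_left_mono tail_bound_coord[OF M _ Y c \<alpha>]) auto
    also have "\<dots> \<le> ennreal ((2 ^ Suc n * K) powr q) * ennreal (64 * K powr \<alpha> * (2 ^ n * K) powr (- \<alpha>))"
      using K by (intro mult_left_mono ennreal_leI mult_right_mono) auto
    also have "\<dots> = ennreal ((2 ^ Suc n * K) powr q * (64 * K powr \<alpha> * (2 ^ n * K) powr (- \<alpha>)))"
      by (rule ennreal_mult[symmetric]) auto
    also have "(2 ^ Suc n * K) powr q * (64 * K powr \<alpha> * (2 ^ n * K) powr (- \<alpha>))
       = 64 * 2 powr q * K powr q * ?r ^ n"
    proof -
      have "((2::real) ^ n) powr q * (2 ^ n) powr (- \<alpha>) = ?r ^ n"
        by (simp add: powr_realpow[symmetric] powr_powr powr_add[symmetric] algebra_simps)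
      moreover have "(2 ^ Suc n * K) powr q * (64 * K powr \<alpha> * (2 ^ n * K) powr (- \<alpha>))
         = 64 * 2 powr q * K powr q * ((2 ^ n) powr q * (2 ^ n) powr (- \<alpha>)) * (K powr \<alpha> * K powr (- \<alpha>))"
        using K by (simp add: powr_mult mult_ac)
      moreover have "K powr \<alpha> * K powr (- \<alpha>) = 1" using K by (simp add: powr_minus)
      ultimately show ?thesis by simp
    qed
    finally show "ennreal ((2 ^ Suc n * K) powr q) * emeasure M (?A n) \<le> ennreal (64 * 2 powr q * K powr q * ?r ^ n)" .
  qed
  also have "(\<Sum>n. ennreal (64 * 2 powr q * K powr q * ?r ^ n)) = ennreal (64 * 2 powr q * K powr q * (1 / (1 - ?r)))"
    using r by (intro suminf_ennreal_eq sums_mult geometric_sums) auto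
  also have "ennreal (K powr q) + \<dots> = ennreal (K powr q + 64 * 2 powr q * K powr q * (1 / (1 - ?r)))"
    using r by (intro ennreal_plus[symmetric]) auto
  also have "K powr q + 64 * 2 powr q * K powr q * (1 / (1 - ?r)) = (1 + 64 * 2 powr q / (1 - ?r)) * K powr q"
    by (simp add: algebra_simps)
  also have "\<dots> = (moment_const \<alpha> q * K) powr q"
  proof -
    have "0 \<le> 64 * 2 powr q / (1 - ?r)" using r by simp
    then show ?thesis using q K by (simp add: moment_const_def powr_mult powr_powr)
  qed
  finally show ?thesis by (simp add: Lp_bd_def)
qed

end

section \<open>The stochastic convolution: coordinates, moments and increments\<close>

locale stable_convolution = diag_semigroup e D A S lam
  for e :: "nat \<Rightarrow> 'h::{real_inner, banach, second_countable_topology}"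
    and D :: "'h set" and A S lam +
  fixes M :: "'w measure" and F :: "real \<Rightarrow> 'w measure" and L :: "nat \<Rightarrow> real \<Rightarrow> 'w \<Rightarrow> real"
    and \<beta> :: "nat \<Rightarrow> real" and \<alpha> \<sigma> \<theta> :: real
  assumes basis: "stochastic_basis M F" and stable: "\<And>k. symmetric_stable_levy M F \<alpha> \<sigma> (L k)"
    and alpha: "1 < \<alpha>" and beta: "\<And>k. \<beta> k > 0" and sigma: "\<sigma> > 0"
    and theta: "0 < \<theta>" "\<theta> < 1" "\<alpha> * \<theta> < 1"
    and summ: "summable (\<lambda>k. \<beta> k powr \<alpha> * lam k powr (- (1 - \<alpha> * \<theta>)))"
begin

sublocale prob_space M using basis by (simp add: stochastic_basis_def)

abbreviation "conv t W \<equiv> stochastic_convolution M S e \<beta> L t W"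

abbreviation "oup k t \<omega> \<equiv> ou_path (lam k) (\<lambda>s. L k s \<omega>) t"

text \<open>\<open>S (t - s)\<close> multiplies \<open>e k\<close> by a scalar exponential, so the
  approximating sums are scalar Riemann sums in direction \<open>e k\<close>, whose pathwise limit
  is given by \<open>ou_path_Riemann\<close>.\<close>

lemma levy_integral_coord:
  assumes t: "t \<ge> 0" and I: "has_levy_integral M (\<lambda>s. S (t - s) (e k)) (L k) t I"
  shows "AE \<omega> in M. I \<omega> \<bullet> e j = (if k = j then oup k t \<omega> else 0)"
proof (rule tendsto_in_prob_unique[OF prob_space_axioms I[unfolded has_levy_integral_def]])
  have lev: "levy_process M F (L k)" using stable by (simp add: symmetric_stable_levy_def)
  have cad: "AE \<omega> in M. cadlag (\<lambda>t. L k t \<omega>)" using lev unfolding levy_process_def cadlag_def by (elim conjE)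
  have zero: "AE \<omega> in M. L k 0 \<omega> = 0" using lev unfolding levy_process_def by (elim conjE)
  show "AE \<omega> in M. (\<lambda>m. (\<Sum>j<m. (L k (t * real (Suc j) / real m) \<omega> - L k (t * real j / real m) \<omega>) *\<^sub>R
           S (t - t * real j / real m) (e k)) \<bullet> e j) \<longlonglongrightarrow> (if k = j then oup k t \<omega> else 0)"
    using cad zero
  proof eventually_elim
    case (elim \<omega>)
    have grid: "0 \<le> t - t * real i / real m" if "i < m" for i m
      using t that mult_left_mono[of "real i" "real m" t] by (simp add: divide_le_eq)
    have eq: "(\<Sum>i<m. (L k (t * real (Suc i) / real m) \<omega> - L k (t * real i / real m) \<omega>) *\<^sub>R
           S (t - t * real i / real m) (e k)) \<bullet> e j
      = (\<Sum>i<m. (L k (0 + t * real (Suc i) / real m) \<omega> - L k (0 + t * real i / real m) \<omega>)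
            * exp (- lam k * (t - t * real i / real m))) * (if k = j then 1 else 0)" for m
      unfolding inner_sum_left sum_distrib_right
      by (intro sum.cong refl) (simp add: S_e[OF grid] inner_e)
    \<comment> \<open>The recursion from time \<open>0\<close> starts at
      \<open>L k 0 \<omega>\<close>, which vanishes almost surely.\<close>
    have "oup k 0 \<omega> = 0" using elim by (simp add: ou_path_def)
    then have "(\<lambda>m. (\<Sum>i<m. (L k (0 + t * real (Suc i) / real m) \<omega> - L k (0 + t * real i / real m) \<omega>)
            * exp (- lam k * (t - t * real i / real m)))) \<longlonglongrightarrow> oup k t \<omega>"
      using ou_path_Riemann[OF elim(1) order_refl t, of "lam k"] lam_pos[of k] by simp
    then have "(\<lambda>m. (\<Sum>i<m. (L k (0 + t * real (Suc i) / real m) \<omega> - L k (0 + t * real i / real m) \<omega>)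
            * exp (- lam k * (t - t * real i / real m))) * (if k = j then 1 else 0)) \<longlonglongrightarrow> oup k t \<omega> * (if k = j then 1 else 0)"
      by (rule tendsto_mult_right)
    then show ?case unfolding eq by (cases "k = j") (simp_all del: of_nat_Suc)
  qed
qed

text \<open>The \<open>j\<close>-th coordinate of the partial sums is constant from
  \<open>m = j + 1\<close> on, so the limit in probability inherits it.\<close>

lemma conv_coord:
  assumes t: "t \<ge> 0" and W: "conv t W"
  shows "AE \<omega> in M. \<forall>j. W \<omega> \<bullet> e j = \<beta> j * oup j t \<omega>"
proof -
  obtain I where I: "\<And>k. has_levy_integral M (\<lambda>s. S (t - s) (e k)) (L k) t (I k)"
    and W: "tendsto_in_prob M (\<lambda>m \<omega>. \<Sum>k<m. \<beta> k *\<^sub>R I k \<omega>) W"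
    using W unfolding stochastic_convolution_def by blast
  have Ic: "AE \<omega> in M. \<forall>k j. I k \<omega> \<bullet> e j = (if k = j then oup k t \<omega> else 0)"
    unfolding AE_all_countable using levy_integral_coord[OF t I] by blast
  have "AE \<omega> in M. W \<omega> \<bullet> e j = \<beta> j * oup j t \<omega>" for j
  proof (rule tendsto_in_prob_unique[OF prob_space_axioms W])
    show "AE \<omega> in M. (\<lambda>m. (\<Sum>k<m. \<beta> k *\<^sub>R I k \<omega>) \<bullet> e j) \<longlonglongrightarrow> \<beta> j * oup j t \<omega>"
      using Ic
    proof eventually_elim
      case (elim \<omega>)
      have "(\<Sum>k<m. \<beta> k *\<^sub>R I k \<omega>) \<bullet> e j = \<beta> j * oup j t \<omega>" if "m > j" for m
      proof -
        have "(\<Sum>k<m. \<beta> k *\<^sub>R I k \<omega>) \<bullet> e j = (\<Sum>k<m. if k = j then \<beta> j * oup j t \<omega> else 0)"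
          unfolding inner_sum_left by (intro sum.cong refl) (simp add: elim)
        then show ?thesis using that by simp
      qed
      then have "\<forall>\<^sub>F m in sequentially. (\<Sum>k<m. \<beta> k *\<^sub>R I k \<omega>) \<bullet> e j = \<beta> j * oup j t \<omega>"
        by (intro eventually_mono[OF eventually_gt_at_top[of j]])
      then show ?case by (rule tendsto_eventually)
    qed
  qed
  then show ?thesis by (simp add: AE_all_countable)
qed

text \<open>Each mild solution comes with its own version of the convolution; since all versions
  share their coordinates, the noise cancels in the difference of two solutions.\<close>

lemma conv_unique:
  assumes "t \<ge> 0" "conv t W" "conv t W'"
  shows "AE \<omega> in M. W \<omega> = W' \<omega>"
  using conv_coord[OF assms(1,2)] conv_coord[OF assms(1,3)]
  by eventually_elim (auto intro: coord_eqI)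

lemma conv_measurable: "conv t W \<Longrightarrow> W \<in> borel_measurable M"
  by (auto simp: stochastic_convolution_def tendsto_in_prob_def)

lemma oup_0: "AE \<omega> in M. oup k 0 \<omega> = 0"
proof -
  have "AE \<omega> in M. L k 0 \<omega> = 0"
    using stable[of k] unfolding symmetric_stable_levy_def levy_process_def by (elim conjE)
  then show ?thesis by eventually_elim (simp add: ou_path_def)
qed

text \<open>The root \<open>1 / \<alpha>\<close> fits the requirement
  \<open>suminf c \<le> K powr \<alpha>\<close> of \<open>Lp_bd_coord\<close>, which is met with
  equality by \<open>K = noise_const * \<delta> powr \<theta>\<close>.\<close>

definition noise_const :: real where
  "noise_const = \<sigma> * (\<Sum>k. \<beta> k powr \<alpha> * lam k powr (- (1 - \<alpha> * \<theta>))) powr (1 / \<alpha>)"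

lemma noise_sum_pos: "(\<Sum>k. \<beta> k powr \<alpha> * lam k powr (- (1 - \<alpha> * \<theta>))) > 0"
  by (rule suminf_pos[OF summ]) (use beta lam_pos in \<open>simp add: less_imp_neq[symmetric]\<close>)

lemma noise_const_pos: "noise_const > 0"
  using noise_sum_pos sigma by (simp add: noise_const_def)

text \<open>\<open>(lam k * \<delta>) powr (\<alpha> * \<theta>) / lam k\<close> equals
  \<open>\<delta> powr (\<alpha> * \<theta>)\<close> times the weight
  \<open>lam k powr (- (1 - \<alpha> * \<theta>))\<close> of the summable series, so the coordinate
  bounds can be summed with the mesh taken out.\<close>

lemma Lp_bd_noise:
  fixes Y :: "'w \<Rightarrow> 'h"
  assumes Y: "Y \<in> borel_measurable M" and d: "\<delta> > 0" and q: "0 < q" "q < \<alpha>"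
    and c: "\<And>k u. (\<integral>\<omega>. 1 - cos (u * (Y \<omega> \<bullet> e k)) \<partial>M)
       \<le> \<sigma> powr \<alpha> * \<bar>\<beta> k * u\<bar> powr \<alpha> * ((lam k * \<delta>) powr (\<alpha> * \<theta>) / lam k)"
  shows "Lp_bd M q Y (moment_const \<alpha> q * (noise_const * \<delta> powr \<theta>))"
proof (rule Lp_bd_coord[OF prob_space_axioms Y, where c="\<lambda>k. \<sigma> powr \<alpha> * \<delta> powr (\<alpha> * \<theta>) * (\<beta> k powr \<alpha> * lam k powr (- (1 - \<alpha> * \<theta>)))"])
  fix k u
  have "(lam k * \<delta>) powr (\<alpha> * \<theta>) / lam k = \<delta> powr (\<alpha> * \<theta>) * lam k powr (- (1 - \<alpha> * \<theta>))"
    using lam_pos[of k] d by (simp add: powr_mult powr_diff powr_minus_divide)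
  then show "(\<integral>\<omega>. 1 - cos (u * (Y \<omega> \<bullet> e k)) \<partial>M)
     \<le> \<sigma> powr \<alpha> * \<delta> powr (\<alpha> * \<theta>) * (\<beta> k powr \<alpha> * lam k powr (- (1 - \<alpha> * \<theta>))) * \<bar>u\<bar> powr \<alpha>"
    using c[of u k] beta[of k] by (simp add: abs_mult powr_mult mult_ac)
next
  show "summable (\<lambda>k. \<sigma> powr \<alpha> * \<delta> powr (\<alpha> * \<theta>) * (\<beta> k powr \<alpha> * lam k powr (- (1 - \<alpha> * \<theta>))))"
    by (intro summable_mult summ)
  show "(\<Sum>k. \<sigma> powr \<alpha> * \<delta> powr (\<alpha> * \<theta>) * (\<beta> k powr \<alpha> * lam k powr (- (1 - \<alpha> * \<theta>)))) \<le> (noise_const * \<delta> powr \<theta>) powr \<alpha>"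
    unfolding suminf_mult[OF summ] noise_const_def using alpha sigma d noise_sum_pos
    by (simp add: powr_mult powr_powr mult_ac)
qed (use alpha q d noise_const_pos in auto)

text \<open>The noise that enters between \<open>s\<close> and \<open>t\<close>. Its exponent
  contains \<open>1 - exp (- \<alpha> * lam k * (t - s))\<close>, estimated with the power
  \<open>\<alpha> * \<theta> \<le> 1\<close>; the extra factor
  \<open>\<alpha> powr (\<alpha> * \<theta>) \<le> \<alpha>\<close> cancels against the denominator
  \<open>\<alpha> * lam k\<close>.\<close>

lemma Lp_bd_conv_new:
  assumes s: "0 \<le> s" "s \<le> t" "t - s \<le> \<delta>" and d: "\<delta> > 0" and q: "0 < q" "q < \<alpha>"
    and Y: "Y \<in> borel_measurable M"
    and Yc: "AE \<omega> in M. \<forall>k. Y \<omega> \<bullet> e k = \<beta> k * (oup k t \<omega> - exp (- lam k * (t - s)) * oup k s \<omega>)"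
  shows "Lp_bd M q Y (moment_const \<alpha> q * (noise_const * \<delta> powr \<theta>))"
proof (rule Lp_bd_noise[OF Y d q])
  fix k u
  define \<xi> where "\<xi> \<omega> = (Y \<omega> \<bullet> e k) / \<beta> k" for \<omega>
  have b: "\<beta> k > 0" by (rule beta)
  have l: "lam k > 0" by (rule lam_pos)
  have "(\<integral>\<omega>. 1 - cos ((\<beta> k * u) * \<xi> \<omega>) \<partial>M)
     \<le> \<sigma> powr \<alpha> * \<bar>\<beta> k * u\<bar> powr \<alpha> * ((1 - exp (- (\<alpha> * lam k) * (t - s))) / (\<alpha> * lam k))"
  proof (rule levy_ou_cos[OF basis stable[of k]])
    show "AE \<omega> in M. \<xi> \<omega> = oup k (s + (t - s)) \<omega> - exp (- lam k * (t - s)) * oup k s \<omega>"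
      using Yc by eventually_elim (use b in \<open>simp add: \<xi>_def\<close>)
    show "\<xi> \<in> borel_measurable M" unfolding \<xi>_def using Y by measurable
  qed (use s l alpha in auto)
  also have "\<dots> \<le> \<sigma> powr \<alpha> * \<bar>\<beta> k * u\<bar> powr \<alpha> * ((lam k * \<delta>) powr (\<alpha> * \<theta>) / lam k)"
  proof (intro mult_left_mono)
    have th: "0 < \<alpha> * \<theta>" "\<alpha> * \<theta> \<le> 1" using theta alpha by auto
    have "1 - exp (- (\<alpha> * lam k) * (t - s)) \<le> (\<alpha> * (lam k * (t - s))) powr (\<alpha> * \<theta>)"
      using one_minus_exp_le_powr[OF _ th, of "\<alpha> * (lam k * (t - s))"] alpha l s by (simp add: mult_ac)
    also have "\<dots> \<le> (\<alpha> * (lam k * \<delta>)) powr (\<alpha> * \<theta>)"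
      using alpha l s th by (intro powr_mono2) auto
    also have "\<dots> = \<alpha> powr (\<alpha> * \<theta>) * (lam k * \<delta>) powr (\<alpha> * \<theta>)" using alpha l d by (simp add: powr_mult)
    also have "\<dots> \<le> \<alpha> powr 1 * (lam k * \<delta>) powr (\<alpha> * \<theta>)"
      using alpha th by (intro mult_right_mono powr_mono) auto
    finally have "1 - exp (- (\<alpha> * lam k) * (t - s)) \<le> \<alpha> * (lam k * \<delta>) powr (\<alpha> * \<theta>)" using alpha by simp
    then have "(1 - exp (- (\<alpha> * lam k) * (t - s))) / (\<alpha> * lam k) \<le> \<alpha> * (lam k * \<delta>) powr (\<alpha> * \<theta>) / (\<alpha> * lam k)"
      using alpha l by (intro divide_right_mono) auto
    then show "(1 - exp (- (\<alpha> * lam k) * (t - s))) / (\<alpha> * lam k) \<le> (lam k * \<delta>) powr (\<alpha> * \<theta>) / lam k"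
      using alpha by simp
  qed auto
  finally show "(\<integral>\<omega>. 1 - cos (u * (Y \<omega> \<bullet> e k)) \<partial>M)
       \<le> \<sigma> powr \<alpha> * \<bar>\<beta> k * u\<bar> powr \<alpha> * ((lam k * \<delta>) powr (\<alpha> * \<theta>) / lam k)"
    using b by (simp add: \<xi>_def mult_ac)
qed

text \<open>What the noise from before \<open>s\<close> loses by damping over a further time
  \<open>h\<close>. The factor \<open>1 - exp (- lam k * h)\<close> is at most
  \<open>(lam k * \<delta>) powr \<theta>\<close> and enters the stable exponent with power
  \<open>\<alpha>\<close>, which gives the same bound as for fresh noise.\<close>

lemma Lp_bd_conv_old:
  assumes s: "0 \<le> s" and h: "0 \<le> h" "h \<le> \<delta>" and d: "\<delta> > 0" and q: "0 < q" "q < \<alpha>"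
    and Y: "Y \<in> borel_measurable M"
    and Yc: "AE \<omega> in M. \<forall>k. Y \<omega> \<bullet> e k = \<beta> k * ((1 - exp (- lam k * h)) * oup k s \<omega>)"
  shows "Lp_bd M q Y (moment_const \<alpha> q * (noise_const * \<delta> powr \<theta>))"
proof (rule Lp_bd_noise[OF Y d q])
  fix k u
  define \<gamma> where "\<gamma> = 1 - exp (- lam k * h)"
  have b: "\<beta> k > 0" by (rule beta)
  have l: "lam k > 0" by (rule lam_pos)
  show "(\<integral>\<omega>. 1 - cos (u * (Y \<omega> \<bullet> e k)) \<partial>M)
       \<le> \<sigma> powr \<alpha> * \<bar>\<beta> k * u\<bar> powr \<alpha> * ((lam k * \<delta>) powr (\<alpha> * \<theta>) / lam k)"
  \<comment> \<open>For \<open>h = 0\<close> the damping factor is \<open>0\<close> and cannot be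
    divided out.\<close>
  proof (cases "h = 0")
    case True
    have "(\<integral>\<omega>. 1 - cos (u * (Y \<omega> \<bullet> e k)) \<partial>M) = (\<integral>\<omega>. 0 \<partial>M)"
      by (rule integral_cong_AE) (use Y Yc True in \<open>auto elim!: eventually_mono\<close>)
    then show ?thesis using l by simp
  next
    case False
    then have g: "\<gamma> > 0" using h l by (simp add: \<gamma>_def)
    define \<xi> where "\<xi> \<omega> = (Y \<omega> \<bullet> e k) / (\<beta> k * \<gamma>)" for \<omega>
    have "(\<integral>\<omega>. 1 - cos ((\<beta> k * \<gamma> * u) * \<xi> \<omega>) \<partial>M)
       \<le> \<sigma> powr \<alpha> * \<bar>\<beta> k * \<gamma> * u\<bar> powr \<alpha> * ((1 - exp (- (\<alpha> * lam k) * s)) / (\<alpha> * lam k))"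
    proof (rule levy_ou_cos[OF basis stable[of k]])
      have "AE \<omega> in M. Y \<omega> \<bullet> e k = \<beta> k * (\<gamma> * oup k s \<omega>)"
        using Yc unfolding \<gamma>_def by eventually_elim blast
      then show "AE \<omega> in M. \<xi> \<omega> = oup k (0 + s) \<omega> - exp (- lam k * s) * oup k 0 \<omega>"
        using oup_0[of k] by eventually_elim (use b g in \<open>simp add: \<xi>_def\<close>)
      show "\<xi> \<in> borel_measurable M" unfolding \<xi>_def using Y by measurable
    qed (use s l alpha in auto)
    also have "\<dots> \<le> \<sigma> powr \<alpha> * \<bar>\<beta> k * \<gamma> * u\<bar> powr \<alpha> * (1 / lam k)"
    proof (intro mult_left_mono)
      have "(1 - exp (- (\<alpha> * lam k) * s)) / (\<alpha> * lam k) \<le> 1 / (\<alpha> * lam k)"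
        using alpha l by (intro divide_right_mono) auto
      also have "\<dots> \<le> 1 / lam k" using alpha l by (simp add: divide_le_eq)
      finally show "(1 - exp (- (\<alpha> * lam k) * s)) / (\<alpha> * lam k) \<le> 1 / lam k" .
    qed auto
    also have "\<dots> = \<sigma> powr \<alpha> * \<bar>\<beta> k * u\<bar> powr \<alpha> * (\<gamma> powr \<alpha> / lam k)"
      using g by (simp add: abs_mult powr_mult mult_ac)
    also have "\<dots> \<le> \<sigma> powr \<alpha> * \<bar>\<beta> k * u\<bar> powr \<alpha> * ((lam k * \<delta>) powr (\<alpha> * \<theta>) / lam k)"
    proof (intro mult_left_mono divide_right_mono)
      have "\<gamma> \<le> (lam k * h) powr \<theta>"
        using one_minus_exp_le_powr[of "lam k * h" \<theta>] l h theta by (simp add: \<gamma>_def)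
      also have "\<dots> \<le> (lam k * \<delta>) powr \<theta>" using l h theta by (intro powr_mono2) auto
      finally have "\<gamma> powr \<alpha> \<le> ((lam k * \<delta>) powr \<theta>) powr \<alpha>" using g alpha by (intro powr_mono2) auto
      then show "\<gamma> powr \<alpha> \<le> (lam k * \<delta>) powr (\<alpha> * \<theta>)" by (simp add: powr_powr mult.commute)
    qed (use l in auto)
    finally show ?thesis using b g by (simp add: \<xi>_def mult_ac)
  qed
qed

text \<open>Both \<open>Wt\<close> and \<open>Ws\<close> are compared with
  \<open>S (t - s) (Ws \<omega>)\<close>: the first difference is the fresh noise, the second the
  loss of the old noise by damping.\<close>

lemma Lp_bd_conv_increment:
  assumes s: "0 \<le> s" "s \<le> t" "t - s \<le> \<delta>" and d: "\<delta> > 0" and q: "1 < q" "q < \<alpha>"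
    and Ws: "conv s Ws" and Wt: "conv t Wt"
  shows "Lp_bd M q (\<lambda>\<omega>. Wt \<omega> - Ws \<omega>) (2 * (moment_const \<alpha> q * (noise_const * \<delta> powr \<theta>)))"
proof -
  have [measurable]: "Ws \<in> borel_measurable M" "Wt \<in> borel_measurable M"
    using Ws Wt conv_measurable by blast+
  have SW[measurable]: "(\<lambda>\<omega>. S (t - s) (Ws \<omega>)) \<in> borel_measurable M"
  proof -
    have "max (t - s) 0 = t - s" using s by simp
    then show ?thesis using S_measurable[of "\<lambda>_. t - s" M Ws] by simp
  qed
  let ?K = "moment_const \<alpha> q * (noise_const * \<delta> powr \<theta>)"
  have K: "?K > 0" using q d noise_const_pos by (simp add: moment_const_pos)
  have c: "AE \<omega> in M. \<forall>k. Ws \<omega> \<bullet> e k = \<beta> k * oup k s \<omega>" "AE \<omega> in M. \<forall>k. Wt \<omega> \<bullet> e k = \<beta> k * oup k t \<omega>"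
    using conv_coord[OF _ Ws] conv_coord[OF _ Wt] s by auto
  have "Lp_bd M q (\<lambda>\<omega>. Wt \<omega> - S (t - s) (Ws \<omega>)) ?K"
  proof (rule Lp_bd_conv_new[OF s d])
    show "AE \<omega> in M. \<forall>k. (Wt \<omega> - S (t - s) (Ws \<omega>)) \<bullet> e k = \<beta> k * (oup k t \<omega> - exp (- lam k * (t - s)) * oup k s \<omega>)"
      using c by eventually_elim (use s in \<open>simp add: inner_diff_left S_coord right_diff_distrib\<close>)
  qed (use q in auto)
  moreover have "Lp_bd M q (\<lambda>\<omega>. Ws \<omega> - S (t - s) (Ws \<omega>)) ?K"
  proof (rule Lp_bd_conv_old[where s=s and h="t - s"])
    show "AE \<omega> in M. \<forall>k. (Ws \<omega> - S (t - s) (Ws \<omega>)) \<bullet> e k = \<beta> k * ((1 - exp (- lam k * (t - s))) * oup k s \<omega>)"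
      using c(1) by eventually_elim (use s in \<open>simp add: inner_diff_left S_coord algebra_simps\<close>)
  qed (use q s d in auto)
  ultimately have "Lp_bd M q (\<lambda>\<omega>. (Wt \<omega> - S (t - s) (Ws \<omega>)) - (Ws \<omega> - S (t - s) (Ws \<omega>))) (?K + ?K)"
    using K q by (intro Lp_bd_diff) auto
  moreover have "(\<lambda>\<omega>. (Wt \<omega> - S (t - s) (Ws \<omega>)) - (Ws \<omega> - S (t - s) (Ws \<omega>))) = (\<lambda>\<omega>. Wt \<omega> - Ws \<omega>)" by simp
  ultimately show ?thesis by (simp only: mult_2)
qed

lemma Lp_bd_conv:
  assumes t: "0 \<le> t" "t \<le> T" and T: "T > 0" and q: "1 < q" "q < \<alpha>" and W: "conv t W"
  shows "Lp_bd M q W (moment_const \<alpha> q * (noise_const * T powr \<theta>))"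
proof (rule Lp_bd_conv_new[where s=0 and t=t])
  have o: "AE \<omega> in M. \<forall>k. oup k 0 \<omega> = 0" using oup_0 by (simp add: AE_all_countable)
  show "AE \<omega> in M. \<forall>k. W \<omega> \<bullet> e k = \<beta> k * (oup k t \<omega> - exp (- lam k * (t - 0)) * oup k 0 \<omega>)"
    using conv_coord[OF t(1) W] o by eventually_elim simp
qed (use t T q conv_measurable[OF W] in auto)

end

section \<open>Oscillation of a fast Markov chain\<close>

abbreviation mat_pow :: "real^'s^'s \<Rightarrow> nat \<Rightarrow> real^'s^'s" where
  "mat_pow Q k \<equiv> (((**) Q) ^^ k) (mat 1)"

lemma mat_pow_bound:
  fixes Q :: "real^'s^'s"
  shows "\<exists>B\<ge>0. \<forall>k i j. \<bar>mat_pow Q k $ i $ j\<bar> \<le> B ^ k"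
proof -
  define B where "B = (\<Sum>i\<in>UNIV. \<Sum>j\<in>UNIV. \<bar>Q $ i $ j\<bar>)"
  have row: "(\<Sum>l\<in>UNIV. \<bar>Q $ i $ l\<bar>) \<le> B" for i
    unfolding B_def using member_le_sum[of i UNIV "\<lambda>i. \<Sum>j\<in>UNIV. \<bar>Q $ i $ j\<bar>"] by (auto intro: sum_nonneg)
  have B: "B \<ge> 0" unfolding B_def by (intro sum_nonneg) auto
  have "\<bar>mat_pow Q k $ i $ j\<bar> \<le> B ^ k" for k i j
  proof (induction k arbitrary: i)
    case (Suc k)
    have "\<bar>mat_pow Q (Suc k) $ i $ j\<bar> = \<bar>\<Sum>l\<in>UNIV. Q $ i $ l * mat_pow Q k $ l $ j\<bar>"
      by (simp add: matrix_matrix_mult_def)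
    also have "\<dots> \<le> (\<Sum>l\<in>UNIV. \<bar>Q $ i $ l\<bar> * B ^ k)"
      by (rule order_trans[OF sum_abs]) (auto intro!: sum_mono mult_left_mono Suc.IH simp: abs_mult)
    also have "\<dots> \<le> B * B ^ k"
      unfolding sum_distrib_right[symmetric] using B row by (intro mult_right_mono) auto
    finally show ?case by simp
  qed (simp add: mat_def)
  with B show ?thesis by blast
qed

lemma mat_pow_scaleR: "mat_pow (t *\<^sub>R Q) k = t ^ k *\<^sub>R mat_pow Q k"
  by (induction k) (simp_all add: vec_eq_iff matrix_matrix_mult_def sum_distrib_left mult_ac)

lemma mat_pow_commute: "mat_pow Q k ** Q = Q ** mat_pow Q k"
  by (induction k) (simp_all add: matrix_mul_assoc[symmetric])

lemma mat_exp_summable: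
  fixes Q :: "real^'s^'s"
  shows "summable (\<lambda>k. (mat_pow Q k *v h) $ i / fact k * y ^ k)"
proof -
  obtain B where B: "B \<ge> 0" "\<And>k i j. \<bar>mat_pow Q k $ i $ j\<bar> \<le> B ^ k" using mat_pow_bound[of Q] by blast
  define H where "H = (\<Sum>j\<in>UNIV. \<bar>h $ j\<bar>)"
  have "\<bar>(mat_pow Q k *v h) $ i\<bar> \<le> H * B ^ k" for k
  proof -
    have "\<bar>(mat_pow Q k *v h) $ i\<bar> \<le> (\<Sum>j\<in>UNIV. B ^ k * \<bar>h $ j\<bar>)"
      unfolding matrix_vector_mult_def vec_lambda_beta
      by (rule order_trans[OF sum_abs]) (auto intro!: sum_mono mult_right_mono B simp: abs_mult)
    then show ?thesis by (simp add: H_def sum_distrib_left mult.commute)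
  qed
  then have bd: "norm ((mat_pow Q k *v h) $ i / fact k * y ^ k) \<le> H * ((B * \<bar>y\<bar>) ^ k /\<^sub>R fact k)" for k
  proof -
    have "norm ((mat_pow Q k *v h) $ i / fact k * y ^ k) = \<bar>(mat_pow Q k *v h) $ i\<bar> * (\<bar>y\<bar> ^ k / fact k)"
      by (simp add: abs_mult power_abs)
    also have "\<dots> \<le> (H * B ^ k) * (\<bar>y\<bar> ^ k / fact k)"
      using \<open>\<And>k. \<bar>(mat_pow Q k *v h) $ i\<bar> \<le> H * B ^ k\<close> by (intro mult_right_mono) auto
    finally show ?thesis by (simp add: power_mult_distrib divide_inverse mult_ac)
  qed
  show ?thesis
    by (rule summable_comparison_test'[OF summable_mult[OF summable_exp_generic[of "B * \<bar>y\<bar>"], of H]]) (rule bd)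
qed

text \<open>\<open>mat_exp\<close> is a series of matrices in the vector space sense; applied to a
  vector, each component becomes a power series in \<open>t\<close>, which can be differentiated
  termwise.\<close>

lemma mat_exp_apply:
  fixes Q :: "real^'s^'s"
  shows "(mat_exp (t *\<^sub>R Q) *v h) $ i = (\<Sum>k. (mat_pow Q k *v h) $ i / fact k * t ^ k)"
proof -
  define E where "E = (\<chi> i j. \<Sum>k. (mat_pow Q k *v axis j 1) $ i / fact k * t ^ k)"
  have entry: "(mat_pow Q k *v axis j 1) $ i = mat_pow Q k $ i $ j" for k i j
    by (simp add: matrix_vector_mult_basis column_def)
  have s: "(\<lambda>k. ((1 / fact k) *\<^sub>R mat_pow (t *\<^sub>R Q) k) $ i $ j) sums (E $ i $ j)" for i j
    using summable_sums[OF mat_exp_summable[of Q "axis j 1" i t]]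
    by (simp add: E_def mat_pow_scaleR entry divide_inverse mult_ac)
  have "(\<lambda>k. (1 / fact k) *\<^sub>R mat_pow (t *\<^sub>R Q) k) sums E"
    unfolding sums_def
  proof (intro vec_tendstoI)
    fix i j
    show "(\<lambda>n. (\<Sum>k<n. (1 / fact k) *\<^sub>R mat_pow (t *\<^sub>R Q) k) $ i $ j) \<longlonglongrightarrow> E $ i $ j"
      using s[of i j] by (simp add: sums_def)
  qed
  then have "mat_exp (t *\<^sub>R Q) = E" by (simp add: mat_exp_def sums_iff)
  then have "(mat_exp (t *\<^sub>R Q) *v h) $ i = (\<Sum>j\<in>UNIV. E $ i $ j * h $ j)" by (simp add: matrix_vector_mult_def)
  moreover have "(\<lambda>k. \<Sum>j\<in>UNIV. ((1 / fact k) *\<^sub>R mat_pow (t *\<^sub>R Q) k) $ i $ j * h $ j) sums (\<Sum>j\<in>UNIV. E $ i $ j * h $ j)"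
    by (intro sums_sum sums_mult2 s)
  moreover have "(\<Sum>j\<in>UNIV. ((1 / fact k) *\<^sub>R mat_pow (t *\<^sub>R Q) k) $ i $ j * h $ j)
     = (mat_pow Q k *v h) $ i / fact k * t ^ k" for k
    by (simp add: mat_pow_scaleR matrix_vector_mult_def sum_distrib_right sum_divide_distrib divide_inverse mult_ac sum_distrib_left)
  ultimately show ?thesis by (simp add: sums_iff)
qed

text \<open>Kolmogorov's equation in the form in which \<open>Q\<close> acts on \<open>h\<close>
  first, so that the derivative is again a transition operator applied to a fixed vector.\<close>

lemma mat_exp_has_derivative:
  fixes Q :: "real^'s^'s"
  shows "((\<lambda>t. (mat_exp (t *\<^sub>R Q) *v h) $ i) has_real_derivative (mat_exp (t *\<^sub>R Q) *v (Q *v h)) $ i) (at t)"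
proof -
  let ?c = "\<lambda>k. (mat_pow Q k *v h) $ i / fact k"
  have "diffs ?c = (\<lambda>k. (mat_pow Q k *v (Q *v h)) $ i / fact k)"
  proof
    fix k
    have "mat_pow Q (Suc k) *v h = mat_pow Q k *v (Q *v h)"
      by (simp add: matrix_vector_mul_assoc mat_pow_commute)
    then show "diffs ?c k = (mat_pow Q k *v (Q *v h)) $ i / fact k"
      by (simp add: diffs_def divide_simps del: funpow.simps)
  qed
  then show ?thesis
    using termdiffs_strong_converges_everywhere[of ?c t, OF mat_exp_summable]
    by (simp add: mat_exp_apply)
qed

text \<open>Fredholm alternative. Uniqueness of the stationary vector makes the left kernel of
  \<open>Q\<close> one-dimensional: a kernel vector \<open>m\<close> of total \<open>s\<close> gives
  the stationary vector \<open>\<nu> + (m - s *\<^sub>R \<nu>)\<close>, hence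
  \<open>m = s *\<^sub>R \<nu>\<close>. So \<open>f\<close>, being orthogonal to
  \<open>\<nu>\<close>, is orthogonal to the left kernel and lies in the range.\<close>

lemma stationary_poisson:
  fixes Q :: "real^'s^'s"
  assumes irr: "weakly_irreducible Q" and nu: "stationary_vector Q \<nu>"
    and f: "(\<Sum>j\<in>UNIV. \<nu> $ j * f $ j) = 0"
  shows "\<exists>h. Q *v h = f"
proof -
  have kern: "\<exists>c. m = c *\<^sub>R \<nu>" if m: "m v* Q = 0" for m
  proof -
    define s where "s = (\<Sum>i\<in>UNIV. m $ i)"
    have uniq: "\<mu> = \<nu>" if "stationary_vector Q \<mu>" for \<mu>
      using irr nu that unfolding weakly_irreducible_def by blast
    have "(\<nu> + 1 *\<^sub>R (m - s *\<^sub>R \<nu>)) v* Q = \<nu> v* Q + (m v* Q - s *\<^sub>R (\<nu> v* Q))"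
      by (simp add: vec_eq_iff vector_matrix_mult_def sum.distrib sum_subtractf sum_distrib_left algebra_simps)
    then have lin: "(\<nu> + 1 *\<^sub>R (m - s *\<^sub>R \<nu>)) v* Q = 0"
      using m nu by (simp add: stationary_vector_def)
    have "(\<Sum>i\<in>UNIV. (\<nu> + 1 *\<^sub>R (m - s *\<^sub>R \<nu>)) $ i) = 1"
      using nu by (simp add: stationary_vector_def sum.distrib sum_subtractf s_def flip: sum_distrib_left)
    then have "\<nu> + 1 *\<^sub>R (m - s *\<^sub>R \<nu>) = \<nu>" using lin by (intro uniq) (simp add: stationary_vector_def)
    then show ?thesis by auto
  qed
  have fin: "f \<bullet> \<nu> = 0" using f by (simp add: inner_vec_def mult.commute)
  define R where "R = range (\<lambda>h. Q *v h)"
  have sub: "subspace R" unfolding R_def by (intro linear_subspace_image matrix_vector_mul_linear subspace_UNIV)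
  obtain a z where az: "a \<in> span R" "\<And>w. w \<in> span R \<Longrightarrow> orthogonal z w" "f = a + z"
    using orthogonal_subspace_decomp_exists[of R f] by blast
  have "z v* Q = 0"
  proof -
    have "(z v* Q) \<bullet> h = 0" for h
      using az(2)[of "Q *v h"] by (simp add: R_def span_base orthogonal_def dot_lmul_matrix)
    then show ?thesis by (metis inner_eq_zero_iff)
  qed
  then obtain c where c: "z = c *\<^sub>R \<nu>" using kern by blast
  have "z \<bullet> z = z \<bullet> f - z \<bullet> a" using az(3) by (simp add: inner_add_right)
  also have "z \<bullet> a = 0" using az(1,2) by (simp add: orthogonal_def)
  also have "z \<bullet> f = 0" using fin by (simp add: c inner_commute)
  finally have "z = 0" by simp
  then have "f \<in> R" using az sub by (simp add: span_eq_iff[symmetric] del: span_eq_iff) 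
  then show ?thesis by (auto simp: R_def)
qed

text \<open>The square is an integral over \<open>[a, b] \<times> [a, b]\<close>, by symmetry twice
  that over \<open>u \<le> v\<close>. The ordering of the two times is what the Markov property
  needs.\<close>

lemma integral_square_triangle:
  fixes g :: "real \<Rightarrow> real"
  assumes [measurable]: "g \<in> borel_measurable borel" and g: "\<And>x. \<bar>g x\<bar> \<le> B" and ab: "a \<le> b"
  shows "(\<integral>u. indicator {a..b} u * g u \<partial>lborel)\<^sup>2
     = 2 * (\<integral>u. indicator {a..b} u * g u * (\<integral>v. indicator {u..b} v * g v \<partial>lborel) \<partial>lborel)"
proof -
  let ?G = "\<lambda>u. indicator {a..b} u * g u"
  have B: "B \<ge> 0" using g[of 0] by linarith
  have bd: "integrable (lborel \<Otimes>\<^sub>M lborel) (\<lambda>(u, v). ?G u * ?G v * k u v)"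
    if [measurable]: "case_prod k \<in> borel_measurable (borel \<Otimes>\<^sub>M borel)" and k: "\<And>u v. \<bar>k u v\<bar> \<le> 1" for k :: "real \<Rightarrow> real \<Rightarrow> real"
  proof (rule integrableI_bounded_set[where A="{a..b} \<times> {a..b}" and B="B * B"])
    show "emeasure (lborel \<Otimes>\<^sub>M lborel) ({a..b} \<times> {a..b}) < \<infinity>"
      using ab by (subst lborel.emeasure_pair_measure_Times) (auto simp: ennreal_mult[symmetric])
    have "\<bar>g u * g v * k u v\<bar> \<le> B * B" for u v
    proof -
      have "\<bar>g u\<bar> * \<bar>g v\<bar> * \<bar>k u v\<bar> \<le> (B * B) * 1"
        using g k B by (intro mult_mono) auto
      then show ?thesis by (simp add: abs_mult)
    qed
    then show "AE x\<in>{a..b} \<times> {a..b} in lborel \<Otimes>\<^sub>M lborel. norm (case x of (u, v) \<Rightarrow> ?G u * ?G v * k u v) \<le> B * B"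
      by (intro AE_I2) auto
    show "AE x in lborel \<Otimes>\<^sub>M lborel. x \<notin> {a..b} \<times> {a..b} \<longrightarrow> (case x of (u, v) \<Rightarrow> ?G u * ?G v * k u v) = 0"
      by (intro AE_I2) (auto simp: indicator_def)
  qed auto
  have [measurable]: "Measurable.pred (borel \<Otimes>\<^sub>M borel) (\<lambda>(u::real, v). u \<le> v)" "Measurable.pred (borel \<Otimes>\<^sub>M borel) (\<lambda>(u::real, v). v < u)"
    by measurable
  have m1[measurable]: "case_prod (\<lambda>(u::real) v. of_bool (u \<le> v) :: real) \<in> borel_measurable (borel \<Otimes>\<^sub>M borel)"
    "case_prod (\<lambda>(u::real) v. of_bool (v < u) :: real) \<in> borel_measurable (borel \<Otimes>\<^sub>M borel)"
    unfolding case_prod_unfold of_bool_def by measurable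
  have iG: "integrable lborel ?G"
    by (rule integrableI_bounded_set[where A="{a..b}" and B=B]) (use ab g in auto)
  have i1: "integrable (lborel \<Otimes>\<^sub>M lborel) (\<lambda>(u, v). ?G u * ?G v * of_bool (u \<le> v))" by (rule bd) (auto simp: m1)
  have i2: "integrable (lborel \<Otimes>\<^sub>M lborel) (\<lambda>(u, v). ?G u * ?G v * of_bool (v < u))" by (rule bd) (auto simp: m1)
  have i0: "integrable (lborel \<Otimes>\<^sub>M lborel) (\<lambda>(u, v). ?G u * ?G v)" using bd[of "\<lambda>_ _. 1"] by simp
  define T where "T = (\<integral>u. \<integral>v. ?G u * ?G v * of_bool (u \<le> v) \<partial>lborel \<partial>lborel)"
  have "(\<integral>u. ?G u \<partial>lborel)\<^sup>2 = (\<integral>u. \<integral>v. ?G u * ?G v \<partial>lborel \<partial>lborel)"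
    by (simp add: power2_eq_square)
  also have "\<dots> = integral\<^sup>L (lborel \<Otimes>\<^sub>M lborel) (\<lambda>(u, v). ?G u * ?G v)"
    using lborel_pair.integral_fst'[OF i0] by simp
  also have "\<dots> = integral\<^sup>L (lborel \<Otimes>\<^sub>M lborel) (\<lambda>x. (case x of (u, v) \<Rightarrow> ?G u * ?G v * of_bool (u \<le> v)) + (case x of (u, v) \<Rightarrow> ?G u * ?G v * of_bool (v < u)))"
    by (intro Bochner_Integration.integral_cong) auto
  also have "\<dots> = integral\<^sup>L (lborel \<Otimes>\<^sub>M lborel) (\<lambda>(u, v). ?G u * ?G v * of_bool (u \<le> v))
      + integral\<^sup>L (lborel \<Otimes>\<^sub>M lborel) (\<lambda>(u, v). ?G u * ?G v * of_bool (v < u))"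
    by (rule Bochner_Integration.integral_add[OF i1 i2])
  also have "integral\<^sup>L (lborel \<Otimes>\<^sub>M lborel) (\<lambda>(u, v). ?G u * ?G v * of_bool (u \<le> v)) = T"
    using lborel_pair.integral_fst'[OF i1] by (simp add: T_def)
  also have "integral\<^sup>L (lborel \<Otimes>\<^sub>M lborel) (\<lambda>(u, v). ?G u * ?G v * of_bool (v < u))
     = (\<integral>v. \<integral>u. ?G u * ?G v * of_bool (v < u) \<partial>lborel \<partial>lborel)"
    using lborel_pair.integral_snd[OF i2] by simp
  also have "\<dots> = T" unfolding T_def
  proof (rule Bochner_Integration.integral_cong[OF refl])
    fix v
    show "(\<integral>u. ?G u * ?G v * of_bool (v < u) \<partial>lborel) = (\<integral>u. ?G v * ?G u * of_bool (v \<le> u) \<partial>lborel)"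
    proof (rule integral_cong_AE)
      show "AE u in lborel. ?G u * ?G v * of_bool (v < u) = ?G v * ?G u * of_bool (v \<le> u)"
        using AE_lborel_singleton[of v] by eventually_elim auto
    qed measurable
  qed
  also have "T + T = 2 * (\<integral>u. ?G u * (\<integral>v. indicator {u..b} v * g v \<partial>lborel) \<partial>lborel)"
  proof -
    have "(\<integral>v. ?G u * ?G v * of_bool (u \<le> v) \<partial>lborel) = ?G u * (\<integral>v. indicator {u..b} v * g v \<partial>lborel)" for u
    proof (cases "u \<in> {a..b}")
      case True
      have "(\<integral>v. ?G u * ?G v * of_bool (u \<le> v) \<partial>lborel) = (\<integral>v. ?G u * (indicator {u..b} v * g v) \<partial>lborel)"
        using True by (intro Bochner_Integration.integral_cong) (auto simp: indicator_def)
      then show ?thesis by simp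
    qed auto
    then show ?thesis by (simp add: T_def)
  qed
  finally show ?thesis .
qed

text \<open>\<open>ct_markov_chain\<close> prescribes the conditional expectation of one state
  indicator at a time, so \<open>h\<close> is expanded over the states and reassembled after
  conditioning at time \<open>u\<close>.\<close>

lemma chain_cond:
  fixes r :: "real \<Rightarrow> 'w \<Rightarrow> 's::finite" and f h :: "real^'s"
  assumes M: "prob_space M" and chain: "ct_markov_chain M r Q" and uv: "0 \<le> u" "u \<le> v"
  shows "(\<integral>\<omega>. f $ r u \<omega> * h $ r v \<omega> \<partial>M)
    = (\<Sum>i\<in>UNIV. measure M {\<omega>\<in>space M. r u \<omega> = i} * f $ i * (mat_exp ((v - u) *\<^sub>R Q) *v h) $ i)"
proof -
  interpret prob_space M by fact
  let ?N = "natural_filtration M r u"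
  have rm: "\<And>t. t \<ge> 0 \<Longrightarrow> r t \<in> measurable M (count_space UNIV)" using chain by (simp add: ct_markov_chain_def)
  have [measurable]: "r u \<in> measurable M (count_space UNIV)" "r v \<in> measurable M (count_space UNIV)"
    using uv by (auto intro: rm)
  have gen: "{r t -` {i} \<inter> space M |t i. 0 \<le> t \<and> t \<le> u} \<subseteq> sets M"
    using rm by (auto intro!: measurable_sets)
  have subN: "subalgebra M ?N"
    unfolding natural_filtration_def subalgebra_def using gen
    by (auto simp: sets.sigma_sets_subset space_measure_of_conv sets_measure_of_conv sets.space_closed intro: sets.sigma_sets_subset[THEN subsetD])
  interpret finite_measure_subalgebra M ?N by unfold_locales (rule subN)
  have rN: "r u \<in> measurable ?N (count_space UNIV)"
  proof (subst measurable_count_space_eq2)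
    have "r u -` {i} \<inter> space ?N \<in> sets ?N" for i
    proof -
      have "r u -` {i} \<inter> space M \<in> sigma_sets (space M) {r t -` {i} \<inter> space M |t i. 0 \<le> t \<and> t \<le> u}"
        using uv by (intro sigma_sets.Basic) auto
      then show ?thesis using gen sets.space_closed[of M]
        by (simp add: natural_filtration_def sets_measure_of_conv space_measure_of_conv) (meson order_trans)
    qed
    then show "r u \<in> space ?N \<rightarrow> UNIV \<and> (\<forall>i\<in>UNIV. r u -` {i} \<inter> space ?N \<in> sets ?N)" by auto
  qed simp
  have fN: "(\<lambda>\<omega>. f $ r u \<omega>) \<in> borel_measurable ?N"
    using measurable_compose[OF rN, of "\<lambda>i. f $ i" borel] by simp
  have one: "(\<integral>\<omega>. f $ r u \<omega> * indicator {j} (r v \<omega>) \<partial>M)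
     = (\<integral>\<omega>. f $ r u \<omega> * mat_exp ((v - u) *\<^sub>R Q) $ (r u \<omega>) $ j \<partial>M)" for j
  proof -
    have int: "integrable M (\<lambda>\<omega>. f $ r u \<omega> * indicator {j} (r v \<omega>))"
      by (rule integrable_const_bound[where B="\<Sum>i\<in>UNIV. \<bar>f $ i\<bar>"])
        (auto simp: indicator_def intro!: AE_I2 member_le_sum[of _ UNIV "\<lambda>i. \<bar>f $ i\<bar>"] sum_nonneg)
    have "(\<integral>\<omega>. f $ r u \<omega> * indicator {j} (r v \<omega>) \<partial>M)
        = (\<integral>\<omega>. f $ r u \<omega> * real_cond_exp M ?N (\<lambda>\<omega>. indicator {j} (r v \<omega>)) \<omega> \<partial>M)"
      by (rule real_cond_exp_intg(2)[symmetric, OF int fN]) measurable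
    also have "\<dots> = (\<integral>\<omega>. f $ r u \<omega> * mat_exp ((v - u) *\<^sub>R Q) $ (r u \<omega>) $ j \<partial>M)"
    proof (rule integral_cong_AE)
      have "AE \<omega> in M. real_cond_exp M ?N (\<lambda>\<omega>. indicator {j} (r v \<omega>)) \<omega> = mat_exp ((v - u) *\<^sub>R Q) $ (r u \<omega>) $ j"
        using chain uv by (simp add: ct_markov_chain_def)
      then show "AE \<omega> in M. f $ r u \<omega> * real_cond_exp M ?N (\<lambda>\<omega>. indicator {j} (r v \<omega>)) \<omega>
           = f $ r u \<omega> * mat_exp ((v - u) *\<^sub>R Q) $ (r u \<omega>) $ j" by eventually_elim simp
    qed measurable
    finally show ?thesis .
  qed
  have bdd: "integrable M (\<lambda>\<omega>. F (r u \<omega>) (r v \<omega>))" for F :: "'s \<Rightarrow> 's \<Rightarrow> real"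
  proof (rule integrable_const_bound[where B="\<Sum>i\<in>UNIV. \<Sum>j\<in>UNIV. \<bar>F i j\<bar>"])
    have "\<bar>F i j\<bar> \<le> (\<Sum>i\<in>UNIV. \<Sum>j\<in>UNIV. \<bar>F i j\<bar>)" for i j
      using member_le_sum[of j UNIV "\<lambda>j. \<bar>F i j\<bar>"] member_le_sum[of i UNIV "\<lambda>i. \<Sum>j\<in>UNIV. \<bar>F i j\<bar>"]
      by (auto intro: order_trans sum_nonneg)
    then show "AE \<omega> in M. norm (F (r u \<omega>) (r v \<omega>)) \<le> (\<Sum>i\<in>UNIV. \<Sum>j\<in>UNIV. \<bar>F i j\<bar>)" by simp
  qed measurable
  have pr: "(\<integral>\<omega>. indicator {i} (r u \<omega>) \<partial>M) = measure M {\<omega>\<in>space M. r u \<omega> = i}" for i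
  proof -
    have "(\<integral>\<omega>. indicat_real {i} (r u \<omega>) \<partial>M) = (\<integral>\<omega>. indicat_real {\<omega>\<in>space M. r u \<omega> = i} \<omega> \<partial>M)"
      by (intro Bochner_Integration.integral_cong) (auto simp: indicator_def)
    then show ?thesis by simp
  qed
  have delta: "(\<Sum>i\<in>UNIV. indicator {i} a * F i) = F a" for a :: 's and F :: "'s \<Rightarrow> real"
  proof -
    have "(\<Sum>i\<in>UNIV. indicator {i} a * F i) = (\<Sum>i\<in>UNIV. if i = a then F i else 0)"
      by (intro sum.cong) (auto simp: indicator_def)
    then show ?thesis by simp
  qed
  have "(\<integral>\<omega>. f $ r u \<omega> * h $ r v \<omega> \<partial>M) = (\<integral>\<omega>. (\<Sum>j\<in>UNIV. h $ j * (f $ r u \<omega> * indicator {j} (r v \<omega>))) \<partial>M)"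
  proof (intro Bochner_Integration.integral_cong refl)
    fix \<omega>
    show "f $ r u \<omega> * h $ r v \<omega> = (\<Sum>j\<in>UNIV. h $ j * (f $ r u \<omega> * indicator {j} (r v \<omega>)))"
      using delta[of "r v \<omega>" "\<lambda>j. h $ j * f $ r u \<omega>"] by (simp only: mult_ac)
  qed
  also have "\<dots> = (\<Sum>j\<in>UNIV. h $ j * (\<integral>\<omega>. f $ r u \<omega> * indicator {j} (r v \<omega>) \<partial>M))"
    using bdd[of "\<lambda>a b. h $ j * (f $ a * indicator {j} b)" for j]
    by (subst Bochner_Integration.integral_sum) auto
  also have "\<dots> = (\<Sum>j\<in>UNIV. h $ j * (\<integral>\<omega>. f $ r u \<omega> * mat_exp ((v - u) *\<^sub>R Q) $ (r u \<omega>) $ j \<partial>M))"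
    by (simp only: one)
  also have "\<dots> = (\<integral>\<omega>. (\<Sum>j\<in>UNIV. h $ j * (f $ r u \<omega> * mat_exp ((v - u) *\<^sub>R Q) $ (r u \<omega>) $ j)) \<partial>M)"
    using bdd[of "\<lambda>a b. h $ j * (f $ a * mat_exp ((v - u) *\<^sub>R Q) $ a $ j)" for j]
    by (subst Bochner_Integration.integral_sum) auto
  also have "\<dots> = (\<integral>\<omega>. (\<Sum>i\<in>UNIV. indicator {i} (r u \<omega>) * (f $ i * (mat_exp ((v - u) *\<^sub>R Q) *v h) $ i)) \<partial>M)"
    unfolding delta by (intro Bochner_Integration.integral_cong refl)
      (simp add: matrix_vector_mult_def sum_distrib_left mult_ac)
  also have "\<dots> = (\<Sum>i\<in>UNIV. (\<integral>\<omega>. indicator {i} (r u \<omega>) \<partial>M) * (f $ i * (mat_exp ((v - u) *\<^sub>R Q) *v h) $ i))"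
    using bdd[of "\<lambda>a b. indicator {i} a * (f $ i * (mat_exp ((v - u) *\<^sub>R Q) *v h) $ i)" for i]
    by (subst Bochner_Integration.integral_sum) auto
  also have "\<dots> = (\<Sum>i\<in>UNIV. measure M {\<omega>\<in>space M. r u \<omega> = i} * (f $ i * (mat_exp ((v - u) *\<^sub>R Q) *v h) $ i))"
    by (simp only: pr)
  finally show ?thesis by (simp only: mult.assoc)
qed

text \<open>Dynkin's formula tested against \<open>f $ r u \<omega>\<close>. The expectation is
  identified only for \<open>v\<close> in \<open>{u..b}\<close>; the function \<open>k\<close>
  extends it to a differentiable function on the whole line, to which the fundamental theorem of
  calculus applies.\<close>

lemma chain_derivative:
  fixes r :: "real \<Rightarrow> 'w \<Rightarrow> 's::finite" and f h :: "real^'s"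
  assumes M: "prob_space M" and chain: "ct_markov_chain M r Q" and u: "0 \<le> u" "u \<le> b"
  shows "set_integrable lborel {u..b} (\<lambda>v. \<integral>\<omega>. f $ r u \<omega> * (Q *v h) $ r v \<omega> \<partial>M)"
    "(LINT v:{u..b}|lborel. (\<integral>\<omega>. f $ r u \<omega> * (Q *v h) $ r v \<omega> \<partial>M))
      = (\<integral>\<omega>. f $ r u \<omega> * h $ r b \<omega> \<partial>M) - (\<integral>\<omega>. f $ r u \<omega> * h $ r u \<omega> \<partial>M)"
proof -
  define k where "k h v = (\<Sum>i\<in>UNIV. measure M {\<omega>\<in>space M. r u \<omega> = i} * f $ i * (mat_exp ((v - u) *\<^sub>R Q) *v h) $ i)" for h v
  have der: "(k h has_real_derivative k (Q *v h) v) (at v)" for h v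
    unfolding k_def
  proof (intro DERIV_sum DERIV_cmult)
    fix i
    show "((\<lambda>v. (mat_exp ((v - u) *\<^sub>R Q) *v h) $ i) has_real_derivative (mat_exp ((v - u) *\<^sub>R Q) *v (Q *v h)) $ i) (at v)"
    proof -
      have "((\<lambda>v. v - u) has_real_derivative 1) (at v)" by (auto intro!: derivative_eq_intros)
      from DERIV_chain2[where f="\<lambda>t. (mat_exp (t *\<^sub>R Q) *v h) $ i" and g="\<lambda>v. v - u", OF mat_exp_has_derivative this]
      show ?thesis by simp
    qed
  qed
  have cont: "continuous_on A (k h)" for h A
    by (rule DERIV_continuous_on) (rule has_field_derivative_at_within[OF der])
  have eq: "(\<integral>\<omega>. f $ r u \<omega> * h $ r v \<omega> \<partial>M) = k h v" if "v \<in> {u..b}" for h v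
    unfolding k_def using that u by (intro chain_cond[OF M chain]) auto
  have si: "set_integrable lborel {u..b} (k (Q *v h))" by (rule borel_integrable_atLeastAtMost'[OF cont])
  show "set_integrable lborel {u..b} (\<lambda>v. \<integral>\<omega>. f $ r u \<omega> * (Q *v h) $ r v \<omega> \<partial>M)"
    using si by (rule set_integrable_cong[THEN iffD1, rotated 3]) (auto simp: eq)
  have "(LINT v:{u..b}|lborel. (\<integral>\<omega>. f $ r u \<omega> * (Q *v h) $ r v \<omega> \<partial>M)) = (LINT v:{u..b}|lborel. k (Q *v h) v)"
    by (intro set_lebesgue_integral_cong) (auto simp: eq)
  also have "\<dots> = (\<integral>v. k (Q *v h) v * indicator {u..b} v \<partial>lborel)"
    by (simp add: set_lebesgue_integral_def mult.commute)
  also have "\<dots> = k h b - k h u"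
    by (rule integral_FTC_Icc_real[OF u(2) der]) (use cont continuous_on_eq_continuous_at[of UNIV] in auto)
  finally show "(LINT v:{u..b}|lborel. (\<integral>\<omega>. f $ r u \<omega> * (Q *v h) $ r v \<omega> \<partial>M))
      = (\<integral>\<omega>. f $ r u \<omega> * h $ r b \<omega> \<partial>M) - (\<integral>\<omega>. f $ r u \<omega> * h $ r u \<omega> \<partial>M)"
    using u by (simp add: eq)
qed

text \<open>For the full generator \<open>Q\<close> one has
  \<open>f = \<epsilon> *\<^sub>R (Q *v h - Qh *v h)\<close>. Dynkin's formula reduces the first
  term to two boundary values, at most \<open>2 * H\<close> together; the second is at most
  \<open>H'\<close> over a time at most \<open>T\<close>.\<close>

lemma chain_correlation:
  fixes r :: "real \<Rightarrow> 'w \<Rightarrow> 's::finite" and f h :: "real^'s"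
  assumes M: "prob_space M" and eps: "\<epsilon> > 0"
    and chain: "ct_markov_chain M r ((1 / \<epsilon>) *\<^sub>R Qt + Qh)" and u: "0 \<le> u" "u \<le> b" "b \<le> T"
    and f: "f = Qt *v h" and bd: "\<And>i. \<bar>f $ i\<bar> \<le> 1" "\<And>i. \<bar>h $ i\<bar> \<le> H" "\<And>i. \<bar>(Qh *v h) $ i\<bar> \<le> H'"
  shows "set_integrable lborel {u..b} (\<lambda>v. \<integral>\<omega>. f $ r u \<omega> * f $ r v \<omega> \<partial>M)"
    "\<bar>LINT v:{u..b}|lborel. (\<integral>\<omega>. f $ r u \<omega> * f $ r v \<omega> \<partial>M)\<bar> \<le> \<epsilon> * (2 * H + T * H')"
proof -
  interpret prob_space M by fact
  let ?Q = "(1 / \<epsilon>) *\<^sub>R Qt + Qh"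
  have rm: "\<And>t. t \<ge> 0 \<Longrightarrow> r t \<in> measurable M (count_space UNIV)" using chain by (simp add: ct_markov_chain_def)
  have H: "0 \<le> H" "0 \<le> H'" using bd(2,3)[of undefined] by linarith+
  have int: "integrable M (\<lambda>\<omega>. f $ r u \<omega> * g $ r v \<omega>)"
    and bnd: "\<bar>\<integral>\<omega>. f $ r u \<omega> * g $ r v \<omega> \<partial>M\<bar> \<le> B"
    if "0 \<le> v" "\<And>i. \<bar>g $ i\<bar> \<le> B" for g B v
  proof -
    have [measurable]: "r u \<in> measurable M (count_space UNIV)" "r v \<in> measurable M (count_space UNIV)"
      using u that by (auto intro: rm)
    have *: "\<bar>f $ i * g $ j\<bar> \<le> B" for i j
      using mult_mono[OF bd(1)[of i] that(2)[of j]] by (simp add: abs_mult)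
    show "integrable M (\<lambda>\<omega>. f $ r u \<omega> * g $ r v \<omega>)"
      by (rule integrable_const_bound[where B=B]) (use * in auto)
    then have "\<bar>\<integral>\<omega>. f $ r u \<omega> * g $ r v \<omega> \<partial>M\<bar> \<le> (\<integral>\<omega>. B \<partial>M)"
      using * by (intro order_trans[OF integral_abs_bound] integral_mono) auto
    then show "\<bar>\<integral>\<omega>. f $ r u \<omega> * g $ r v \<omega> \<partial>M\<bar> \<le> B" by (simp add: prob_space)
  qed
  have absb: "\<exists>B. \<forall>i. \<bar>g $ i\<bar> \<le> B" for g :: "real^'s"
    using component_le_norm_cart[of g] by blast
  have int': "integrable M (\<lambda>\<omega>. f $ r u \<omega> * g $ r v \<omega>)" if "0 \<le> v" for g v
    using absb[of g] int[OF that] by blast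
  define c1 c2 where "c1 v = (\<integral>\<omega>. f $ r u \<omega> * (?Q *v h) $ r v \<omega> \<partial>M)"
    and "c2 v = (\<integral>\<omega>. f $ r u \<omega> * (Qh *v h) $ r v \<omega> \<partial>M)" for v
  have Qf: "f $ i = \<epsilon> * (?Q *v h) $ i - \<epsilon> * (Qh *v h) $ i" for i
    using eps by (simp add: f matrix_vector_mult_def sum_distrib_left sum_subtractf[symmetric] algebra_simps)
  have split: "(\<integral>\<omega>. f $ r u \<omega> * f $ r v \<omega> \<partial>M) = \<epsilon> * c1 v - \<epsilon> * c2 v" if "v \<in> {u..b}" for v
  proof -
    have v: "0 \<le> v" using that u by simp
    have "(\<integral>\<omega>. f $ r u \<omega> * f $ r v \<omega> \<partial>M) = (\<integral>\<omega>. \<epsilon> * (f $ r u \<omega> * (?Q *v h) $ r v \<omega>) - \<epsilon> * (f $ r u \<omega> * (Qh *v h) $ r v \<omega>) \<partial>M)"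
      by (subst (2) Qf) (simp add: algebra_simps)
    also have "\<dots> = \<epsilon> * c1 v - \<epsilon> * c2 v"
      unfolding c1_def c2_def using int'[OF v]
      by (subst Bochner_Integration.integral_diff) auto
    finally show ?thesis .
  qed
  note d = chain_derivative[OF M chain u(1,2), of f h, folded c1_def]
  have c2: "set_integrable lborel {u..b} c2"
  proof -
    define k where "k v = (\<Sum>i\<in>UNIV. measure M {\<omega>\<in>space M. r u \<omega> = i} * f $ i * (mat_exp ((v - u) *\<^sub>R ?Q) *v (Qh *v h)) $ i)" for v
    have "continuous_on {u..b} k"
      unfolding k_def
    proof (intro continuous_on_sum continuous_on_mult continuous_on_const)
      fix i
      have "continuous_on UNIV (\<lambda>t. (mat_exp (t *\<^sub>R ?Q) *v (Qh *v h)) $ i)"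
        by (rule DERIV_continuous_on) (rule mat_exp_has_derivative)
      moreover have "continuous_on {u..b} (\<lambda>v. v - u)" by (intro continuous_intros)
      ultimately show "continuous_on {u..b} (\<lambda>v. (mat_exp ((v - u) *\<^sub>R ?Q) *v (Qh *v h)) $ i)"
        by (rule continuous_on_compose2) auto
    qed
    then have si: "set_integrable lborel {u..b} k" by (rule borel_integrable_atLeastAtMost')
    have ck: "c2 v = k v" if "v \<in> {u..b}" for v
      unfolding k_def c2_def using that u by (intro chain_cond[OF M chain]) auto
    show ?thesis using si by (rule set_integrable_cong[THEN iffD1, rotated 3]) (auto simp: ck)
  qed
  have i12: "set_integrable lborel {u..b} (\<lambda>v. \<epsilon> * c1 v - \<epsilon> * c2 v)"
    using d(1) c2 by (intro set_integral_diff set_integrable_mult_right)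
  show "set_integrable lborel {u..b} (\<lambda>v. \<integral>\<omega>. f $ r u \<omega> * f $ r v \<omega> \<partial>M)"
    using i12 by (rule set_integrable_cong[THEN iffD1, rotated 3]) (auto simp: split)
  have "(LINT v:{u..b}|lborel. (\<integral>\<omega>. f $ r u \<omega> * f $ r v \<omega> \<partial>M)) = (LINT v:{u..b}|lborel. \<epsilon> * c1 v - \<epsilon> * c2 v)"
    by (intro set_lebesgue_integral_cong) (auto simp: split)
  also have "\<dots> = \<epsilon> * (LINT v:{u..b}|lborel. c1 v) - \<epsilon> * (LINT v:{u..b}|lborel. c2 v)"
    using d(1) c2 by (subst set_integral_diff) (auto simp: set_integral_mult_right)
  finally have "\<bar>LINT v:{u..b}|lborel. (\<integral>\<omega>. f $ r u \<omega> * f $ r v \<omega> \<partial>M)\<bar>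
     = \<epsilon> * \<bar>(LINT v:{u..b}|lborel. c1 v) - (LINT v:{u..b}|lborel. c2 v)\<bar>"
    using eps by (simp add: abs_mult flip: right_diff_distrib)
  also have "\<dots> \<le> \<epsilon> * (2 * H + T * H')"
  proof (intro mult_left_mono)
    have "\<bar>LINT v:{u..b}|lborel. c1 v\<bar> \<le> 2 * H"
      unfolding d(2) using bnd[OF _ bd(2), of b] bnd[OF _ bd(2), of u] u by linarith
    moreover have "\<bar>LINT v:{u..b}|lborel. c2 v\<bar> \<le> T * H'"
    proof -
      have "\<bar>LINT v:{u..b}|lborel. c2 v\<bar> \<le> (LINT v:{u..b}|lborel. H')"
        unfolding set_lebesgue_integral_def
      proof (rule order_trans[OF integral_abs_bound integral_mono])
        show "integrable lborel (\<lambda>v. \<bar>indicat_real {u..b} v *\<^sub>R c2 v\<bar>)"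
          using c2 unfolding set_integrable_def by (rule integrable_abs)
        show "integrable lborel (\<lambda>v. indicat_real {u..b} v *\<^sub>R H')" using u by simp
        show "\<bar>indicat_real {u..b} v *\<^sub>R c2 v\<bar> \<le> indicat_real {u..b} v *\<^sub>R H'" for v
          using bnd[of v "Qh *v h" H'] bd(3) u by (auto simp: indicator_def c2_def)
      qed
      also have "\<dots> = (b - u) * H'" using u by (simp add: set_lebesgue_integral_def)
      also have "\<dots> \<le> T * H'" using u H by (intro mult_right_mono) auto
      finally show ?thesis .
    qed
    ultimately show "\<bar>(LINT v:{u..b}|lborel. c1 v) - (LINT v:{u..b}|lborel. c2 v)\<bar> \<le> 2 * H + T * H'" by linarith
  qed (use eps in simp)
  finally show "\<bar>LINT v:{u..b}|lborel. (\<integral>\<omega>. f $ r u \<omega> * f $ r v \<omega> \<partial>M)\<bar> \<le> \<epsilon> * (2 * H + T * H')" .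
qed

text \<open>Paths are right-continuous only almost surely, so \<open>r\<close> itself need not be
  jointly measurable. Outside a null set \<open>r'\<close> is the pointwise limit of its values on
  finer and finer grids; on the null set it is made constant.\<close>

lemma chain_regular_version:
  fixes r :: "real \<Rightarrow> 'w \<Rightarrow> 's::finite"
  assumes M: "prob_space M" and chain: "ct_markov_chain M r Q"
  shows "\<exists>r'. (\<lambda>(t, \<omega>). r' t \<omega>) \<in> measurable (borel \<Otimes>\<^sub>M M) (count_space UNIV) \<and> (AE \<omega> in M. \<forall>t\<ge>0. r' t \<omega> = r t \<omega>)"
proof -
  interpret prob_space M by fact
  have rm[measurable]: "\<And>t. t \<ge> 0 \<Longrightarrow> r t \<in> measurable M (count_space UNIV)" using chain by (simp add: ct_markov_chain_def)
  have "AE \<omega> in M. \<forall>t\<ge>0. eventually (\<lambda>s. r s \<omega> = r t \<omega>) (at_right t)"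
    using chain by (simp add: ct_markov_chain_def)
  then obtain N where N: "N \<in> null_sets M" "{\<omega>\<in>space M. \<not> (\<forall>t\<ge>0. eventually (\<lambda>s. r s \<omega> = r t \<omega>) (at_right t))} \<subseteq> N"
    by (auto simp: eventually_ae_filter)
  define r' where "r' t \<omega> = (if \<omega> \<in> N then undefined else r (max t 0) \<omega>)" for t \<omega>
  have [measurable]: "N \<in> sets M" using N by auto
  have r'm[measurable]: "r' t \<in> measurable M (count_space UNIV)" for t
    unfolding r'_def using rm[of "max t 0"] by measurable
  \<comment> \<open>The first point of the grid of mesh \<open>1 / (n + 1)\<close> strictly after
    \<open>t\<close>, so that right continuity applies also when \<open>t\<close> is a grid
    point.\<close>
  define \<tau> where "\<tau> n t = (of_int \<lfloor>real (Suc n) * t\<rfloor> + 1) / real (Suc n)" for n and t :: real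
  have \<tau>: "t < \<tau> n t" "\<tau> n t \<le> t + 1 / real (Suc n)" for n t
  proof -
    have "real (Suc n) * t < of_int \<lfloor>real (Suc n) * t\<rfloor> + 1" by linarith
    then show "t < \<tau> n t" unfolding \<tau>_def by (simp add: pos_less_divide_eq mult.commute)
    have "of_int \<lfloor>real (Suc n) * t\<rfloor> + 1 \<le> (t + 1 / real (Suc n)) * real (Suc n)"
      by (simp add: algebra_simps del: of_nat_Suc)
    then show "\<tau> n t \<le> t + 1 / real (Suc n)" unfolding \<tau>_def by (subst pos_divide_le_eq) auto
  qed
  have lim: "(\<lambda>n. indicator {i} (r' (\<tau> n t) \<omega>) :: real) \<longlonglongrightarrow> indicator {i} (r' t \<omega>)" if \<omega>: "\<omega> \<in> space M" for i t \<omega>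
  proof (rule tendsto_eventually)
    show "\<forall>\<^sub>F n in sequentially. indicator {i} (r' (\<tau> n t) \<omega>) = (indicator {i} (r' t \<omega>) :: real)"
    proof (cases "\<omega> \<in> N")
      case False
      have up: "(\<lambda>n. t + 1 / real (Suc n)) \<longlonglongrightarrow> t"
        using tendsto_add[OF tendsto_const[of t] LIMSEQ_Suc[OF lim_1_over_n]] by simp
      have tt: "(\<lambda>n. \<tau> n t) \<longlonglongrightarrow> t"
      proof (rule real_tendsto_sandwich[OF _ _ tendsto_const up])
        show "\<forall>\<^sub>F n in sequentially. t \<le> \<tau> n t" using less_imp_le[OF \<tau>(1)] by (rule always_eventually[OF allI])
        show "\<forall>\<^sub>F n in sequentially. \<tau> n t \<le> t + 1 / real (Suc n)" using \<tau>(2) by (rule always_eventually[OF allI])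
      qed
      show ?thesis
      proof (cases "t < 0")
        case True
        then have "\<forall>\<^sub>F n in sequentially. \<tau> n t < 0" using order_tendstoD(2)[OF tt] by auto
        then show ?thesis by eventually_elim (use True in \<open>simp add: r'_def max_def\<close>)
      next
        case t: False
        have "\<tau> n t \<noteq> t" for n using \<tau>(1)[of t n] by simp
        then have "filterlim (\<lambda>n. \<tau> n t) (at_right t) sequentially" using tt \<tau>(1) by (simp add: filterlim_at)
        moreover have "\<forall>t\<ge>0. eventually (\<lambda>s. r s \<omega> = r t \<omega>) (at_right t)" using N(2) \<omega> False by blast
        then have "eventually (\<lambda>s. r s \<omega> = r t \<omega>) (at_right t)" using t by simp
        ultimately have "\<forall>\<^sub>F n in sequentially. r (\<tau> n t) \<omega> = r t \<omega>"
          by (rule eventually_compose_filterlim[rotated])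
        then show ?thesis
        proof eventually_elim
          case (elim n)
          have "0 \<le> \<tau> n t" using \<tau>(1)[of t n] t by linarith
          then show ?case using elim t by (simp add: r'_def max_def)
        qed
      qed
    qed (simp add: r'_def)
  qed
  have ind: "(\<lambda>x. indicator {i} (r' (fst x) (snd x)) :: real) \<in> borel_measurable (borel \<Otimes>\<^sub>M M)" for i
  proof (rule borel_measurable_LIMSEQ_real)
    show "(\<lambda>n. indicator {i} (r' (\<tau> n (fst x)) (snd x)) :: real) \<longlonglongrightarrow> indicator {i} (r' (fst x) (snd x))"
      if "x \<in> space (borel \<Otimes>\<^sub>M M)" for x
      using that by (intro lim) (auto simp: space_pair_measure indicator_def split: if_splits)
    fix n
    show "(\<lambda>x. indicator {i} (r' (\<tau> n (fst x)) (snd x)) :: real) \<in> borel_measurable (borel \<Otimes>\<^sub>M M)"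
      unfolding \<tau>_def
    proof (rule measurable_compose_countable[where f="\<lambda>z x. indicator {i} (r' ((of_int z + 1) / real (Suc n)) (snd x))" and g="\<lambda>x. \<lfloor>real (Suc n) * fst x\<rfloor>"])
      show "(\<lambda>x. indicator {i} (r' ((of_int z + 1) / real (Suc n)) (snd x)) :: real) \<in> borel_measurable (borel \<Otimes>\<^sub>M M)" for z :: int
        by measurable
      show "(\<lambda>x. \<lfloor>real (Suc n) * fst x\<rfloor>) \<in> measurable (borel \<Otimes>\<^sub>M M) (count_space UNIV)" by measurable
    qed
  qed
  have "(\<lambda>x. r' (fst x) (snd x)) \<in> measurable (borel \<Otimes>\<^sub>M M) (count_space UNIV)"
  proof (subst measurable_count_space_eq2)
    have eq: "(\<lambda>x. r' (fst x) (snd x)) -` {i} \<inter> space (borel \<Otimes>\<^sub>M M)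
       = (\<lambda>x. indicator {i} (r' (fst x) (snd x)) :: real) -` {1} \<inter> space (borel \<Otimes>\<^sub>M M)" for i
      by (auto simp: indicator_def split: if_splits)
    have "(\<lambda>x. r' (fst x) (snd x)) -` {i} \<inter> space (borel \<Otimes>\<^sub>M M) \<in> sets (borel \<Otimes>\<^sub>M M)" for i
      unfolding eq by (rule measurable_sets[OF ind]) simp
    then show "(\<lambda>x. r' (fst x) (snd x)) \<in> space (borel \<Otimes>\<^sub>M M) \<rightarrow> UNIV \<and>
      (\<forall>i\<in>UNIV. (\<lambda>x. r' (fst x) (snd x)) -` {i} \<inter> space (borel \<Otimes>\<^sub>M M) \<in> sets (borel \<Otimes>\<^sub>M M))" by auto
  qed simp
  moreover have "AE \<omega> in M. \<forall>t\<ge>0. r' t \<omega> = r t \<omega>"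
    using AE_not_in[OF N(1)] by eventually_elim (simp add: r'_def max_def)
  ultimately show ?thesis by (auto simp: case_prod_unfold)
qed

text \<open>The ordered double integral of \<open>integral_square_triangle\<close> and Fubini leave,
  for each \<open>u\<close>, a correlation integral of order \<open>\<epsilon>\<close>. The outer
  integral contributes the length once, so the bound is linear in \<open>b - a\<close> and gains
  \<open>\<epsilon>\<close> over the trivial quadratic one.\<close>

lemma chain_second_moment:
  fixes r r' :: "real \<Rightarrow> 'w \<Rightarrow> 's::finite" and f h :: "real^'s"
  assumes M: "prob_space M" and eps: "\<epsilon> > 0"
    and chain: "ct_markov_chain M r ((1 / \<epsilon>) *\<^sub>R Qt + Qh)" and ab: "0 \<le> a" "a \<le> b" "b \<le> T"
    and f: "f = Qt *v h" and bd: "\<And>i. \<bar>f $ i\<bar> \<le> 1" "\<And>i. \<bar>h $ i\<bar> \<le> H" "\<And>i. \<bar>(Qh *v h) $ i\<bar> \<le> H'"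
    and r'm: "(\<lambda>(t, \<omega>). r' t \<omega>) \<in> measurable (borel \<Otimes>\<^sub>M M) (count_space UNIV)"
    and r': "AE \<omega> in M. \<forall>t\<ge>0. r' t \<omega> = r t \<omega>"
  shows "(\<integral>\<omega>. (\<integral>u. indicator {a..b} u * f $ r' u \<omega> \<partial>lborel)\<^sup>2 \<partial>M) \<le> 2 * (b - a) * (\<epsilon> * (2 * H + T * H'))"
proof -
  interpret prob_space M by fact
  interpret pair_sigma_finite lborel M ..
  have zm[measurable]: "(\<lambda>x. f $ r' (fst x) (snd x)) \<in> borel_measurable (borel \<Otimes>\<^sub>M M)"
    using measurable_compose[OF r'm, of "\<lambda>i. f $ i" borel] by (simp add: case_prod_unfold)
  have z2: "(\<lambda>x. f $ r' (p x) (q x)) \<in> borel_measurable K"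
    if "p \<in> borel_measurable K" "q \<in> measurable K M" for K :: "'z measure" and p q
    using measurable_compose[OF measurable_Pair[OF that] zm] by simp
  have z1[measurable]: "(\<lambda>u. f $ r' u \<omega>) \<in> borel_measurable borel" if "\<omega> \<in> space M" for \<omega>
    using that by (intro z2) auto
  have zu[measurable]: "(\<lambda>\<omega>. f $ r' u \<omega>) \<in> borel_measurable M" for u
    by (intro z2) auto
  define C where "C = \<epsilon> * (2 * H + T * H')"
  define J where "J u \<omega> = (\<integral>v. indicator {u..b} v * f $ r' v \<omega> \<partial>lborel)" for u \<omega>
  have indm: "indicator {u..b} v = (if u \<le> v \<and> v \<le> b then 1 else 0 :: real)" for u v by (simp add: indicator_def)
  have Jm[measurable]: "(\<lambda>x. J (fst x) (snd x)) \<in> borel_measurable (lborel \<Otimes>\<^sub>M M)"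
  proof -
    have "(\<lambda>p. indicator {fst (fst p)..b} (snd p) * f $ r' (snd p) (snd (fst p)) :: real) \<in> borel_measurable ((lborel \<Otimes>\<^sub>M M) \<Otimes>\<^sub>M lborel)"
      unfolding indm by (intro borel_measurable_times z2) measurable
    then show ?thesis unfolding J_def
      by (intro lborel.borel_measurable_lebesgue_integral) (simp add: case_prod_unfold)
  qed
  have J_bd: "\<bar>J u \<omega>\<bar> \<le> b - a" if "u \<in> {a..b}" "\<omega> \<in> space M" for u \<omega>
  proof -
    have i: "integrable lborel (\<lambda>v. indicat_real {u..b} v * f $ r' v \<omega>)"
      using that by (intro integrableI_bounded_set[where A="{u..b}" and B=1]) (auto simp: bd)
    have "\<bar>J u \<omega>\<bar> \<le> (\<integral>v. indicat_real {u..b} v \<partial>lborel)"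
      unfolding J_def
    proof (rule order_trans[OF integral_abs_bound integral_mono])
      show "integrable lborel (\<lambda>v. \<bar>indicat_real {u..b} v * f $ r' v \<omega>\<bar>)" using i by (rule integrable_abs)
      show "integrable lborel (indicat_real {u..b})" using that by (intro integrable_real_indicator) auto
      show "\<bar>indicat_real {u..b} v * f $ r' v \<omega>\<bar> \<le> indicat_real {u..b} v" for v
        using bd(1)[of "r' v \<omega>"] by (simp add: abs_mult split: split_indicator)
    qed
    then show ?thesis using that by simp
  qed
  have int1: "integrable (lborel \<Otimes>\<^sub>M M) (\<lambda>(u, \<omega>). indicator {a..b} u * f $ r' u \<omega> * J u \<omega>)"
  proof (rule integrableI_bounded_set[where A="{a..b} \<times> space M" and B="b - a"])
    show "emeasure (lborel \<Otimes>\<^sub>M M) ({a..b} \<times> space M) < \<infinity>"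
      using ab by (subst sigma_finite_measure.emeasure_pair_measure_Times[OF prob_space_imp_sigma_finite[OF M]]) (auto simp: emeasure_space_1)
    have "\<bar>f $ r' u \<omega> * J u \<omega>\<bar> \<le> b - a" if "u \<in> {a..b}" "\<omega> \<in> space M" for u \<omega>
      using mult_mono[OF bd(1)[of "r' u \<omega>"] J_bd[OF that]] by (simp add: abs_mult)
    then show "AE x\<in>{a..b} \<times> space M in lborel \<Otimes>\<^sub>M M. norm (case x of (u, \<omega>) \<Rightarrow> indicator {a..b} u * f $ r' u \<omega> * J u \<omega>) \<le> b - a"
      by (intro AE_I2) auto
    show "AE x in lborel \<Otimes>\<^sub>M M. x \<notin> {a..b} \<times> space M \<longrightarrow> (case x of (u, \<omega>) \<Rightarrow> indicator {a..b} u * f $ r' u \<omega> * J u \<omega>) = 0"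
      by (intro AE_I2) (auto simp: space_pair_measure indicator_def split: if_splits)
    show "(\<lambda>(u, \<omega>). indicator {a..b} u * f $ r' u \<omega> * J u \<omega>) \<in> borel_measurable (lborel \<Otimes>\<^sub>M M)"
      unfolding case_prod_unfold by (intro borel_measurable_times z2 Jm) measurable
  qed (use ab in auto)
  have inner: "(\<integral>\<omega>. f $ r' u \<omega> * J u \<omega> \<partial>M) \<le> C" if u: "u \<in> {a..b}" for u
  proof -
    have i: "integrable (lborel \<Otimes>\<^sub>M M) (\<lambda>(v, \<omega>). indicator {u..b} v * (f $ r' u \<omega> * f $ r' v \<omega>))"
    proof (rule integrableI_bounded_set[where A="{u..b} \<times> space M" and B=1])
      show "emeasure (lborel \<Otimes>\<^sub>M M) ({u..b} \<times> space M) < \<infinity>"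
        using u by (subst sigma_finite_measure.emeasure_pair_measure_Times[OF prob_space_imp_sigma_finite[OF M]]) (auto simp: emeasure_space_1)
      have "\<bar>f $ i * f $ j\<bar> \<le> 1" for i j using mult_mono[OF bd(1)[of i] bd(1)[of j]] by (simp add: abs_mult)
      then show "AE x\<in>{u..b} \<times> space M in lborel \<Otimes>\<^sub>M M. norm (case x of (v, \<omega>) \<Rightarrow> indicator {u..b} v * (f $ r' u \<omega> * f $ r' v \<omega>)) \<le> 1"
        by (intro AE_I2) auto
      show "AE x in lborel \<Otimes>\<^sub>M M. x \<notin> {u..b} \<times> space M \<longrightarrow> (case x of (v, \<omega>) \<Rightarrow> indicator {u..b} v * (f $ r' u \<omega> * f $ r' v \<omega>)) = 0"
        by (intro AE_I2) (auto simp: space_pair_measure indicator_def split: if_splits)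
      show "(\<lambda>(v, \<omega>). indicator {u..b} v * (f $ r' u \<omega> * f $ r' v \<omega>)) \<in> borel_measurable (lborel \<Otimes>\<^sub>M M)"
        unfolding case_prod_unfold by (intro borel_measurable_times z2) measurable
    qed auto
    have "(\<integral>\<omega>. f $ r' u \<omega> * J u \<omega> \<partial>M) = (\<integral>\<omega>. (\<integral>v. indicator {u..b} v * (f $ r' u \<omega> * f $ r' v \<omega>) \<partial>lborel) \<partial>M)"
      unfolding J_def by (simp add: mult.left_commute flip: integral_mult_right_zero)
    also have "\<dots> = (\<integral>v. (\<integral>\<omega>. indicator {u..b} v * (f $ r' u \<omega> * f $ r' v \<omega>) \<partial>M) \<partial>lborel)"
      using Fubini_integral[OF i] by simp
    also have "\<dots> = (LINT v:{u..b}|lborel. (\<integral>\<omega>. f $ r u \<omega> * f $ r v \<omega> \<partial>M))"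
      unfolding set_lebesgue_integral_def
    proof (intro Bochner_Integration.integral_cong refl)
      fix v
      have "(\<integral>\<omega>. f $ r' u \<omega> * f $ r' v \<omega> \<partial>M) = (\<integral>\<omega>. f $ r u \<omega> * f $ r v \<omega> \<partial>M)" if "v \<in> {u..b}"
      proof (rule integral_cong_AE)
        have "r u \<in> measurable M (count_space UNIV)" "r v \<in> measurable M (count_space UNIV)"
          using chain u that ab by (auto simp: ct_markov_chain_def)
        then show "(\<lambda>\<omega>. f $ r u \<omega> * f $ r v \<omega>) \<in> borel_measurable M" by measurable
        show "AE \<omega> in M. f $ r' u \<omega> * f $ r' v \<omega> = f $ r u \<omega> * f $ r v \<omega>"
          using r' by eventually_elim (use u that ab in auto)
      qed measurable
      then show "(\<integral>\<omega>. indicator {u..b} v * (f $ r' u \<omega> * f $ r' v \<omega>) \<partial>M) = indicat_real {u..b} v *\<^sub>R (\<integral>\<omega>. f $ r u \<omega> * f $ r v \<omega> \<partial>M)"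
        by (cases "v \<in> {u..b}") auto
    qed
    also have "\<dots> \<le> C"
      using chain_correlation(2)[OF M eps chain _ _ ab(3) f bd, of u] u ab unfolding C_def by auto
    finally show ?thesis .
  qed
  have "(\<integral>\<omega>. (\<integral>u. indicator {a..b} u * f $ r' u \<omega> \<partial>lborel)\<^sup>2 \<partial>M)
     = (\<integral>\<omega>. 2 * (\<integral>u. indicator {a..b} u * f $ r' u \<omega> * J u \<omega> \<partial>lborel) \<partial>M)"
    unfolding J_def using bd(1) ab z1
    by (intro Bochner_Integration.integral_cong refl integral_square_triangle[where B=1]) auto
  also have "\<dots> = 2 * (\<integral>u. (\<integral>\<omega>. indicator {a..b} u * f $ r' u \<omega> * J u \<omega> \<partial>M) \<partial>lborel)"
    using Fubini_integral[OF int1] by simp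
  also have "(\<integral>u. (\<integral>\<omega>. indicator {a..b} u * f $ r' u \<omega> * J u \<omega> \<partial>M) \<partial>lborel) \<le> (\<integral>u. indicator {a..b} u * C \<partial>lborel)"
  proof (rule integral_mono)
    show "integrable lborel (\<lambda>u. \<integral>\<omega>. indicator {a..b} u * f $ r' u \<omega> * J u \<omega> \<partial>M)"
      using integrable_fst'[OF int1] by simp
    show "integrable lborel (\<lambda>u. indicat_real {a..b} u * C)" using ab by simp
    show "(\<integral>\<omega>. indicator {a..b} u * f $ r' u \<omega> * J u \<omega> \<partial>M) \<le> indicator {a..b} u * C" for u
      using inner[of u] by (cases "u \<in> {a..b}") auto
  qed
  also have "(\<integral>u. indicator {a..b} u * C \<partial>lborel) = (b - a) * C" using ab by simp
  finally show ?thesis by (simp only: C_def mult.assoc)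
qed

section \<open>Integral inequalities and measurability for random processes\<close>

lemma norm_integral_le_nn:
  fixes f :: "'a \<Rightarrow> 'b::{banach, second_countable_topology}"
  shows "ennreal (norm (integral\<^sup>L N f)) \<le> (\<integral>\<^sup>+ x. ennreal (norm (f x)) \<partial>N)"
  \<comment> \<open>A function that is not integrable has Bochner integral \<open>0\<close>, so the
    bound holds for every \<open>f\<close> and estimates can precede integrability.\<close>
  by (cases "integrable N f") (auto simp: integral_norm_bound_ennreal not_integrable_integral_eq)

lemma nn_integral_singular_kernel:
  fixes s \<theta> :: real
  assumes s: "0 < s" and th: "\<theta> < 1"
  shows "(\<integral>\<^sup>+ u\<in>{0..s}. ennreal ((s - u) powr (- \<theta>)) \<partial>lborel) = ennreal (s powr (1 - \<theta>) / (1 - \<theta>))"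
proof -
  define F where "F u = - ((s - u) powr (1 - \<theta>) / (1 - \<theta>))" for u
  have "((\<lambda>u. (s - u) powr (- \<theta>)) has_integral (F s - F 0)) {0..s}"
  proof (rule fundamental_theorem_of_calculus_interior)
    show "continuous_on {0..s} F" unfolding F_def using th
      by (intro continuous_intros continuous_on_powr') auto
    fix x assume x: "x \<in> {0<..<s}"
    have "((\<lambda>z. z powr (1 - \<theta>)) has_real_derivative (1 - \<theta>) * (s - x) powr (1 - \<theta> - 1)) (at (s - x))"
      using x by (intro has_real_derivative_powr) auto
    moreover have "((\<lambda>u. s - u) has_real_derivative - 1) (at x)" by (auto intro!: derivative_eq_intros)
    ultimately have "((\<lambda>u. (s - u) powr (1 - \<theta>)) has_real_derivative (1 - \<theta>) * (s - x) powr (1 - \<theta> - 1) * - 1) (at x)"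
      by (rule DERIV_chain2)
    from DERIV_minus[OF DERIV_cdivide[OF this, of "1 - \<theta>"]]
    have "(F has_real_derivative (s - x) powr (- \<theta>)) (at x)"
      unfolding F_def using th by simp
    then show "(F has_vector_derivative (s - x) powr (- \<theta>)) (at x)"
      by (simp add: has_real_derivative_iff_has_vector_derivative)
  qed (use s in simp)
  then have "(\<integral>\<^sup>+ u. ennreal ((s - u) powr (- \<theta>)) * indicator {0..s} u \<partial>lborel) = ennreal (F s - F 0)"
    by (rule nn_integral_has_integral_lebesgue'[rotated]) simp
  then show ?thesis using s th by (simp add: F_def)
qed

text \<open>\<open>Lp_bd_integral\<close> for the measure of density \<open>w\<close>. The moment
  bound is asked for only where \<open>w\<close> is positive, which confines \<open>s\<close> to the
  relevant time interval.\<close>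

lemma Lp_bd_weighted:
  fixes w :: "real \<Rightarrow> real" and f :: "real \<Rightarrow> 'w \<Rightarrow> real"
    and G :: "'w \<Rightarrow> 'h::{real_normed_vector, second_countable_topology}"
  assumes p: "p > 1" and M: "sigma_finite_measure M"
    and w[measurable]: "w \<in> borel_measurable borel" and W: "(\<integral>\<^sup>+ s. ennreal (w s) \<partial>lborel) \<le> ennreal W" "W > 0"
    and f[measurable]: "case_prod f \<in> borel_measurable (borel \<Otimes>\<^sub>M M)" and c: "c \<ge> 0"
    and fc: "\<And>s. w s > 0 \<Longrightarrow> Lp_bd M p (f s) c"
    and G: "AE \<omega> in M. ennreal (norm (G \<omega>)) \<le> (\<integral>\<^sup>+ s. ennreal (w s) * ennreal \<bar>f s \<omega>\<bar> \<partial>lborel)"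
    and Gm: "G \<in> borel_measurable M"
  shows "Lp_bd M p G (W * c)"
proof (rule Lp_bd_integral[where N="density lborel (\<lambda>s. ennreal (w s))" and f=f])
  let ?N = "density lborel (\<lambda>s. ennreal (w s))"
  have e: "emeasure ?N (space ?N) = (\<integral>\<^sup>+ s. ennreal (w s) \<partial>lborel)"
    by (subst emeasure_density) auto
  show "emeasure ?N (space ?N) \<le> ennreal W" using e W by simp
  have "emeasure ?N (space ?N) \<noteq> \<infinity>" using e W by (auto simp: top_unique)
  then have "finite_measure ?N" by (rule finite_measureI)
  then show "sigma_finite_measure ?N" by (simp add: finite_measure_def)
  have "sets (?N \<Otimes>\<^sub>M M) = sets (borel \<Otimes>\<^sub>M M)" by (rule sets_pair_measure_cong) auto
  then show "case_prod f \<in> borel_measurable (?N \<Otimes>\<^sub>M M)" using f by (simp cong: measurable_cong_sets)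
  show "AE s in ?N. Lp_bd M p (f s) c"
    using fc by (subst AE_density) auto
  show "AE \<omega> in M. ennreal (norm (G \<omega>)) \<le> (\<integral>\<^sup>+ s. ennreal \<bar>f s \<omega>\<bar> \<partial>?N)"
    using G AE_space
  proof eventually_elim
    case (elim \<omega>)
    have [measurable]: "(\<lambda>s. f s \<omega>) \<in> borel_measurable borel" using f elim(2) by measurable
    show ?case using elim(1) by (subst nn_integral_density) auto
  qed
qed (use assms in auto)

text \<open>\<open>\<bar>z\<bar> \<le> 1 + \<bar>z\<bar> powr q\<close> bounds the first moments
  uniformly in time, so by Fubini the time integral is finite along almost every path.\<close>

lemma Lp_bd_AE_finite:
  fixes f :: "real \<Rightarrow> 'w \<Rightarrow> real"
  assumes M: "prob_space M" and f[measurable]: "case_prod f \<in> borel_measurable (borel \<Otimes>\<^sub>M M)"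
    and q: "q \<ge> 1" and fc: "\<And>t. t \<in> {0..T} \<Longrightarrow> Lp_bd M q (f t) c"
  shows "AE \<omega> in M. (\<integral>\<^sup>+ s\<in>{0..T}. ennreal \<bar>f s \<omega>\<bar> \<partial>lborel) < \<infinity>"
proof -
  interpret prob_space M by fact
  interpret pair_sigma_finite lborel M ..
  have fm[measurable]: "(\<lambda>x. ennreal \<bar>f (fst x) (snd x)\<bar> * indicator {0..T} (fst x)) \<in> borel_measurable (borel \<Otimes>\<^sub>M M)"
    using f by (simp add: case_prod_unfold)
  have fm': "(\<lambda>(s, \<omega>). ennreal \<bar>f s \<omega>\<bar> * indicator {0..T} s) \<in> borel_measurable (lborel \<Otimes>\<^sub>M M)"
    using fm by (simp add: case_prod_unfold cong: measurable_cong_sets[OF sets_pair_measure_cong[OF sets_lborel refl]])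
  have ft[measurable]: "f t \<in> borel_measurable M" for t using f by measurable
  have one: "(\<integral>\<^sup>+ \<omega>. ennreal \<bar>f t \<omega>\<bar> \<partial>M) \<le> ennreal (1 + c powr q)" if "t \<in> {0..T}" for t
  proof -
    have "(\<integral>\<^sup>+ \<omega>. ennreal \<bar>f t \<omega>\<bar> \<partial>M) \<le> (\<integral>\<^sup>+ \<omega>. 1 + ennreal (norm (f t \<omega>) powr q) \<partial>M)"
    proof (intro nn_integral_mono)
      fix \<omega>
      have "\<bar>f t \<omega>\<bar> \<le> 1 + \<bar>f t \<omega>\<bar> powr q"
      proof (cases "\<bar>f t \<omega>\<bar> \<le> 1")
        case False
        then have "\<bar>f t \<omega>\<bar> powr 1 \<le> \<bar>f t \<omega>\<bar> powr q" using q by (intro powr_mono) auto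
        then show ?thesis using False by simp
      qed (simp add: add_increasing2)
      then show "ennreal \<bar>f t \<omega>\<bar> \<le> 1 + ennreal (norm (f t \<omega>) powr q)"
        by (simp add: ennreal_leI flip: ennreal_1 ennreal_plus)
    qed
    also have "\<dots> = 1 + (\<integral>\<^sup>+ \<omega>. ennreal (norm (f t \<omega>) powr q) \<partial>M)"
      by (subst nn_integral_add) (auto simp: emeasure_space_1)
    also have "\<dots> \<le> 1 + ennreal (c powr q)" using fc[OF that] by (simp add: Lp_bd_def)
    finally show ?thesis by (simp flip: ennreal_1 ennreal_plus)
  qed
  have "(\<integral>\<^sup>+ \<omega>. (\<integral>\<^sup>+ s\<in>{0..T}. ennreal \<bar>f s \<omega>\<bar> \<partial>lborel) \<partial>M)
     = (\<integral>\<^sup>+ s. (\<integral>\<^sup>+ \<omega>. ennreal \<bar>f s \<omega>\<bar> * indicator {0..T} s \<partial>M) \<partial>lborel)"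
    using Fubini'[OF fm'] by simp
  also have "\<dots> \<le> (\<integral>\<^sup>+ s. ennreal (1 + c powr q) * indicator {0..T} s \<partial>lborel)"
    using one by (intro nn_integral_mono) (auto simp: indicator_def)
  also have "\<dots> < \<infinity>"
    by (subst nn_integral_cmult_indicator) (auto simp: ennreal_mult_less_top emeasure_lborel_Icc_eq)
  finally have fin: "(\<integral>\<^sup>+ \<omega>. (\<integral>\<^sup>+ s\<in>{0..T}. ennreal \<bar>f s \<omega>\<bar> \<partial>lborel) \<partial>M) \<noteq> \<infinity>" by simp
  have m: "(\<lambda>\<omega>. \<integral>\<^sup>+ s\<in>{0..T}. ennreal \<bar>f s \<omega>\<bar> \<partial>lborel) \<in> borel_measurable M"
    using measurable_pair_swap[OF fm'] by (intro lborel.borel_measurable_nn_integral) (simp add: case_prod_unfold)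
  show ?thesis using nn_integral_noteq_infinite[OF m fin] by (simp add: less_top)
qed

text \<open>At each time the statement may fail on a null set depending on the time; Fubini turns
  this into a single null set outside which it holds at almost every time.\<close>

lemma AE_commute_lborel:
  assumes M: "prob_space M" and m: "Measurable.pred (borel \<Otimes>\<^sub>M M) (\<lambda>x. P (fst x) (snd x))"
    and P: "\<And>t. t \<in> A \<Longrightarrow> AE \<omega> in M. P t \<omega>" and A: "A \<in> sets borel"
  shows "AE \<omega> in M. AE t in lborel. t \<in> A \<longrightarrow> P t \<omega>"
proof -
  interpret prob_space M by fact
  interpret pair_sigma_finite lborel M ..
  have [measurable]: "Measurable.pred (borel \<Otimes>\<^sub>M M) (\<lambda>x. fst x \<in> A)"
    using A by measurable
  have "Measurable.pred (borel \<Otimes>\<^sub>M M) (\<lambda>x. fst x \<in> A \<longrightarrow> P (fst x) (snd x))"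
    using m by measurable
  then have "{x \<in> space (borel \<Otimes>\<^sub>M M). fst x \<in> A \<longrightarrow> P (fst x) (snd x)} \<in> sets (borel \<Otimes>\<^sub>M M)"
    by (simp add: pred_def)
  moreover have "sets (lborel \<Otimes>\<^sub>M M) = sets (borel \<Otimes>\<^sub>M M)" by (rule sets_pair_measure_cong) auto
  ultimately have "{x \<in> space (lborel \<Otimes>\<^sub>M M). fst x \<in> A \<longrightarrow> P (fst x) (snd x)} \<in> sets (lborel \<Otimes>\<^sub>M M)"
    by (simp add: space_pair_measure)
  from AE_commute[OF this] P show ?thesis by auto
qed

text \<open>The crude bound by \<open>m\<close>, which is finite almost surely, replaces a priori
  moments of \<open>u\<close>: it makes the time integral of \<open>u\<close> finite along paths, as
  \<open>gronwall_integral\<close> demands. That lemma controls only the time integral, so its bound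
  is inserted once more into the inequality at the fixed time \<open>t\<close>; hence the shape of
  the constant.\<close>

lemma gronwall_Lp:
  fixes u G :: "real \<Rightarrow> 'w \<Rightarrow> real" and m :: "'w \<Rightarrow> ennreal"
  assumes M: "prob_space M" and q: "q > 1" and K: "K > 0" and T: "T > 0" and c: "c > 0"
    and u[measurable]: "case_prod u \<in> borel_measurable (borel \<Otimes>\<^sub>M M)"
    and G[measurable]: "case_prod G \<in> borel_measurable (borel \<Otimes>\<^sub>M M)"
    and nonneg: "\<And>t \<omega>. 0 \<le> u t \<omega>" "\<And>t \<omega>. 0 \<le> G t \<omega>"
    and ineq: "\<And>t. t \<in> {0..T} \<Longrightarrow> AE \<omega> in M. ennreal (u t \<omega>) \<le> ennreal (G t \<omega>) + ennreal K * (\<integral>\<^sup>+ s\<in>{0..t}. ennreal (u s \<omega>) \<partial>lborel)"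
    and m[measurable]: "m \<in> borel_measurable M" and mfin: "AE \<omega> in M. m \<omega> < \<infinity>"
    and um: "\<And>t. t \<in> {0..T} \<Longrightarrow> AE \<omega> in M. ennreal (u t \<omega>) \<le> ennreal (G t \<omega>) + m \<omega>"
    and Gc: "\<And>t. t \<in> {0..T} \<Longrightarrow> Lp_bd M q (G t) c"
    and t: "t \<in> {0..T}"
  shows "Lp_bd M q (u t) (c + K * (2 * exp (2 * K * T)) * (T * c))"
proof -
  interpret prob_space M by fact
  have sf: "sigma_finite_measure M" by unfold_locales
  have [measurable]: "(\<lambda>x. u (f x) (g x)) \<in> borel_measurable N" "(\<lambda>x. G (f x) (g x)) \<in> borel_measurable N"
    if "f \<in> borel_measurable N" "g \<in> measurable N M" for f g and N :: "'z measure"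
    using measurable_compose[OF measurable_Pair[OF that] u] measurable_compose[OF measurable_Pair[OF that] G] by auto
  have us[measurable]: "(\<lambda>s. u s \<omega>) \<in> borel_measurable borel" "(\<lambda>s. G s \<omega>) \<in> borel_measurable borel" if "\<omega> \<in> space M" for \<omega>
    using that u G by measurable
  define IG where "IG \<omega> = (\<integral>\<^sup>+ s\<in>{0..T}. ennreal (G s \<omega>) \<partial>lborel)" for \<omega>
  have indm: "indicator {0..t} s = (if 0 \<le> s \<and> s \<le> t then 1 else 0 :: ennreal)" for s t :: real by (simp add: indicator_def)
  have IGm[measurable]: "IG \<in> borel_measurable M" unfolding IG_def by measurable
  have IGfin: "AE \<omega> in M. IG \<omega> < \<infinity>"
    using Lp_bd_AE_finite[OF M G _ Gc] q nonneg by (simp add: IG_def)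
  have iu: "(\<lambda>x. \<integral>\<^sup>+ s\<in>{0..fst x}. ennreal (u s (snd x)) \<partial>lborel) \<in> borel_measurable (borel \<Otimes>\<^sub>M M)"
    unfolding indm by measurable
  have "AE \<omega> in M. AE t in lborel. t \<in> {0..T} \<longrightarrow> ennreal (u t \<omega>) \<le> ennreal (G t \<omega>) + m \<omega>"
    by (rule AE_commute_lborel[OF M _ um]) measurable
  moreover have "AE \<omega> in M. AE t in lborel. t \<in> {0..T} \<longrightarrow> ennreal (u t \<omega>) \<le> ennreal (G t \<omega>) + ennreal K * (\<integral>\<^sup>+ s\<in>{0..t}. ennreal (u s \<omega>) \<partial>lborel)"
    by (rule AE_commute_lborel[OF M _ ineq]) (use iu in measurable)
  ultimately have main: "AE \<omega> in M. (\<integral>\<^sup>+ s\<in>{0..T}. ennreal (u s \<omega>) \<partial>lborel) \<le> ennreal (2 * exp (2 * K * T)) * IG \<omega>"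
    using mfin IGfin AE_space
  proof eventually_elim
    case (elim \<omega>)
    note [measurable] = us[OF elim(5)]
    have "(\<integral>\<^sup>+ s\<in>{0..T}. ennreal (u s \<omega>) \<partial>lborel) \<le> (\<integral>\<^sup>+ s. ennreal (G s \<omega>) * indicator {0..T} s + m \<omega> * indicator {0..T} s \<partial>lborel)"
      by (intro nn_integral_mono_AE, use elim(1) in eventually_elim) (auto simp: indicator_def)
    also have "\<dots> = IG \<omega> + m \<omega> * emeasure lborel {0..T}"
      unfolding IG_def by (subst nn_integral_add) (auto simp: nn_integral_cmult_indicator)
    also have "\<dots> < \<infinity>" using elim(3,4) T by (simp add: ennreal_mult_less_top)
    finally have fin: "(\<integral>\<^sup>+ s\<in>{0..T}. ennreal (u s \<omega>) \<partial>lborel) < \<infinity>" .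
    show ?case unfolding IG_def
      by (rule gronwall_integral[OF _ _ K _ elim(2) fin]) (use T in auto)
  qed
  \<comment> \<open>\<open>IG\<close> may be infinite on a null set; \<open>J\<close> is its
    real-valued version, for which moments can be estimated.\<close>
  define J where "J \<omega> = enn2real (IG \<omega>)" for \<omega>
  have Jm[measurable]: "J \<in> borel_measurable M" unfolding J_def by measurable
  have Jb: "Lp_bd M q J (T * c)"
  proof (rule Lp_bd_weighted[OF q sf, where w="indicator {0..T}" and f=G])
    show "(\<integral>\<^sup>+ s. ennreal (indicat_real {0..T} s) \<partial>lborel) \<le> ennreal T"
      using T by (simp add: ennreal_indicator)
    show "AE \<omega> in M. ennreal (norm (J \<omega>)) \<le> (\<integral>\<^sup>+ s. ennreal (indicat_real {0..T} s) * ennreal \<bar>G s \<omega>\<bar> \<partial>lborel)"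
      using IGfin
    proof eventually_elim
      case (elim \<omega>)
      have "ennreal (norm (J \<omega>)) = IG \<omega>" using elim by (simp add: J_def)
      then show ?case using nonneg by (simp add: IG_def ennreal_indicator mult.commute)
    qed
    show "J \<in> borel_measurable M" unfolding J_def by measurable
    show "Lp_bd M q (G s) c" if "0 < indicat_real {0..T} s" for s
      using that Gc by (auto simp: indicator_def split: if_splits)
  qed (use T c G in auto)
  let ?k = "K * (2 * exp (2 * K * T))"
  have k: "?k > 0" using K by simp
  have "Lp_bd M q (\<lambda>\<omega>. G t \<omega> + ?k *\<^sub>R J \<omega>) (c + \<bar>?k\<bar> * (T * c))"
    using k T c t by (intro Lp_bd_add[OF q Gc] Lp_bd_scaleR[OF Jb]) auto
  then have "Lp_bd M q (\<lambda>\<omega>. G t \<omega> + ?k *\<^sub>R J \<omega>) (c + ?k * (T * c))" using k by (simp only: abs_of_pos)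
  then show ?thesis
  proof (rule Lp_bd_mono)
    show "AE \<omega> in M. norm (u t \<omega>) \<le> norm (G t \<omega> + ?k *\<^sub>R J \<omega>)"
      using main ineq[OF t] IGfin
    proof eventually_elim
      case (elim \<omega>)
      have J0: "J \<omega> \<ge> 0" by (simp add: J_def)
      have "(\<integral>\<^sup>+ s\<in>{0..t}. ennreal (u s \<omega>) \<partial>lborel) \<le> (\<integral>\<^sup>+ s\<in>{0..T}. ennreal (u s \<omega>) \<partial>lborel)"
        using t by (intro nn_integral_mono) (auto simp: indicator_def)
      also have "\<dots> \<le> ennreal (2 * exp (2 * K * T)) * ennreal (J \<omega>)" using elim by (simp add: J_def)
      finally have "ennreal K * (\<integral>\<^sup>+ s\<in>{0..t}. ennreal (u s \<omega>) \<partial>lborel) \<le> ennreal K * (ennreal (2 * exp (2 * K * T)) * ennreal (J \<omega>))"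
        by (intro mult_left_mono) auto
      also have "\<dots> = ennreal (?k * J \<omega>)" using K J0 by (simp add: ennreal_mult[symmetric] mult.assoc)
      finally have "ennreal (u t \<omega>) \<le> ennreal (G t \<omega>) + ennreal (?k * J \<omega>)"
        using elim(2) by (meson add_left_mono order_trans)
      also have "\<dots> = ennreal (G t \<omega> + ?k * J \<omega>)" using nonneg k J0 by (intro ennreal_plus[symmetric]) auto
      finally have "u t \<omega> \<le> G t \<omega> + ?k * J \<omega>"
        using nonneg k J0 by (subst (asm) ennreal_le_iff) auto
      then show ?case using nonneg[of t \<omega>] by simp
    qed
  qed (use k T c q in auto)
qed

text \<open>Hoelder's inequality for \<open>U * G\<close> with \<open>G \<in> L\<^sup>q\<close>; as \<open>\<bar>U\<bar> \<le> 1\<close>, the second moment of \<open>U\<close> bounds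
  its moment of the conjugate order \<open>p q / (q - p) \<ge> 2\<close>.\<close>

lemma Lp_bd_mult_small:
  fixes U G :: "'w \<Rightarrow> real"
  assumes [measurable]: "U \<in> borel_measurable M" "G \<in> borel_measurable M"
    and U: "\<And>\<omega>. \<omega> \<in> space M \<Longrightarrow> \<bar>U \<omega>\<bar> \<le> 1" and U2: "(\<integral>\<^sup>+ \<omega>. ennreal ((U \<omega>)\<^sup>2) \<partial>M) \<le> ennreal \<eta>" and \<eta>: "\<eta> > 0"
    and pq: "1 < p" "p < q" "q \<le> 2" and G: "Lp_bd M q G c"
  shows "Lp_bd M p (\<lambda>\<omega>. U \<omega> * G \<omega>) ((c powr q + 1) powr (1 / p) * \<eta> powr ((q - p) / (p * q)))"
proof -
  \<comment> \<open>\<open>\<kappa>\<close> is the common size of both terms of the estimate, since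
    \<open>\<eta> powr (- (p / q)) * \<eta> = \<kappa>\<close>; \<open>s\<close> is the weight in
    Young's inequality for which \<open>s powr (q / p) = \<kappa>\<close>.\<close>
  define \<kappa> where "\<kappa> = \<eta> powr ((q - p) / q)"
  define s where "s = \<kappa> powr (p / q)"
  have \<kappa>: "\<kappa> > 0" using \<eta> by (simp add: \<kappa>_def)
  have s: "s > 0" using \<kappa> by (simp add: s_def)
  have ex: "p * (q / (q - p)) \<ge> 2"
  proof -
    \<comment> \<open>The right-hand side equals \<open>p * q - 2 * (q - p)\<close>; each summand is
      nonnegative because \<open>1 < p < q \<le> 2\<close>.\<close>
    have "0 \<le> (2 - p) * (2 - q) + 4 * (p - 1)" using pq by (intro add_nonneg_nonneg mult_nonneg_nonneg) auto
    then have "2 * (q - p) \<le> p * q" by (simp add: algebra_simps)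
    then show ?thesis using pq by (simp add: pos_le_divide_eq)
  qed
  have pt: "\<bar>U \<omega> * G \<omega>\<bar> powr p \<le> \<kappa> * \<bar>G \<omega>\<bar> powr q + \<eta> powr (- (p / q)) * (U \<omega>)\<^sup>2" if \<omega>: "\<omega> \<in> space M" for \<omega>
  proof -
    let ?P = "q / p" and ?Q = "q / (q - p)"
    have "\<bar>U \<omega> * G \<omega>\<bar> powr p = (s * \<bar>G \<omega>\<bar> powr p) * (\<bar>U \<omega>\<bar> powr p / s)"
      using s by (simp add: abs_mult powr_mult)
    also have "\<dots> \<le> (s * \<bar>G \<omega>\<bar> powr p) powr ?P / ?P + (\<bar>U \<omega>\<bar> powr p / s) powr ?Q / ?Q"
    proof (rule Youngs_inequality)
      show "1 / ?P + 1 / ?Q = 1" using pq by (simp add: field_simps)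
    qed (use pq s in \<open>auto simp: less_divide_eq\<close>)
    also have "\<dots> \<le> (s * \<bar>G \<omega>\<bar> powr p) powr ?P + (\<bar>U \<omega>\<bar> powr p / s) powr ?Q"
    proof (rule add_mono)
      have dd: "x / y \<le> x" if "x \<ge> 0" "y \<ge> 1" for x y :: real
        using that by (simp add: divide_le_eq mult_left_mono[of 1 y x, simplified])
      have "1 \<le> ?P" "1 \<le> ?Q" using pq by (auto simp: le_divide_eq)
      then show "(s * \<bar>G \<omega>\<bar> powr p) powr ?P / ?P \<le> (s * \<bar>G \<omega>\<bar> powr p) powr ?P"
        "(\<bar>U \<omega>\<bar> powr p / s) powr ?Q / ?Q \<le> (\<bar>U \<omega>\<bar> powr p / s) powr ?Q"
        by - (rule dd, rule powr_ge_zero, assumption)+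
    qed
    also have "(s * \<bar>G \<omega>\<bar> powr p) powr ?P = \<kappa> * \<bar>G \<omega>\<bar> powr q"
      using s pq \<kappa> by (simp add: powr_mult powr_powr s_def)
    also have "(\<bar>U \<omega>\<bar> powr p / s) powr ?Q = \<eta> powr (- (p / q)) * \<bar>U \<omega>\<bar> powr (p * ?Q)"
    proof -
      have "s powr ?Q = \<eta> powr (p / q)" using pq by (simp add: s_def \<kappa>_def powr_powr)
      moreover have "(\<bar>U \<omega>\<bar> powr p / s) powr ?Q = (\<bar>U \<omega>\<bar> powr p) powr ?Q / s powr ?Q"
        by (rule powr_divide)
      ultimately show ?thesis by (simp add: powr_powr powr_minus_divide)
    qed
    also have "\<bar>U \<omega>\<bar> powr (p * ?Q) \<le> \<bar>U \<omega>\<bar> powr 2" using ex U[OF \<omega>] by (intro powr_mono') auto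
    also have "\<bar>U \<omega>\<bar> powr 2 = (U \<omega>)\<^sup>2" using powr_realpow'[of "\<bar>U \<omega>\<bar>" 2] by simp
    finally show ?thesis by (simp add: mult_left_mono)
  qed
  have "(\<integral>\<^sup>+ \<omega>. ennreal (norm (U \<omega> * G \<omega>) powr p) \<partial>M)
    \<le> (\<integral>\<^sup>+ \<omega>. ennreal \<kappa> * ennreal (norm (G \<omega>) powr q) + ennreal (\<eta> powr (- (p / q))) * ennreal ((U \<omega>)\<^sup>2) \<partial>M)"
    using pt \<kappa> by (intro nn_integral_mono) (simp add: ennreal_leI flip: ennreal_mult ennreal_plus)
  also have "\<dots> = ennreal \<kappa> * (\<integral>\<^sup>+ \<omega>. ennreal (norm (G \<omega>) powr q) \<partial>M) + ennreal (\<eta> powr (- (p / q))) * (\<integral>\<^sup>+ \<omega>. ennreal ((U \<omega>)\<^sup>2) \<partial>M)"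
    by (subst nn_integral_add) (auto simp: nn_integral_cmult)
  also have "\<dots> \<le> ennreal \<kappa> * ennreal (c powr q) + ennreal (\<eta> powr (- (p / q))) * ennreal \<eta>"
    using G U2 by (intro add_mono mult_left_mono) (auto simp: Lp_bd_def)
  also have "\<dots> = ennreal (\<kappa> * c powr q + \<eta> powr (- (p / q)) * \<eta>)"
    using \<kappa> \<eta> by (simp add: ennreal_mult ennreal_plus)
  also have "\<eta> powr (- (p / q)) * \<eta> = \<kappa>"
    using \<eta> pq powr_add[of \<eta> "- (p / q)" 1] by (simp add: \<kappa>_def diff_divide_distrib)
  also have "\<kappa> * c powr q + \<kappa> = ((c powr q + 1) powr (1 / p) * \<eta> powr ((q - p) / (p * q))) powr p"
  proof -
    have "0 < c powr q + 1" by (simp add: add_nonneg_pos)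
    then show ?thesis using pq \<eta> by (simp add: powr_mult powr_powr \<kappa>_def distrib_left distrib_right mult.commute)
  qed
  finally show ?thesis by (simp add: Lp_bd_def)
qed

text \<open>Truncating the time at \<open>0\<close> pulls the generators of the predictable
  sigma-algebra back to measurable rectangles, \<open>{0} \<times> B\<close> becoming
  \<open>{..0} \<times> B\<close>.\<close>

lemma predictable_jointly_measurable:
  fixes X :: "real \<Rightarrow> 'w \<Rightarrow> 'h::topological_space"
  assumes basis: "stochastic_basis M F" and X: "predictable_process M F X"
  shows "(\<lambda>(t, \<omega>). X (max t 0) \<omega>) \<in> borel_measurable (borel \<Otimes>\<^sub>M M)"
proof -
  have F: "\<And>t. t \<ge> 0 \<Longrightarrow> subalgebra M (F t)" using basis by (simp add: stochastic_basis_def)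
  have "(\<lambda>(t, \<omega>). (max t 0, \<omega>)) \<in> measurable (borel \<Otimes>\<^sub>M M) (predictable_sigma M F)"
    unfolding predictable_sigma_def
  proof (rule measurable_measure_of)
    have sub: "B \<subseteq> space M" "B \<in> sets M" if "B \<in> sets (F t)" "t \<ge> 0" for B t
      using F[OF that(2)] that(1) sets.sets_into_space[OF that(1)] by (auto simp: subalgebra_def)
    then show "{{0} \<times> B |B. B \<in> sets (F 0)} \<union> {{s<..t} \<times> B |s t B. 0 \<le> s \<and> s \<le> t \<and> B \<in> sets (F s)} \<subseteq> Pow ({0..} \<times> space M)"
      by (fastforce dest: sub(1))
    show "(\<lambda>(t::real, \<omega>). (max t 0, \<omega>)) \<in> space (borel \<Otimes>\<^sub>M M) \<rightarrow> {0..} \<times> space M"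
      by (auto simp: space_pair_measure)
    fix A assume "A \<in> {{0} \<times> B |B. B \<in> sets (F 0)} \<union> {{s<..t} \<times> B |s t B. 0 \<le> s \<and> s \<le> t \<and> B \<in> sets (F s)}"
    then consider B where "A = {0} \<times> B" "B \<in> sets (F 0)"
      | s t B where "A = {s<..t} \<times> B" "0 \<le> s" "s \<le> t" "B \<in> sets (F s)" by blast
    then show "(\<lambda>(t::real, \<omega>). (max t 0, \<omega>)) -` A \<inter> space (borel \<Otimes>\<^sub>M M) \<in> sets (borel \<Otimes>\<^sub>M M)"
    proof cases
      case (1 B)
      have "(\<lambda>(t::real, \<omega>). (max t 0, \<omega>)) -` A \<inter> space (borel \<Otimes>\<^sub>M M) = {..0} \<times> B"
        using sub[OF 1(2)] by (auto simp: 1 space_pair_measure)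
      then show ?thesis using sub[OF 1(2)] by (auto intro: pair_measureI)
    next
      case (2 s t B)
      have "(\<lambda>(t::real, \<omega>). (max t 0, \<omega>)) -` A \<inter> space (borel \<Otimes>\<^sub>M M) = {s<..t} \<times> B"
        using sub[OF 2(4,2)] 2(2,3) by (auto simp: 2(1) space_pair_measure)
      then show ?thesis using sub[OF 2(4,2)] by (auto intro: pair_measureI)
    qed
  qed
  from measurable_compose[OF this X[unfolded predictable_process_def]]
  show ?thesis by (simp add: case_prod_unfold)
qed

section \<open>Moments and time regularity of the averaged solution\<close>

lemma joint_comp:
  assumes "case_prod Y \<in> measurable (borel \<Otimes>\<^sub>M M) K" "f \<in> borel_measurable N" "g \<in> measurable N M"
  shows "(\<lambda>x. Y (f x) (g x)) \<in> measurable N K"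
  using measurable_compose[OF measurable_Pair[OF assms(2,3)] assms(1)] by simp

lemma integrable_indicator_dominated:
  fixes F :: "real \<Rightarrow> 'h::{banach, second_countable_topology}"
  assumes "F \<in> borel_measurable borel" "A \<in> sets borel"
    and dom: "\<And>s. s \<in> A \<Longrightarrow> norm (F s) \<le> norm (g s)" and fin: "(\<integral>\<^sup>+ s\<in>A. ennreal (norm (g s)) \<partial>lborel) < \<infinity>"
  shows "integrable lborel (\<lambda>s. indicator A s *\<^sub>R F s)"
proof (rule integrableI_bounded)
  have "(\<integral>\<^sup>+ s. ennreal (norm (indicator A s *\<^sub>R F s)) \<partial>lborel) \<le> (\<integral>\<^sup>+ s\<in>A. ennreal (norm (g s)) \<partial>lborel)"
    by (intro nn_integral_mono) (auto simp: indicator_def dom ennreal_leI)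
  then show "(\<integral>\<^sup>+ s. ennreal (norm (indicator A s *\<^sub>R F s)) \<partial>lborel) < \<infinity>" using fin by (rule le_less_trans)
qed (use assms in measurable)

context diag_semigroup begin

text \<open>The deterministic convolution of the mild formulation. The truncation inside
  \<open>S\<close> has no effect on \<open>{0..t}\<close> and keeps the integrand Borel in all
  variables.\<close>

definition mconv :: "(real \<Rightarrow> 'h) \<Rightarrow> real \<Rightarrow> 'h" where
  "mconv g t = (\<integral>s. indicator {0..t} s *\<^sub>R S (max (t - s) 0) (g s) \<partial>lborel)"

lemma mconv_integrable:
  assumes [measurable]: "g \<in> borel_measurable borel" and fin: "(\<integral>\<^sup>+ s\<in>{0..t}. ennreal (norm (g s)) \<partial>lborel) < \<infinity>"
  shows "integrable lborel (\<lambda>s. indicator {0..t} s *\<^sub>R S (max (t - s) 0) (g s))"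
  by (rule integrable_indicator_dominated[OF _ _ _ fin]) (auto intro: S_contraction)

lemma norm_mconv_le: "ennreal (norm (mconv g t)) \<le> (\<integral>\<^sup>+ s\<in>{0..t}. ennreal (norm (g s)) \<partial>lborel)"
  unfolding mconv_def
  by (rule order_trans[OF norm_integral_le_nn])
    (intro nn_integral_mono, auto simp: indicator_def intro!: ennreal_leI S_contraction)

lemma mconv_diff:
  assumes "g \<in> borel_measurable borel" "(\<integral>\<^sup>+ s\<in>{0..t}. ennreal (norm (g s)) \<partial>lborel) < \<infinity>"
    and "h \<in> borel_measurable borel" "(\<integral>\<^sup>+ s\<in>{0..t}. ennreal (norm (h s)) \<partial>lborel) < \<infinity>"
  shows "mconv (\<lambda>s. g s - h s) t = mconv g t - mconv h t"
  unfolding mconv_def using mconv_integrable[OF assms(1,2)] mconv_integrable[OF assms(3,4)]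
  by (subst Bochner_Integration.integral_diff[symmetric]) (auto simp: S_diff scaleR_diff_right)

lemma mconv_measurable:
  assumes g: "case_prod g \<in> borel_measurable (borel \<Otimes>\<^sub>M M)"
  shows "(\<lambda>(t, \<omega>). mconv (\<lambda>s. g s \<omega>) t) \<in> borel_measurable (borel \<Otimes>\<^sub>M M)"
proof -
  have eq: "indicat_real {0..t} s = (if 0 \<le> s \<and> s \<le> t then 1 else 0)" for s t :: real by (simp add: indicator_def)
  have [measurable]: "(\<lambda>p. g (snd p) (snd (fst p))) \<in> borel_measurable ((borel \<Otimes>\<^sub>M M) \<Otimes>\<^sub>M lborel)"
    by (rule joint_comp[OF g]) measurable
  show ?thesis unfolding mconv_def case_prod_unfold eq
    by (intro lborel.borel_measurable_lebesgue_integral) (simp add: case_prod_unfold, measurable)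
qed

end

lemma nn_integral_singular_weight:
  assumes s: "0 \<le> s" "s \<le> T" and \<theta>: "0 < \<theta>" "\<theta> < 1" and d: "0 \<le> d"
  shows "(\<integral>\<^sup>+ u. ennreal (indicator {0..s} u * (d / (s - u)) powr \<theta>) \<partial>lborel)
     \<le> ennreal (d powr \<theta> * (T powr (1 - \<theta>) / (1 - \<theta>)))"
\<comment> \<open>For \<open>s = 0\<close> only \<open>u = 0\<close> is left, where division by
  \<open>0\<close> makes the integrand \<open>0\<close>.\<close>
proof (cases "s = 0")
  case True
  have "(\<integral>\<^sup>+ u. ennreal (indicator {0..s} u * (d / (s - u)) powr \<theta>) \<partial>lborel) = (\<integral>\<^sup>+ u. 0 \<partial>(lborel :: real measure))"
    by (rule nn_integral_cong) (use True in \<open>auto simp: indicator_def\<close>)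
  then show ?thesis by simp
next
  case False
  have "(\<integral>\<^sup>+ u. ennreal (indicator {0..s} u * (d / (s - u)) powr \<theta>) \<partial>lborel)
     = (\<integral>\<^sup>+ u. ennreal (d powr \<theta>) * (ennreal ((s - u) powr (- \<theta>)) * indicator {0..s} u) \<partial>lborel)"
  proof (intro nn_integral_cong)
    fix u
    have "(d / (s - u)) powr \<theta> = d powr \<theta> * (s - u) powr (- \<theta>)" if "u \<in> {0..s}"
      using that d by (simp add: powr_divide powr_minus_divide)
    then show "ennreal (indicator {0..s} u * (d / (s - u)) powr \<theta>)
        = ennreal (d powr \<theta>) * (ennreal ((s - u) powr (- \<theta>)) * indicator {0..s} u)"
      by (cases "u \<in> {0..s}") (simp_all add: ennreal_mult)
  qed
  also have "\<dots> = ennreal (d powr \<theta>) * ennreal (s powr (1 - \<theta>) / (1 - \<theta>))"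
    using s False \<theta> by (subst nn_integral_cmult) (auto simp: nn_integral_singular_kernel)
  also have "\<dots> = ennreal (d powr \<theta> * (s powr (1 - \<theta>) / (1 - \<theta>)))"
    using \<theta> by (intro ennreal_mult[symmetric]) auto
  also have "\<dots> \<le> ennreal (d powr \<theta> * (T powr (1 - \<theta>) / (1 - \<theta>)))"
    using s \<theta> by (intro ennreal_leI mult_left_mono divide_right_mono powr_mono2) auto
  finally show ?thesis .
qed

locale averaging = stable_convolution e D A S lam M F L \<beta> \<alpha> \<sigma> \<theta>
  for e :: "nat \<Rightarrow> 'h::{real_inner, banach, second_countable_topology}"
    and D A S lam and M :: "'w measure" and F L \<beta> \<alpha> \<sigma> \<theta> +
  fixes b :: "'h \<Rightarrow> 's::finite \<Rightarrow> 'h" and K :: real and \<nu> :: "real^'s" and x :: 'h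
    and Xbar :: "real \<Rightarrow> 'w \<Rightarrow> 'h" and T :: real
  assumes K: "K > 0" and lip: "\<And>y z i. norm (b y i - b z i) \<le> K * norm (y - z)"
    and nu: "\<And>i. 0 \<le> \<nu> $ i" "(\<Sum>i\<in>UNIV. \<nu> $ i) = 1"
    and x: "x \<in> frac_power_dom e lam \<theta>"
    and Xbar: "mild_solution M F S e \<beta> L (\<lambda>s \<omega> y. averaged_drift b \<nu> y) x Xbar"
    and T: "T > 0"
begin

lemma sf_M: "sigma_finite_measure M" by unfold_locales

text \<open>The summand \<open>1\<close> keeps the bound positive, as \<open>Lp_bd_add\<close>
  requires.\<close>

definition B0 :: real where "B0 = 1 + (\<Sum>i\<in>UNIV. norm (b 0 i))"

lemma B0: "B0 \<ge> 1" by (simp add: B0_def sum_nonneg)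

lemma b_growth: "norm (b y i) \<le> B0 + K * norm y"
proof -
  have "norm (b y i) \<le> norm (b 0 i) + norm (b y i - b 0 i)" by (rule norm_triangle_sub)
  also have "norm (b 0 i) \<le> B0" unfolding B0_def using member_le_sum[of i UNIV "\<lambda>i. norm (b 0 i)"] by simp
  finally show ?thesis using lip[of y i 0] by simp
qed

abbreviation "bbar y \<equiv> averaged_drift b \<nu> y"

lemma bbar_growth: "norm (bbar y) \<le> B0 + K * norm y"
proof -
  have "norm (bbar y) \<le> (\<Sum>i\<in>UNIV. \<nu> $ i * (B0 + K * norm y))"
    unfolding averaged_drift_def
    by (rule order_trans[OF norm_sum]) (auto intro!: sum_mono mult_left_mono b_growth nu simp: nu)
  then show ?thesis by (simp add: nu flip: sum_distrib_right)
qed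

lemma b_measurable1 [measurable (raw)]: 
  assumes "f \<in> borel_measurable N" shows "(\<lambda>x. b (f x) i) \<in> borel_measurable N"
proof -
  have "K-lipschitz_on UNIV (\<lambda>y. b y i)" using K lip by (intro lipschitz_onI) (auto simp: dist_norm)
  then have "(\<lambda>y. b y i) \<in> borel_measurable borel"
    by (intro borel_measurable_continuous_onI lipschitz_on_continuous_on)
  from measurable_compose[OF assms this] show ?thesis .
qed

lemma b_measurable:
  assumes "f \<in> borel_measurable N" "g \<in> measurable N (count_space UNIV)"
  shows "(\<lambda>x. b (f x) (g x)) \<in> borel_measurable N"
  by (rule measurable_compose_countable'[where I=UNIV and f="\<lambda>i x. b (f x) i", OF b_measurable1[OF assms(1)] assms(2)]) auto

lemma bbar_measurable [measurable (raw)]: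
  "f \<in> borel_measurable N \<Longrightarrow> (\<lambda>x. bbar (f x)) \<in> borel_measurable N"
  unfolding averaged_drift_def by measurable

definition Y :: "real \<Rightarrow> 'w \<Rightarrow> 'h" where "Y t = Xbar (max t 0)"

lemma Y_joint: "case_prod Y \<in> borel_measurable (borel \<Otimes>\<^sub>M M)"
proof -
  have "predictable_process M F Xbar" using Xbar by (simp add: mild_solution_def)
  from predictable_jointly_measurable[OF basis this] show ?thesis by (simp add: Y_def[abs_def])
qed

lemma Y_comp [measurable (raw)]:
  "f \<in> borel_measurable N \<Longrightarrow> g \<in> measurable N M \<Longrightarrow> (\<lambda>x. Y (f x) (g x)) \<in> borel_measurable N"
  by (rule joint_comp[OF Y_joint])

lemma Y_path [measurable]: "\<omega> \<in> space M \<Longrightarrow> (\<lambda>s. Y s \<omega>) \<in> borel_measurable borel"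
  and Y_rv [measurable]: "Y t \<in> borel_measurable M"
  by measurable

text \<open>\<open>mild_solution\<close> grants a version of the convolution for each time
  separately. The remainder of the equation is instead one jointly measurable process, which at each
  \<open>t \<ge> 0\<close> equals such a version almost surely.\<close>

definition noise :: "real \<Rightarrow> 'w \<Rightarrow> 'h" where
  "noise t \<omega> = Y t \<omega> - S (max t 0) x - mconv (\<lambda>s. bbar (Y s \<omega>)) t"

lemma mconv_bbar_joint: "(\<lambda>(t, \<omega>). mconv (\<lambda>s. bbar (Y s \<omega>)) t) \<in> borel_measurable (borel \<Otimes>\<^sub>M M)"
  by (rule mconv_measurable) (simp add: case_prod_unfold)

lemma mconv_bbar_rv: "(\<lambda>\<omega>. mconv (\<lambda>s. bbar (Y s \<omega>)) t) \<in> borel_measurable M"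
  using joint_comp[where Y="\<lambda>t \<omega>. mconv (\<lambda>u. bbar (Y u \<omega>)) t" and f="\<lambda>_. t" and g="\<lambda>\<omega>. \<omega>", OF mconv_bbar_joint] by simp

lemma noise_joint: "case_prod noise \<in> borel_measurable (borel \<Otimes>\<^sub>M M)"
proof -
  note mconv_bbar_joint
  then have "(\<lambda>p. Y (fst p) (snd p) - S (max (fst p) 0) x - mconv (\<lambda>s. bbar (Y s (snd p))) (fst p)) \<in> borel_measurable (borel \<Otimes>\<^sub>M M)"
    by (intro borel_measurable_diff) (auto simp: case_prod_unfold)
  then show ?thesis by (simp add: noise_def[abs_def] case_prod_unfold)
qed

lemma noise_rv [measurable]: "noise t \<in> borel_measurable M"
  using joint_comp[OF noise_joint, of "\<lambda>_. t" M "\<lambda>\<omega>. \<omega>"] by simp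

lemma mild_conv:
  assumes t: "t \<ge> 0"
  shows "\<exists>W. conv t W \<and> (AE \<omega> in M. noise t \<omega> = W \<omega> \<and> (\<integral>\<^sup>+ s\<in>{0..t}. ennreal (norm (bbar (Y s \<omega>))) \<partial>lborel) < \<infinity>)"
proof -
  obtain W where W: "conv t W" and
    ae: "AE \<omega> in M. set_integrable lborel {0..t} (\<lambda>s. bbar (Xbar s \<omega>)) \<and>
           Xbar t \<omega> = S t x + (LINT s:{0..t}|lborel. S (t - s) (bbar (Xbar s \<omega>))) + W \<omega>"
    using Xbar t unfolding mild_solution_def by blast
  have "AE \<omega> in M. noise t \<omega> = W \<omega> \<and> (\<integral>\<^sup>+ s\<in>{0..t}. ennreal (norm (bbar (Y s \<omega>))) \<partial>lborel) < \<infinity>"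
    using ae
  proof eventually_elim
    case (elim \<omega>)
    have "(LINT s:{0..t}|lborel. S (t - s) (bbar (Xbar s \<omega>))) = mconv (\<lambda>s. bbar (Y s \<omega>)) t"
      unfolding mconv_def set_lebesgue_integral_def Y_def
      by (intro Bochner_Integration.integral_cong) (auto simp: indicator_def max_def)
    then have "noise t \<omega> = W \<omega>" using elim t by (simp add: noise_def Y_def max_def)
    moreover have "(\<integral>\<^sup>+ s\<in>{0..t}. ennreal (norm (bbar (Y s \<omega>))) \<partial>lborel)
       = (\<integral>\<^sup>+ s. ennreal (norm (indicator {0..t} s *\<^sub>R bbar (Xbar s \<omega>))) \<partial>lborel)"
      unfolding Y_def by (intro nn_integral_cong) (auto simp: indicator_def max_def)
    ultimately show ?case using elim by (simp add: set_integrable_def integrable_iff_bounded)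
  qed
  then show ?thesis using W by blast
qed

lemma Lp_bd_noise_at:
  assumes t: "t \<in> {0..T}" and q: "1 < q" "q < \<alpha>"
  shows "Lp_bd M q (noise t) (moment_const \<alpha> q * (noise_const * T powr \<theta>))"
proof -
  obtain W where W: "conv t W" "AE \<omega> in M. noise t \<omega> = W \<omega>" using mild_conv[of t] t by force
  have "Lp_bd M q W (moment_const \<alpha> q * (noise_const * T powr \<theta>))" using t T q W by (intro Lp_bd_conv) auto
  then show ?thesis
    by (rule Lp_bd_mono) (use W q moment_const_pos[of q \<alpha>] noise_const_pos in \<open>auto elim!: eventually_mono\<close>)
qed

lemma Lp_bd_noise_increment:
  assumes s: "0 \<le> s" "s \<le> t" "t - s \<le> \<delta>" "\<delta> > 0" and q: "1 < q" "q < \<alpha>"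
  shows "Lp_bd M q (\<lambda>\<omega>. noise t \<omega> - noise s \<omega>) (2 * (moment_const \<alpha> q * (noise_const * \<delta> powr \<theta>)))"
proof -
  obtain W where W: "conv t W" "AE \<omega> in M. noise t \<omega> = W \<omega>" using mild_conv[of t] s by force
  obtain W' where W': "conv s W'" "AE \<omega> in M. noise s \<omega> = W' \<omega>" using mild_conv[of s] s by force
  have "Lp_bd M q (\<lambda>\<omega>. W \<omega> - W' \<omega>) (2 * (moment_const \<alpha> q * (noise_const * \<delta> powr \<theta>)))"
    by (rule Lp_bd_conv_increment[OF s q W'(1) W(1)])
  then show ?thesis
  proof (rule Lp_bd_mono)
    show "AE \<omega> in M. norm (noise t \<omega> - noise s \<omega>) \<le> norm (W \<omega> - W' \<omega>)"
      using W(2) W'(2) by eventually_elim simp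
  qed (use q moment_const_pos[of q \<alpha>] noise_const_pos in auto)
qed

text \<open>\<open>gronwall_Lp\<close> with the forcing \<open>c0 + norm (noise t \<omega>)\<close>,
  whose moments come from the convolution; the pathwise bound \<open>m\<close> is the time integral
  of the drift norm, finite because a mild solution has integrable drift. \<open>c0\<close> collects
  the initial value and the constant part of the growth bound.\<close>

lemma Y_moment:
  assumes q: "1 < q" "q < \<alpha>"
  shows "\<exists>C>0. \<forall>t\<in>{0..T}. Lp_bd M q (Y t) C"
proof -
  define cW where "cW = moment_const \<alpha> q * (noise_const * T powr \<theta>)"
  have cW: "cW > 0" using q T noise_const_pos by (simp add: cW_def moment_const_pos)
  define c0 where "c0 = norm x + B0 * T"
  have c0: "c0 > 0" using B0 T by (simp add: c0_def add_nonneg_pos)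
  define m where "m \<omega> = (\<integral>\<^sup>+ s\<in>{0..T}. ennreal (norm (bbar (Y s \<omega>))) \<partial>lborel)" for \<omega>
  have [measurable]: "m \<in> borel_measurable M" unfolding m_def by measurable
  have nj: "(\<lambda>p. noise (fst p) (snd p)) \<in> borel_measurable (borel \<Otimes>\<^sub>M M)"
    using noise_joint by (simp add: case_prod_unfold)
  have split: "norm (Y t \<omega>) \<le> norm x + norm (noise t \<omega>) + norm (mconv (\<lambda>s. bbar (Y s \<omega>)) t)" for t \<omega>
  proof -
    have "Y t \<omega> = S (max t 0) x + noise t \<omega> + mconv (\<lambda>s. bbar (Y s \<omega>)) t" by (simp add: noise_def)
    then have "norm (Y t \<omega>) \<le> norm (S (max t 0) x) + norm (noise t \<omega>) + norm (mconv (\<lambda>s. bbar (Y s \<omega>)) t)"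
      by (metis norm_triangle_le norm_triangle_ineq add_right_mono)
    then show ?thesis using S_contraction[of "max t 0" x] by simp
  qed
  have split': "ennreal (norm (Y t \<omega>)) \<le> ennreal (norm x + norm (noise t \<omega>)) + ennreal (norm (mconv (\<lambda>s. bbar (Y s \<omega>)) t))" for t \<omega>
    using split[of t \<omega>] by (simp add: ennreal_leI flip: ennreal_plus)
  have "Lp_bd M q (\<lambda>\<omega>. norm (Y t \<omega>)) ((c0 + cW) + K * (2 * exp (2 * K * T)) * (T * (c0 + cW)))" if t: "t \<in> {0..T}" for t
  proof (rule gronwall_Lp[OF prob_space_axioms q(1) K T, where G="\<lambda>t \<omega>. c0 + norm (noise t \<omega>)" and m=m and t=t and u="\<lambda>t \<omega>. norm (Y t \<omega>)"])
    fix t assume t: "t \<in> {0..T}"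
    show "Lp_bd M q (\<lambda>\<omega>. c0 + norm (noise t \<omega>)) (c0 + cW)"
    proof (rule Lp_bd_add[OF q(1)])
      show "Lp_bd M q (\<lambda>_. c0) c0" using q c0 by (intro Lp_bd_const prob_space_axioms) auto
      show "Lp_bd M q (\<lambda>\<omega>. norm (noise t \<omega>)) cW"
        using Lp_bd_noise_at[OF t q] by (simp add: Lp_bd_norm cW_def)
    qed (use c0 cW in auto)
    show "AE \<omega> in M. ennreal (norm (Y t \<omega>)) \<le> ennreal (c0 + norm (noise t \<omega>)) + m \<omega>"
    proof (intro AE_I2)
      fix \<omega>
      have "ennreal (norm (mconv (\<lambda>s. bbar (Y s \<omega>)) t)) \<le> m \<omega>"
        unfolding m_def using t
        by (intro order_trans[OF norm_mconv_le nn_integral_mono]) (auto simp: indicator_def)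
      moreover have "ennreal (norm x + norm (noise t \<omega>)) \<le> ennreal (c0 + norm (noise t \<omega>))"
        using B0 T by (intro ennreal_leI) (simp add: c0_def)
      ultimately show "ennreal (norm (Y t \<omega>)) \<le> ennreal (c0 + norm (noise t \<omega>)) + m \<omega>"
        using split'[of t \<omega>] by (meson add_mono order_trans)
    qed
    show "AE \<omega> in M. ennreal (norm (Y t \<omega>)) \<le> ennreal (c0 + norm (noise t \<omega>)) + ennreal K * (\<integral>\<^sup>+ s\<in>{0..t}. ennreal (norm (Y s \<omega>)) \<partial>lborel)"
    proof (rule AE_I2)
      fix \<omega> assume [measurable]: "\<omega> \<in> space M"
      have "ennreal (norm (mconv (\<lambda>s. bbar (Y s \<omega>)) t)) \<le> (\<integral>\<^sup>+ s\<in>{0..t}. ennreal (norm (bbar (Y s \<omega>))) \<partial>lborel)"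
        by (rule norm_mconv_le)
      also have "\<dots> \<le> (\<integral>\<^sup>+ s. ennreal B0 * indicator {0..t} s + ennreal K * (ennreal (norm (Y s \<omega>)) * indicator {0..t} s) \<partial>lborel)"
        using bbar_growth B0 K
        by (intro nn_integral_mono) (auto simp: indicator_def ennreal_leI simp flip: ennreal_mult ennreal_plus)
      also have "\<dots> = ennreal B0 * ennreal t + ennreal K * (\<integral>\<^sup>+ s\<in>{0..t}. ennreal (norm (Y s \<omega>)) \<partial>lborel)"
        using t by (subst nn_integral_add) (auto simp: nn_integral_cmult nn_integral_cmult_indicator)
      also have "ennreal B0 * ennreal t \<le> ennreal (B0 * T)"
        using t B0 by (auto simp: ennreal_mult[symmetric] intro!: ennreal_leI mult_left_mono)
      finally have *: "ennreal (norm (mconv (\<lambda>s. bbar (Y s \<omega>)) t)) \<le> ennreal (B0 * T) + ennreal K * (\<integral>\<^sup>+ s\<in>{0..t}. ennreal (norm (Y s \<omega>)) \<partial>lborel)"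
        by (simp add: add_right_mono)
      have "ennreal (norm (Y t \<omega>)) \<le> ennreal (norm x + norm (noise t \<omega>)) + (ennreal (B0 * T) + ennreal K * (\<integral>\<^sup>+ s\<in>{0..t}. ennreal (norm (Y s \<omega>)) \<partial>lborel))"
        using split'[of t \<omega>] * by (meson add_left_mono order_trans)
      also have "\<dots> = ennreal (c0 + norm (noise t \<omega>)) + ennreal K * (\<integral>\<^sup>+ s\<in>{0..t}. ennreal (norm (Y s \<omega>)) \<partial>lborel)"
        using B0 T by (simp add: c0_def ennreal_plus add_ac)
      finally show "ennreal (norm (Y t \<omega>)) \<le> ennreal (c0 + norm (noise t \<omega>)) + ennreal K * (\<integral>\<^sup>+ s\<in>{0..t}. ennreal (norm (Y s \<omega>)) \<partial>lborel)" .
    qed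
  next
    obtain W where "AE \<omega> in M. noise T \<omega> = W \<omega> \<and> m \<omega> < \<infinity>"
      using mild_conv[OF less_imp_le[OF T]] unfolding m_def by blast
    then show "AE \<omega> in M. m \<omega> < \<infinity>" by eventually_elim blast
    show "(\<lambda>(t, \<omega>). norm (Y t \<omega>)) \<in> borel_measurable (borel \<Otimes>\<^sub>M M)"
      unfolding case_prod_unfold by measurable
    show "(\<lambda>(t, \<omega>). c0 + norm (noise t \<omega>)) \<in> borel_measurable (borel \<Otimes>\<^sub>M M)"
      using nj unfolding case_prod_unfold by measurable
    show "0 \<le> c0 + norm (noise t \<omega>)" for t \<omega> using c0 by (intro add_nonneg_nonneg) auto
    show "0 < c0 + cW" using c0 cW by simp
  qed (use t in simp_all)
  moreover have "(c0 + cW) + K * (2 * exp (2 * K * T)) * (T * (c0 + cW)) > 0"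
    using c0 cW K T by (intro add_pos_nonneg) auto
  ultimately show ?thesis by (auto simp: Lp_bd_norm)
qed

lemma drift_moment:
  assumes Y: "Lp_bd M q (Y t) C" and C: "C > 0" and q: "1 < q"
  shows "Lp_bd M q (\<lambda>\<omega>. bbar (Y t \<omega>)) (B0 + K * C)" "Lp_bd M q (\<lambda>\<omega>. b (Y t \<omega>) i) (B0 + K * C)"
proof -
  have "Lp_bd M q (\<lambda>\<omega>. norm (Y t \<omega>)) C" using Y by (simp add: Lp_bd_norm)
  from Lp_bd_scaleR[OF this, of K] have "Lp_bd M q (\<lambda>\<omega>. K * norm (Y t \<omega>)) (K * C)" using K C by simp
  then have "Lp_bd M q (\<lambda>\<omega>. B0 + K * norm (Y t \<omega>)) (B0 + K * C)"
    using q B0 K C by (intro Lp_bd_add Lp_bd_const prob_space_axioms) auto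
  then show "Lp_bd M q (\<lambda>\<omega>. bbar (Y t \<omega>)) (B0 + K * C)" "Lp_bd M q (\<lambda>\<omega>. b (Y t \<omega>) i) (B0 + K * C)"
    by (rule Lp_bd_mono; use bbar_growth b_growth B0 K C q in \<open>auto intro!: AE_I2 order_trans[OF _ abs_ge_self]\<close>)+
qed

text \<open>On \<open>{s..t}\<close> the integrand is new and contraction suffices; on
  \<open>{0..s}\<close> the semigroup time grows from \<open>s - u\<close> to \<open>t - u\<close>,
  which \<open>S_increment\<close> estimates with a weight singular at \<open>u = s\<close>.\<close>

lemma mconv_increment_le:
  assumes [measurable]: "g \<in> borel_measurable borel" and st: "0 \<le> s" "s \<le> t"
    and fin: "(\<integral>\<^sup>+ u\<in>{0..t}. ennreal (norm (g u)) \<partial>lborel) < \<infinity>"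
  shows "ennreal (norm (mconv g t - mconv g s))
     \<le> (\<integral>\<^sup>+ u. ennreal (indicator {s..t} u + indicator {0..s} u * ((t - s) / (s - u)) powr \<theta>) * ennreal (norm (g u)) \<partial>lborel)"
proof -
  have "(\<integral>\<^sup>+ u\<in>{0..s}. ennreal (norm (g u)) \<partial>lborel) \<le> (\<integral>\<^sup>+ u\<in>{0..t}. ennreal (norm (g u)) \<partial>lborel)"
    using st by (intro nn_integral_mono) (auto simp: indicator_def)
  then have fins: "(\<integral>\<^sup>+ u\<in>{0..s}. ennreal (norm (g u)) \<partial>lborel) < \<infinity>" using fin by (rule le_less_trans)
  have eq: "mconv g t - mconv g s = (\<integral>u. indicator {0..t} u *\<^sub>R S (max (t - u) 0) (g u) - indicator {0..s} u *\<^sub>R S (max (s - u) 0) (g u) \<partial>lborel)"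
    unfolding mconv_def by (intro Bochner_Integration.integral_diff[symmetric] mconv_integrable fin fins) auto
  have "ennreal (norm (mconv g t - mconv g s)) \<le> (\<integral>\<^sup>+ u. ennreal (norm (indicator {0..t} u *\<^sub>R S (max (t - u) 0) (g u) - indicator {0..s} u *\<^sub>R S (max (s - u) 0) (g u))) \<partial>lborel)"
    unfolding eq by (rule norm_integral_le_nn)
  also have "\<dots> \<le> (\<integral>\<^sup>+ u. ennreal (indicator {s..t} u + indicator {0..s} u * ((t - s) / (s - u)) powr \<theta>) * ennreal (norm (g u)) \<partial>lborel)"
  proof (intro nn_integral_mono_AE)
    show "AE u in lborel. ennreal (norm (indicator {0..t} u *\<^sub>R S (max (t - u) 0) (g u) - indicator {0..s} u *\<^sub>R S (max (s - u) 0) (g u)))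
       \<le> ennreal (indicator {s..t} u + indicator {0..s} u * ((t - s) / (s - u)) powr \<theta>) * ennreal (norm (g u))"
      \<comment> \<open>At \<open>u = s\<close> the two parts overlap and neither case of the
        estimate applies; one point is negligible.\<close>
      using AE_lborel_singleton[of s]
    proof eventually_elim
      case (elim u)
      have "norm (indicator {0..t} u *\<^sub>R S (max (t - u) 0) (g u) - indicator {0..s} u *\<^sub>R S (max (s - u) 0) (g u))
         \<le> (indicator {s..t} u + indicator {0..s} u * ((t - s) / (s - u)) powr \<theta>) * norm (g u)"
      proof (cases "u < 0 \<or> t < u")
        case True
        then have "u \<notin> {0..t}" "u \<notin> {0..s}" "u \<notin> {s..t}" using st by auto
        then show ?thesis by simp
      next
        case in_range: False
        show ?thesis
        proof (cases "u < s")
        case True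
        with in_range have 2: "0 \<le> u" "u < s" by auto
        have "norm (S ((s - u) + (t - s)) (g u) - S (s - u) (g u)) \<le> ((t - s) / (s - u)) powr \<theta> * norm (g u)"
          using 2 st theta by (intro S_increment) auto
        moreover have "u \<in> {0..t}" "u \<in> {0..s}" "u \<notin> {s..t}" "max (t - u) 0 = (s - u) + (t - s)" "max (s - u) 0 = s - u"
          using 2 st by auto
        ultimately show ?thesis by simp
      next
        case False
        with in_range elim have "u \<in> {0..t}" "u \<notin> {0..s}" "u \<in> {s..t}" "max (t - u) 0 = t - u" "0 \<le> t - u"
          using st by auto
        then show ?thesis using S_contraction[of "t - u" "g u"] by simp
      qed
      qed
      moreover have "0 \<le> indicat_real {s..t} u + indicator {0..s} u * ((t - s) / (s - u)) powr \<theta>" by simp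
      ultimately show ?case by (simp only: ennreal_mult[symmetric] norm_ge_zero ennreal_leI)
    qed
  qed
  finally show ?thesis .
qed

text \<open>Three increments of the same order: the initial value by its regularity, the drift
  convolution by a singular weight whose mass is of order \<open>\<delta> powr \<theta>\<close>, and
  the noise. \<open>\<delta> \<le> 1\<close> serves to bound the length \<open>t - s\<close> of the
  new part by \<open>\<delta> powr \<theta>\<close>.\<close>

lemma Y_increment:
  assumes p: "1 < p" "p < \<alpha>"
  shows "\<exists>C>0. \<forall>s t \<delta>. 0 \<le> s \<and> s \<le> t \<and> t \<le> T \<and> t - s \<le> \<delta> \<and> 0 < \<delta> \<and> \<delta> \<le> 1
      \<longrightarrow> Lp_bd M p (\<lambda>\<omega>. Y t \<omega> - Y s \<omega>) (C * \<delta> powr \<theta>)"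
proof -
  obtain C where C: "C > 0" "\<And>t. t \<in> {0..T} \<Longrightarrow> Lp_bd M p (Y t) C" using Y_moment[OF p] by blast
  obtain Cx where Cx: "Cx \<ge> 0" "\<And>s h. 0 \<le> s \<Longrightarrow> 0 \<le> h \<Longrightarrow> norm (S (s + h) x - S s x) \<le> Cx * h powr \<theta>"
    using S_increment_dom[OF x] theta by force
  define C1 where "C1 = 1 + T powr (1 - \<theta>) / (1 - \<theta>)"
  define C2 where "C2 = 2 * (moment_const \<alpha> p * noise_const)"
  define C3 where "C3 = B0 + K * C"
  have pos: "C1 > 0" "C2 > 0" "C3 > 0"
    using theta p noise_const_pos moment_const_pos[of p \<alpha>] B0 K C
    by (auto simp: C1_def C2_def C3_def intro: add_pos_nonneg)
  have "Lp_bd M p (\<lambda>\<omega>. Y t \<omega> - Y s \<omega>) ((Cx + 1 + C1 * C3 + C2) * \<delta> powr \<theta>)"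
    if st: "0 \<le> s" "s \<le> t" "t \<le> T" "t - s \<le> \<delta>" "0 < \<delta>" "\<delta> \<le> 1" for s t \<delta>
  proof -
    define d where "d = \<delta> powr \<theta>"
    have d: "d > 0" using st by (simp add: d_def)
    have "\<delta> powr 1 \<le> \<delta> powr \<theta>" using st theta by (intro powr_mono') auto
    then have dd: "\<delta> \<le> d" using st by (simp add: d_def)
    have hd: "(t - s) powr \<theta> \<le> d" unfolding d_def using st theta by (intro powr_mono2) auto
    define w where "w u = indicat_real {s..t} u + indicator {0..s} u * ((t - s) / (s - u)) powr \<theta>" for u
    have [measurable]: "w \<in> borel_measurable borel" unfolding w_def by measurable
    have W: "(\<integral>\<^sup>+ u. ennreal (w u) \<partial>lborel) \<le> ennreal (C1 * d)"
    proof -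
      have "(\<integral>\<^sup>+ u. ennreal (w u) \<partial>lborel)
        = (\<integral>\<^sup>+ u. indicator {s..t} u \<partial>lborel) + (\<integral>\<^sup>+ u. ennreal (indicator {0..s} u * ((t - s) / (s - u)) powr \<theta>) \<partial>lborel)"
        unfolding w_def by (subst nn_integral_add[symmetric]) (auto simp: ennreal_plus ennreal_indicator)
      also have "\<dots> \<le> ennreal \<delta> + ennreal ((t - s) powr \<theta> * (T powr (1 - \<theta>) / (1 - \<theta>)))"
        using st theta by (intro add_mono nn_integral_singular_weight) (auto intro!: ennreal_leI)
      also have "\<dots> = ennreal (\<delta> + (t - s) powr \<theta> * (T powr (1 - \<theta>) / (1 - \<theta>)))"
        using st theta by (intro ennreal_plus[symmetric]) auto
      also have "\<dots> \<le> ennreal (d + d * (T powr (1 - \<theta>) / (1 - \<theta>)))"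
        using dd hd theta by (intro ennreal_leI add_mono mult_right_mono) auto
      finally show ?thesis by (simp add: C1_def algebra_simps)
    qed
    have V: "Lp_bd M p (\<lambda>\<omega>. mconv (\<lambda>u. bbar (Y u \<omega>)) t - mconv (\<lambda>u. bbar (Y u \<omega>)) s) ((C1 * d) * C3)"
    proof (rule Lp_bd_weighted[OF p(1) sf_M _ W, where f="\<lambda>u \<omega>. norm (bbar (Y u \<omega>))"])
      show "Lp_bd M p (\<lambda>\<omega>. norm (bbar (Y u \<omega>))) C3" if "0 < w u" for u
      proof -
        have "u \<in> {0..T}"
        proof (rule ccontr)
          assume "u \<notin> {0..T}"
          then have "w u = 0" using st by (auto simp: w_def indicator_def)
          then show False using that by simp
        qed
        then show ?thesis using drift_moment(1)[OF C(2) C(1) p(1)] by (simp add: Lp_bd_norm C3_def)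
      qed
      obtain W where "AE \<omega> in M. noise t \<omega> = W \<omega> \<and> (\<integral>\<^sup>+ s\<in>{0..t}. ennreal (norm (bbar (Y s \<omega>))) \<partial>lborel) < \<infinity>"
        using mild_conv[of t] st by auto
      then show "AE \<omega> in M. ennreal (norm (mconv (\<lambda>u. bbar (Y u \<omega>)) t - mconv (\<lambda>u. bbar (Y u \<omega>)) s))
          \<le> (\<integral>\<^sup>+ u. ennreal (w u) * ennreal \<bar>norm (bbar (Y u \<omega>))\<bar> \<partial>lborel)"
        using AE_space
      proof eventually_elim
        case (elim \<omega>)
        then have [measurable]: "\<omega> \<in> space M" by simp
        show ?case unfolding w_def abs_norm_cancel
          by (rule mconv_increment_le[OF _ st(1,2)]) (use elim in auto)
      qed
      show "(\<lambda>\<omega>. mconv (\<lambda>u. bbar (Y u \<omega>)) t - mconv (\<lambda>u. bbar (Y u \<omega>)) s) \<in> borel_measurable M"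
        by (intro borel_measurable_diff mconv_bbar_rv)
    qed (use pos d in \<open>auto simp: case_prod_unfold\<close>)

    have N: "Lp_bd M p (\<lambda>\<omega>. noise t \<omega> - noise s \<omega>) (C2 * d)"
      using Lp_bd_noise_increment[OF st(1,2,4,5) p] by (simp add: C2_def d_def mult.assoc)
    have Xi: "Lp_bd M p (\<lambda>_. S t x - S s x) ((Cx + 1) * d)"
    proof (rule Lp_bd_const[OF prob_space_axioms])
      have "norm (S (s + (t - s)) x - S s x) \<le> Cx * (t - s) powr \<theta>" using st by (intro Cx) auto
      also have "\<dots> \<le> (Cx + 1) * d" using hd Cx(1) d by (intro mult_mono) auto
      finally show "norm (S t x - S s x) \<le> (Cx + 1) * d" by simp
    qed (use p in simp)
    have pc: "0 < (Cx + 1) * d" "0 < (C1 * d) * C3" "0 < C2 * d" using pos d Cx(1) by simp_all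
    have "Lp_bd M p (\<lambda>\<omega>. ((S t x - S s x) + (mconv (\<lambda>u. bbar (Y u \<omega>)) t - mconv (\<lambda>u. bbar (Y u \<omega>)) s)) + (noise t \<omega> - noise s \<omega>))
        (((Cx + 1) * d + (C1 * d) * C3) + C2 * d)"
      using p pc by (intro Lp_bd_add Xi V N borel_measurable_add borel_measurable_diff mconv_bbar_rv noise_rv) (simp_all add: add_pos_pos)
    moreover have "((S t x - S s x) + (mconv (\<lambda>u. bbar (Y u \<omega>)) t - mconv (\<lambda>u. bbar (Y u \<omega>)) s)) + (noise t \<omega> - noise s \<omega>) = Y t \<omega> - Y s \<omega>" for \<omega>
    proof -
      have "max t 0 = t" "max s 0 = s" using st by auto
      then show ?thesis by (simp add: noise_def)
    qed
    moreover have "((Cx + 1) * d + (C1 * d) * C3) + C2 * d = (Cx + 1 + C1 * C3 + C2) * \<delta> powr \<theta>"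
      by (simp add: d_def algebra_simps)
    ultimately show ?thesis by (simp only:)
  qed
  moreover have "Cx + 1 + C1 * C3 + C2 > 0" using pos Cx(1) by (intro add_pos_pos add_nonneg_pos mult_pos_pos) auto
  ultimately show ?thesis by blast
qed

end

section \<open>The averaging error\<close>

definition grid_floor :: "real \<Rightarrow> real \<Rightarrow> real" where
  "grid_floor \<delta> s = \<delta> * of_int \<lfloor>s / \<delta>\<rfloor>"

lemma grid_floor_bounds:
  assumes "\<delta> > 0" "0 \<le> s"
  shows "0 \<le> grid_floor \<delta> s" "grid_floor \<delta> s \<le> s" "s - grid_floor \<delta> s \<le> \<delta>"
proof -
  have "of_int \<lfloor>s / \<delta>\<rfloor> \<le> s / \<delta>" "s / \<delta> \<le> of_int \<lfloor>s / \<delta>\<rfloor> + 1" by linarith+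
  moreover have "0 \<le> \<lfloor>s / \<delta>\<rfloor>" using assms by simp
  ultimately have "\<delta> * of_int \<lfloor>s / \<delta>\<rfloor> \<le> \<delta> * (s / \<delta>)" "\<delta> * (s / \<delta>) \<le> \<delta> * (of_int \<lfloor>s / \<delta>\<rfloor> + 1)"
    "0 \<le> \<delta> * of_int \<lfloor>s / \<delta>\<rfloor>"
    using assms by (simp_all only: mult_left_mono less_imp_le mult_nonneg_nonneg of_int_0_le_iff)
  then show "0 \<le> grid_floor \<delta> s" "grid_floor \<delta> s \<le> s" "s - grid_floor \<delta> s \<le> \<delta>"
    using assms by (auto simp: grid_floor_def distrib_left)
qed

lemma grid_floor_measurable [measurable]: "grid_floor \<delta> \<in> borel_measurable borel"
  unfolding grid_floor_def[abs_def] by measurable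

text \<open>Neighbouring closed cells share a grid point, so these points, a null set, are left out.
  The cell of index \<open>nat \<lfloor>t / \<delta>\<rfloor>\<close> contains \<open>t\<close>,
  whence the \<open>+ 1\<close>, and is cut off there.\<close>

lemma grid_cell_sum:
  fixes v :: "nat \<Rightarrow> 'h::real_vector"
  assumes d: "\<delta> > 0" and t: "0 \<le> t" and s: "s \<notin> range (\<lambda>j. real j * \<delta>)"
  shows "(\<Sum>j<nat \<lfloor>t / \<delta>\<rfloor> + 1. indicator {real j * \<delta>..min (real (Suc j) * \<delta>) t} s *\<^sub>R v j)
     = indicator {0..t} s *\<^sub>R v (nat \<lfloor>s / \<delta>\<rfloor>)"
proof (cases "s \<in> {0..t}")
  case False
  have "indicat_real {real j * \<delta>..min (real (Suc j) * \<delta>) t} s = 0" for j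
  proof -
    have "0 \<le> real j * \<delta>" using d by simp
    then show ?thesis using False by (auto simp: indicator_def simp del: of_nat_Suc)
  qed
  then show ?thesis using False by simp
next
  case True
  define i where "i = nat \<lfloor>s / \<delta>\<rfloor>"
  have nn: "0 \<le> s / \<delta>" using True d by simp
  have i: "real i \<le> s / \<delta>" "s / \<delta> < real i + 1" using nn by (auto simp: i_def)
  have i': "real i * \<delta> \<le> s" "s < real (Suc i) * \<delta>" using i d by (simp_all add: field_simps)
  have "\<lfloor>s / \<delta>\<rfloor> \<le> \<lfloor>t / \<delta>\<rfloor>" using True d by (intro floor_mono divide_right_mono) auto
  then have iN: "i < nat \<lfloor>t / \<delta>\<rfloor> + 1" by (simp add: i_def)
  have "indicat_real {real j * \<delta>..min (real (Suc j) * \<delta>) t} s = (if j = i then 1 else 0)" for j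
  proof (cases j i rule: linorder_cases)
    case less
    then have "real (Suc j) * \<delta> \<le> real i * \<delta>" using d by (intro mult_right_mono) auto
    moreover have "s \<noteq> real i * \<delta>" using s by auto
    ultimately have "real (Suc j) * \<delta> < s" using i' by linarith
    then show ?thesis using less by (auto simp: indicator_def simp del: of_nat_Suc)
  next
    case equal
    then show ?thesis using i' True by (simp add: indicator_def del: of_nat_Suc)
  next
    case greater
    then have "real (Suc i) * \<delta> \<le> real j * \<delta>" using d by (intro mult_right_mono) auto
    then have "s < real j * \<delta>" using i' by linarith
    then show ?thesis using greater by (auto simp: indicator_def simp del: of_nat_Suc)
  qed
  then have "(\<Sum>j<nat \<lfloor>t / \<delta>\<rfloor> + 1. indicator {real j * \<delta>..min (real (Suc j) * \<delta>) t} s *\<^sub>R v j)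
     = (\<Sum>j<nat \<lfloor>t / \<delta>\<rfloor> + 1. if j = i then v i else 0)"
    by (intro sum.cong refl) (simp del: of_nat_Suc)
  also have "\<dots> = v i" using iN by simp
  finally show ?thesis using True by (simp add: i_def)
qed

context averaging begin

text \<open>The centred indicator of state \<open>i\<close>, as a function of the current state
  \<open>j\<close>. It is annihilated by \<open>\<nu>\<close>, which is what
  \<open>stationary_poisson\<close> asks for.\<close>

definition cvec :: "'s \<Rightarrow> real^'s" where
  "cvec i = (\<chi> j. (if j = i then 1 else 0) - \<nu> $ i)"

lemma cvec_bound: "\<bar>cvec i $ j\<bar> \<le> 1"
proof -
  have "\<nu> $ i \<le> 1" using member_le_sum[of i UNIV "\<lambda>i. \<nu> $ i"] nu by simp
  then show ?thesis using nu(1)[of i] by (auto simp: cvec_def)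
qed

text \<open>Separates the random state from the path: the chain enters only through the scalars
  \<open>cvec i $ j\<close>, so oscillation estimates for scalar functions of the chain
  suffice.\<close>

lemma drift_difference: "b y j - bbar y = (\<Sum>i\<in>UNIV. cvec i $ j *\<^sub>R b y i)"
proof -
  have "(\<Sum>i\<in>UNIV. cvec i $ j *\<^sub>R b y i) = (\<Sum>i\<in>UNIV. (if i = j then b y i else 0) - \<nu> $ i *\<^sub>R b y i)"
    by (intro sum.cong refl) (auto simp: cvec_def algebra_simps)
  then show ?thesis by (simp add: averaged_drift_def sum_subtractf)
qed

text \<open>In each state the drift along the path and along its frozen version is almost surely
  integrable, so the error terms can be separated inside Bochner integrals.\<close>

lemma Y_finite:
  assumes q: "1 < q" "q < \<alpha>" and d: "\<delta> > 0" and t: "t \<in> {0..T}"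
  shows "AE \<omega> in M. \<forall>i. (\<integral>\<^sup>+ s\<in>{0..t}. ennreal (norm (b (Y s \<omega>) i)) \<partial>lborel) < \<infinity>
     \<and> (\<integral>\<^sup>+ s\<in>{0..t}. ennreal (norm (b (Y (grid_floor \<delta> s) \<omega>) i)) \<partial>lborel) < \<infinity>"
proof -
  obtain C where C: "C > 0" "\<And>t. t \<in> {0..T} \<Longrightarrow> Lp_bd M q (Y t) C" using Y_moment[OF q] by blast
  have *: "AE \<omega> in M. (\<integral>\<^sup>+ s\<in>{0..t}. ennreal \<bar>norm (b (Y (g s) \<omega>) i)\<bar> \<partial>lborel) < \<infinity>"
    if g[measurable]: "g \<in> borel_measurable borel" "\<And>s. s \<in> {0..t} \<Longrightarrow> g s \<in> {0..T}" for g i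
  proof (rule Lp_bd_AE_finite[OF prob_space_axioms])
    show "(\<lambda>(s, \<omega>). norm (b (Y (g s) \<omega>) i)) \<in> borel_measurable (borel \<Otimes>\<^sub>M M)"
      unfolding case_prod_unfold by measurable
    show "Lp_bd M q (\<lambda>\<omega>. norm (b (Y (g s) \<omega>) i)) (B0 + K * C)" if "s \<in> {0..t}" for s
      using drift_moment(2)[OF C(2)[OF g(2)[OF that]] C(1) q(1)] by (simp only: Lp_bd_norm)
  qed (use q in simp)
  have "AE \<omega> in M. (\<integral>\<^sup>+ s\<in>{0..t}. ennreal (norm (b (Y s \<omega>) i)) \<partial>lborel) < \<infinity>" for i
    using *[of "\<lambda>s. s" i] t by simp
  moreover have "AE \<omega> in M. (\<integral>\<^sup>+ s\<in>{0..t}. ennreal (norm (b (Y (grid_floor \<delta> s) \<omega>) i)) \<partial>lborel) < \<infinity>" for i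
  proof -
    have "grid_floor \<delta> s \<in> {0..T}" if "s \<in> {0..t}" for s
      using grid_floor_bounds[OF d, of s] that t by auto
    from *[OF grid_floor_measurable this] show ?thesis by simp
  qed
  ultimately have "AE \<omega> in M. \<forall>i\<in>UNIV. (\<integral>\<^sup>+ s\<in>{0..t}. ennreal (norm (b (Y s \<omega>) i)) \<partial>lborel) < \<infinity>
     \<and> (\<integral>\<^sup>+ s\<in>{0..t}. ennreal (norm (b (Y (grid_floor \<delta> s) \<omega>) i)) \<partial>lborel) < \<infinity>"
    by (intro AE_finite_allI AE_conjI) auto
  then show ?thesis by simp
qed

section \<open>Freezing the path and the semigroup on a grid\<close>

context
  fixes R :: "real \<Rightarrow> 'w \<Rightarrow> 's"
  assumes R: "(\<lambda>(s, \<omega>). R s \<omega>) \<in> measurable (borel \<Otimes>\<^sub>M M) (count_space UNIV)"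
begin

definition fluct :: "'s \<Rightarrow> real \<Rightarrow> 'w \<Rightarrow> real" where "fluct i s \<omega> = cvec i $ R s \<omega>"

lemma R_comp: "f \<in> borel_measurable N \<Longrightarrow> g \<in> measurable N M \<Longrightarrow> (\<lambda>x. R (f x) (g x)) \<in> measurable N (count_space UNIV)"
  by (rule joint_comp[OF R])

lemma fluct_comp [measurable (raw)]:
  "f \<in> borel_measurable N \<Longrightarrow> g \<in> measurable N M \<Longrightarrow> (\<lambda>x. fluct i (f x) (g x)) \<in> borel_measurable N"
  unfolding fluct_def by (rule measurable_compose[OF R_comp]) auto

lemma fluct_bound: "\<bar>fluct i s \<omega>\<bar> \<le> 1" by (simp add: fluct_def cvec_bound)

definition freeze_drift :: "'s \<Rightarrow> real \<Rightarrow> real \<Rightarrow> 'w \<Rightarrow> 'h" where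
  "freeze_drift i \<delta> t \<omega> = (\<integral>s. indicator {0..t} s *\<^sub>R (fluct i s \<omega> *\<^sub>R S (max (t - s) 0) (b (Y s \<omega>) i - b (Y (grid_floor \<delta> s) \<omega>) i)) \<partial>lborel)"

definition freeze_semigroup :: "'s \<Rightarrow> real \<Rightarrow> real \<Rightarrow> 'w \<Rightarrow> 'h" where
  "freeze_semigroup i \<delta> t \<omega> = (\<integral>s. indicator {0..t} s *\<^sub>R (fluct i s \<omega> *\<^sub>R
     (S (max (t - s) 0) (b (Y (grid_floor \<delta> s) \<omega>) i) - S (max (t - grid_floor \<delta> s) 0) (b (Y (grid_floor \<delta> s) \<omega>) i))) \<partial>lborel)"

definition cell_fluct :: "'s \<Rightarrow> real \<Rightarrow> real \<Rightarrow> nat \<Rightarrow> 'w \<Rightarrow> real" where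
  "cell_fluct i \<delta> t j \<omega> = (\<integral>s. indicator {real j * \<delta>..min (real (Suc j) * \<delta>) t} s * fluct i s \<omega> \<partial>lborel)"

text \<open>After freezing, the vector is constant on each cell and leaves the integral, so only
  scalar integrals of the chain remain. The vector is random and may depend on the chain, which is
  why the product is treated by Hoelder's inequality.\<close>

definition frozen_part :: "'s \<Rightarrow> real \<Rightarrow> real \<Rightarrow> 'w \<Rightarrow> 'h" where
  "frozen_part i \<delta> t \<omega> = (\<Sum>j<nat \<lfloor>t / \<delta>\<rfloor> + 1. cell_fluct i \<delta> t j \<omega> *\<^sub>R S (max (t - real j * \<delta>) 0) (b (Y (real j * \<delta>) \<omega>) i))"

lemma err_measurable [measurable]:
  "freeze_drift i \<delta> t \<in> borel_measurable M" "freeze_semigroup i \<delta> t \<in> borel_measurable M"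
  "cell_fluct i \<delta> t j \<in> borel_measurable M" "frozen_part i \<delta> t \<in> borel_measurable M"
proof -
  show "freeze_drift i \<delta> t \<in> borel_measurable M" unfolding freeze_drift_def[abs_def] by measurable
  show "freeze_semigroup i \<delta> t \<in> borel_measurable M" unfolding freeze_semigroup_def[abs_def] by measurable
  show o: "cell_fluct i \<delta> t j \<in> borel_measurable M" for j unfolding cell_fluct_def[abs_def] by measurable
  show "frozen_part i \<delta> t \<in> borel_measurable M" unfolding frozen_part_def[abs_def] using o by measurable
qed

lemma freeze_drift_bound:
  assumes p: "1 < p" "p < \<alpha>" and t: "t \<in> {0..T}" and d: "0 < \<delta>" "\<delta> \<le> 1" and c: "c > 0"
    and inc: "\<And>s. s \<in> {0..T} \<Longrightarrow> Lp_bd M p (\<lambda>\<omega>. Y s \<omega> - Y (grid_floor \<delta> s) \<omega>) c"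
  shows "Lp_bd M p (freeze_drift i \<delta> t) (T * (K * c))"
proof (rule Lp_bd_weighted[OF p(1) sf_M, where w="indicator {0..t}" and f="\<lambda>s \<omega>. K * norm (Y s \<omega> - Y (grid_floor \<delta> s) \<omega>)"])
  show "(\<integral>\<^sup>+ s. ennreal (indicat_real {0..t} s) \<partial>lborel) \<le> ennreal T"
    using t by (simp add: ennreal_indicator ennreal_leI)
  show "(\<lambda>(s, \<omega>). K * norm (Y s \<omega> - Y (grid_floor \<delta> s) \<omega>)) \<in> borel_measurable (borel \<Otimes>\<^sub>M M)"
    unfolding case_prod_unfold by measurable
  show "Lp_bd M p (\<lambda>\<omega>. K * norm (Y s \<omega> - Y (grid_floor \<delta> s) \<omega>)) (K * c)" if "0 < indicat_real {0..t} s" for s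
  proof -
    have "s \<in> {0..T}" using that t by (auto simp: indicator_def split: if_splits)
    from inc[OF this] have "Lp_bd M p (\<lambda>\<omega>. norm (Y s \<omega> - Y (grid_floor \<delta> s) \<omega>)) c" by (simp only: Lp_bd_norm)
    from Lp_bd_scaleR[OF this, of K] show ?thesis using K c by simp
  qed
  show "AE \<omega> in M. ennreal (norm (freeze_drift i \<delta> t \<omega>)) \<le> (\<integral>\<^sup>+ s. ennreal (indicat_real {0..t} s) * ennreal \<bar>K * norm (Y s \<omega> - Y (grid_floor \<delta> s) \<omega>)\<bar> \<partial>lborel)"
  proof (intro AE_I2)
    fix \<omega>
    show "ennreal (norm (freeze_drift i \<delta> t \<omega>)) \<le> (\<integral>\<^sup>+ s. ennreal (indicat_real {0..t} s) * ennreal \<bar>K * norm (Y s \<omega> - Y (grid_floor \<delta> s) \<omega>)\<bar> \<partial>lborel)"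
      unfolding freeze_drift_def
    proof (rule order_trans[OF norm_integral_le_nn nn_integral_mono])
      fix s
      define v where "v = b (Y s \<omega>) i - b (Y (grid_floor \<delta> s) \<omega>) i"
      have "\<bar>fluct i s \<omega>\<bar> * norm (S (max (t - s) 0) v) \<le> 1 * norm v"
        using fluct_bound[of i s \<omega>] by (intro mult_mono S_contraction) auto
      also have "norm v \<le> K * norm (Y s \<omega> - Y (grid_floor \<delta> s) \<omega>)" unfolding v_def by (rule lip)
      finally have "\<bar>fluct i s \<omega>\<bar> * norm (S (max (t - s) 0) v) \<le> K * norm (Y s \<omega> - Y (grid_floor \<delta> s) \<omega>)" by simp
      then have "norm (indicat_real {0..t} s *\<^sub>R (fluct i s \<omega> *\<^sub>R S (max (t - s) 0) v)) \<le> indicat_real {0..t} s * \<bar>K * norm (Y s \<omega> - Y (grid_floor \<delta> s) \<omega>)\<bar>"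
        using K by (simp add: abs_mult mult.assoc mult_left_mono)
      then show "ennreal (norm (indicat_real {0..t} s *\<^sub>R (fluct i s \<omega> *\<^sub>R S (max (t - s) 0) (b (Y s \<omega>) i - b (Y (grid_floor \<delta> s) \<omega>) i))))
         \<le> ennreal (indicat_real {0..t} s) * ennreal \<bar>K * norm (Y s \<omega> - Y (grid_floor \<delta> s) \<omega>)\<bar>"
        unfolding v_def by (subst ennreal_mult[symmetric]) (auto intro: ennreal_leI)
    qed
  qed
qed (use T K c in auto)

text \<open>Freezing moves the semigroup time from \<open>t - s\<close> to
  \<open>t - grid_floor \<delta> s\<close>, by at most \<open>\<delta>\<close>;
  \<open>S_increment\<close> at the positive time \<open>t - s\<close> gives a kernel singular only
  at \<open>s = t\<close>, a point that is discarded.\<close>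

lemma freeze_semigroup_bound:
  assumes p: "1 < p" "p < \<alpha>" and t: "t \<in> {0..T}" and d: "0 < \<delta>" "\<delta> \<le> 1" and c: "c > 0"
    and mom: "\<And>s. s \<in> {0..T} \<Longrightarrow> Lp_bd M p (\<lambda>\<omega>. b (Y s \<omega>) i) c"
  shows "Lp_bd M p (freeze_semigroup i \<delta> t) ((\<delta> powr \<theta> * (T powr (1 - \<theta>) / (1 - \<theta>))) * c)"
proof (rule Lp_bd_weighted[OF p(1) sf_M, where w="\<lambda>s. indicator {0..t} s * (\<delta> / (t - s)) powr \<theta>" and f="\<lambda>s \<omega>. norm (b (Y (grid_floor \<delta> s) \<omega>) i)"])
  show "(\<integral>\<^sup>+ s. ennreal (indicat_real {0..t} s * (\<delta> / (t - s)) powr \<theta>) \<partial>lborel) \<le> ennreal (\<delta> powr \<theta> * (T powr (1 - \<theta>) / (1 - \<theta>)))"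
    using t d theta by (intro nn_integral_singular_weight) auto
  show "(\<lambda>(s, \<omega>). norm (b (Y (grid_floor \<delta> s) \<omega>) i)) \<in> borel_measurable (borel \<Otimes>\<^sub>M M)"
    unfolding case_prod_unfold by measurable
  show "Lp_bd M p (\<lambda>\<omega>. norm (b (Y (grid_floor \<delta> s) \<omega>) i)) c" if "0 < indicat_real {0..t} s * (\<delta> / (t - s)) powr \<theta>" for s
  proof -
    have "s \<in> {0..t}" using that by (cases "s \<in> {0..t}") auto
    then have "grid_floor \<delta> s \<in> {0..T}" using grid_floor_bounds[OF d(1), of s] t by auto
    from mom[OF this] show ?thesis by (simp only: Lp_bd_norm)
  qed
  show "AE \<omega> in M. ennreal (norm (freeze_semigroup i \<delta> t \<omega>)) \<le> (\<integral>\<^sup>+ s. ennreal (indicat_real {0..t} s * (\<delta> / (t - s)) powr \<theta>) * ennreal \<bar>norm (b (Y (grid_floor \<delta> s) \<omega>) i)\<bar> \<partial>lborel)"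
  proof (intro AE_I2)
    fix \<omega>
    show "ennreal (norm (freeze_semigroup i \<delta> t \<omega>)) \<le> (\<integral>\<^sup>+ s. ennreal (indicat_real {0..t} s * (\<delta> / (t - s)) powr \<theta>) * ennreal \<bar>norm (b (Y (grid_floor \<delta> s) \<omega>) i)\<bar> \<partial>lborel)"
      unfolding freeze_semigroup_def
    proof (rule order_trans[OF norm_integral_le_nn nn_integral_mono_AE])
      show "AE s in lborel. ennreal (norm (indicat_real {0..t} s *\<^sub>R (fluct i s \<omega> *\<^sub>R
          (S (max (t - s) 0) (b (Y (grid_floor \<delta> s) \<omega>) i) - S (max (t - grid_floor \<delta> s) 0) (b (Y (grid_floor \<delta> s) \<omega>) i)))))
          \<le> ennreal (indicat_real {0..t} s * (\<delta> / (t - s)) powr \<theta>) * ennreal \<bar>norm (b (Y (grid_floor \<delta> s) \<omega>) i)\<bar>"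
        using AE_lborel_singleton[of t]
      proof eventually_elim
        case (elim s)
        define v where "v = b (Y (grid_floor \<delta> s) \<omega>) i"
        show ?case unfolding v_def[symmetric]
        proof (cases "s \<in> {0..t}")
          case True
          then have s: "0 \<le> s" "0 < t - s" using elim by auto
          note g = grid_floor_bounds[OF d(1) s(1)]
          have mx: "max (t - s) 0 = t - s" "max (t - grid_floor \<delta> s) 0 = (t - s) + (s - grid_floor \<delta> s)"
            using s g by auto
          have "norm (S (t - s) v - S ((t - s) + (s - grid_floor \<delta> s)) v) \<le> ((s - grid_floor \<delta> s) / (t - s)) powr \<theta> * norm v"
            using S_increment[OF s(2), of "s - grid_floor \<delta> s" \<theta> v] g theta by (simp add: norm_minus_commute)
          also have "\<dots> \<le> (\<delta> / (t - s)) powr \<theta> * norm v"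
            using s g theta by (intro mult_right_mono powr_mono2 divide_right_mono) auto
          finally have "\<bar>fluct i s \<omega>\<bar> * norm (S (t - s) v - S ((t - s) + (s - grid_floor \<delta> s)) v) \<le> 1 * ((\<delta> / (t - s)) powr \<theta> * norm v)"
            using fluct_bound[of i s \<omega>] by (intro mult_mono) auto
          then have "norm (indicat_real {0..t} s *\<^sub>R (fluct i s \<omega> *\<^sub>R (S (max (t - s) 0) v - S (max (t - grid_floor \<delta> s) 0) v)))
             \<le> (indicat_real {0..t} s * (\<delta> / (t - s)) powr \<theta>) * \<bar>norm v\<bar>"
            using True by (simp add: mx)
          then show "ennreal (norm (indicat_real {0..t} s *\<^sub>R (fluct i s \<omega> *\<^sub>R (S (max (t - s) 0) v - S (max (t - grid_floor \<delta> s) 0) v))))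
             \<le> ennreal (indicat_real {0..t} s * (\<delta> / (t - s)) powr \<theta>) * ennreal \<bar>norm v\<bar>"
            by (subst ennreal_mult[symmetric]) (auto intro: ennreal_leI)
        qed simp
      qed
    qed
  qed
qed (use T c d theta in auto)

lemma cell_fluct_le: "\<omega> \<in> space M \<Longrightarrow> 0 < \<delta> \<Longrightarrow> \<bar>cell_fluct i \<delta> t j \<omega>\<bar> \<le> \<delta>"
proof -
  assume \<omega>[measurable]: "\<omega> \<in> space M" and d: "0 < \<delta>"
  let ?I = "{real j * \<delta>..min (real (Suc j) * \<delta>) t}"
  have "ennreal (norm (cell_fluct i \<delta> t j \<omega>)) \<le> (\<integral>\<^sup>+ s. ennreal (norm (indicat_real ?I s * fluct i s \<omega>)) \<partial>lborel)"
    unfolding cell_fluct_def by (rule norm_integral_le_nn)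
  also have "\<dots> \<le> (\<integral>\<^sup>+ s. indicator {real j * \<delta>..real (Suc j) * \<delta>} s \<partial>lborel)"
    using fluct_bound by (intro nn_integral_mono) (auto simp: indicator_def abs_mult ennreal_leI simp flip: ennreal_1)
  also have "\<dots> = ennreal \<delta>" using d by (simp add: algebra_simps)
  finally show "\<bar>cell_fluct i \<delta> t j \<omega>\<bar> \<le> \<delta>" using d by (simp add: ennreal_le_iff)
qed

text \<open>Divided by \<open>\<delta>\<close>, a cell integral is at most \<open>1\<close> with
  second moment at most \<open>\<eta> / \<delta>\<close>, so \<open>Lp_bd_mult_small\<close>
  applies. The at most \<open>t / \<delta> + 1\<close> cells are added by the triangle inequality,
  each with its factor \<open>\<delta>\<close>; this costs
  \<open>t + \<delta> \<le> T + 1\<close>.\<close>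

lemma frozen_part_bound:
  assumes p: "1 < p" "p < q" "q \<le> 2" and t: "t \<in> {0..T}" and d: "0 < \<delta>" "\<delta> \<le> 1" and c: "c > 0"
    and mom: "\<And>s. s \<in> {0..T} \<Longrightarrow> Lp_bd M q (\<lambda>\<omega>. b (Y s \<omega>) i) c"
    and \<eta>: "\<eta> > 0" and osc: "\<And>a c. 0 \<le> a \<Longrightarrow> a \<le> c \<Longrightarrow> c \<le> T \<Longrightarrow>
       (\<integral>\<omega>. (\<integral>u. indicator {a..c} u * fluct i u \<omega> \<partial>lborel)\<^sup>2 \<partial>M) \<le> (c - a) * \<eta>"
  shows "Lp_bd M p (frozen_part i \<delta> t) ((T + 1) * ((c powr q + 1) powr (1 / p) * (\<eta> / \<delta>) powr ((q - p) / (p * q))))"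
proof -
  let ?k = "(c powr q + 1) powr (1 / p) * (\<eta> / \<delta>) powr ((q - p) / (p * q))"
  let ?N = "nat \<lfloor>t / \<delta>\<rfloor> + 1"

  have "0 < c powr q + 1" by (simp add: add_nonneg_pos)
  then have k: "?k > 0" using \<eta> d by simp
  have cell: "Lp_bd M p (\<lambda>\<omega>. cell_fluct i \<delta> t j \<omega> *\<^sub>R S (max (t - real j * \<delta>) 0) (b (Y (real j * \<delta>) \<omega>) i)) (\<delta> * ?k)"
    if j: "j < ?N" for j
  proof -
    have "real j \<le> t / \<delta>" using j t d by (simp add: less_Suc_eq_le le_nat_iff le_floor_iff)
    then have jt: "real j * \<delta> \<le> t" using d by (simp add: pos_le_divide_eq)
    define U where "U \<omega> = cell_fluct i \<delta> t j \<omega> / \<delta>" for \<omega>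
    have [measurable]: "U \<in> borel_measurable M" unfolding U_def by measurable
    have U1: "\<bar>U \<omega>\<bar> \<le> 1" if "\<omega> \<in> space M" for \<omega>
      using cell_fluct_le[OF that d(1), of i t j] d by (simp add: U_def)
    have "(\<integral>\<omega>. (cell_fluct i \<delta> t j \<omega>)\<^sup>2 \<partial>M) \<le> (min (real (Suc j) * \<delta>) t - real j * \<delta>) * \<eta>"
      unfolding cell_fluct_def using jt t d by (intro osc) (auto simp: distrib_right)
    also have "\<dots> \<le> \<delta> * \<eta>" using \<eta> by (intro mult_right_mono) (auto simp: distrib_right)
    finally have o2: "(\<integral>\<omega>. (cell_fluct i \<delta> t j \<omega>)\<^sup>2 \<partial>M) \<le> \<delta> * \<eta>" .
    have iU: "integrable M (\<lambda>\<omega>. (U \<omega>)\<^sup>2)"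
      by (rule integrable_const_bound[where B=1]) (use U1 in \<open>auto simp: abs_square_le_1\<close>)
    have "(\<integral>\<^sup>+ \<omega>. ennreal ((U \<omega>)\<^sup>2) \<partial>M) = ennreal (\<integral>\<omega>. (U \<omega>)\<^sup>2 \<partial>M)"
      by (rule nn_integral_eq_integral[OF iU]) auto
    also have "(\<integral>\<omega>. (U \<omega>)\<^sup>2 \<partial>M) = (\<integral>\<omega>. (cell_fluct i \<delta> t j \<omega>)\<^sup>2 \<partial>M) / \<delta>\<^sup>2"
      by (simp add: U_def power_divide)
    also have "\<dots> \<le> (\<delta> * \<eta>) / \<delta>\<^sup>2" using o2 by (intro divide_right_mono) auto
    also have "(\<delta> * \<eta>) / \<delta>\<^sup>2 = \<eta> / \<delta>" using d by (simp add: power2_eq_square)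
    finally have U2: "(\<integral>\<^sup>+ \<omega>. ennreal ((U \<omega>)\<^sup>2) \<partial>M) \<le> ennreal (\<eta> / \<delta>)" by (simp add: ennreal_leI)
    have "real j * \<delta> \<in> {0..T}" using jt t d by auto
    from mom[OF this] have G: "Lp_bd M q (\<lambda>\<omega>. norm (b (Y (real j * \<delta>) \<omega>) i)) c" by (simp only: Lp_bd_norm)
    have "Lp_bd M p (\<lambda>\<omega>. U \<omega> * norm (b (Y (real j * \<delta>) \<omega>) i)) ?k"
      using \<eta> d by (intro Lp_bd_mult_small U1 U2 p G) auto
    from Lp_bd_scaleR[OF this _ less_imp_le[OF k], of \<delta>]
    have "Lp_bd M p (\<lambda>\<omega>. \<delta> *\<^sub>R (U \<omega> * norm (b (Y (real j * \<delta>) \<omega>) i))) (\<delta> * ?k)" using d by simp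
    then show ?thesis
    proof (rule Lp_bd_mono)
      show "AE \<omega> in M. norm (cell_fluct i \<delta> t j \<omega> *\<^sub>R S (max (t - real j * \<delta>) 0) (b (Y (real j * \<delta>) \<omega>) i))
          \<le> norm (\<delta> *\<^sub>R (U \<omega> * norm (b (Y (real j * \<delta>) \<omega>) i)))"
      proof (intro AE_I2)
        fix \<omega>
        have "\<bar>cell_fluct i \<delta> t j \<omega>\<bar> * norm (S (max (t - real j * \<delta>) 0) (b (Y (real j * \<delta>) \<omega>) i))
            \<le> \<bar>cell_fluct i \<delta> t j \<omega>\<bar> * norm (b (Y (real j * \<delta>) \<omega>) i)"
          by (intro mult_left_mono S_contraction) auto
        then show "norm (cell_fluct i \<delta> t j \<omega> *\<^sub>R S (max (t - real j * \<delta>) 0) (b (Y (real j * \<delta>) \<omega>) i))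
          \<le> norm (\<delta> *\<^sub>R (U \<omega> * norm (b (Y (real j * \<delta>) \<omega>) i)))"
          using d by (simp add: U_def abs_mult)
      qed
    qed (use k d p in auto)
  qed
  have "Lp_bd M p (frozen_part i \<delta> t) (real (card {..<?N}) * (\<delta> * ?k))"
    unfolding frozen_part_def[abs_def]
  proof (rule Lp_bd_sum[OF p(1)])
    show "{..<?N} \<noteq> {}" by (auto simp: lessThan_empty_iff)
    show "0 < \<delta> * ?k" using k d by simp
  qed (use cell in auto)
  then show ?thesis
  proof (rule Lp_bd_mono)
    have "real ?N \<le> t / \<delta> + 1" using t d by simp
    then have "real ?N * \<delta> \<le> (t / \<delta> + 1) * \<delta>" using d by (intro mult_right_mono) auto
    also have "\<dots> = t + \<delta>" using d by (simp add: distrib_right)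
    also have "\<dots> \<le> T + 1" using t d by simp
    finally have "(real ?N * \<delta>) * ?k \<le> (T + 1) * ?k" using k by (intro mult_right_mono) auto
    then show "real (card {..<?N}) * (\<delta> * ?k) \<le> (T + 1) * ?k" by (simp only: card_lessThan mult.assoc)
    show "0 \<le> real (card {..<?N}) * (\<delta> * ?k)" using k d by (intro mult_nonneg_nonneg) auto
  qed (use p in auto)
qed

text \<open>Telescoping through two intermediate integrals: first the path is frozen, then the
  semigroup time, and the last integral is \<open>frozen_part\<close>.\<close>

lemma err_decomposition:
  assumes \<omega>: "\<omega> \<in> space M" and t: "t \<ge> 0" and d: "\<delta> > 0"
    and f1: "(\<integral>\<^sup>+ s\<in>{0..t}. ennreal (norm (b (Y s \<omega>) i)) \<partial>lborel) < \<infinity>"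
    and f2: "(\<integral>\<^sup>+ s\<in>{0..t}. ennreal (norm (b (Y (grid_floor \<delta> s) \<omega>) i)) \<partial>lborel) < \<infinity>"
  shows "integrable lborel (\<lambda>s. indicator {0..t} s *\<^sub>R (fluct i s \<omega> *\<^sub>R S (max (t - s) 0) (b (Y s \<omega>) i)))"
    "(\<integral>s. indicator {0..t} s *\<^sub>R (fluct i s \<omega> *\<^sub>R S (max (t - s) 0) (b (Y s \<omega>) i)) \<partial>lborel)
      = freeze_drift i \<delta> t \<omega> + freeze_semigroup i \<delta> t \<omega> + frozen_part i \<delta> t \<omega>"
proof -
  note [measurable] = \<omega>
  let ?u = "\<lambda>s. b (Y s \<omega>) i" and ?v = "\<lambda>s. b (Y (grid_floor \<delta> s) \<omega>) i"
  let ?I0 = "\<lambda>s. indicator {0..t} s *\<^sub>R (fluct i s \<omega> *\<^sub>R S (max (t - s) 0) (?u s))"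
  let ?I1 = "\<lambda>s. indicator {0..t} s *\<^sub>R (fluct i s \<omega> *\<^sub>R S (max (t - s) 0) (?v s))"
  let ?I2 = "\<lambda>s. indicator {0..t} s *\<^sub>R (fluct i s \<omega> *\<^sub>R S (max (t - grid_floor \<delta> s) 0) (?v s))"
  have zS: "norm (fluct i s \<omega> *\<^sub>R S (max r 0) y) \<le> norm y" for s r y
    using mult_mono[OF fluct_bound[of i s \<omega>] S_contraction[of "max r 0" y]] by simp
  show i0: "integrable lborel ?I0"
    by (rule integrable_indicator_dominated[OF _ _ zS f1]) measurable
  have i1: "integrable lborel ?I1"
    by (rule integrable_indicator_dominated[OF _ _ zS f2]) measurable
  have i2: "integrable lborel ?I2"
    by (rule integrable_indicator_dominated[OF _ _ zS f2]) measurable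
  have A: "freeze_drift i \<delta> t \<omega> = integral\<^sup>L lborel ?I0 - integral\<^sup>L lborel ?I1"
    unfolding freeze_drift_def Bochner_Integration.integral_diff[OF i0 i1, symmetric]
    by (rule Bochner_Integration.integral_cong[OF refl]) (simp add: S_diff scaleR_diff_right)
  have B: "freeze_semigroup i \<delta> t \<omega> = integral\<^sup>L lborel ?I1 - integral\<^sup>L lborel ?I2"
    unfolding freeze_semigroup_def Bochner_Integration.integral_diff[OF i1 i2, symmetric]
    by (rule Bochner_Integration.integral_cong[OF refl]) (simp add: scaleR_diff_right)
  let ?J = "\<lambda>j. {real j * \<delta>..min (real (Suc j) * \<delta>) t}"
  let ?y = "\<lambda>j. S (max (t - real j * \<delta>) 0) (b (Y (real j * \<delta>) \<omega>) i)"
  have iz: "integrable lborel (\<lambda>s. indicat_real (?J j) s * fluct i s \<omega>)" for j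
  proof (rule integrableI_bounded_set[where A="?J j" and B=1])
    show "AE s\<in>?J j in lborel. norm (indicat_real (?J j) s * fluct i s \<omega>) \<le> 1"
      using fluct_bound by (intro AE_I2) auto
  qed (auto simp: emeasure_lborel_Icc_eq)
  have "integral\<^sup>L lborel ?I2 = (\<integral>s. (\<Sum>j<nat \<lfloor>t / \<delta>\<rfloor> + 1. (indicat_real (?J j) s * fluct i s \<omega>) *\<^sub>R ?y j) \<partial>lborel)"
  proof (rule integral_cong_AE)
    have "countable (range (\<lambda>j::nat. real j * \<delta>))" by simp
    then have "range (\<lambda>j::nat. real j * \<delta>) \<in> null_sets lborel" by (rule countable_imp_null_set_lborel)
    then have "AE s in lborel. s \<notin> range (\<lambda>j::nat. real j * \<delta>)" by (rule AE_not_in)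
    then show "AE s in lborel. ?I2 s = (\<Sum>j<nat \<lfloor>t / \<delta>\<rfloor> + 1. (indicat_real (?J j) s * fluct i s \<omega>) *\<^sub>R ?y j)"
    proof eventually_elim
      case (elim s)
      have "(\<Sum>j<nat \<lfloor>t / \<delta>\<rfloor> + 1. (indicat_real (?J j) s * fluct i s \<omega>) *\<^sub>R ?y j)
        = (\<Sum>j<nat \<lfloor>t / \<delta>\<rfloor> + 1. indicat_real (?J j) s *\<^sub>R (fluct i s \<omega> *\<^sub>R ?y j))"
        by (simp only: scaleR_scaleR)
      also have "\<dots> = indicator {0..t} s *\<^sub>R (fluct i s \<omega> *\<^sub>R ?y (nat \<lfloor>s / \<delta>\<rfloor>))"
        by (rule grid_cell_sum[OF d t elim])
      also have "\<dots> = ?I2 s"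
      proof (cases "s \<in> {0..t}")
        case True
        then have "0 \<le> \<lfloor>s / \<delta>\<rfloor>" using d by simp
        then have "real (nat \<lfloor>s / \<delta>\<rfloor>) * \<delta> = grid_floor \<delta> s" by (simp add: grid_floor_def mult.commute)
        then show ?thesis by (simp only:)
      qed simp
      finally show ?case ..
    qed
  qed measurable
  also have "\<dots> = (\<Sum>j<nat \<lfloor>t / \<delta>\<rfloor> + 1. \<integral>s. (indicat_real (?J j) s * fluct i s \<omega>) *\<^sub>R ?y j \<partial>lborel)"
    using iz by (intro Bochner_Integration.integral_sum integrable_scaleR_left)
  also have "\<dots> = frozen_part i \<delta> t \<omega>"
    unfolding frozen_part_def cell_fluct_def using iz by (intro sum.cong refl integral_scaleR_left)
  finally have C: "integral\<^sup>L lborel ?I2 = frozen_part i \<delta> t \<omega>" .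
  show "integral\<^sup>L lborel ?I0 = freeze_drift i \<delta> t \<omega> + freeze_semigroup i \<delta> t \<omega> + frozen_part i \<delta> t \<omega>"
    unfolding A B C by simp
qed

lemma mconv_decomposition:
  assumes q: "1 < q" "q < \<alpha>" and d: "\<delta> > 0" and t: "t \<in> {0..T}"
  shows "AE \<omega> in M. mconv (\<lambda>s. b (Y s \<omega>) (R s \<omega>) - bbar (Y s \<omega>)) t
     = (\<Sum>i\<in>UNIV. freeze_drift i \<delta> t \<omega> + freeze_semigroup i \<delta> t \<omega> + frozen_part i \<delta> t \<omega>)"
  using Y_finite[OF q d t] AE_space
proof eventually_elim
  case (elim \<omega>)
  have t0: "t \<ge> 0" using t by simp
  note dec = err_decomposition[OF elim(2) t0 d elim(1)[rule_format, THEN conjunct1] elim(1)[rule_format, THEN conjunct2]]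
  have "mconv (\<lambda>s. b (Y s \<omega>) (R s \<omega>) - bbar (Y s \<omega>)) t
     = (\<integral>s. (\<Sum>i\<in>UNIV. indicator {0..t} s *\<^sub>R (fluct i s \<omega> *\<^sub>R S (max (t - s) 0) (b (Y s \<omega>) i))) \<partial>lborel)"
    unfolding mconv_def
  proof (rule Bochner_Integration.integral_cong[OF refl])
    fix s
    interpret bounded_linear "S (max (t - s) 0)" by (rule S_bl) simp
    show "indicator {0..t} s *\<^sub>R S (max (t - s) 0) (b (Y s \<omega>) (R s \<omega>) - bbar (Y s \<omega>))
      = (\<Sum>i\<in>UNIV. indicator {0..t} s *\<^sub>R (fluct i s \<omega> *\<^sub>R S (max (t - s) 0) (b (Y s \<omega>) i)))"
      unfolding drift_difference sum scaleR fluct_def scaleR_sum_right ..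
  qed
  also have "\<dots> = (\<Sum>i\<in>UNIV. \<integral>s. indicator {0..t} s *\<^sub>R (fluct i s \<omega> *\<^sub>R S (max (t - s) 0) (b (Y s \<omega>) i)) \<partial>lborel)"
    by (rule Bochner_Integration.integral_sum) (rule dec(1))
  also have "\<dots> = (\<Sum>i\<in>UNIV. freeze_drift i \<delta> t \<omega> + freeze_semigroup i \<delta> t \<omega> + frozen_part i \<delta> t \<omega>)"
    by (simp only: dec(2))
  finally show ?case .
qed

end

end

section \<open>Assembly of the rate\<close>

lemma Lp_norm_le:
  assumes "Lp_bd M p f c" "c \<ge> 0" "p > 0"
  shows "Lp_norm M p f \<le> ennreal c"
proof -
  define I where "I = (\<integral>\<^sup>+ \<omega>. ennreal (norm (f \<omega>) powr p) \<partial>M)"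
  have I: "I \<le> ennreal (c powr p)" using assms(1) by (simp add: Lp_bd_def I_def)
  then have fin: "I \<noteq> \<infinity>" by (auto simp: top_unique)
  have "enn2real I \<le> c powr p" using I by (rule enn2real_leI[rotated]) simp
  then have "enn2real I powr (1 / p) \<le> (c powr p) powr (1 / p)"
    using assms(3) by (intro powr_mono2) auto
  also have "\<dots> = c" using assms(2,3) by (simp add: powr_powr)
  finally show ?thesis using fin by (simp add: Lp_norm_def I_def[symmetric] ennreal_leI)
qed

context averaging begin

text \<open>The constant is chosen before \<open>R\<close>, \<open>\<epsilon>\<close>,
  \<open>\<delta>\<close> and \<open>t\<close>, hence the quantifiers inside the conclusion; the
  chain enters only through joint measurability and the second moment bound on intervals.\<close>

lemma average_error:
  assumes pq: "1 < p" "p < q" "q < \<alpha>" "\<alpha> \<le> 2" and C0: "C0 > 0"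
  shows "\<exists>C>0. \<forall>R \<epsilon> \<delta> t. (\<lambda>(s, \<omega>). R s \<omega>) \<in> measurable (borel \<Otimes>\<^sub>M M) (count_space UNIV) \<and> 0 < \<epsilon> \<and> 0 < \<delta> \<and> \<delta> \<le> 1 \<and> t \<in> {0..T} \<and>
     (\<forall>i a c. 0 \<le> a \<and> a \<le> c \<and> c \<le> T \<longrightarrow>
        (\<integral>\<omega>. (\<integral>u. indicator {a..c} u * cvec i $ R u \<omega> \<partial>lborel)\<^sup>2 \<partial>M) \<le> (c - a) * (\<epsilon> * C0)) \<longrightarrow>
     Lp_bd M p (\<lambda>\<omega>. mconv (\<lambda>s. b (Y s \<omega>) (R s \<omega>) - bbar (Y s \<omega>)) t) (C * (\<delta> powr \<theta> + (\<epsilon> / \<delta>) powr ((q - p) / (p * q))))"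
proof -
  have p: "1 < p" "p < \<alpha>" and q: "1 < q" "q < \<alpha>" using pq by auto
  define \<gamma> where "\<gamma> = (q - p) / (p * q)"
  obtain Cp where Cp: "Cp > 0" "\<And>t. t \<in> {0..T} \<Longrightarrow> Lp_bd M p (Y t) Cp" using Y_moment[OF p] by blast
  obtain Cq where Cq: "Cq > 0" "\<And>t. t \<in> {0..T} \<Longrightarrow> Lp_bd M q (Y t) Cq" using Y_moment[OF q] by blast
  obtain Ci where Ci: "Ci > 0" "\<And>s t \<delta>. 0 \<le> s \<and> s \<le> t \<and> t \<le> T \<and> t - s \<le> \<delta> \<and> 0 < \<delta> \<and> \<delta> \<le> 1
      \<Longrightarrow> Lp_bd M p (\<lambda>\<omega>. Y t \<omega> - Y s \<omega>) (Ci * \<delta> powr \<theta>)" using Y_increment[OF p] by blast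
  define c1 c2 where "c1 = B0 + K * Cp" and "c2 = B0 + K * Cq"
  have c12: "c1 > 0" "c2 > 0" using B0 K Cp Cq by (auto simp: c1_def c2_def intro: add_pos_pos)
  \<comment> \<open>Constants of the three errors: freezing the path, freezing the semigroup, and
    the oscillation of the chain; \<open>C0 powr \<gamma>\<close> comes out of
    \<open>(\<epsilon> * C0 / \<delta>) powr \<gamma>\<close>.\<close>
  define a1 a2 a3 where "a1 = T * (K * Ci)" and "a2 = (T powr (1 - \<theta>) / (1 - \<theta>)) * c1"
    and "a3 = (T + 1) * ((c2 powr q + 1) powr (1 / p) * C0 powr \<gamma>)"
  have "0 < c2 powr q + 1" by (simp add: add_nonneg_pos)
  then have a: "a1 > 0" "a2 > 0" "a3 > 0" using T K Ci c12 theta C0 by (auto simp: a1_def a2_def a3_def)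
  let ?n = "real (card (UNIV :: 's set))"
  have n: "?n > 0" by (simp add: card_gt_0_iff)
  have main: "Lp_bd M p (\<lambda>\<omega>. mconv (\<lambda>s. b (Y s \<omega>) (R s \<omega>) - bbar (Y s \<omega>)) t)
      (?n * (a1 + a2 + a3) * (\<delta> powr \<theta> + (\<epsilon> / \<delta>) powr \<gamma>))"
    if R: "(\<lambda>(s, \<omega>). R s \<omega>) \<in> measurable (borel \<Otimes>\<^sub>M M) (count_space UNIV)"
      and e: "0 < \<epsilon>" and d: "0 < \<delta>" "\<delta> \<le> 1" and t: "t \<in> {0..T}"
      and osc: "\<And>i a c. 0 \<le> a \<Longrightarrow> a \<le> c \<Longrightarrow> c \<le> T \<Longrightarrow>
        (\<integral>\<omega>. (\<integral>u. indicator {a..c} u * cvec i $ R u \<omega> \<partial>lborel)\<^sup>2 \<partial>M) \<le> (c - a) * (\<epsilon> * C0)"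
    for R \<epsilon> \<delta> t
  proof -
    note [measurable] = err_measurable[OF R]
    define x1 x2 where "x1 = \<delta> powr \<theta>" and "x2 = (\<epsilon> / \<delta>) powr \<gamma>"
    have x12: "x1 > 0" "x2 > 0" using d e by (auto simp: x1_def x2_def)
    have A: "Lp_bd M p (freeze_drift R i \<delta> t) (a1 * x1)" for i
    proof -
      have "Lp_bd M p (\<lambda>\<omega>. Y s \<omega> - Y (grid_floor \<delta> s) \<omega>) (Ci * x1)" if "s \<in> {0..T}" for s
        unfolding x1_def using grid_floor_bounds[OF d(1), of s] that d by (intro Ci(2)) auto
      from freeze_drift_bound[OF R p t d _ this] Ci x12
      have "Lp_bd M p (freeze_drift R i \<delta> t) (T * (K * (Ci * x1)))" by simp
      then show ?thesis by (simp only: a1_def mult.assoc)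
    qed
    have B: "Lp_bd M p (freeze_semigroup R i \<delta> t) (a2 * x1)" for i
    proof -
      have "Lp_bd M p (freeze_semigroup R i \<delta> t) ((\<delta> powr \<theta> * (T powr (1 - \<theta>) / (1 - \<theta>))) * c1)"
        unfolding c1_def using Cp p by (intro freeze_semigroup_bound[OF R p t d] drift_moment(2)) (use c12 c1_def in auto)
      then show ?thesis by (simp only: a2_def x1_def mult_ac)
    qed
    have C: "Lp_bd M p (frozen_part R i \<delta> t) (a3 * x2)" for i
    proof -
      have "Lp_bd M p (frozen_part R i \<delta> t) ((T + 1) * ((c2 powr q + 1) powr (1 / p) * (\<epsilon> * C0 / \<delta>) powr \<gamma>))"
        unfolding \<gamma>_def
      proof (rule frozen_part_bound[OF R _ _ _ t d c12(2)])
        show "Lp_bd M q (\<lambda>\<omega>. b (Y s \<omega>) i) c2" if "s \<in> {0..T}" for s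
          unfolding c2_def by (rule drift_moment(2)[OF Cq(2)[OF that] Cq(1) q(1)])
        show "(\<integral>\<omega>. (\<integral>u. indicator {a..c} u * fluct R i u \<omega> \<partial>lborel)\<^sup>2 \<partial>M) \<le> (c - a) * (\<epsilon> * C0)"
          if "0 \<le> a" "a \<le> c" "c \<le> T" for a c
          unfolding fluct_def[OF R] by (rule osc[OF that])
      qed (use pq e C0 in auto)
      also have "(\<epsilon> * C0 / \<delta>) powr \<gamma> = C0 powr \<gamma> * (\<epsilon> / \<delta>) powr \<gamma>"
        using e C0 d by (simp add: powr_mult[symmetric] mult.commute)
      finally show ?thesis by (simp only: a3_def x2_def mult.assoc)
    qed
    have pos: "0 < a1 * x1" "0 < a2 * x1" "0 < a3 * x2" using a x12 by auto
    have "Lp_bd M p (\<lambda>\<omega>. \<Sum>i\<in>UNIV. freeze_drift R i \<delta> t \<omega> + freeze_semigroup R i \<delta> t \<omega> + frozen_part R i \<delta> t \<omega>)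
        (?n * ((a1 * x1 + a2 * x1) + a3 * x2))"
      using pos by (intro Lp_bd_sum Lp_bd_add A B C p) (auto intro: add_pos_pos)
    then show ?thesis
    proof (rule Lp_bd_mono)
      show "AE \<omega> in M. norm (mconv (\<lambda>s. b (Y s \<omega>) (R s \<omega>) - bbar (Y s \<omega>)) t)
         \<le> norm (\<Sum>i\<in>UNIV. freeze_drift R i \<delta> t \<omega> + freeze_semigroup R i \<delta> t \<omega> + frozen_part R i \<delta> t \<omega>)"
        using mconv_decomposition[OF R p d(1) t] by eventually_elim simp
      have "(a1 * x1 + a2 * x1) + a3 * x2 \<le> (a1 + a2 + a3) * (x1 + x2)"
      proof -
        have "0 \<le> a1 * x2" "0 \<le> a2 * x2" "0 \<le> a3 * x1" using a x12 by auto
        then show ?thesis by (simp add: distrib_left distrib_right)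
      qed
      then have "?n * ((a1 * x1 + a2 * x1) + a3 * x2) \<le> ?n * ((a1 + a2 + a3) * (x1 + x2))"
        using n by (intro mult_left_mono) auto
      then show "?n * ((a1 * x1 + a2 * x1) + a3 * x2) \<le> ?n * (a1 + a2 + a3) * (\<delta> powr \<theta> + (\<epsilon> / \<delta>) powr \<gamma>)"
        by (simp only: x1_def x2_def mult.assoc)
      have "0 \<le> (a1 * x1 + a2 * x1) + a3 * x2" using pos by linarith
      then show "0 \<le> ?n * ((a1 * x1 + a2 * x1) + a3 * x2)" using n by simp
    qed (use p in simp)
  qed
  have "0 < ?n * (a1 + a2 + a3)" using n a by simp
  then show ?thesis using main unfolding \<gamma>_def by (intro exI[of _ "?n * (a1 + a2 + a3)"]) blast
qed

text \<open>The initial values and the noise cancel, so the difference is a convolution of drift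
  differences. Inserting the switching drift along the averaged path splits it into a Lipschitz term
  for Gronwall and the averaging error as forcing. \<open>R\<close> is the jointly measurable
  version of \<open>r\<close>.\<close>

lemma difference_bound:
  assumes p: "1 < p" "p < \<alpha>" and c: "c > 0"
    and R: "(\<lambda>(s, \<omega>). R s \<omega>) \<in> measurable (borel \<Otimes>\<^sub>M M) (count_space UNIV)"
    and r: "AE \<omega> in M. \<forall>t\<ge>0. R t \<omega> = r t \<omega>"
    and X: "mild_solution M F S e \<beta> L (\<lambda>s \<omega> y. b y (r s \<omega>)) x X"
    and avg: "\<And>t. t \<in> {0..T} \<Longrightarrow> Lp_bd M p (\<lambda>\<omega>. mconv (\<lambda>s. b (Y s \<omega>) (R s \<omega>) - bbar (Y s \<omega>)) t) c"
    and t: "t \<in> {0..T}"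
  shows "Lp_bd M p (\<lambda>\<omega>. X t \<omega> - Xbar t \<omega>) ((1 + K * (2 * exp (2 * K * T)) * T) * c)"
proof -
  define Z where "Z t = X (max t 0)" for t
  have "predictable_process M F X" using X by (simp add: mild_solution_def)
  from predictable_jointly_measurable[OF basis this]
  have Zj: "case_prod Z \<in> borel_measurable (borel \<Otimes>\<^sub>M M)" by (simp add: Z_def[abs_def])
  have Zc[measurable (raw)]: "(\<lambda>x. Z (f x) (g x)) \<in> borel_measurable N"
    if "f \<in> borel_measurable N" "g \<in> measurable N M" for f g and N :: "'z measure"
    by (rule joint_comp[OF Zj that])
  have bm: "(\<lambda>x. b (G (f x) (g x)) (R (f x) (g x))) \<in> borel_measurable N"
    if "case_prod G \<in> borel_measurable (borel \<Otimes>\<^sub>M M)" "f \<in> borel_measurable N" "g \<in> measurable N M"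
    for f g G and N :: "'z measure"
    by (intro b_measurable joint_comp[OF that] joint_comp[OF R that(2,3)])
  \<comment> \<open>Switching drift along the given solution, switching drift along
    \<open>Y\<close>, averaged drift along \<open>Y\<close>: \<open>f1 - f2\<close> is estimated by
    Lipschitz continuity, \<open>f2 - f3\<close> is the averaging error.\<close>
  define f1 f2 f3 where "f1 \<omega> s = b (Z s \<omega>) (R s \<omega>)" and "f2 \<omega> s = b (Y s \<omega>) (R s \<omega>)" and "f3 \<omega> s = bbar (Y s \<omega>)" for \<omega> s
  have fm[measurable]: "f1 \<omega> \<in> borel_measurable borel" "f2 \<omega> \<in> borel_measurable borel" "f3 \<omega> \<in> borel_measurable borel"
    if "\<omega> \<in> space M" for \<omega>
    unfolding f1_def[abs_def] f2_def[abs_def] f3_def[abs_def] using that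
    by (auto intro!: bm Zj Y_joint)
  define fin where "fin t g \<longleftrightarrow> (\<integral>\<^sup>+ s\<in>{0..t}. ennreal (norm (g s :: 'h)) \<partial>lborel) < \<infinity>" for t :: real and g
  have key: "AE \<omega> in M. Z t \<omega> - Y t \<omega> = mconv (f1 \<omega>) t - mconv (f3 \<omega>) t \<and> fin t (f1 \<omega>) \<and> fin t (f2 \<omega>) \<and> fin t (f3 \<omega>)"
    if t: "t \<in> {0..T}" for t
  proof -
    have t0: "t \<ge> 0" using t by simp
    obtain W where W: "conv t W" "AE \<omega> in M. noise t \<omega> = W \<omega> \<and> (\<integral>\<^sup>+ s\<in>{0..t}. ennreal (norm (bbar (Y s \<omega>))) \<partial>lborel) < \<infinity>"
      using mild_conv[OF t0] by blast
    obtain W' where W': "conv t W'" "AE \<omega> in M. set_integrable lborel {0..t} (\<lambda>s. b (X s \<omega>) (r s \<omega>)) \<and>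
           X t \<omega> = S t x + (LINT s:{0..t}|lborel. S (t - s) (b (X s \<omega>) (r s \<omega>))) + W' \<omega>"
      using X t0 unfolding mild_solution_def by blast
    show ?thesis
      using W(2) W'(2) conv_unique[OF t0 W(1) W'(1)] r Y_finite[OF p zero_less_one t] AE_space
    proof eventually_elim
      case (elim \<omega>)
      have f1: "f1 \<omega> s = b (X s \<omega>) (r s \<omega>)" if "0 \<le> s" for s
        using elim(4) that by (simp add: f1_def Z_def max_def)
      have "(LINT s:{0..t}|lborel. S (t - s) (b (X s \<omega>) (r s \<omega>))) = mconv (f1 \<omega>) t"
        unfolding mconv_def set_lebesgue_integral_def
        by (rule Bochner_Integration.integral_cong[OF refl]) (auto simp: indicator_def max_def f1)
      then have Zt: "Z t \<omega> = S t x + mconv (f1 \<omega>) t + W' \<omega>" using elim(2) t0 by (simp add: Z_def)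
      have m0: "max t 0 = t" using t0 by simp
      have "Y t \<omega> = S t x + mconv (f3 \<omega>) t + W \<omega>"
        using elim(1) unfolding noise_def m0 f3_def[abs_def] by (simp add: algebra_simps)
      then have 1: "Z t \<omega> - Y t \<omega> = mconv (f1 \<omega>) t - mconv (f3 \<omega>) t" using Zt elim(3) by simp
      have "(\<integral>\<^sup>+ s\<in>{0..t}. ennreal (norm (f1 \<omega> s)) \<partial>lborel)
         = (\<integral>\<^sup>+ s. ennreal (norm (indicator {0..t} s *\<^sub>R b (X s \<omega>) (r s \<omega>))) \<partial>lborel)"
        by (intro nn_integral_cong) (auto simp: indicator_def f1)
      then have 2: "fin t (f1 \<omega>)" using elim(2) by (simp add: fin_def set_integrable_def integrable_iff_bounded)
      have 3: "fin t (f3 \<omega>)" using elim(1) by (simp add: fin_def f3_def)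
      note [measurable] = elim(6)
      have "(\<integral>\<^sup>+ s\<in>{0..t}. ennreal (norm (f2 \<omega> s)) \<partial>lborel) \<le> (\<integral>\<^sup>+ s. (\<Sum>i\<in>UNIV. ennreal (norm (b (Y s \<omega>) i)) * indicator {0..t} s) \<partial>lborel)"
        unfolding f2_def by (intro nn_integral_mono member_le_sum[where f="\<lambda>i. ennreal (norm (b (Y _ \<omega>) i)) * indicator {0..t} _"]) auto
      also have "\<dots> = (\<Sum>i\<in>UNIV. (\<integral>\<^sup>+ s\<in>{0..t}. ennreal (norm (b (Y s \<omega>) i)) \<partial>lborel))"
        by (rule nn_integral_sum) measurable
      also have "\<dots> < \<infinity>" using elim(5) by simp
      finally have "fin t (f2 \<omega>)" by (simp add: fin_def)
      with 1 2 3 show ?case by blast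
    qed
  qed
  \<comment> \<open>The crude bound for Gronwall, almost surely finite because mild solutions have
    integrable drift; nothing is claimed about its moments.\<close>
  define m where "m \<omega> = (\<integral>\<^sup>+ s\<in>{0..T}. ennreal (norm (b (Z s \<omega>) (R s \<omega>) - bbar (Y s \<omega>))) \<partial>lborel)" for \<omega>
  define G where "G t \<omega> = norm (mconv (\<lambda>s. b (Y s \<omega>) (R s \<omega>) - bbar (Y s \<omega>)) t)" for t \<omega>
  have mm: "m \<in> borel_measurable M"
  proof -
    have [measurable]: "(\<lambda>p. b (Z (snd p) (fst p)) (R (snd p) (fst p)) - bbar (Y (snd p) (fst p))) \<in> borel_measurable (M \<Otimes>\<^sub>M lborel)"
      by (intro borel_measurable_diff bm Zj) measurable
    show ?thesis unfolding m_def
      by (intro lborel.borel_measurable_nn_integral) (simp add: case_prod_unfold, measurable)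
  qed
  have Gm: "case_prod G \<in> borel_measurable (borel \<Otimes>\<^sub>M M)"
  proof -
    have "(\<lambda>(t, \<omega>). mconv (\<lambda>s. b (Y s \<omega>) (R s \<omega>) - bbar (Y s \<omega>)) t) \<in> borel_measurable (borel \<Otimes>\<^sub>M M)"
      by (rule mconv_measurable) (auto simp: case_prod_unfold intro!: borel_measurable_diff bm Y_joint)
    then show ?thesis by (simp add: G_def[abs_def] case_prod_unfold)
  qed
  have fin_diff: "(\<integral>\<^sup>+ s\<in>{0..t}. ennreal (norm (g s - h s)) \<partial>lborel) < \<infinity>"
    if "fin t g" "fin t h" and [measurable]: "g \<in> borel_measurable borel" "h \<in> borel_measurable borel" for t g h
  proof -
    have "(\<integral>\<^sup>+ s\<in>{0..t}. ennreal (norm (g s - h s)) \<partial>lborel)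
      \<le> (\<integral>\<^sup>+ s. ennreal (norm (g s)) * indicator {0..t} s + ennreal (norm (h s)) * indicator {0..t} s \<partial>lborel)"
      by (intro nn_integral_mono) (auto simp: indicator_def norm_triangle_ineq4 ennreal_leI simp flip: ennreal_plus)
    also have "\<dots> = (\<integral>\<^sup>+ s\<in>{0..t}. ennreal (norm (g s)) \<partial>lborel) + (\<integral>\<^sup>+ s\<in>{0..t}. ennreal (norm (h s)) \<partial>lborel)"
      by (rule nn_integral_add) measurable
    finally show ?thesis using that(1,2) by (auto simp: fin_def less_top[symmetric] top_unique)
  qed
  have "Lp_bd M p (\<lambda>\<omega>. norm (Z t \<omega> - Y t \<omega>)) (c + K * (2 * exp (2 * K * T)) * (T * c))"
  proof (rule gronwall_Lp[OF prob_space_axioms p(1) K T c, where u="\<lambda>t \<omega>. norm (Z t \<omega> - Y t \<omega>)" and G=G and m=m and t=t])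
    show "(\<lambda>(t, \<omega>). norm (Z t \<omega> - Y t \<omega>)) \<in> borel_measurable (borel \<Otimes>\<^sub>M M)"
      unfolding case_prod_unfold by measurable
    show "Lp_bd M p (G t) c" if "t \<in> {0..T}" for t
      unfolding G_def[abs_def] Lp_bd_norm by (rule avg[OF that])
    have "T \<in> {0..T}" using T by simp
    from key[OF this] show "AE \<omega> in M. m \<omega> < \<infinity>"
      using AE_space
    proof eventually_elim
      case (elim \<omega>)
      then show ?case using fin_diff[of T "f1 \<omega>" "f3 \<omega>"] fm[OF elim(2)] T by (simp add: m_def f1_def f3_def)
    qed
    fix t assume t: "t \<in> {0..T}"
    show "AE \<omega> in M. ennreal (norm (Z t \<omega> - Y t \<omega>)) \<le> ennreal (G t \<omega>) + m \<omega>"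
      using key[OF t] AE_space
    proof eventually_elim
      case (elim \<omega>)
      have "Z t \<omega> - Y t \<omega> = mconv (\<lambda>s. f1 \<omega> s - f3 \<omega> s) t"
        using elim fm[OF elim(2)] unfolding fin_def by (simp add: mconv_diff)
      then have "ennreal (norm (Z t \<omega> - Y t \<omega>)) \<le> (\<integral>\<^sup>+ s\<in>{0..t}. ennreal (norm (f1 \<omega> s - f3 \<omega> s)) \<partial>lborel)"
        using norm_mconv_le by simp
      also have "\<dots> \<le> m \<omega>" unfolding m_def f1_def f3_def using t by (intro nn_integral_mono) (auto simp: indicator_def)
      finally show ?case by (rule add_increasing[rotated]) simp
    qed
    show "AE \<omega> in M. ennreal (norm (Z t \<omega> - Y t \<omega>)) \<le> ennreal (G t \<omega>) + ennreal K * (\<integral>\<^sup>+ s\<in>{0..t}. ennreal (norm (Z s \<omega> - Y s \<omega>)) \<partial>lborel)"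
      using key[OF t] AE_space
    proof eventually_elim
      case (elim \<omega>)
      note [measurable] = elim(2)
      have "Z t \<omega> - Y t \<omega> = (mconv (f1 \<omega>) t - mconv (f2 \<omega>) t) + (mconv (f2 \<omega>) t - mconv (f3 \<omega>) t)"
        using elim by simp
      also have "\<dots> = mconv (\<lambda>s. f1 \<omega> s - f2 \<omega> s) t + mconv (\<lambda>s. f2 \<omega> s - f3 \<omega> s) t"
        using elim fm[OF elim(2)] unfolding fin_def by (simp add: mconv_diff)
      finally have "norm (Z t \<omega> - Y t \<omega>) \<le> norm (mconv (\<lambda>s. f1 \<omega> s - f2 \<omega> s) t) + G t \<omega>"
        by (simp add: norm_triangle_ineq G_def f2_def[abs_def] f3_def[abs_def])
      then have "ennreal (norm (Z t \<omega> - Y t \<omega>)) \<le> ennreal (G t \<omega>) + ennreal (norm (mconv (\<lambda>s. f1 \<omega> s - f2 \<omega> s) t))"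
        by (simp add: G_def add.commute ennreal_leI flip: ennreal_plus)
      also have "ennreal (norm (mconv (\<lambda>s. f1 \<omega> s - f2 \<omega> s) t)) \<le> (\<integral>\<^sup>+ s\<in>{0..t}. ennreal (norm (f1 \<omega> s - f2 \<omega> s)) \<partial>lborel)"
        by (rule norm_mconv_le)
      also have "\<dots> \<le> (\<integral>\<^sup>+ s. ennreal K * (ennreal (norm (Z s \<omega> - Y s \<omega>)) * indicator {0..t} s) \<partial>lborel)"
        using K lip by (intro nn_integral_mono) (auto simp: indicator_def f1_def f2_def ennreal_leI simp flip: ennreal_mult)
      also have "\<dots> = ennreal K * (\<integral>\<^sup>+ s\<in>{0..t}. ennreal (norm (Z s \<omega> - Y s \<omega>)) \<partial>lborel)"
        by (rule nn_integral_cmult) measurable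
      finally show ?case by (simp add: add_left_mono)
    qed
  qed (use t mm Gm in \<open>auto simp: G_def\<close>)
  moreover have "max t 0 = t" using t by simp
  moreover have "c + K * (2 * exp (2 * K * T)) * (T * c) = (1 + K * (2 * exp (2 * K * T)) * T) * c"
    by (simp add: algebra_simps)
  ultimately show ?thesis by (simp only: Lp_bd_norm Z_def Y_def)
qed

text \<open>\<open>\<delta>\<close> stays free here, so that the balance with
  \<open>\<epsilon>\<close> becomes a question about exponents only.\<close>

lemma averaging_rate:
  fixes Qt Qh :: "real^'s^'s" and r :: "real \<Rightarrow> real \<Rightarrow> 'w \<Rightarrow> 's" and X :: "real \<Rightarrow> real \<Rightarrow> 'w \<Rightarrow> 'h"
  assumes pq: "1 < p" "p < q" "q < \<alpha>" "\<alpha> \<le> 2"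
    and h: "\<And>i. Qt *v h i = cvec i"
    and chain: "\<And>\<epsilon>. \<epsilon> \<in> {0<..<1} \<Longrightarrow> ct_markov_chain M (r \<epsilon>) ((1 / \<epsilon>) *\<^sub>R Qt + Qh)"
    and X: "\<And>\<epsilon>. \<epsilon> \<in> {0<..<1} \<Longrightarrow> mild_solution M F S e \<beta> L (\<lambda>s \<omega> y. b y (r \<epsilon> s \<omega>)) x (X \<epsilon>)"
  shows "\<exists>C>0. \<forall>\<epsilon>\<in>{0<..<1}. \<forall>\<delta>. 0 < \<delta> \<and> \<delta> \<le> 1 \<longrightarrow> (\<forall>t\<in>{0..T}.
    Lp_bd M p (\<lambda>\<omega>. X \<epsilon> t \<omega> - Xbar t \<omega>) (C * (\<delta> powr \<theta> + (\<epsilon> / \<delta>) powr ((q - p) / (p * q)))))"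
proof -
  have p: "1 < p" "p < \<alpha>" using pq by auto
  define H H' where "H = (\<Sum>i\<in>UNIV. norm (h i))" and "H' = (\<Sum>i\<in>UNIV. norm (Qh *v h i))"
  have H: "\<bar>h i $ j\<bar> \<le> H" for i j
    using member_le_sum[of i UNIV "\<lambda>i. norm (h i)"] component_le_norm_cart[of "h i" j] by (simp add: H_def)
  have H': "\<bar>(Qh *v h i) $ j\<bar> \<le> H'" for i j
    using member_le_sum[of i UNIV "\<lambda>i. norm (Qh *v h i)"] component_le_norm_cart[of "Qh *v h i" j] by (simp add: H'_def)
  have H0: "H \<ge> 0" "H' \<ge> 0" by (auto simp: H_def H'_def intro: sum_nonneg)
  \<comment> \<open>Twice the bracket of \<open>chain_second_moment\<close>; the added
    \<open>1\<close> makes it positive.\<close>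
  define C0 where "C0 = 2 * (2 * H + T * H') + 1"
  have C0: "C0 > 0" using H0 T by (simp add: C0_def add_nonneg_pos)
  obtain C where C: "C > 0" "\<And>R \<epsilon> \<delta> t. (\<lambda>(s, \<omega>). R s \<omega>) \<in> measurable (borel \<Otimes>\<^sub>M M) (count_space UNIV) \<and> 0 < \<epsilon> \<and> 0 < \<delta> \<and> \<delta> \<le> 1 \<and> t \<in> {0..T} \<and>
     (\<forall>i a c. 0 \<le> a \<and> a \<le> c \<and> c \<le> T \<longrightarrow>
        (\<integral>\<omega>. (\<integral>u. indicator {a..c} u * cvec i $ R u \<omega> \<partial>lborel)\<^sup>2 \<partial>M) \<le> (c - a) * (\<epsilon> * C0)) \<Longrightarrow>
     Lp_bd M p (\<lambda>\<omega>. mconv (\<lambda>s. b (Y s \<omega>) (R s \<omega>) - bbar (Y s \<omega>)) t) (C * (\<delta> powr \<theta> + (\<epsilon> / \<delta>) powr ((q - p) / (p * q))))"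
    using average_error[OF pq C0] by blast
  define E where "E = 1 + K * (2 * exp (2 * K * T)) * T"
  have E: "E > 0" using K T by (simp add: E_def add_pos_nonneg)
  have "Lp_bd M p (\<lambda>\<omega>. X \<epsilon> t \<omega> - Xbar t \<omega>) (E * C * (\<delta> powr \<theta> + (\<epsilon> / \<delta>) powr ((q - p) / (p * q))))"
    if e: "\<epsilon> \<in> {0<..<1}" and d: "0 < \<delta>" "\<delta> \<le> 1" and t: "t \<in> {0..T}" for \<epsilon> \<delta> t
  proof -
    have e0: "\<epsilon> > 0" using e by simp
    \<comment> \<open>The jointly measurable version depends on \<open>\<epsilon>\<close>; the
      constants fixed above do not.\<close>
    obtain R where R: "(\<lambda>(t, \<omega>). R t \<omega>) \<in> measurable (borel \<Otimes>\<^sub>M M) (count_space UNIV)"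
      "AE \<omega> in M. \<forall>t\<ge>0. R t \<omega> = r \<epsilon> t \<omega>"
      using chain_regular_version[OF prob_space_axioms chain[OF e]] by blast
    have osc: "(\<integral>\<omega>. (\<integral>u. indicator {a..c} u * cvec i $ R u \<omega> \<partial>lborel)\<^sup>2 \<partial>M) \<le> (c - a) * (\<epsilon> * C0)"
      if ac: "0 \<le> a" "a \<le> c" "c \<le> T" for i a c
    proof -
      have "(\<integral>\<omega>. (\<integral>u. indicator {a..c} u * cvec i $ R u \<omega> \<partial>lborel)\<^sup>2 \<partial>M) \<le> 2 * (c - a) * (\<epsilon> * (2 * H + T * H'))"
        by (rule chain_second_moment[OF prob_space_axioms e0 chain[OF e] ac h[symmetric] cvec_bound H H' R])
      also have "\<dots> = (c - a) * (\<epsilon> * (2 * (2 * H + T * H')))" by (simp add: algebra_simps)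
      also have "\<dots> \<le> (c - a) * (\<epsilon> * C0)" using ac e0 by (intro mult_left_mono) (auto simp: C0_def)
      finally show ?thesis .
    qed
    let ?c = "C * (\<delta> powr \<theta> + (\<epsilon> / \<delta>) powr ((q - p) / (p * q)))"
    have "?c > 0" using C(1) d e0 by (intro mult_pos_pos add_pos_pos) auto
    from difference_bound[OF p this R X[OF e] _ t] C(2) R(1) e0 d osc
    have "Lp_bd M p (\<lambda>\<omega>. X \<epsilon> t \<omega> - Xbar t \<omega>) ((1 + K * (2 * exp (2 * K * T)) * T) * ?c)" by blast
    then show ?thesis by (simp only: E_def mult.assoc)
  qed
  then show ?thesis using C(1) E by (intro exI[of _ "E * C"]) auto
qed

end

text \<open>The hypothesis on \<open>\<rho>\<close> rearranges to \<open>\<rho> * \<theta> * (p *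
  \<alpha>) < (1 - \<rho>) * (\<alpha> - p)\<close>, the case \<open>q = \<alpha>\<close> of the
  claim; by continuity strictness leaves room for some \<open>q < \<alpha>\<close>. It also forces
  \<open>\<rho> < 1\<close>, so that \<open>\<epsilon> / \<delta>\<close> is a positive power of
  \<open>\<epsilon>\<close>.\<close>

lemma rate_exponents:
  fixes \<alpha> p \<theta> \<rho> :: real
  assumes p: "1 < p" "p < \<alpha>" and \<theta>: "0 < \<theta>" and rho: "0 < \<rho>" "\<rho> < (\<alpha> - p) / (\<alpha> - p + p * \<theta> * \<alpha>)"
  shows "\<exists>q. p < q \<and> q < \<alpha> \<and> \<rho> < 1 \<and> \<rho> * \<theta> \<le> (1 - \<rho>) * ((q - p) / (p * q))"
proof -
  have pos: "0 < p * \<theta> * \<alpha>" "0 < \<alpha> - p + p * \<theta> * \<alpha>" using p \<theta> by (auto intro: add_pos_pos)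
  have lt: "\<rho> * (\<alpha> - p + p * \<theta> * \<alpha>) < \<alpha> - p" using rho(2) pos(2) by (simp add: pos_less_divide_eq)
  have "(\<alpha> - p) / (\<alpha> - p + p * \<theta> * \<alpha>) < 1" using pos by simp
  then have r1: "\<rho> < 1" using rho(2) by linarith
  have "((\<lambda>q. (1 - \<rho>) * (q - p) - \<rho> * \<theta> * (p * q)) \<longlongrightarrow> (1 - \<rho>) * (\<alpha> - p) - \<rho> * \<theta> * (p * \<alpha>)) (at_left \<alpha>)"
    by (intro tendsto_intros)
  moreover have "0 < (1 - \<rho>) * (\<alpha> - p) - \<rho> * \<theta> * (p * \<alpha>)" using lt by (simp add: algebra_simps)
  ultimately have "\<forall>\<^sub>F q in at_left \<alpha>. 0 < (1 - \<rho>) * (q - p) - \<rho> * \<theta> * (p * q)" by (rule order_tendstoD(1))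
  moreover have "\<forall>\<^sub>F q in at_left \<alpha>. q \<in> {p<..<\<alpha>}" by (rule eventually_at_left_real[OF p(2)])
  ultimately have "\<forall>\<^sub>F q in at_left \<alpha>. 0 < (1 - \<rho>) * (q - p) - \<rho> * \<theta> * (p * q) \<and> q \<in> {p<..<\<alpha>}"
    by (rule eventually_conj)
  from eventually_happens'[OF trivial_limit_at_left_real this]
  obtain q where q: "0 < (1 - \<rho>) * (q - p) - \<rho> * \<theta> * (p * q)" "p < q" "q < \<alpha>" by auto
  have "0 < p * q" using p q by simp
  moreover have "\<rho> * \<theta> * (p * q) \<le> (1 - \<rho>) * (q - p)" using q by linarith
  ultimately have "\<rho> * \<theta> \<le> (1 - \<rho>) * (q - p) / (p * q)" by (simp only: pos_le_divide_eq)
  then show ?thesis using q r1 by (intro exI[of _ q]) simp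
qed

theorem theorem2p1:
  fixes M :: "'w measure" and F :: "real \<Rightarrow> 'w measure"
    and D :: "'h::{real_inner, banach, second_countable_topology} set"
    and A :: "'h \<Rightarrow> 'h" and S :: "real \<Rightarrow> 'h \<Rightarrow> 'h"
    and e :: "nat \<Rightarrow> 'h" and lam \<beta> :: "nat \<Rightarrow> real"
    and L :: "nat \<Rightarrow> real \<Rightarrow> 'w \<Rightarrow> real"
    and b :: "'h \<Rightarrow> 's::finite \<Rightarrow> 'h"
    and Qt Qh :: "real^'s^'s" and \<nu> :: "real^'s"
    and r :: "real \<Rightarrow> real \<Rightarrow> 'w \<Rightarrow> 's" and r0 :: 's
    and X :: "real \<Rightarrow> real \<Rightarrow> 'w \<Rightarrow> 'h" and Xbar :: "real \<Rightarrow> 'w \<Rightarrow> 'h" and x :: 'h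
    and \<alpha> \<sigma> \<theta> T p \<rho> :: real
  assumes basis: "stochastic_basis M F"
    and alpha: "1 < \<alpha>" "\<alpha> \<le> 2"
    and sigma: "\<sigma> > 0"
    and onb: "orthonormal_basis e"
    and beta: "\<And>k. \<beta> k > 0"
    and L_stable: "\<And>k. symmetric_stable_levy M F \<alpha> \<sigma> (L k)"
    and L_iid: "iid_processes M L"
    and A1_self_adjoint: "self_adjoint_op D A"
    and A1_compact: "compact_resolvent D A"
    and A1_spectrum: "op_spectrum D (\<lambda>y. - A y) = range lam"
    and A1_lam: "0 < lam 0" "strict_mono lam" "filterlim lam at_top sequentially"
    and A1_eigen: "\<And>k. e k \<in> D" "\<And>k. - A (e k) = lam k *\<^sub>R e k"
    and semigroup: "generates_C0_semigroup D A S"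
    and A2: "\<And>i. \<exists>K>0. \<forall>y z. norm (b y i - b z i) \<le> K * norm (y - z)"
    and A3: "0 < \<theta>" "\<theta> < 1" "0 < \<alpha> * \<theta>" "\<alpha> * \<theta> < 1"
      "summable (\<lambda>k. \<beta> k powr \<alpha> * lam k powr (- (1 - \<alpha> * \<theta>)))"
    and Qt: "generator_matrix Qt" and Qh: "generator_matrix Qh"
    and irred: "weakly_irreducible Qt" and nu: "stationary_vector Qt \<nu>"
    and chain: "\<And>\<epsilon>. \<epsilon> \<in> {0<..<1} \<Longrightarrow> ct_markov_chain M (r \<epsilon>) ((1 / \<epsilon>) *\<^sub>R Qt + Qh)"
    and chain_init: "\<And>\<epsilon>. \<epsilon> \<in> {0<..<1} \<Longrightarrow> AE \<omega> in M. r \<epsilon> 0 \<omega> = r0"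
    and x: "x \<in> frac_power_dom e lam \<theta>"
    and X: "\<And>\<epsilon>. \<epsilon> \<in> {0<..<1} \<Longrightarrow>
      mild_solution M F S e \<beta> L (\<lambda>s \<omega> y. b y (r \<epsilon> s \<omega>)) x (X \<epsilon>)"
    and Xbar: "mild_solution M F S e \<beta> L (\<lambda>s \<omega> y. averaged_drift b \<nu> y) x Xbar"
    and T: "T > 0"
    and p: "1 < p" "p < \<alpha>"
    and rho: "\<rho> < (\<alpha> - p) / (\<alpha> - p + p * \<theta> * \<alpha>)"
  shows "\<exists>\<epsilon>0\<in>{0<..<1}. \<exists>C>0. \<forall>\<epsilon>\<in>{0<..<\<epsilon>0}.
    (SUP t\<in>{0..T}. Lp_norm M p (\<lambda>\<omega>. X \<epsilon> t \<omega> - Xbar t \<omega>)) \<le> ennreal (C * \<epsilon> powr (\<rho> * \<theta>))"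
proof -
  obtain Ki where Ki: "\<And>i. Ki i > 0" "\<And>i y z. norm (b y i - b z i) \<le> Ki i * norm (y - z)"
    using A2 by metis
  \<comment> \<open>One Lipschitz constant for all states, since the sum dominates every
    \<open>Ki i\<close>.\<close>
  define K where "K = (\<Sum>i\<in>UNIV. Ki i)"
  have K: "K > 0" unfolding K_def using Ki(1) by (intro sum_pos) auto
  have lip: "norm (b y i - b z i) \<le> K * norm (y - z)" for y z i
  proof -
    have "Ki i \<le> K" unfolding K_def using Ki(1) by (intro member_le_sum) (auto intro: less_imp_le)
    then show ?thesis using Ki(2)[of y i z] mult_right_mono[of "Ki i" K "norm (y - z)"] by simp
  qed
  have lam: "lam k > 0" for k
    using A1_lam(1) strict_mono_mono[OF A1_lam(2)] by (meson le0 less_le_trans monoD)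
  have nu1: "(\<Sum>i\<in>UNIV. \<nu> $ i) = 1" using nu by (simp add: stationary_vector_def)
  have nu0: "0 \<le> \<nu> $ i" for i using irred nu unfolding weakly_irreducible_def by blast
  note poisson = stationary_poisson[OF irred nu] and alpha_le_2 = alpha(2)
  interpret averaging e D A S lam M F L \<beta> \<alpha> \<sigma> \<theta> b K \<nu> x Xbar T
    by unfold_locales
      (rule onb A1_eigen lam semigroup basis L_stable alpha beta sigma A3 K lip nu0 nu1 x Xbar T)+
  have "\<exists>h. Qt *v h = cvec i" for i
  proof (rule poisson)
    have "(\<Sum>j\<in>UNIV. \<nu> $ j * cvec i $ j) = (\<Sum>j\<in>UNIV. (if j = i then \<nu> $ j else 0) - \<nu> $ j * \<nu> $ i)"
      by (intro sum.cong) (auto simp: cvec_def algebra_simps)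
    also have "\<dots> = 0" using nu1 by (simp add: sum_subtractf flip: sum_distrib_right)
    finally show "(\<Sum>j\<in>UNIV. \<nu> $ j * cvec i $ j) = 0" .
  qed
  then obtain h where h: "\<And>i. Qt *v h i = cvec i" by metis
  define \<rho>1 where "\<rho>1 = (\<alpha> - p) / (\<alpha> - p + p * \<theta> * \<alpha>)"
  \<comment> \<open>The theorem allows \<open>\<rho> \<le> 0\<close>, for which
    \<open>\<delta>\<close> would not be small; half the critical value then replaces it, and as
    \<open>\<epsilon> < 1\<close> the larger exponent gives the stronger bound.\<close>
  define \<rho>' where "\<rho>' = (if \<rho> > 0 then \<rho> else \<rho>1 / 2)"
  have "0 < \<rho>1"
    unfolding \<rho>1_def using p A3 by (intro divide_pos_pos add_pos_pos) auto
  then have rho': "0 < \<rho>'" "\<rho>' < (\<alpha> - p) / (\<alpha> - p + p * \<theta> * \<alpha>)" "\<rho> \<le> \<rho>'"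
    using rho unfolding \<rho>1_def[symmetric] by (auto simp: \<rho>'_def)
  obtain q where q: "p < q" "q < \<alpha>" "\<rho>' < 1" "\<rho>' * \<theta> \<le> (1 - \<rho>') * ((q - p) / (p * q))"
    using rate_exponents[OF p A3(1) rho'(1,2)] by blast
  obtain C where C: "C > 0" "\<And>\<epsilon> \<delta> t. \<epsilon> \<in> {0<..<1} \<Longrightarrow> 0 < \<delta> \<Longrightarrow> \<delta> \<le> 1 \<Longrightarrow> t \<in> {0..T} \<Longrightarrow>
    Lp_bd M p (\<lambda>\<omega>. X \<epsilon> t \<omega> - Xbar t \<omega>) (C * (\<delta> powr \<theta> + (\<epsilon> / \<delta>) powr ((q - p) / (p * q))))"
    using averaging_rate[OF p(1) q(1,2) alpha_le_2 h chain X] by blast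
  have "(SUP t\<in>{0..T}. Lp_norm M p (\<lambda>\<omega>. X \<epsilon> t \<omega> - Xbar t \<omega>)) \<le> ennreal (2 * C * \<epsilon> powr (\<rho> * \<theta>))"
    if e: "\<epsilon> \<in> {0<..<1/2}" for \<epsilon>
  proof (rule SUP_least)
    fix t assume t: "t \<in> {0..T}"
    have e': "0 < \<epsilon>" "\<epsilon> < 1" using e by auto
    define \<delta> where "\<delta> = \<epsilon> powr \<rho>'"
    have d: "0 < \<delta>" "\<delta> \<le> 1" using e' rho' by (auto simp: \<delta>_def powr_le1)
    have 1: "\<delta> powr \<theta> \<le> \<epsilon> powr (\<rho> * \<theta>)"
      using e' rho' A3 by (simp add: \<delta>_def powr_powr powr_mono' mult_right_mono)
    have "\<epsilon> / \<delta> = \<epsilon> powr (1 - \<rho>')" using e' by (simp add: \<delta>_def powr_diff)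
    then have "(\<epsilon> / \<delta>) powr ((q - p) / (p * q)) = \<epsilon> powr ((1 - \<rho>') * ((q - p) / (p * q)))" by (simp only: powr_powr)
    also have "\<dots> \<le> \<epsilon> powr (\<rho>' * \<theta>)" using e' q(4) by (intro powr_mono') auto
    also have "\<dots> \<le> \<epsilon> powr (\<rho> * \<theta>)" using e' rho' A3 by (intro powr_mono' mult_right_mono) auto
    finally have 2: "(\<epsilon> / \<delta>) powr ((q - p) / (p * q)) \<le> \<epsilon> powr (\<rho> * \<theta>)" .
    have "Lp_norm M p (\<lambda>\<omega>. X \<epsilon> t \<omega> - Xbar t \<omega>) \<le> ennreal (C * (\<delta> powr \<theta> + (\<epsilon> / \<delta>) powr ((q - p) / (p * q))))"
      using C(1) p e' d t by (intro Lp_norm_le C(2)) auto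
    also have "\<dots> \<le> ennreal (C * (\<epsilon> powr (\<rho> * \<theta>) + \<epsilon> powr (\<rho> * \<theta>)))"
      using C(1) by (intro ennreal_leI mult_left_mono add_mono 1 2) auto
    finally show "Lp_norm M p (\<lambda>\<omega>. X \<epsilon> t \<omega> - Xbar t \<omega>) \<le> ennreal (2 * C * \<epsilon> powr (\<rho> * \<theta>))"
      by (simp add: mult_ac)
  qed
  \<comment> \<open>\<open>1/2\<close> is an arbitrary choice below \<open>1\<close>; the factor
    \<open>2\<close> counts the two errors, each at most
    \<open>\<epsilon> powr (\<rho> * \<theta>)\<close>.\<close>
  then show ?thesis using C(1) by (intro bexI[of _ "1/2"] exI[of _ "2 * C"]) auto
qed

end
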